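(* Let $k$ be an algebraically closed field of characteristic zero. Every braided balanced structure on a Fibonacci category over $k$ is modular. Thus there are four non-equivalent Fibonacci modular categories $\mathcal{F}_u$, parameterized by the primitive roots of unity $u\in k$ of order $10$.
   Context: A Fibonacci category is a semisimple $k$-linear monoidal category with two simple objects $I$ (the monoidal unit) and $X$, and $X\otimes X\cong I\oplus X$. A balanced structure is a twist: a natural automorphism $\theta$ of the identity functor with $\theta_I=\mathrm{id}_I$ and $\theta_{Y\otimes Z}=(\theta_Y\otimes\theta_Z)c_{Z,Y}c_{Y,Z}$. A fusion category is modular if it is rigid, braided, ribbon, and the matrix $\tilde S_{Y,Z}=\mathrm{tr}(c_{Y,Z}c_{Z,Y})$, indexed by isomorphism classes of simple objects, is non-degenerate. Equivalence means braided balanced monoidal equivalence. The category $\mathcal{F}_u$: put $a=u+u^{-1}$ (so $a^2=a+1$). Take $I$ to be a strict unit and fix basis vectors $\mu\in\mathrm{Hom}(X\otimes X,X)$ and $\varepsilon\in\mathrm{Hom}(X\otimes X,I)$. The associativity constraint $\alpha_{X,X,X}:(X\otimes X)\otimes X\to X\otimes (X\otimes X)$ is determined by $\varepsilon(1\otimes\mu)\circ\alpha_{X,X,X}=\varepsilon(\mu\otimes 1)$, $\ \mu(1\otimes\mu)\circ\alpha_{X,X,X}=a\,\mu(\mu\otimes1)+(\varepsilon\otimes 1)$, $\ (1\otimes\varepsilon)\circ\alpha_{X,X,X}=-a\,\mu(\mu\otimes1)-a\,(\varepsilon\otimes1)$. The braiding is $\mu\circ c_{X,X}=u\,\mu$,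 $\varepsilon\circ c_{X,X}=u^2\,\varepsilon$, and the twist is $\theta_I=\mathrm{id}_I$, $\theta_X=u^{-2}\mathrm{id}_X$. *)

theory Defs
  imports "HOL-Computational_Algebra.Polynomial"
begin

section \<open>Categories, functors, natural isomorphisms\<close>

record ('o, 'm) cat =
  Obj :: "'o set"
  Arr :: "'m set"
  Dom :: "'m \<Rightarrow> 'o"
  Cod :: "'m \<Rightarrow> 'o"
  Ident :: "'o \<Rightarrow> 'm"
  Comp :: "'m \<Rightarrow> 'm \<Rightarrow> 'm" (infixl "\<cdot>\<index>" 55)

definition hom :: "('o, 'm, 'x) cat_scheme \<Rightarrow> 'o \<Rightarrow> 'o \<Rightarrow> 'm set" where
  "hom C A B = {f \<in> Arr C. Dom C f = A \<and> Cod C f = B}"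

locale category =
  fixes C :: "('o, 'm, 'x) cat_scheme" (structure)
  assumes dom_obj: "f \<in> Arr C \<Longrightarrow> Dom C f \<in> Obj C"
    and cod_obj: "f \<in> Arr C \<Longrightarrow> Cod C f \<in> Obj C"
    and ident_hom: "A \<in> Obj C \<Longrightarrow> Ident C A \<in> hom C A A"
    and comp_hom: "f \<in> hom C A B \<Longrightarrow> g \<in> hom C B D \<Longrightarrow> g \<cdot> f \<in> hom C A D"
    and comp_ident_left: "f \<in> hom C A B \<Longrightarrow> Ident C B \<cdot> f = f"
    and comp_ident_right: "f \<in> hom C A B \<Longrightarrow> f \<cdot> Ident C A = f"
    and comp_assoc: "f \<in> hom C A B \<Longrightarrow> g \<in> hom C B D \<Longrightarrow> h \<in> hom C D E \<Longrightarrow>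
      (h \<cdot> g) \<cdot> f = h \<cdot> (g \<cdot> f)"

definition inverse_arrs :: "('o, 'm, 'x) cat_scheme \<Rightarrow> 'm \<Rightarrow> 'm \<Rightarrow> bool" where
  "inverse_arrs C f g \<longleftrightarrow> f \<in> Arr C \<and> g \<in> hom C (Cod C f) (Dom C f) \<and>
     g \<cdot>\<^bsub>C\<^esub> f = Ident C (Dom C f) \<and> f \<cdot>\<^bsub>C\<^esub> g = Ident C (Cod C f)"

definition iso_arr :: "('o, 'm, 'x) cat_scheme \<Rightarrow> 'm \<Rightarrow> bool" where
  "iso_arr C f \<longleftrightarrow> (\<exists>g. inverse_arrs C f g)"

definition inv_arr :: "('o, 'm, 'x) cat_scheme \<Rightarrow> 'm \<Rightarrow> 'm" where
  "inv_arr C f = (THE g. inverse_arrs C f g)"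

definition iso_obj :: "('o, 'm, 'x) cat_scheme \<Rightarrow> 'o \<Rightarrow> 'o \<Rightarrow> bool" where
  "iso_obj C A B \<longleftrightarrow> (\<exists>f \<in> hom C A B. iso_arr C f)"

locale cat_functor = C: category C + D: category D
  for C :: "('o, 'm, 'x) cat_scheme" and D :: "('p, 'n, 'y) cat_scheme" +
  fixes FO :: "'o \<Rightarrow> 'p" and FA :: "'m \<Rightarrow> 'n"
  assumes obj_map: "A \<in> Obj C \<Longrightarrow> FO A \<in> Obj D"
    and arr_map: "f \<in> hom C A B \<Longrightarrow> FA f \<in> hom D (FO A) (FO B)"
    and ident_map: "A \<in> Obj C \<Longrightarrow> FA (Ident C A) = Ident D (FO A)"
    and comp_map: "f \<in> hom C A B \<Longrightarrow> g \<in> hom C B E \<Longrightarrow>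
      FA (g \<cdot>\<^bsub>C\<^esub> f) = FA g \<cdot>\<^bsub>D\<^esub> FA f"

definition natural_iso ::
  "('o, 'm, 'x) cat_scheme \<Rightarrow> ('p, 'n, 'y) cat_scheme \<Rightarrow> ('o \<Rightarrow> 'p) \<Rightarrow> ('m \<Rightarrow> 'n) \<Rightarrow>
   ('o \<Rightarrow> 'p) \<Rightarrow> ('m \<Rightarrow> 'n) \<Rightarrow> ('o \<Rightarrow> 'n) \<Rightarrow> bool" where
  "natural_iso C D FO FA GO GA \<eta> \<longleftrightarrow>
     (\<forall>A \<in> Obj C. \<eta> A \<in> hom D (FO A) (GO A) \<and> iso_arr D (\<eta> A)) \<and>
     (\<forall>f \<in> Arr C. \<eta> (Cod C f) \<cdot>\<^bsub>D\<^esub> FA f = GA f \<cdot>\<^bsub>D\<^esub> \<eta> (Dom C f))"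

definition is_equivalence ::
  "('o, 'm, 'x) cat_scheme \<Rightarrow> ('p, 'n, 'y) cat_scheme \<Rightarrow> ('o \<Rightarrow> 'p) \<Rightarrow> ('m \<Rightarrow> 'n) \<Rightarrow> bool" where
  "is_equivalence C D FO FA \<longleftrightarrow> cat_functor C D FO FA \<and>
     (\<exists>GO GA \<eta> \<epsilon>. cat_functor D C GO GA \<and>
        natural_iso C C (\<lambda>A. A) (\<lambda>f. f) (\<lambda>A. GO (FO A)) (\<lambda>f. GA (FA f)) \<eta> \<and>
        natural_iso D D (\<lambda>B. FO (GO B)) (\<lambda>g. FA (GA g)) (\<lambda>B. B) (\<lambda>g. g) \<epsilon>)"


section \<open>Semisimple linear categories\<close>

record ('o, 'm, 'k) lincat = "('o, 'm) cat" +
  Zero :: "'o \<Rightarrow> 'o \<Rightarrow> 'm"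
  Add :: "'m \<Rightarrow> 'm \<Rightarrow> 'm" (infixl "\<oplus>\<index>" 53)
  Smult :: "'k \<Rightarrow> 'm \<Rightarrow> 'm" (infixr "\<bullet>\<index>" 60)

text \<open>Additive inverses need no separate axiom: \<open>(- 1) \<bullet> f\<close> is inverse to \<open>f\<close>.\<close>

locale linear_category = category C
  for C :: "('o, 'm, 'k :: field, 'x) lincat_scheme" (structure) +
  assumes zero_hom: "A \<in> Obj C \<Longrightarrow> B \<in> Obj C \<Longrightarrow> Zero C A B \<in> hom C A B"
    and add_hom: "f \<in> hom C A B \<Longrightarrow> g \<in> hom C A B \<Longrightarrow> f \<oplus> g \<in> hom C A B"
    and smult_hom: "f \<in> hom C A B \<Longrightarrow> r \<bullet> f \<in> hom C A B"
    and add_assoc: "f \<in> hom C A B \<Longrightarrow> g \<in> hom C A B \<Longrightarrow> h \<in> hom C A B \<Longrightarrow>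
      (f \<oplus> g) \<oplus> h = f \<oplus> (g \<oplus> h)"
    and add_commute: "f \<in> hom C A B \<Longrightarrow> g \<in> hom C A B \<Longrightarrow> f \<oplus> g = g \<oplus> f"
    and add_zero: "f \<in> hom C A B \<Longrightarrow> f \<oplus> Zero C A B = f"
    and smult_zero: "f \<in> hom C A B \<Longrightarrow> 0 \<bullet> f = Zero C A B"
    and smult_one: "f \<in> hom C A B \<Longrightarrow> 1 \<bullet> f = f"
    and smult_smult: "f \<in> hom C A B \<Longrightarrow> r \<bullet> (s \<bullet> f) = (r * s) \<bullet> f"
    and smult_add_left: "f \<in> hom C A B \<Longrightarrow> (r + s) \<bullet> f = (r \<bullet> f) \<oplus> (s \<bullet> f)"
    and smult_add_right: "f \<in> hom C A B \<Longrightarrow> g \<in> hom C A B \<Longrightarrow>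
      r \<bullet> (f \<oplus> g) = (r \<bullet> f) \<oplus> (r \<bullet> g)"
    and comp_add_left: "f \<in> hom C A B \<Longrightarrow> g \<in> hom C B D \<Longrightarrow> h \<in> hom C B D \<Longrightarrow>
      (g \<oplus> h) \<cdot> f = (g \<cdot> f) \<oplus> (h \<cdot> f)"
    and comp_add_right: "f \<in> hom C A B \<Longrightarrow> g \<in> hom C A B \<Longrightarrow> h \<in> hom C B D \<Longrightarrow>
      h \<cdot> (f \<oplus> g) = (h \<cdot> f) \<oplus> (h \<cdot> g)"
    and comp_smult_left: "f \<in> hom C A B \<Longrightarrow> g \<in> hom C B D \<Longrightarrow> (r \<bullet> g) \<cdot> f = r \<bullet> (g \<cdot> f)"
    and comp_smult_right: "f \<in> hom C A B \<Longrightarrow> g \<in> hom C B D \<Longrightarrow> g \<cdot> (r \<bullet> f) = r \<bullet> (g \<cdot> f)"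

definition zero_obj :: "('o, 'm, 'x) cat_scheme \<Rightarrow> 'o \<Rightarrow> bool" where
  "zero_obj C Z \<longleftrightarrow> Z \<in> Obj C \<and>
     (\<forall>A \<in> Obj C. (\<exists>!f. f \<in> hom C A Z) \<and> (\<exists>!f. f \<in> hom C Z A))"

definition biproduct :: "('o, 'm, 'k, 'x) lincat_scheme \<Rightarrow> 'o \<Rightarrow> 'o \<Rightarrow> 'o \<Rightarrow> bool" where
  "biproduct C P A B \<longleftrightarrow> P \<in> Obj C \<and> A \<in> Obj C \<and> B \<in> Obj C \<and>
     (\<exists>i \<in> hom C A P. \<exists>j \<in> hom C B P. \<exists>p \<in> hom C P A. \<exists>q \<in> hom C P B.
        p \<cdot>\<^bsub>C\<^esub> i = Ident C A \<and> q \<cdot>\<^bsub>C\<^esub> j = Ident C B \<and>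
        p \<cdot>\<^bsub>C\<^esub> j = Zero C B A \<and> q \<cdot>\<^bsub>C\<^esub> i = Zero C A B \<and>
        (i \<cdot>\<^bsub>C\<^esub> p) \<oplus>\<^bsub>C\<^esub> (j \<cdot>\<^bsub>C\<^esub> q) = Ident C P)"

definition monic :: "('o, 'm, 'x) cat_scheme \<Rightarrow> 'm \<Rightarrow> bool" where
  "monic C m \<longleftrightarrow> m \<in> Arr C \<and>
     (\<forall>A. \<forall>f \<in> hom C A (Dom C m). \<forall>g \<in> hom C A (Dom C m). m \<cdot>\<^bsub>C\<^esub> f = m \<cdot>\<^bsub>C\<^esub> g \<longrightarrow> f = g)"

definition epic :: "('o, 'm, 'x) cat_scheme \<Rightarrow> 'm \<Rightarrow> bool" where
  "epic C e \<longleftrightarrow> e \<in> Arr C \<and>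
     (\<forall>B. \<forall>f \<in> hom C (Cod C e) B. \<forall>g \<in> hom C (Cod C e) B. f \<cdot>\<^bsub>C\<^esub> e = g \<cdot>\<^bsub>C\<^esub> e \<longrightarrow> f = g)"

definition is_kernel :: "('o, 'm, 'k, 'x) lincat_scheme \<Rightarrow> 'm \<Rightarrow> 'm \<Rightarrow> bool" where
  "is_kernel C k f \<longleftrightarrow> f \<in> Arr C \<and> k \<in> Arr C \<and> Cod C k = Dom C f \<and>
     f \<cdot>\<^bsub>C\<^esub> k = Zero C (Dom C k) (Cod C f) \<and>
     (\<forall>A. \<forall>h \<in> hom C A (Dom C f). f \<cdot>\<^bsub>C\<^esub> h = Zero C A (Cod C f) \<longrightarrow>
        (\<exists>!h'. h' \<in> hom C A (Dom C k) \<and> k \<cdot>\<^bsub>C\<^esub> h' = h))"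

definition is_cokernel :: "('o, 'm, 'k, 'x) lincat_scheme \<Rightarrow> 'm \<Rightarrow> 'm \<Rightarrow> bool" where
  "is_cokernel C c f \<longleftrightarrow> f \<in> Arr C \<and> c \<in> Arr C \<and> Dom C c = Cod C f \<and>
     c \<cdot>\<^bsub>C\<^esub> f = Zero C (Dom C f) (Cod C c) \<and>
     (\<forall>B. \<forall>h \<in> hom C (Cod C f) B. h \<cdot>\<^bsub>C\<^esub> f = Zero C (Dom C f) B \<longrightarrow>
        (\<exists>!h'. h' \<in> hom C (Cod C c) B \<and> h' \<cdot>\<^bsub>C\<^esub> c = h))"

locale abelian_category = linear_category C
  for C :: "('o, 'm, 'k :: field, 'x) lincat_scheme" (structure) +
  assumes ex_zero: "\<exists>Z. zero_obj C Z"
    and ex_biproduct: "A \<in> Obj C \<Longrightarrow> B \<in> Obj C \<Longrightarrow> \<exists>P. biproduct C P A B"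
    and ex_kernel: "f \<in> Arr C \<Longrightarrow> \<exists>k. is_kernel C k f"
    and ex_cokernel: "f \<in> Arr C \<Longrightarrow> \<exists>c. is_cokernel C c f"
    and monic_normal: "monic C m \<Longrightarrow> \<exists>f. is_kernel C m f"
    and epic_normal: "epic C e \<Longrightarrow> \<exists>f. is_cokernel C e f"

definition simple :: "('o, 'm, 'x) cat_scheme \<Rightarrow> 'o \<Rightarrow> bool" where
  "simple C S \<longleftrightarrow> S \<in> Obj C \<and> \<not> zero_obj C S \<and>
     (\<forall>m. monic C m \<and> Cod C m = S \<longrightarrow> zero_obj C (Dom C m) \<or> iso_arr C m)"

inductive semisimple_obj :: "('o, 'm, 'k, 'x) lincat_scheme \<Rightarrow> 'o \<Rightarrow> bool" for C where
  empty_sum: "zero_obj C Z \<Longrightarrow> semisimple_obj C Z"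
| add_summand: "simple C S \<Longrightarrow> semisimple_obj C A \<Longrightarrow> biproduct C P S A \<Longrightarrow> semisimple_obj C P"

inductive_set hom_span :: "('o, 'm, 'k, 'x) lincat_scheme \<Rightarrow> 'o \<Rightarrow> 'o \<Rightarrow> 'm set \<Rightarrow> 'm set"
  for C A B S where
  span_zero: "Zero C A B \<in> hom_span C A B S"
| span_step: "f \<in> S \<Longrightarrow> g \<in> hom_span C A B S \<Longrightarrow> (r \<bullet>\<^bsub>C\<^esub> f) \<oplus>\<^bsub>C\<^esub> g \<in> hom_span C A B S"

text \<open>As usual for semisimple linear categories, morphism spaces are finite-dimensional; over an
  algebraically closed field Schur's lemma then gives that simple objects have only scalar
  endomorphisms.\<close>

locale semisimple_category = abelian_category C
  for C :: "('o, 'm, 'k :: field, 'x) lincat_scheme" (structure) +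
  assumes finite_dim: "A \<in> Obj C \<Longrightarrow> B \<in> Obj C \<Longrightarrow>
      \<exists>S. finite S \<and> S \<subseteq> hom C A B \<and> hom C A B = hom_span C A B S"
    and semisimple: "A \<in> Obj C \<Longrightarrow> semisimple_obj C A"

locale linear_functor = C: linear_category C + D: linear_category D + cat_functor C D FO FA
  for C :: "('o, 'm, 'k :: field, 'x) lincat_scheme" and D :: "('p, 'n, 'k, 'y) lincat_scheme"
    and FO :: "'o \<Rightarrow> 'p" and FA :: "'m \<Rightarrow> 'n" +
  assumes add_map: "f \<in> hom C A B \<Longrightarrow> g \<in> hom C A B \<Longrightarrow> FA (f \<oplus>\<^bsub>C\<^esub> g) = FA f \<oplus>\<^bsub>D\<^esub> FA g"
    and smult_map: "f \<in> hom C A B \<Longrightarrow> FA (r \<bullet>\<^bsub>C\<^esub> f) = r \<bullet>\<^bsub>D\<^esub> FA f"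


section \<open>Monoidal, braided and balanced categories\<close>

record ('o, 'm, 'k) moncat = "('o, 'm, 'k) lincat" +
  TenO :: "'o \<Rightarrow> 'o \<Rightarrow> 'o" (infixl "\<odot>\<index>" 70)
  TenA :: "'m \<Rightarrow> 'm \<Rightarrow> 'm" (infixl "\<otimes>\<index>" 70)
  Unit :: 'o
  Assoc :: "'o \<Rightarrow> 'o \<Rightarrow> 'o \<Rightarrow> 'm"
  LUnit :: "'o \<Rightarrow> 'm"
  RUnit :: "'o \<Rightarrow> 'm"

locale monoidal_category = linear_category C
  for C :: "('o, 'm, 'k :: field, 'x) moncat_scheme" (structure) +
  assumes ten_obj: "A \<in> Obj C \<Longrightarrow> B \<in> Obj C \<Longrightarrow> A \<odot> B \<in> Obj C"
    and ten_hom: "f \<in> hom C A A' \<Longrightarrow> g \<in> hom C B B' \<Longrightarrow> f \<otimes> g \<in> hom C (A \<odot> B) (A' \<odot> B')"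
    and ten_ident: "A \<in> Obj C \<Longrightarrow> B \<in> Obj C \<Longrightarrow> Ident C A \<otimes> Ident C B = Ident C (A \<odot> B)"
    and ten_comp: "f \<in> hom C A A' \<Longrightarrow> f' \<in> hom C A' A'' \<Longrightarrow> g \<in> hom C B B' \<Longrightarrow> g' \<in> hom C B' B'' \<Longrightarrow>
      (f' \<cdot> f) \<otimes> (g' \<cdot> g) = (f' \<otimes> g') \<cdot> (f \<otimes> g)"
    and ten_add_left: "f \<in> hom C A A' \<Longrightarrow> f' \<in> hom C A A' \<Longrightarrow> g \<in> hom C B B' \<Longrightarrow>
      (f \<oplus> f') \<otimes> g = (f \<otimes> g) \<oplus> (f' \<otimes> g)"
    and ten_add_right: "f \<in> hom C A A' \<Longrightarrow> g \<in> hom C B B' \<Longrightarrow> g' \<in> hom C B B' \<Longrightarrow>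
      f \<otimes> (g \<oplus> g') = (f \<otimes> g) \<oplus> (f \<otimes> g')"
    and ten_smult_left: "f \<in> hom C A A' \<Longrightarrow> g \<in> hom C B B' \<Longrightarrow> (r \<bullet> f) \<otimes> g = r \<bullet> (f \<otimes> g)"
    and ten_smult_right: "f \<in> hom C A A' \<Longrightarrow> g \<in> hom C B B' \<Longrightarrow> f \<otimes> (r \<bullet> g) = r \<bullet> (f \<otimes> g)"
    and unit_obj: "Unit C \<in> Obj C"
    and assoc_hom: "A \<in> Obj C \<Longrightarrow> B \<in> Obj C \<Longrightarrow> D \<in> Obj C \<Longrightarrow>
      Assoc C A B D \<in> hom C (A \<odot> B \<odot> D) (A \<odot> (B \<odot> D))"
    and assoc_iso: "A \<in> Obj C \<Longrightarrow> B \<in> Obj C \<Longrightarrow> D \<in> Obj C \<Longrightarrow> iso_arr C (Assoc C A B D)"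
    and assoc_natural: "f \<in> hom C A A' \<Longrightarrow> g \<in> hom C B B' \<Longrightarrow> h \<in> hom C D D' \<Longrightarrow>
      Assoc C A' B' D' \<cdot> (f \<otimes> g \<otimes> h) = (f \<otimes> (g \<otimes> h)) \<cdot> Assoc C A B D"
    and lunit_hom: "A \<in> Obj C \<Longrightarrow> LUnit C A \<in> hom C (Unit C \<odot> A) A"
    and lunit_iso: "A \<in> Obj C \<Longrightarrow> iso_arr C (LUnit C A)"
    and lunit_natural: "f \<in> hom C A B \<Longrightarrow> LUnit C B \<cdot> (Ident C (Unit C) \<otimes> f) = f \<cdot> LUnit C A"
    and runit_hom: "A \<in> Obj C \<Longrightarrow> RUnit C A \<in> hom C (A \<odot> Unit C) A"
    and runit_iso: "A \<in> Obj C \<Longrightarrow> iso_arr C (RUnit C A)"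
    and runit_natural: "f \<in> hom C A B \<Longrightarrow> RUnit C B \<cdot> (f \<otimes> Ident C (Unit C)) = f \<cdot> RUnit C A"
    and pentagon: "A \<in> Obj C \<Longrightarrow> B \<in> Obj C \<Longrightarrow> D \<in> Obj C \<Longrightarrow> E \<in> Obj C \<Longrightarrow>
      Assoc C A B (D \<odot> E) \<cdot> Assoc C (A \<odot> B) D E =
      (Ident C A \<otimes> Assoc C B D E) \<cdot> Assoc C A (B \<odot> D) E \<cdot> (Assoc C A B D \<otimes> Ident C E)"
    and triangle: "A \<in> Obj C \<Longrightarrow> B \<in> Obj C \<Longrightarrow>
      (Ident C A \<otimes> LUnit C B) \<cdot> Assoc C A (Unit C) B = RUnit C A \<otimes> Ident C B"

record ('o, 'm, 'k) balcat = "('o, 'm, 'k) moncat" +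
  Braid :: "'o \<Rightarrow> 'o \<Rightarrow> 'm"
  Twist :: "'o \<Rightarrow> 'm"

locale braided_category = monoidal_category C
  for C :: "('o, 'm, 'k :: field, 'x) balcat_scheme" (structure) +
  assumes braid_hom: "A \<in> Obj C \<Longrightarrow> B \<in> Obj C \<Longrightarrow> Braid C A B \<in> hom C (A \<odot> B) (B \<odot> A)"
    and braid_iso: "A \<in> Obj C \<Longrightarrow> B \<in> Obj C \<Longrightarrow> iso_arr C (Braid C A B)"
    and braid_natural: "f \<in> hom C A A' \<Longrightarrow> g \<in> hom C B B' \<Longrightarrow>
      Braid C A' B' \<cdot> (f \<otimes> g) = (g \<otimes> f) \<cdot> Braid C A B"
    and hexagon_right: "A \<in> Obj C \<Longrightarrow> B \<in> Obj C \<Longrightarrow> D \<in> Obj C \<Longrightarrow>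
      Assoc C B D A \<cdot> Braid C A (B \<odot> D) \<cdot> Assoc C A B D =
      (Ident C B \<otimes> Braid C A D) \<cdot> Assoc C B A D \<cdot> (Braid C A B \<otimes> Ident C D)"
    and hexagon_left: "A \<in> Obj C \<Longrightarrow> B \<in> Obj C \<Longrightarrow> D \<in> Obj C \<Longrightarrow>
      inv_arr C (Assoc C D A B) \<cdot> Braid C (A \<odot> B) D \<cdot> inv_arr C (Assoc C A B D) =
      (Braid C A D \<otimes> Ident C B) \<cdot> inv_arr C (Assoc C A D B) \<cdot> (Ident C A \<otimes> Braid C B D)"

locale balanced_category = braided_category C
  for C :: "('o, 'm, 'k :: field, 'x) balcat_scheme" (structure) +
  assumes twist_hom: "A \<in> Obj C \<Longrightarrow> Twist C A \<in> hom C A A"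
    and twist_iso: "A \<in> Obj C \<Longrightarrow> iso_arr C (Twist C A)"
    and twist_natural: "f \<in> hom C A B \<Longrightarrow> Twist C B \<cdot> f = f \<cdot> Twist C A"
    and twist_unit: "Twist C (Unit C) = Ident C (Unit C)"
    and twist_ten: "A \<in> Obj C \<Longrightarrow> B \<in> Obj C \<Longrightarrow>
      Twist C (A \<odot> B) = (Twist C A \<otimes> Twist C B) \<cdot> Braid C B A \<cdot> Braid C A B"

locale braided_balanced_functor =
  C: balanced_category C + D: balanced_category D + linear_functor C D FO FA
  for C :: "('o, 'm, 'k :: field, 'x) balcat_scheme" and D :: "('p, 'n, 'k, 'y) balcat_scheme"
    and FO :: "'o \<Rightarrow> 'p" and FA :: "'m \<Rightarrow> 'n" +
  fixes J :: "'o \<Rightarrow> 'o \<Rightarrow> 'n" and J0 :: 'n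
  assumes J_hom: "A \<in> Obj C \<Longrightarrow> B \<in> Obj C \<Longrightarrow>
      J A B \<in> hom D (FO A \<odot>\<^bsub>D\<^esub> FO B) (FO (A \<odot>\<^bsub>C\<^esub> B))"
    and J_iso: "A \<in> Obj C \<Longrightarrow> B \<in> Obj C \<Longrightarrow> iso_arr D (J A B)"
    and J_natural: "f \<in> hom C A A' \<Longrightarrow> g \<in> hom C B B' \<Longrightarrow>
      J A' B' \<cdot>\<^bsub>D\<^esub> (FA f \<otimes>\<^bsub>D\<^esub> FA g) = FA (f \<otimes>\<^bsub>C\<^esub> g) \<cdot>\<^bsub>D\<^esub> J A B"
    and J0_hom: "J0 \<in> hom D (Unit D) (FO (Unit C))"
    and J0_iso: "iso_arr D J0"
    and J_assoc: "A \<in> Obj C \<Longrightarrow> B \<in> Obj C \<Longrightarrow> E \<in> Obj C \<Longrightarrow>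
      FA (Assoc C A B E) \<cdot>\<^bsub>D\<^esub> J (A \<odot>\<^bsub>C\<^esub> B) E \<cdot>\<^bsub>D\<^esub> (J A B \<otimes>\<^bsub>D\<^esub> Ident D (FO E)) =
      J A (B \<odot>\<^bsub>C\<^esub> E) \<cdot>\<^bsub>D\<^esub> (Ident D (FO A) \<otimes>\<^bsub>D\<^esub> J B E) \<cdot>\<^bsub>D\<^esub> Assoc D (FO A) (FO B) (FO E)"
    and J_lunit: "A \<in> Obj C \<Longrightarrow>
      FA (LUnit C A) \<cdot>\<^bsub>D\<^esub> J (Unit C) A \<cdot>\<^bsub>D\<^esub> (J0 \<otimes>\<^bsub>D\<^esub> Ident D (FO A)) = LUnit D (FO A)"
    and J_runit: "A \<in> Obj C \<Longrightarrow>
      FA (RUnit C A) \<cdot>\<^bsub>D\<^esub> J A (Unit C) \<cdot>\<^bsub>D\<^esub> (Ident D (FO A) \<otimes>\<^bsub>D\<^esub> J0) = RUnit D (FO A)"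
    and J_braid: "A \<in> Obj C \<Longrightarrow> B \<in> Obj C \<Longrightarrow>
      FA (Braid C A B) \<cdot>\<^bsub>D\<^esub> J A B = J B A \<cdot>\<^bsub>D\<^esub> Braid D (FO A) (FO B)"
    and twist_map: "A \<in> Obj C \<Longrightarrow> FA (Twist C A) = Twist D (FO A)"

definition balanced_equivalent ::
  "('o, 'm, 'k :: field, 'x) balcat_scheme \<Rightarrow> ('p, 'n, 'k, 'y) balcat_scheme \<Rightarrow> bool" where
  "balanced_equivalent C D \<longleftrightarrow>
     (\<exists>FO FA J J0. braided_balanced_functor C D FO FA J J0 \<and> is_equivalence C D FO FA)"


section \<open>Duality, trace and modularity\<close>

text \<open>\<open>D\<close> is a left dual of \<open>A\<close>, with evaluation \<open>D \<odot> A \<rightarrow> I\<close> and coevaluation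
  \<open>I \<rightarrow> A \<odot> D\<close>; equivalently \<open>A\<close> is a right dual of \<open>D\<close>.\<close>

definition left_dual ::
  "('o, 'm, 'k, 'x) moncat_scheme \<Rightarrow> 'o \<Rightarrow> 'o \<Rightarrow> 'm \<Rightarrow> 'm \<Rightarrow> bool" where
  "left_dual C A D ev coev \<longleftrightarrow> A \<in> Obj C \<and> D \<in> Obj C \<and>
     ev \<in> hom C (D \<odot>\<^bsub>C\<^esub> A) (Unit C) \<and> coev \<in> hom C (Unit C) (A \<odot>\<^bsub>C\<^esub> D) \<and>
     RUnit C A \<cdot>\<^bsub>C\<^esub> (Ident C A \<otimes>\<^bsub>C\<^esub> ev) \<cdot>\<^bsub>C\<^esub> Assoc C A D A \<cdot>\<^bsub>C\<^esub> (coev \<otimes>\<^bsub>C\<^esub> Ident C A) = LUnit C A \<and>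
     LUnit C D \<cdot>\<^bsub>C\<^esub> (ev \<otimes>\<^bsub>C\<^esub> Ident C D) \<cdot>\<^bsub>C\<^esub> inv_arr C (Assoc C D A D) \<cdot>\<^bsub>C\<^esub>
       (Ident C D \<otimes>\<^bsub>C\<^esub> coev) = RUnit C D"

definition rigid :: "('o, 'm, 'k, 'x) moncat_scheme \<Rightarrow> bool" where
  "rigid C \<longleftrightarrow> (\<forall>A \<in> Obj C. (\<exists>D ev coev. left_dual C A D ev coev) \<and>
                             (\<exists>D ev coev. left_dual C D A ev coev))"

definition dual_arr :: "('o, 'm, 'k, 'x) moncat_scheme \<Rightarrow> 'o \<Rightarrow> 'o \<Rightarrow> 'm \<Rightarrow> 'm \<Rightarrow> 'm \<Rightarrow> 'm" where
  "dual_arr C A D ev coev f =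
     LUnit C D \<cdot>\<^bsub>C\<^esub> (ev \<otimes>\<^bsub>C\<^esub> Ident C D) \<cdot>\<^bsub>C\<^esub> ((Ident C D \<otimes>\<^bsub>C\<^esub> f) \<otimes>\<^bsub>C\<^esub> Ident C D) \<cdot>\<^bsub>C\<^esub>
       inv_arr C (Assoc C D A D) \<cdot>\<^bsub>C\<^esub> (Ident C D \<otimes>\<^bsub>C\<^esub> coev) \<cdot>\<^bsub>C\<^esub> inv_arr C (RUnit C D)"

locale ribbon_category = balanced_category C
  for C :: "('o, 'm, 'k :: field, 'x) balcat_scheme" (structure) +
  assumes rigid: "rigid C"
    and twist_dual: "left_dual C A D ev coev \<Longrightarrow>
      Twist C D = dual_arr C A D ev coev (Twist C A)"

text \<open>The trace of \<open>f : A \<rightarrow> A\<close> is the scalar \<open>t\<close> for which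
  \<open>I \<rightarrow> A \<odot> D \<rightarrow> A \<odot> D \<rightarrow> D \<odot> A \<rightarrow> I\<close>, given by coevaluation, \<open>(\<theta>\<^sub>A f) \<otimes> 1\<close>, braiding and
  evaluation, is \<open>t\<close> times the identity.\<close>

definition trace :: "('o, 'm, 'k, 'x) balcat_scheme \<Rightarrow> 'o \<Rightarrow> 'm \<Rightarrow> 'k" where
  "trace C A f = (THE t. \<exists>D ev coev. left_dual C A D ev coev \<and>
     ev \<cdot>\<^bsub>C\<^esub> Braid C A D \<cdot>\<^bsub>C\<^esub> ((Twist C A \<cdot>\<^bsub>C\<^esub> f) \<otimes>\<^bsub>C\<^esub> Ident C D) \<cdot>\<^bsub>C\<^esub> coev =
     t \<bullet>\<^bsub>C\<^esub> Ident C (Unit C))"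

definition s_matrix :: "('o, 'm, 'k, 'x) balcat_scheme \<Rightarrow> 'o \<Rightarrow> 'o \<Rightarrow> 'k" where
  "s_matrix C Y Z = trace C (Z \<odot>\<^bsub>C\<^esub> Y) (Braid C Y Z \<cdot>\<^bsub>C\<^esub> Braid C Z Y)"

definition simple_reps :: "('o, 'm, 'x) cat_scheme \<Rightarrow> 'o set \<Rightarrow> bool" where
  "simple_reps C R \<longleftrightarrow> R \<subseteq> {S. simple C S} \<and>
     (\<forall>S. simple C S \<longrightarrow> (\<exists>!T. T \<in> R \<and> iso_obj C S T))"

definition nondegenerate_on :: "'o set \<Rightarrow> ('o \<Rightarrow> 'o \<Rightarrow> 'k :: field) \<Rightarrow> bool" where
  "nondegenerate_on R M \<longleftrightarrow>
     (\<forall>v. (\<forall>Y \<in> R. (\<Sum>Z \<in> R. M Y Z * v Z) = 0) \<longrightarrow> (\<forall>Z \<in> R. v Z = 0))"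

locale fusion_category = semisimple_category C + monoidal_category C
  for C :: "('o, 'm, 'k :: field, 'x) moncat_scheme" (structure) +
  assumes fusion_rigid: "rigid C"
    and unit_simple: "simple C (Unit C)"
    and finitely_many_simples: "\<exists>R. finite R \<and> simple_reps C R"

locale modular_category = fusion_category C + ribbon_category C
  for C :: "('o, 'm, 'k :: field, 'x) balcat_scheme" (structure) +
  assumes s_nondegenerate: "simple_reps C R \<Longrightarrow> nondegenerate_on R (s_matrix C)"


section \<open>Fibonacci categories\<close>

locale fibonacci_category = semisimple_category C + monoidal_category C
  for C :: "('o, 'm, 'k :: field, 'x) moncat_scheme" (structure) +
  assumes unit_simple: "simple C (Unit C)"
    and fibonacci_object: "\<exists>X. simple C X \<and> \<not> iso_obj C X (Unit C) \<and>
      (\<forall>S. simple C S \<longrightarrow> iso_obj C S (Unit C) \<or> iso_obj C S X) \<and>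
      (\<exists>P. biproduct C P (Unit C) X \<and> iso_obj C (X \<odot> X) P)"

definition primitive_root :: "nat \<Rightarrow> 'k :: field \<Rightarrow> bool" where
  "primitive_root n u \<longleftrightarrow> n > 0 \<and> u ^ n = 1 \<and> (\<forall>m. 0 < m \<and> m < n \<longrightarrow> u ^ m \<noteq> 1)"



section \<open>The categories \<open>F\<^sub>u\<close>\<close>

text \<open>A list of labels stands for the direct sum of the corresponding simple objects, and an
  arrow is a block matrix: the entry in row \<open>i\<close> and column \<open>j\<close> maps the \<open>j\<close>-th summand of the
  source to the \<open>i\<close>-th summand of the target, and vanishes unless these carry the same label.
  \<open>mk_arr\<close> forces this vanishing, so that arrows with equal entries are equal.\<close>

datatype fib = One | Tau

datatype 'k fib_arr = FibArr (src: "fib list") (tgt: "fib list") (entry: "nat \<Rightarrow> nat \<Rightarrow> 'k")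

definition mk_arr :: "fib list \<Rightarrow> fib list \<Rightarrow> (nat \<Rightarrow> nat \<Rightarrow> 'k :: field) \<Rightarrow> 'k fib_arr" where
  "mk_arr xs ys m = FibArr xs ys
     (\<lambda>i j. if i < length ys \<and> j < length xs \<and> ys ! i = xs ! j then m i j else 0)"

fun fuse :: "fib \<Rightarrow> fib \<Rightarrow> fib list" where
  "fuse One y = [y]"
| "fuse Tau One = [Tau]"
| "fuse Tau Tau = [One, Tau]"

text \<open>The summands of \<open>xs \<otimes> ys\<close> are indexed by triples \<open>(i, j, z)\<close>, where \<open>z\<close> is a summand of
  \<open>xs ! i \<otimes> ys ! j\<close>. The unit \<open>[One]\<close> is then strict.\<close>

definition ten_basis :: "fib list \<Rightarrow> fib list \<Rightarrow> (nat \<times> nat \<times> fib) list" where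
  "ten_basis xs ys = [(i, j, z). i \<leftarrow> [0..<length xs], j \<leftarrow> [0..<length ys], z \<leftarrow> fuse (xs ! i) (ys ! j)]"

definition fib_tenO :: "fib list \<Rightarrow> fib list \<Rightarrow> fib list" where
  "fib_tenO xs ys = map (\<lambda>(i, j, z). z) (ten_basis xs ys)"

definition fib_comp :: "'k :: field fib_arr \<Rightarrow> 'k fib_arr \<Rightarrow> 'k fib_arr" where
  "fib_comp g f = mk_arr (src f) (tgt g) (\<lambda>i j. \<Sum>l < length (tgt f). entry g i l * entry f l j)"

definition fib_tenA :: "'k :: field fib_arr \<Rightarrow> 'k fib_arr \<Rightarrow> 'k fib_arr" where
  "fib_tenA f g = mk_arr (fib_tenO (src f) (src g)) (fib_tenO (tgt f) (tgt g))
     (\<lambda>p q. case (ten_basis (tgt f) (tgt g) ! p, ten_basis (src f) (src g) ! q) of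
        ((i, j, z), (i', j', z')) \<Rightarrow> if z = z' then entry f i i' * entry g j j' else 0)"

text \<open>\<open>fib_F a x y z w t s\<close> is the coefficient, on the summands \<open>w\<close>, of the associativity constraint
  from the summand through \<open>s \<subseteq> x \<otimes> y\<close> of \<open>(x \<otimes> y) \<otimes> z\<close> to the summand through
  \<open>t \<subseteq> y \<otimes> z\<close> of \<open>x \<otimes> (y \<otimes> z)\<close>. The projections of \<open>X \<otimes> (X \<otimes> X)\<close> to the two copies of
  \<open>X\<close> are \<open>\<mu>(1 \<otimes> \<mu>)\<close> (for \<open>t = Tau\<close>) and \<open>1 \<otimes> \<epsilon>\<close> (for \<open>t = One\<close>), and similarly
  \<open>\<mu>(\<mu> \<otimes> 1)\<close> and \<open>\<epsilon> \<otimes> 1\<close> for \<open>(X \<otimes> X) \<otimes> X\<close>. The lemma \<open>fib_cat_relations\<close> below recovers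
  the defining relations.\<close>

definition fib_F :: "'k :: field \<Rightarrow> fib \<Rightarrow> fib \<Rightarrow> fib \<Rightarrow> fib \<Rightarrow> fib \<Rightarrow> fib \<Rightarrow> 'k" where
  "fib_F a x y z w t s =
     (if x = Tau \<and> y = Tau \<and> z = Tau \<and> w = Tau then
        (case (t, s) of (Tau, Tau) \<Rightarrow> a | (Tau, One) \<Rightarrow> 1 | (One, Tau) \<Rightarrow> - a | (One, One) \<Rightarrow> - a)
      else 1)"

definition fib_assoc :: "'k :: field \<Rightarrow> fib list \<Rightarrow> fib list \<Rightarrow> fib list \<Rightarrow> 'k fib_arr" where
  "fib_assoc u xs ys zs =
     mk_arr (fib_tenO (fib_tenO xs ys) zs) (fib_tenO xs (fib_tenO ys zs))
       (\<lambda>p q. case (ten_basis xs (fib_tenO ys zs) ! p, ten_basis (fib_tenO xs ys) zs ! q) of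
          ((i, m, w), (n, l', w')) \<Rightarrow>
            (case (ten_basis ys zs ! m, ten_basis xs ys ! n) of
              ((j, l, t), (i', j', s)) \<Rightarrow>
                if i = i' \<and> j = j' \<and> l = l'
                then fib_F (u + inverse u) (xs ! i) (ys ! j) (zs ! l) w t s else 0))"

definition fib_R :: "'k :: field \<Rightarrow> fib \<Rightarrow> fib \<Rightarrow> fib \<Rightarrow> 'k" where
  "fib_R u x y z =
     (if x = Tau \<and> y = Tau then (case z of One \<Rightarrow> u ^ 2 | Tau \<Rightarrow> u) else 1)"

definition fib_braid :: "'k :: field \<Rightarrow> fib list \<Rightarrow> fib list \<Rightarrow> 'k fib_arr" where
  "fib_braid u xs ys = mk_arr (fib_tenO xs ys) (fib_tenO ys xs)
     (\<lambda>p q. case (ten_basis ys xs ! p, ten_basis xs ys ! q) of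
        ((j, i, z), (i', j', z')) \<Rightarrow>
          if i = i' \<and> j = j' \<and> z = z' then fib_R u (xs ! i) (ys ! j) z else 0)"

definition fib_ident :: "fib list \<Rightarrow> 'k :: field fib_arr" where
  "fib_ident xs = mk_arr xs xs (\<lambda>i j. if i = j then 1 else 0)"

definition fib_twist :: "'k :: field \<Rightarrow> fib list \<Rightarrow> 'k fib_arr" where
  "fib_twist u xs = mk_arr xs xs
     (\<lambda>i j. if i = j then (case xs ! i of One \<Rightarrow> 1 | Tau \<Rightarrow> inverse (u ^ 2)) else 0)"

definition fib_cat :: "'k :: field \<Rightarrow> (fib list, 'k fib_arr, 'k) balcat" where
  "fib_cat u = \<lparr>
     Obj = UNIV,
     Arr = {f. f = mk_arr (src f) (tgt f) (entry f)},
     Dom = src,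
     Cod = tgt,
     Ident = fib_ident,
     Comp = fib_comp,
     Zero = (\<lambda>xs ys. mk_arr xs ys (\<lambda>i j. 0)),
     Add = (\<lambda>f g. mk_arr (src f) (tgt f) (\<lambda>i j. entry f i j + entry g i j)),
     Smult = (\<lambda>r f. mk_arr (src f) (tgt f) (\<lambda>i j. r * entry f i j)),
     TenO = fib_tenO,
     TenA = fib_tenA,
     Unit = [One],
     Assoc = fib_assoc u,
     LUnit = fib_ident,
     RUnit = fib_ident,
     Braid = fib_braid u,
     Twist = fib_twist u \<rparr>"

definition fib_mu :: "'k :: field fib_arr" where
  "fib_mu = mk_arr [One, Tau] [Tau] (\<lambda>i j. 1)"

definition fib_eps :: "'k :: field fib_arr" where
  "fib_eps = mk_arr [One, Tau] [One] (\<lambda>i j. 1)"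

lemma fib_cat_relations:
  fixes u :: "'k :: field"
  defines "F \<equiv> fib_cat u" and "a \<equiv> u + inverse u" and "X \<equiv> [Tau]"
    and "\<mu> \<equiv> fib_mu" and "\<epsilon> \<equiv> fib_eps"
  defines "e \<equiv> Ident F X"
  shows "\<mu> \<in> hom F (X \<odot>\<^bsub>F\<^esub> X) X" and "\<epsilon> \<in> hom F (X \<odot>\<^bsub>F\<^esub> X) (Unit F)"
    and "\<epsilon> \<cdot>\<^bsub>F\<^esub> (e \<otimes>\<^bsub>F\<^esub> \<mu>) \<cdot>\<^bsub>F\<^esub> Assoc F X X X = \<epsilon> \<cdot>\<^bsub>F\<^esub> (\<mu> \<otimes>\<^bsub>F\<^esub> e)"
    and "\<mu> \<cdot>\<^bsub>F\<^esub> (e \<otimes>\<^bsub>F\<^esub> \<mu>) \<cdot>\<^bsub>F\<^esub> Assoc F X X X =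
      a \<bullet>\<^bsub>F\<^esub> (\<mu> \<cdot>\<^bsub>F\<^esub> (\<mu> \<otimes>\<^bsub>F\<^esub> e)) \<oplus>\<^bsub>F\<^esub> (\<epsilon> \<otimes>\<^bsub>F\<^esub> e)"
    and "(e \<otimes>\<^bsub>F\<^esub> \<epsilon>) \<cdot>\<^bsub>F\<^esub> Assoc F X X X =
      (- a) \<bullet>\<^bsub>F\<^esub> (\<mu> \<cdot>\<^bsub>F\<^esub> (\<mu> \<otimes>\<^bsub>F\<^esub> e)) \<oplus>\<^bsub>F\<^esub> (- a) \<bullet>\<^bsub>F\<^esub> (\<epsilon> \<otimes>\<^bsub>F\<^esub> e)"
    and "\<mu> \<cdot>\<^bsub>F\<^esub> Braid F X X = u \<bullet>\<^bsub>F\<^esub> \<mu>"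
    and "\<epsilon> \<cdot>\<^bsub>F\<^esub> Braid F X X = u ^ 2 \<bullet>\<^bsub>F\<^esub> \<epsilon>"
    and "Twist F (Unit F) = Ident F (Unit F)"
    and "Twist F X = inverse (u ^ 2) \<bullet>\<^bsub>F\<^esub> e"
  unfolding assms
  by (auto simp: fib_cat_def hom_def fib_mu_def fib_eps_def mk_arr_def fib_comp_def fib_tenA_def
      fib_assoc_def fib_braid_def fib_twist_def fib_ident_def fib_tenO_def ten_basis_def fib_F_def
      fib_R_def fun_eq_iff less_Suc_eq numeral_eq_Suc nth_Cons')

end

theory Submission
  imports Defs
begin

text \<open>Choosing, in a Fibonacci category, an inclusion of each simple summand of \<open>x \<otimes> y\<close> for simple
  \<open>x\<close> and \<open>y\<close>, and a decomposition of every object into simple ones, turns arrows into block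
  matrices, and the structure constraints into matrices with scalar coefficients \<open>F\<close>, \<open>R\<close> and
  \<open>T\<close>. The pentagon on \<open>X \<otimes> X \<otimes> X \<otimes> X\<close> determines \<open>F\<close> up to rescaling the inclusion of the unit into
  \<open>X \<otimes> X\<close>, in terms of a root of \<open>a\<^sup>2 = a + 1\<close>; no rigidity is needed for this. The hexagon then
  forces \<open>a = u + u\<^sup>-\<^sup>1\<close>, which says that \<open>u\<close> is a primitive tenth root of unity, and the twist on
  \<open>X\<close> is \<open>u\<^sup>-\<^sup>2\<close>. So taking matrices is a balanced monoidal equivalence to \<open>F\<^sub>u\<close>, and \<open>u\<close> is an
  invariant, because \<open>u\<^sup>-\<^sup>2\<close> is preserved by equivalences and \<open>u\<^sup>5 = -1\<close>. Since the coefficient of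
  \<open>F\<close> between the two unit channels is \<open>-a \<noteq> 0\<close>, every object is its own dual; balancing turns
  the double braiding of two simple objects into a quotient of twists, so that the S-matrix can
  be read off from the twists and the dimension \<open>1 - a\<close> of \<open>X\<close>.\<close>

section \<open>Linear categories\<close>

text \<open>Two facts that are often quoted have to come out of coherence here. The unit constraints
  at \<open>I\<close> agree because the triangle turns their ratio into an associator coefficient,
  and the pentagon on four units says that its square equals its cube. The unit-to-unit coefficient
  \<open>s\<close> of the associator on \<open>X\<close>, on which all duality rests, is nonzero
  because the pentagon contains both \<open>s*s + r*g*q = 1\<close> and \<open>s = r*q*g\<close>. A
  matrix depends on decompositions, and the one chosen for a tensor product is in general not built
  from those of its factors. The tensor structure of the functor is exactly this change of basis,
  the matrix of an identity arrow, so every coherence axiom says that two products of matrices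
  represent the same arrow. The trace is a description ranging over all duals, so loops are
  evaluated for an arbitrary dual and reduced to the standard one. Characteristic zero enters
  arithmetically: a degenerate S-matrix means \<open>a = 3\<close>, which turns
  \<open>a^2 = a + 1\<close> into \<open>5 = 0\<close>, and a root of smaller order gives
  \<open>10 = 0\<close>. Algebraic closure serves Schur's lemma and the existence of a tenth
  root.\<close>

lemma homE: "f \<in> hom C A B \<Longrightarrow> f \<in> Arr C \<and> Dom C f = A \<and> Cod C f = B"
  by (simp add: hom_def)

section \<open>Composition and inverse arrows as typed rewriting\<close>

context category
begin

lemma arr_obj [simp]:
  assumes "f \<in> Arr C" shows "Dom C f \<in> Obj C" "Cod C f \<in> Obj C"
  using assms dom_obj cod_obj by auto

lemma hom_obj:
  assumes "f \<in> hom C A B" shows "A \<in> Obj C" "B \<in> Obj C"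
  using assms by (auto simp: hom_def)

lemma ident_arr [simp]:
  assumes "A \<in> Obj C"
  shows "Ident C A \<in> Arr C" "Dom C (Ident C A) = A" "Cod C (Ident C A) = A"
  using ident_hom[OF assms] by (auto simp: hom_def)

lemma comp_arr [simp]:
  assumes "f \<in> Arr C" "g \<in> Arr C" "Cod C f = Dom C g"
  shows "g \<cdot> f \<in> Arr C" "Dom C (g \<cdot> f) = Dom C f" "Cod C (g \<cdot> f) = Cod C g"
  using comp_hom[of f "Dom C f" "Cod C f" g "Cod C g"] assms by (auto simp: hom_def)

lemma comp_assoc_arr [simp]:
  assumes "f \<in> Arr C" "g \<in> Arr C" "h \<in> Arr C" "Cod C f = Dom C g" "Cod C g = Dom C h"
  shows "(h \<cdot> g) \<cdot> f = h \<cdot> (g \<cdot> f)"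
  using comp_assoc[of f "Dom C f" "Cod C f" g "Cod C g" h "Cod C h"] assms by (auto simp: hom_def)

lemma comp_ident_arr [simp]:
  assumes "f \<in> Arr C"
  shows "Cod C f = B \<Longrightarrow> Ident C B \<cdot> f = f" "Dom C f = A \<Longrightarrow> f \<cdot> Ident C A = f"
  using comp_ident_left comp_ident_right assms by (auto simp: hom_def)

lemma inverse_arrs_unique:
  assumes "inverse_arrs C f g" "inverse_arrs C f h" shows "g = h"
proof -
  have "f \<in> Arr C" "g \<in> Arr C" "Dom C g = Cod C f" "Cod C g = Dom C f"
    "h \<in> Arr C" "Dom C h = Cod C f" "Cod C h = Dom C f"
    "g \<cdot> f = Ident C (Dom C f)" "f \<cdot> h = Ident C (Cod C f)"
    using assms by (auto simp: inverse_arrs_def hom_def)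
  moreover from this have "g = g \<cdot> (f \<cdot> h)" by simp
  moreover from calculation have "(g \<cdot> f) \<cdot> h = g \<cdot> (f \<cdot> h)"
    by (intro comp_assoc_arr) auto
  ultimately show ?thesis by simp
qed

lemma inv_arr_eqI: "inverse_arrs C f g \<Longrightarrow> inv_arr C f = g"
  unfolding inv_arr_def using inverse_arrs_unique by blast

lemma inverse_arrsI:
  assumes "f \<in> hom C A B" "g \<in> hom C B A" "g \<cdot> f = Ident C A" "f \<cdot> g = Ident C B"
  shows "inverse_arrs C f g"
  using assms by (auto simp: inverse_arrs_def hom_def)

lemma inv_arr:
  assumes "iso_arr C f"
  shows "f \<in> Arr C" "inv_arr C f \<in> Arr C" "Dom C (inv_arr C f) = Cod C f"
    "Cod C (inv_arr C f) = Dom C f"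
    "inv_arr C f \<cdot> f = Ident C (Dom C f)" "f \<cdot> inv_arr C f = Ident C (Cod C f)"
proof -
  obtain g where g: "inverse_arrs C f g" using assms by (auto simp: iso_arr_def)
  then have "inverse_arrs C f (inv_arr C f)" by (simp add: inv_arr_eqI)
  then show "f \<in> Arr C" "inv_arr C f \<in> Arr C" "Dom C (inv_arr C f) = Cod C f"
    "Cod C (inv_arr C f) = Dom C f"
    "inv_arr C f \<cdot> f = Ident C (Dom C f)" "f \<cdot> inv_arr C f = Ident C (Cod C f)"
    by (auto simp: inverse_arrs_def hom_def)
qed

lemma inv_arr_cancel:
  assumes "iso_arr C f"
  shows "g \<in> Arr C \<Longrightarrow> Cod C g = Dom C f \<Longrightarrow> inv_arr C f \<cdot> (f \<cdot> g) = g"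
    and "g \<in> Arr C \<Longrightarrow> Cod C g = Cod C f \<Longrightarrow> f \<cdot> (inv_arr C f \<cdot> g) = g"
proof -
  note [simp] = inv_arr[OF assms]
  show "inv_arr C f \<cdot> (f \<cdot> g) = g" if "g \<in> Arr C" "Cod C g = Dom C f"
    using that comp_assoc_arr[of g f "inv_arr C f"] by simp
  show "f \<cdot> (inv_arr C f \<cdot> g) = g" if "g \<in> Arr C" "Cod C g = Cod C f"
    using that comp_assoc_arr[of g "inv_arr C f" f] by simp
qed

lemma iso_arrI: "inverse_arrs C f g \<Longrightarrow> iso_arr C f"
  by (auto simp: iso_arr_def)

lemma inv_arr_iso: "iso_arr C f \<Longrightarrow> iso_arr C (inv_arr C f)"
  using inv_arr[of f] by (intro iso_arrI[of _ f]) (auto simp: inverse_arrs_def hom_def)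

lemma comp_iso:
  assumes "iso_arr C f" "iso_arr C g" "Cod C f = Dom C g"
  shows "iso_arr C (g \<cdot> f)"
proof -
  note [simp] = inv_arr[OF assms(1)] inv_arr[OF assms(2)] inv_arr_cancel[OF assms(1)]
    inv_arr_cancel[OF assms(2)] assms(3)
  show ?thesis
    by (rule iso_arrI[of _ "inv_arr C f \<cdot> inv_arr C g"]) (auto simp: inverse_arrs_def hom_def)
qed

lemma iso_objI: "f \<in> hom C A B \<Longrightarrow> iso_arr C f \<Longrightarrow> iso_obj C A B"
  by (auto simp: iso_obj_def)

lemma iso_obj_sym: assumes "iso_obj C A B" shows "iso_obj C B A"
proof -
  obtain f where f: "f \<in> hom C A B" "iso_arr C f" using assms by (auto simp: iso_obj_def)
  have "inv_arr C f \<in> hom C B A" using inv_arr[OF f(2)] f(1) by (simp add: hom_def)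
  then show ?thesis using inv_arr_iso[OF f(2)] by (rule iso_objI)
qed

lemma iso_obj_trans: assumes "iso_obj C A B" "iso_obj C B D" shows "iso_obj C A D"
proof -
  obtain f g where f: "f \<in> hom C A B" "iso_arr C f" and g: "g \<in> hom C B D" "iso_arr C g"
    using assms by (auto simp: iso_obj_def)
  have "iso_arr C (g \<cdot> f)" using f g by (intro comp_iso) (auto simp: hom_def)
  then show ?thesis using comp_hom[OF f(1) g(1)] by (intro iso_objI)
qed

lemma iso_obj_refl: "A \<in> Obj C \<Longrightarrow> iso_obj C A A"
  unfolding iso_obj_def
  by (rule bexI[of _ "Ident C A"], rule iso_arrI[of _ "Ident C A"]) (auto simp: inverse_arrs_def hom_def)

end

section \<open>Arithmetic and finite sums in hom spaces\<close>

context linear_category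
begin

lemma zero_arr [simp]:
  assumes "A \<in> Obj C" "B \<in> Obj C"
  shows "Zero C A B \<in> Arr C" "Dom C (Zero C A B) = A" "Cod C (Zero C A B) = B"
  using zero_hom[OF assms] by (auto simp: hom_def)

lemma add_arr [simp]:
  assumes "f \<in> Arr C" "g \<in> Arr C" "Dom C f = Dom C g" "Cod C f = Cod C g"
  shows "f \<oplus> g \<in> Arr C" "Dom C (f \<oplus> g) = Dom C g" "Cod C (f \<oplus> g) = Cod C g"
  using add_hom[of f "Dom C f" "Cod C f" g] assms by (auto simp: hom_def)

lemma smult_arr [simp]:
  assumes "f \<in> Arr C"
  shows "r \<bullet> f \<in> Arr C" "Dom C (r \<bullet> f) = Dom C f" "Cod C (r \<bullet> f) = Cod C f"
  using smult_hom[of f "Dom C f" "Cod C f" r] assms by (auto simp: hom_def)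

lemma comp_smult_arr [simp]:
  assumes "f \<in> Arr C" "g \<in> Arr C" "Cod C f = Dom C g"
  shows "(r \<bullet> g) \<cdot> f = r \<bullet> (g \<cdot> f)" "g \<cdot> (r \<bullet> f) = r \<bullet> (g \<cdot> f)"
  using comp_smult_left[of f "Dom C f" "Cod C f" g "Cod C g"]
    comp_smult_right[of f "Dom C f" "Cod C f" g "Cod C g"] assms by (auto simp: hom_def)

lemma comp_add_arr [simp]:
  assumes "f \<in> Arr C" "g \<in> Arr C" "h \<in> Arr C"
  shows "Cod C f = Dom C g \<Longrightarrow> Dom C h = Dom C g \<Longrightarrow> Cod C h = Cod C g \<Longrightarrow>
      (g \<oplus> h) \<cdot> f = (g \<cdot> f) \<oplus> (h \<cdot> f)"
    "Dom C f = Dom C g \<Longrightarrow> Cod C f = Cod C g \<Longrightarrow> Cod C g = Dom C h \<Longrightarrow>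
      h \<cdot> (f \<oplus> g) = (h \<cdot> f) \<oplus> (h \<cdot> g)"
  using comp_add_left[of f "Dom C f" "Cod C f" g "Cod C g" h]
    comp_add_right[of f "Dom C f" "Cod C f" g h "Cod C h"] assms by (auto simp: hom_def)

lemma smult_simps [simp]:
  assumes "f \<in> Arr C"
  shows "1 \<bullet> f = f" "r \<bullet> (s \<bullet> f) = (r * s) \<bullet> f" "0 \<bullet> f = Zero C (Dom C f) (Cod C f)"
  using assms smult_one smult_smult smult_zero by (auto simp: hom_def)

lemma smult_add_arr:
  assumes "f \<in> Arr C" "g \<in> Arr C" "Dom C f = Dom C g" "Cod C f = Cod C g"
  shows "r \<bullet> (f \<oplus> g) = (r \<bullet> f) \<oplus> (r \<bullet> g)"
  using assms smult_add_right[of f "Dom C f" "Cod C f" g] by (auto simp: hom_def)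

lemma add_smult_arr:
  assumes "f \<in> Arr C"
  shows "(r + s) \<bullet> f = (r \<bullet> f) \<oplus> (s \<bullet> f)"
  using assms smult_add_left[of f "Dom C f" "Cod C f"] by (auto simp: hom_def)

lemma add_assoc_arr:
  assumes "f \<in> Arr C" "g \<in> Arr C" "h \<in> Arr C" "Dom C f = Dom C g" "Cod C f = Cod C g"
     "Dom C g = Dom C h" "Cod C g = Cod C h"
  shows "(f \<oplus> g) \<oplus> h = f \<oplus> (g \<oplus> h)"
  using assms add_assoc[of f "Dom C f" "Cod C f" g h] by (auto simp: hom_def)

lemma add_commute_arr:
  assumes "f \<in> Arr C" "g \<in> Arr C" "Dom C f = Dom C g" "Cod C f = Cod C g"
  shows "f \<oplus> g = g \<oplus> f"
  using assms add_commute[of f "Dom C f" "Cod C f" g] by (auto simp: hom_def)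

lemma add_left_commute_arr:
  assumes "f \<in> Arr C" "g \<in> Arr C" "h \<in> Arr C" "Dom C f = Dom C g" "Cod C f = Cod C g"
     "Dom C g = Dom C h" "Cod C g = Cod C h"
  shows "f \<oplus> (g \<oplus> h) = g \<oplus> (f \<oplus> h)"
  using assms add_commute_arr[of f g] add_assoc_arr[of f g h] add_assoc_arr[of g f h] by simp

lemmas add_ac_arr = add_assoc_arr add_commute_arr add_left_commute_arr

lemma add_zero_arr [simp]:
  assumes "f \<in> Arr C" "Dom C f = A" "Cod C f = B"
  shows "f \<oplus> Zero C A B = f" "Zero C A B \<oplus> f = f"
  using assms add_zero[of f "Dom C f" "Cod C f"] add_commute_arr[of f "Zero C A B"] by (auto simp: hom_def)

lemma smult_zero_arr [simp]:
  assumes "A \<in> Obj C" "B \<in> Obj C" shows "r \<bullet> Zero C A B = Zero C A B"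
proof -
  have "r \<bullet> Zero C A B = r \<bullet> (0 \<bullet> Zero C A B)" using assms by (simp del: smult_simps(2))
  also have "\<dots> = (r * 0) \<bullet> Zero C A B" using assms by (intro smult_simps) simp
  also have "\<dots> = Zero C A B" using assms by simp
  finally show ?thesis .
qed

lemma comp_zero_arr [simp]:
  assumes "f \<in> Arr C" "A \<in> Obj C"
  shows "Cod C f = A \<Longrightarrow> B \<in> Obj C \<Longrightarrow> Zero C A B \<cdot> f = Zero C (Dom C f) B"
    "Dom C f = B \<Longrightarrow> f \<cdot> Zero C A B = Zero C A (Cod C f)"
  using comp_smult_arr(1)[of f "Zero C A B" 0] comp_smult_arr(2)[of "Zero C A B" f 0] assms
  by auto

lemma add_minus [simp]:
  assumes "f \<in> Arr C"
  shows "f \<oplus> (- 1) \<bullet> f = Zero C (Dom C f) (Cod C f)" "(- 1) \<bullet> f \<oplus> f = Zero C (Dom C f) (Cod C f)"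
  using add_smult_arr[OF assms, of 1 "-1"] add_smult_arr[OF assms, of "-1" 1] assms by simp_all

lemma add_minus_eq:
  assumes "f \<in> Arr C" "g \<in> Arr C" "Dom C f = Dom C g" "Cod C f = Cod C g"
    and "f \<oplus> (- 1) \<bullet> g = Zero C (Dom C g) (Cod C g)"
  shows "f = g"
proof -
  have "f = f \<oplus> ((- 1) \<bullet> g \<oplus> g)" using assms by simp
  also have "\<dots> = (f \<oplus> (- 1) \<bullet> g) \<oplus> g" using assms by (subst add_assoc_arr) auto
  also have "\<dots> = g" using assms by simp
  finally show ?thesis .
qed

lemma smult_cancel:
  assumes "f \<in> Arr C" "g \<in> Arr C" "r \<noteq> 0" "r \<bullet> f = r \<bullet> g" shows "f = g"
  using arg_cong[OF assms(4), of "\<lambda>h. inverse r \<bullet> h"] assms(1-3) by simp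

text \<open>Source and target are arguments because the empty sum has to be the zero arrow of a
  definite hom space.\<close>

primrec osum :: "'o \<Rightarrow> 'o \<Rightarrow> (nat \<Rightarrow> 'm) \<Rightarrow> nat \<Rightarrow> 'm" where
  "osum A B f 0 = Zero C A B"
| "osum A B f (Suc n) = osum A B f n \<oplus> f n"

lemma osum_hom:
  assumes "A \<in> Obj C" "B \<in> Obj C" "\<And>i. i < n \<Longrightarrow> f i \<in> hom C A B"
  shows "osum A B f n \<in> hom C A B"
  using assms(3) by (induction n) (auto intro!: zero_hom add_hom assms(1,2))

text \<open>\<open>L\<close> is any map of hom spaces that is additive on well-typed arrows.
  Composition on either side, scaling, tensoring with a fixed arrow and closing an arrow up to a
  loop are all treated as instances.\<close>

lemma osum_map:
  assumes "A \<in> Obj C" "B \<in> Obj C" "\<And>i. i < n \<Longrightarrow> f i \<in> hom C A B"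
    and "L (Zero C A B) = Zero C A' B'"
    and "\<And>g h. g \<in> hom C A B \<Longrightarrow> h \<in> hom C A B \<Longrightarrow> L (g \<oplus> h) = L g \<oplus> L h"
  shows "L (osum A B f n) = osum A' B' (\<lambda>i. L (f i)) n"
  using assms(3) by (induction n) (auto simp: assms osum_hom)

lemma osum_cong:
  assumes "\<And>i. i < n \<Longrightarrow> f i = g i"
  shows "osum A B f n = osum A B g n"
  using assms by (induction n) auto

lemma osum_zero:
  assumes "A \<in> Obj C" "B \<in> Obj C" "\<And>i. i < n \<Longrightarrow> f i = Zero C A B"
  shows "osum A B f n = Zero C A B"
  using assms(3) by (induction n) (auto simp: assms)

lemma osum_single:
  assumes "A \<in> Obj C" "B \<in> Obj C" "k < n" "f k \<in> hom C A B" "\<And>i. i < n \<Longrightarrow> i \<noteq> k \<Longrightarrow> f i = Zero C A B"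
  shows "osum A B f n = f k"
  using assms(3,5)
proof (induction n)
  case (Suc n)
  show ?case
  proof (cases "k = n")
    case True
    then have "osum A B f n = Zero C A B" using Suc.prems assms by (intro osum_zero) auto
    then show ?thesis using True assms(4) by (auto simp: hom_def)
  next
    case False
    then show ?thesis using Suc assms by (auto simp: hom_def)
  qed
qed simp

lemma osum_comp:
  assumes "A \<in> Obj C" "B \<in> Obj C" "\<And>i. i < n \<Longrightarrow> f i \<in> hom C A B"
  shows "g \<in> hom C B D \<Longrightarrow> g \<cdot> osum A B f n = osum A D (\<lambda>i. g \<cdot> f i) n"
    and "h \<in> hom C D A \<Longrightarrow> osum A B f n \<cdot> h = osum D B (\<lambda>i. f i \<cdot> h) n"
proof -
  show "g \<cdot> osum A B f n = osum A D (\<lambda>i. g \<cdot> f i) n" if "g \<in> hom C B D"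
    using assms that by (intro osum_map) (auto simp: hom_def)
  show "osum A B f n \<cdot> h = osum D B (\<lambda>i. f i \<cdot> h) n" if "h \<in> hom C D A"
    using assms that by (intro osum_map) (auto simp: hom_def)
qed

lemma osum_smult:
  assumes "f \<in> hom C A B"
  shows "osum A B (\<lambda>i. c i \<bullet> f) n = (\<Sum>i<n. c i) \<bullet> f"
  using assms by (induction n) (auto simp: add_smult_arr hom_def)

lemma zero_objI:
  assumes "A \<in> Obj C" "Ident C A = Zero C A A"
  shows "zero_obj C A"
proof -
  have "f = Zero C B A" if "f \<in> hom C B A" for f B
    using that assms comp_ident_left[OF that] hom_obj[OF that] by (auto simp: hom_def)
  moreover have "f = Zero C A B" if "f \<in> hom C A B" for f B
    using that assms comp_ident_right[OF that] hom_obj[OF that] by (auto simp: hom_def)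
  ultimately show ?thesis using assms by (auto simp: zero_obj_def intro!: ex1I zero_hom)
qed

lemma zero_objD:
  assumes "zero_obj C Z"
  shows "Z \<in> Obj C" "f \<in> hom C Z B \<Longrightarrow> f = Zero C Z B" "f \<in> hom C B Z \<Longrightarrow> f = Zero C B Z"
  using assms hom_obj zero_hom unfolding zero_obj_def by metis+

end

section \<open>Decompositions into simple objects\<close>

datatype 'm dec = Dec (lab: "fib list") (inc: "nat \<Rightarrow> 'm") (prj: "nat \<Rightarrow> 'm")

text \<open>Completeness is expressed by joint cancellability of the inclusions instead of the
  formula that the sum of all \<open>inc\<close> after \<open>prj\<close> is the identity.
  Cancellability is easy to verify when decompositions are built, in particular for tensor products;
  the formula is recovered in \<open>dec_complete\<close>.\<close>

definition is_dec :: "('o, 'm, 'k, 'x) lincat_scheme \<Rightarrow> (fib \<Rightarrow> 'o) \<Rightarrow> 'm dec \<Rightarrow> 'o \<Rightarrow> bool" where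
  "is_dec C S d A \<longleftrightarrow> A \<in> Obj C \<and>
     (\<forall>i < length (lab d). inc d i \<in> hom C (S (lab d ! i)) A \<and> prj d i \<in> hom C A (S (lab d ! i))) \<and>
     (\<forall>i < length (lab d). \<forall>j < length (lab d). prj d i \<cdot>\<^bsub>C\<^esub> inc d j =
        (if i = j then Ident C (S (lab d ! i)) else Zero C (S (lab d ! j)) (S (lab d ! i)))) \<and>
     (\<forall>B. \<forall>f \<in> hom C A B. \<forall>g \<in> hom C A B.
        (\<forall>i < length (lab d). f \<cdot>\<^bsub>C\<^esub> inc d i = g \<cdot>\<^bsub>C\<^esub> inc d i) \<longrightarrow> f = g)"

text \<open>Isolates what matrix calculus needs: Schur's lemma for two objects and decompositions.
  The same locale then covers the given category, where Schur's lemma takes work, and the block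
  matrices, where it is read off from entries.\<close>

locale simple_system = linear_category C
  for C :: "('o, 'm, 'k :: field, 'x) lincat_scheme" (structure) and S :: "fib \<Rightarrow> 'o" +
  assumes S_obj [simp]: "S l \<in> Obj C"
    and schur_scalar: "f \<in> hom C (S l) (S l) \<Longrightarrow> \<exists>c. f = c \<bullet> Ident C (S l)"
    and schur_zero: "l \<noteq> m \<Longrightarrow> f \<in> hom C (S l) (S m) \<Longrightarrow> f = Zero C (S l) (S m)"
    and ident_nonzero: "Ident C (S l) \<noteq> Zero C (S l) (S l)"
    and ex_dec: "A \<in> Obj C \<Longrightarrow> \<exists>d. is_dec C S d A"
begin

abbreviation dec :: "'m dec \<Rightarrow> 'o \<Rightarrow> bool" where "dec \<equiv> is_dec C S"

abbreviation dlen :: "'m dec \<Rightarrow> nat" where "dlen d \<equiv> length (lab d)"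

lemma decD:
  assumes "dec d A"
  shows "A \<in> Obj C" "i < dlen d \<Longrightarrow> inc d i \<in> Arr C" "i < dlen d \<Longrightarrow> Dom C (inc d i) = S (lab d ! i)"
    "i < dlen d \<Longrightarrow> Cod C (inc d i) = A"
    "i < dlen d \<Longrightarrow> prj d i \<in> Arr C" "i < dlen d \<Longrightarrow> Dom C (prj d i) = A"
    "i < dlen d \<Longrightarrow> Cod C (prj d i) = S (lab d ! i)"
  using assms unfolding is_dec_def by (blast dest: homE)+

lemma dec_hom:
  assumes "dec d A" "i < dlen d"
  shows "inc d i \<in> hom C (S (lab d ! i)) A" "prj d i \<in> hom C A (S (lab d ! i))"
  using assms unfolding is_dec_def by blast+

lemma dec_prj_inc:
  assumes "dec d A" "i < dlen d" "j < dlen d"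
  shows "prj d i \<cdot> inc d j = (if i = j then Ident C (S (lab d ! i)) else Zero C (S (lab d ! j)) (S (lab d ! i)))"
  using assms unfolding is_dec_def by blast

lemma dec_epi:
  assumes "dec d A" "f \<in> hom C A B" "g \<in> hom C A B" "\<And>i. i < dlen d \<Longrightarrow> f \<cdot> inc d i = g \<cdot> inc d i"
  shows "f = g"
  using assms unfolding is_dec_def by blast

text \<open>Composed with \<open>inc d j\<close>, all terms of the sum but the \<open>j\<close>-th
  vanish, so both sides agree on every inclusion.\<close>

lemma dec_complete:
  assumes "dec d A"
  shows "osum A A (\<lambda>i. inc d i \<cdot> prj d i) (dlen d) = Ident C A" (is "?s = _")
proof (rule dec_epi[OF assms])
  note [simp] = decD[OF assms]
  have h: "inc d i \<cdot> prj d i \<in> hom C A A" if "i < dlen d" for i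
    using assms that by (simp add: hom_def)
  show "?s \<in> hom C A A" using assms h by (intro osum_hom) auto
  show "Ident C A \<in> hom C A A" using assms by (simp add: hom_def)
  fix j assume j: "j < dlen d"
  have "?s \<cdot> inc d j = osum (S (lab d ! j)) A (\<lambda>i. (inc d i \<cdot> prj d i) \<cdot> inc d j) (dlen d)"
    using assms h j by (intro osum_comp) (auto simp: hom_def)
  also have "\<dots> = (inc d j \<cdot> prj d j) \<cdot> inc d j"
    using assms j by (intro osum_single) (auto simp: hom_def dec_prj_inc[OF assms])
  also have "\<dots> = Ident C A \<cdot> inc d j" using assms j by (simp add: dec_prj_inc[OF assms])
  finally show "?s \<cdot> inc d j = Ident C A \<cdot> inc d j" .
qed

text \<open>Inserting the resolution of the identity of \<open>A\<close> shows that an arrow into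
  \<open>A\<close> is the sum of \<open>inc\<close> after its components.\<close>

lemma dec_mono:
  assumes "dec d A" "f \<in> hom C B A" "g \<in> hom C B A" "\<And>i. i < dlen d \<Longrightarrow> prj d i \<cdot> f = prj d i \<cdot> g"
  shows "f = g"
proof -
  note [simp] = decD[OF assms(1)]
  have h: "inc d i \<cdot> prj d i \<in> hom C A A" if "i < dlen d" for i
    using assms that by (simp add: hom_def)
  have eq: "k = osum B A (\<lambda>i. inc d i \<cdot> (prj d i \<cdot> k)) (dlen d)" if "k \<in> hom C B A" for k
  proof -
    have "k = osum A A (\<lambda>i. inc d i \<cdot> prj d i) (dlen d) \<cdot> k"
      using dec_complete[OF assms(1)] that by (auto simp: hom_def)
    also have "\<dots> = osum B A (\<lambda>i. (inc d i \<cdot> prj d i) \<cdot> k) (dlen d)"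
      using assms(1) h that by (intro osum_comp) (auto simp: hom_def)
    also have "\<dots> = osum B A (\<lambda>i. inc d i \<cdot> (prj d i \<cdot> k)) (dlen d)"
      using assms(1) that by (intro osum_cong) (auto simp: hom_def)
    finally show ?thesis .
  qed
  have "osum B A (\<lambda>i. inc d i \<cdot> (prj d i \<cdot> f)) (dlen d) = osum B A (\<lambda>i. inc d i \<cdot> (prj d i \<cdot> g)) (dlen d)"
    using assms(4) by (intro osum_cong) auto
  then show ?thesis using eq[OF assms(2)] eq[OF assms(3)] by simp
qed

definition coef :: "'m \<Rightarrow> 'k" where
  "coef f = (THE c. f = c \<bullet> Ident C (Dom C f))"

lemma scalar_inj: "c \<bullet> Ident C (S l) = c' \<bullet> Ident C (S l) \<Longrightarrow> c = c'"
proof (rule ccontr)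
  assume eq: "c \<bullet> Ident C (S l) = c' \<bullet> Ident C (S l)" and "c \<noteq> c'"
  have "(c - c') \<bullet> Ident C (S l) = (c \<bullet> Ident C (S l)) \<oplus> ((- c') \<bullet> Ident C (S l))"
    using add_smult_arr[of "Ident C (S l)" c "- c'"] by simp
  also have "\<dots> = (0::'k) \<bullet> Ident C (S l)"
    unfolding eq using add_smult_arr[of "Ident C (S l)" c' "- c'"] by simp
  finally have "(c - c') \<bullet> Ident C (S l) = (c - c') \<bullet> Zero C (S l) (S l)" by simp
  then show False using \<open>c \<noteq> c'\<close> smult_cancel[of "Ident C (S l)" "Zero C (S l) (S l)" "c - c'"] ident_nonzero[of l]
    by simp
qed

lemma coef_eqI: "f = c \<bullet> Ident C (S l) \<Longrightarrow> coef f = c"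
  unfolding coef_def by (auto dest: scalar_inj)

lemma coef_hom: "f \<in> hom C (S l) (S l) \<Longrightarrow> f = coef f \<bullet> Ident C (S l)"
  using schur_scalar coef_eqI by metis

lemma coef_ident [simp]: "coef (Ident C (S l)) = 1"
  by (rule coef_eqI[of _ _ l]) simp

lemma coef_zero [simp]: "coef (Zero C (S l) (S l)) = 0"
  by (rule coef_eqI[of _ _ l]) simp

lemma coef_smult [simp]: "f \<in> hom C (S l) (S l) \<Longrightarrow> coef (r \<bullet> f) = r * coef f"
  by (rule coef_eqI[of _ _ l], subst (1) coef_hom) (auto simp: hom_def)

lemma coef_add [simp]:
  assumes "f \<in> hom C (S l) (S l)" "g \<in> hom C (S l) (S l)" shows "coef (f \<oplus> g) = coef f + coef g"
  by (rule coef_eqI[of _ _ l], subst coef_hom[OF assms(1)], subst coef_hom[OF assms(2)])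
    (simp add: add_smult_arr)

lemma coef_comp:
  assumes "f \<in> hom C (S l) (S m)" "g \<in> hom C (S m) (S l)"
  shows "coef (g \<cdot> f) = (if l = m then coef g * coef f else 0)"
proof (cases "l = m")
  case True
  then show ?thesis
    using coef_hom[of f l] coef_hom[of g l] assms
    by (auto intro!: coef_eqI[of _ _ l]) (metis S_obj comp_ident_arr(1) comp_smult_arr ident_arr smult_arr smult_simps(2))
next
  case False
  then have "f = Zero C (S l) (S m)" using schur_zero assms by auto
  then show ?thesis using False assms by (auto simp: hom_def)
qed

lemma coef_osum:
  assumes "\<And>i. i < n \<Longrightarrow> f i \<in> hom C (S l) (S l)"
  shows "coef (osum (S l) (S l) f n) = (\<Sum>i<n. coef (f i))"
  using assms
proof (induction n)
  case (Suc n)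
  then show ?case using coef_add[of "osum (S l) (S l) f n" l "f n"] osum_hom[of "S l" "S l" n f] by simp
qed simp

end

section \<open>Split image factorizations\<close>

context linear_category
begin

lemma biproductE:
  assumes "biproduct C P A B"
  obtains i j p q where "P \<in> Obj C" "A \<in> Obj C" "B \<in> Obj C"
    "i \<in> hom C A P" "j \<in> hom C B P" "p \<in> hom C P A" "q \<in> hom C P B"
    "p \<cdot> i = Ident C A" "q \<cdot> j = Ident C B" "p \<cdot> j = Zero C B A" "q \<cdot> i = Zero C A B"
    "(i \<cdot> p) \<oplus> (j \<cdot> q) = Ident C P"
  using assms unfolding biproduct_def by blast

lemma comp_cancel:
  assumes "g \<cdot> f = h" "x \<in> Arr C" "f \<in> Arr C" "g \<in> Arr C" "Cod C x = Dom C f" "Cod C f = Dom C g"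
  shows "g \<cdot> (f \<cdot> x) = h \<cdot> x"
  using assms(1) comp_assoc_arr[OF assms(2-6)] by simp

text \<open>An image factorization \<open>f = i p\<close> whose two halves split: \<open>s\<close>
  is a section of \<open>p\<close> and \<open>q\<close> a retraction of \<open>i\<close>. When every
  arrow has one, kernels and cokernels arise by splitting the idempotents \<open>1 - s p\<close> and
  \<open>1 - i q\<close>.\<close>

definition split_factor where
  "split_factor f R i p s q \<longleftrightarrow> R \<in> Obj C \<and> i \<in> hom C R (Cod C f) \<and> p \<in> hom C (Dom C f) R \<and>
     s \<in> hom C R (Dom C f) \<and> q \<in> hom C (Cod C f) R \<and> f = i \<cdot> p \<and> p \<cdot> s = Ident C R \<and> q \<cdot> i = Ident C R"

lemma split_factorD:
  assumes "split_factor f R i p s q"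
  shows "R \<in> Obj C" "i \<in> Arr C" "p \<in> Arr C" "s \<in> Arr C" "q \<in> Arr C"
    "Dom C i = R" "Cod C i = Cod C f" "Dom C p = Dom C f" "Cod C p = R"
    "Dom C s = R" "Cod C s = Dom C f" "Dom C q = Cod C f" "Cod C q = R"
    "i \<cdot> p = f" "p \<cdot> s = Ident C R" "q \<cdot> i = Ident C R"
    "x \<in> Arr C \<Longrightarrow> Cod C x = R \<Longrightarrow> p \<cdot> (s \<cdot> x) = x"
    "x \<in> Arr C \<Longrightarrow> Cod C x = R \<Longrightarrow> q \<cdot> (i \<cdot> x) = x"
    "x \<in> Arr C \<Longrightarrow> Cod C x = Dom C f \<Longrightarrow> i \<cdot> (p \<cdot> x) = f \<cdot> x"
proof -
  show a: "R \<in> Obj C" "i \<in> Arr C" "p \<in> Arr C" "s \<in> Arr C" "q \<in> Arr C"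
    "Dom C i = R" "Cod C i = Cod C f" "Dom C p = Dom C f" "Cod C p = R"
    "Dom C s = R" "Cod C s = Dom C f" "Dom C q = Cod C f" "Cod C q = R"
    using assms unfolding split_factor_def by (blast dest: homE)+
  show e: "i \<cdot> p = f" "p \<cdot> s = Ident C R" "q \<cdot> i = Ident C R"
    using assms unfolding split_factor_def by simp_all
  show "x \<in> Arr C \<Longrightarrow> Cod C x = R \<Longrightarrow> p \<cdot> (s \<cdot> x) = x"
    "x \<in> Arr C \<Longrightarrow> Cod C x = R \<Longrightarrow> q \<cdot> (i \<cdot> x) = x"
    "x \<in> Arr C \<Longrightarrow> Cod C x = Dom C f \<Longrightarrow> i \<cdot> (p \<cdot> x) = f \<cdot> x"
    using comp_cancel[OF e(2), of x] comp_cancel[OF e(3), of x] comp_cancel[OF e(1), of x] a by auto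
qed

lemma split_factor_zero_left:
  assumes "split_factor f R i p s q" "x \<in> Arr C" "Dom C x = R" "x \<cdot> p = Zero C (Dom C f) (Cod C x)"
  shows "x = Zero C R (Cod C x)"
proof -
  note [simp] = split_factorD[OF assms(1)]
  have "x = (x \<cdot> p) \<cdot> s" using assms(2,3) by simp
  also have "\<dots> = Zero C R (Cod C x)"
    unfolding assms(4) using assms(2) arr_obj(1)[of p] by simp
  finally show ?thesis .
qed

lemma split_factor_zero_right:
  assumes "split_factor f R i p s q" "x \<in> Arr C" "Cod C x = R" "i \<cdot> x = Zero C (Dom C x) (Cod C f)"
  shows "x = Zero C (Dom C x) R"
proof -
  note [simp] = split_factorD[OF assms(1)]
  have "x = q \<cdot> (i \<cdot> x)" using assms(2,3) by simp
  also have "\<dots> = Zero C (Dom C x) R"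
    unfolding assms(4) using assms(2) by simp
  finally show ?thesis .
qed

end

section \<open>Abelian structure obtained from Schur's lemma and direct sums\<close>

locale simple_system_sums = simple_system +
  assumes ex_zero_obj: "\<exists>Z. zero_obj C Z"
    and ex_sum: "A \<in> Obj C \<Longrightarrow> B \<in> Obj C \<Longrightarrow> \<exists>P. biproduct C P A B"
begin

text \<open>A nonzero arrow has a nonzero entry with respect to decompositions of its source and
  target. By Schur such an entry joins equal labels and is an invertible scalar; dividing by it
  gives \<open>b\<close>.\<close>

lemma nonzero_split:
  assumes "f \<in> Arr C" "f \<noteq> Zero C (Dom C f) (Cod C f)" "dec d (Dom C f)"
  obtains j b where "j < dlen d" "b \<in> hom C (Cod C f) (S (lab d ! j))"
    "b \<cdot> (f \<cdot> inc d j) = Ident C (S (lab d ! j))"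
proof -
  note [simp] = decD[OF assms(3)]
  obtain j where j: "j < dlen d" "f \<cdot> inc d j \<noteq> Zero C (Dom C f) (Cod C f) \<cdot> inc d j"
    using dec_epi[OF assms(3), of f "Cod C f" "Zero C (Dom C f) (Cod C f)"] assms by (auto simp: hom_def)
  obtain d' where d': "dec d' (Cod C f)" using ex_dec[of "Cod C f"] assms by auto
  note [simp] = decD[OF d']
  let ?S = "S (lab d ! j)"
  have ne: "f \<cdot> inc d j \<noteq> Zero C ?S (Cod C f)" using j assms(1) by simp
  then obtain i where i: "i < dlen d'" "prj d' i \<cdot> (f \<cdot> inc d j) \<noteq> prj d' i \<cdot> Zero C ?S (Cod C f)"
    using dec_mono[OF d', of "f \<cdot> inc d j" ?S "Zero C ?S (Cod C f)"] j assms(1) by (auto simp: hom_def)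
  let ?g = "prj d' i \<cdot> (f \<cdot> inc d j)"
  have gh: "?g \<in> hom C ?S (S (lab d' ! i))" using i j assms(1) by (simp add: hom_def)
  have gne: "?g \<noteq> Zero C ?S (S (lab d' ! i))" using i j assms(1) by simp
  have l: "lab d' ! i = lab d ! j" using schur_zero gh gne by metis
  then have c: "?g = coef ?g \<bullet> Ident C ?S" using coef_hom gh by simp
  have cne: "coef ?g \<noteq> 0"
  proof
    assume "coef ?g = 0" with c have "?g = 0 \<bullet> Ident C ?S" by simp
    then show False using gne l by simp
  qed
  show ?thesis
  proof (rule that[of j "inverse (coef ?g) \<bullet> prj d' i"])
    show "inverse (coef ?g) \<bullet> prj d' i \<in> hom C (Cod C f) ?S" using i l by (simp add: hom_def)
    have "inverse (coef ?g) \<bullet> prj d' i \<cdot> (f \<cdot> inc d j) = inverse (coef ?g) \<bullet> ?g"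
      using i j assms(1) by simp
    also have "\<dots> = inverse (coef ?g) \<bullet> (coef ?g \<bullet> Ident C ?S)" using c by simp
    also have "\<dots> = Ident C ?S" using cne by simp
    finally show "inverse (coef ?g) \<bullet> prj d' i \<cdot> (f \<cdot> inc d j) = Ident C ?S" .
  qed (use j in auto)
qed

text \<open>One step of Gaussian elimination. The arrow \<open>f a b f\<close> is the part of
  \<open>f\<close> through \<open>T\<close>, and the remainder \<open>f'\<close> is orthogonal to
  it: \<open>f' a = 0\<close> and \<open>b f' = 0\<close>. So the image of \<open>f\<close> is the
  direct sum of \<open>T\<close> and the image of \<open>f'\<close>.\<close>

lemma split_factor_step:
  assumes f: "f \<in> Arr C" and a: "a \<in> hom C T (Dom C f)" and b: "b \<in> hom C (Cod C f) T"
    and baf: "b \<cdot> (f \<cdot> a) = Ident C T"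
    and sf: "split_factor (f \<oplus> (- 1) \<bullet> (f \<cdot> (a \<cdot> (b \<cdot> f)))) R' i' p' s' q'"
  shows "\<exists>R i p s q. split_factor f R i p s q"
proof -
  let ?A = "Dom C f" and ?B = "Cod C f"
  have [simp]: "a \<in> Arr C" "Dom C a = T" "Cod C a = ?A" "b \<in> Arr C" "Dom C b = ?B" "Cod C b = T" "f \<in> Arr C"
    "T \<in> Obj C"
    using a b f hom_obj by (auto simp: hom_def)
  define f' where "f' = f \<oplus> (- 1) \<bullet> (f \<cdot> (a \<cdot> (b \<cdot> f)))"
  have f'[simp]: "f' \<in> Arr C" "Dom C f' = ?A" "Cod C f' = ?B" by (simp_all add: f'_def)
  note sf = sf[folded f'_def]
  note S[simp] = split_factorD[OF sf]
  have baf'[simp]: "x \<in> Arr C \<Longrightarrow> Cod C x = T \<Longrightarrow> b \<cdot> (f \<cdot> (a \<cdot> x)) = x" for x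
    using comp_cancel[of b "f \<cdot> a" "Ident C T" x] baf by simp
  note [simp] = baf
  have "f' \<cdot> a = Zero C T ?B" by (simp add: f'_def)
  then have "i' \<cdot> (p' \<cdot> a) = Zero C T ?B" by simp
  then have pa: "p' \<cdot> a = Zero C T R'" using split_factor_zero_right[OF sf, of "p' \<cdot> a"] by simp
  have "b \<cdot> f' = Zero C ?A T" by (simp add: f'_def)
  then have "(b \<cdot> i') \<cdot> p' = Zero C ?A T" by simp
  then have bi: "b \<cdot> i' = Zero C R' T" using split_factor_zero_left[OF sf, of "b \<cdot> i'"] by simp
  have pa'[simp]: "x \<in> Arr C \<Longrightarrow> Cod C x = T \<Longrightarrow> p' \<cdot> (a \<cdot> x) = Zero C (Dom C x) R'" for x
    using comp_cancel[OF pa, of x] by simp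
  have bi'[simp]: "x \<in> Arr C \<Longrightarrow> Cod C x = R' \<Longrightarrow> b \<cdot> (i' \<cdot> x) = Zero C (Dom C x) T" for x
    using comp_cancel[OF bi, of x] by simp
  note [simp] = pa bi
  \<comment> \<open>The section and the retraction of the remainder need not be orthogonal to
    \<open>T\<close>. The idempotents \<open>t = 1 - a b f\<close> and \<open>w = 1 - f a b\<close>
    project the \<open>T\<close>-part away, and \<open>t s'\<close> and \<open>q' w\<close> are the
    corrected maps.\<close>
  define t where "t = Ident C ?A \<oplus> (- 1) \<bullet> (a \<cdot> (b \<cdot> f))"
  define w where "w = Ident C ?B \<oplus> (- 1) \<bullet> (f \<cdot> (a \<cdot> b))"
  have [simp]: "t \<in> Arr C" "Dom C t = ?A" "Cod C t = ?A" "w \<in> Arr C" "Dom C w = ?B" "Cod C w = ?B"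
    by (simp_all add: t_def w_def)
  have pt: "p' \<cdot> t = p'" and bft: "b \<cdot> (f \<cdot> t) = Zero C ?A T"
    and wfa: "w \<cdot> (f \<cdot> a) = Zero C T ?B" and wi: "w \<cdot> i' = i'"
    by (simp_all add: t_def w_def)
  have [simp]: "x \<in> Arr C \<Longrightarrow> Cod C x = ?A \<Longrightarrow> p' \<cdot> (t \<cdot> x) = p' \<cdot> x" for x
    using comp_cancel[OF pt, of x] by simp
  have [simp]: "x \<in> Arr C \<Longrightarrow> Cod C x = ?A \<Longrightarrow> b \<cdot> (f \<cdot> (t \<cdot> x)) = Zero C (Dom C x) T" for x
    using comp_cancel[of b "f \<cdot> t" _ x] bft by simp
  have [simp]: "x \<in> Arr C \<Longrightarrow> Cod C x = T \<Longrightarrow> w \<cdot> (f \<cdot> (a \<cdot> x)) = Zero C (Dom C x) ?B" for x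
    using comp_cancel[of w "f \<cdot> a" _ x] wfa by simp
  have [simp]: "x \<in> Arr C \<Longrightarrow> Cod C x = R' \<Longrightarrow> w \<cdot> (i' \<cdot> x) = i' \<cdot> x" for x
    using comp_cancel[OF wi, of x] by simp
  note [simp] = pt bft wfa wi
  obtain P where "biproduct C P T R'" using ex_sum by force
  then obtain i j p q where h: "P \<in> Obj C" "i \<in> hom C T P" "j \<in> hom C R' P" "p \<in> hom C P T" "q \<in> hom C P R'"
    and e: "p \<cdot> i = Ident C T" "q \<cdot> j = Ident C R'" "p \<cdot> j = Zero C R' T" "q \<cdot> i = Zero C T R'"
    and sum[simp]: "(i \<cdot> p) \<oplus> (j \<cdot> q) = Ident C P" by (elim biproductE)
  have [simp]: "P \<in> Obj C" "i \<in> Arr C" "j \<in> Arr C" "p \<in> Arr C" "q \<in> Arr C" "Dom C i = T" "Dom C j = R'"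
    "Cod C i = P" "Cod C j = P" "Dom C p = P" "Dom C q = P" "Cod C p = T" "Cod C q = R'"
    using h by (auto simp: hom_def)
  have [simp]: "x \<in> Arr C \<Longrightarrow> Cod C x = T \<Longrightarrow> p \<cdot> (i \<cdot> x) = x"
     "x \<in> Arr C \<Longrightarrow> Cod C x = T \<Longrightarrow> q \<cdot> (i \<cdot> x) = Zero C (Dom C x) R'"
     "y \<in> Arr C \<Longrightarrow> Cod C y = R' \<Longrightarrow> p \<cdot> (j \<cdot> y) = Zero C (Dom C y) T"
     "y \<in> Arr C \<Longrightarrow> Cod C y = R' \<Longrightarrow> q \<cdot> (j \<cdot> y) = y" for x y
    using comp_cancel[OF e(1), of x] comp_cancel[OF e(4), of x] comp_cancel[OF e(3), of y] comp_cancel[OF e(2), of y]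
    by auto
  have "split_factor f P (f \<cdot> (a \<cdot> p) \<oplus> i' \<cdot> q) (i \<cdot> (b \<cdot> f) \<oplus> j \<cdot> p') (a \<cdot> p \<oplus> t \<cdot> (s' \<cdot> q)) (i \<cdot> b \<oplus> j \<cdot> (q' \<cdot> w))"
  proof -
    have "(f \<cdot> (a \<cdot> p) \<oplus> i' \<cdot> q) \<cdot> (i \<cdot> (b \<cdot> f) \<oplus> j \<cdot> p') = f \<cdot> (a \<cdot> (b \<cdot> f)) \<oplus> f'"
      by (simp)
    also have "\<dots> = f"
      unfolding f'_def by (subst add_left_commute_arr) simp_all
    finally show ?thesis by (simp add: split_factor_def hom_def)
  qed
  then show ?thesis by blast
qed

text \<open>Induction on the number of summands of the source on which \<open>f\<close> does not
  vanish. Elimination at the pivot \<open>j\<close> kills column \<open>j\<close>, and a column that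
  was zero stays zero because the subtracted term factors through \<open>f\<close> on the
  right.\<close>

lemma split_factor_ex:
  assumes f: "f \<in> Arr C"
  shows "\<exists>R i p s q. split_factor f R i p s q"
proof -
  obtain d where d: "dec d (Dom C f)" using f ex_dec[of "Dom C f"] by auto
  show ?thesis using d f
  proof (induction "card {j. j < dlen d \<and> f \<cdot> inc d j \<noteq> Zero C (S (lab d ! j)) (Cod C f)}" arbitrary: f rule: less_induct)
    case less
    note d = less.prems(1)
    note [simp] = less.prems(2) decD[OF d]
    show ?case
    proof (cases "f = Zero C (Dom C f) (Cod C f)")
      case True
      obtain Z where Z: "zero_obj C Z" using ex_zero_obj by blast
      have [simp]: "Z \<in> Obj C" "Zero C Z Z = Ident C Z" using zero_objD(2)[OF Z, of "Ident C Z" Z] zero_objD(1)[OF Z]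
        by (auto simp: hom_def)
      have "split_factor f Z (Zero C Z (Cod C f)) (Zero C (Dom C f) Z) (Zero C Z (Dom C f)) (Zero C (Cod C f) Z)"
        using True by (auto simp: split_factor_def hom_def)
      then show ?thesis by blast
    next
      case False
      obtain j b where j: "j < dlen d" and b: "b \<in> hom C (Cod C f) (S (lab d ! j))"
        and bfa: "b \<cdot> (f \<cdot> inc d j) = Ident C (S (lab d ! j))"
        using nonzero_split[OF less.prems(2) False d] by blast
      have [simp]: "b \<in> Arr C" "Dom C b = Cod C f" "Cod C b = S (lab d ! j)" using b by (auto simp: hom_def)
      define f' where "f' = f \<oplus> (- 1) \<bullet> (f \<cdot> (inc d j \<cdot> (b \<cdot> f)))"
      have [simp]: "f' \<in> Arr C" "Dom C f' = Dom C f" "Cod C f' = Cod C f" using j by (simp_all add: f'_def)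
      let ?N = "\<lambda>f. {j. j < dlen d \<and> f \<cdot> inc d j \<noteq> Zero C (S (lab d ! j)) (Cod C f)}"
      have "f' \<cdot> inc d j = Zero C (S (lab d ! j)) (Cod C f)"
        using j bfa by (simp add: f'_def)
      moreover have "f' \<cdot> inc d k = Zero C (S (lab d ! k)) (Cod C f)" if "k < dlen d" "f \<cdot> inc d k = Zero C (S (lab d ! k)) (Cod C f)" for k
        using j that by (simp add: f'_def)
      moreover have "f \<cdot> inc d j \<noteq> Zero C (S (lab d ! j)) (Cod C f)"
        using bfa ident_nonzero[of "lab d ! j"] by auto
      ultimately have "?N f' \<subset> ?N f" using j by auto
      then have "card (?N f') < card (?N f)" by (intro psubset_card_mono) auto
      then obtain R i p s q where "split_factor f' R i p s q"
        using less.hyps[of f'] d by auto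
      then show ?thesis using split_factor_step[of f "inc d j" "S (lab d ! j)" b] j b bfa
        by (auto simp: f'_def hom_def)
    qed
  qed
qed

text \<open>The kernel is the image of the idempotent \<open>1 - s p\<close>: since \<open>i\<close>
  is a split mono, \<open>f h = 0\<close> forces \<open>p h = 0\<close>, so this idempotent fixes
  \<open>h\<close>, and \<open>h\<close> factors through its image.\<close>

lemma ex_kernel: assumes f: "f \<in> Arr C" shows "\<exists>k. is_kernel C k f"
proof -
  obtain R i p s q where sf: "split_factor f R i p s q" using split_factor_ex[OF f] by blast
  note [simp] = split_factorD[OF sf] f
  define e where "e = Ident C (Dom C f) \<oplus> (- 1) \<bullet> (s \<cdot> p)"
  have [simp]: "e \<in> Arr C" "Dom C e = Dom C f" "Cod C e = Dom C f" by (simp_all add: e_def)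
  obtain R2 i2 p2 s2 q2 where sf2: "split_factor e R2 i2 p2 s2 q2" using split_factor_ex[of e] by auto
  note S2 [simp] = split_factorD[OF sf2]
  have "p \<cdot> e = Zero C (Dom C f) R" by (simp add: e_def)
  then have "(p \<cdot> i2) \<cdot> p2 = Zero C (Dom C f) R" by simp
  then have pi: "p \<cdot> i2 = Zero C R2 R" using split_factor_zero_left[OF sf2, of "p \<cdot> i2"] by simp
  have fi: "f \<cdot> i2 = Zero C R2 (Cod C f)"
  proof -
    have "f \<cdot> i2 = i \<cdot> (p \<cdot> i2)" by simp
    also have "\<dots> = Zero C R2 (Cod C f)" unfolding pi by simp
    finally show ?thesis .
  qed
  have "\<exists>!h'. h' \<in> hom C A (Dom C i2) \<and> i2 \<cdot> h' = h" if h: "h \<in> hom C A (Dom C f)" "f \<cdot> h = Zero C A (Cod C f)" for A h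
  proof
    have [simp]: "h \<in> Arr C" "Dom C h = A" "Cod C h = Dom C f" "A \<in> Obj C" using h hom_obj by (auto simp: hom_def)
    have "i \<cdot> (p \<cdot> h) = Zero C A (Cod C f)" using h(2) by simp
    then have "p \<cdot> h = Zero C A R" using split_factor_zero_right[OF sf, of "p \<cdot> h"] by simp
    then have "e \<cdot> h = h" by (simp add: e_def)
    then show "p2 \<cdot> h \<in> hom C A (Dom C i2) \<and> i2 \<cdot> (p2 \<cdot> h) = h" by (simp add: hom_def)
    show "h' = p2 \<cdot> h" if "h' \<in> hom C A (Dom C i2) \<and> i2 \<cdot> h' = h" for h'
    proof -
      have [simp]: "h' \<in> Arr C" "Dom C h' = A" "Cod C h' = R2" and e: "i2 \<cdot> h' = h" using that by (auto simp: hom_def)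
      have "h' = q2 \<cdot> (i2 \<cdot> h')" by simp
      also have "\<dots> = q2 \<cdot> (e \<cdot> h)" using \<open>e \<cdot> h = h\<close> e by simp
      also have "\<dots> = q2 \<cdot> (i2 \<cdot> (p2 \<cdot> h))" by (subst S2(19)) auto
      also have "\<dots> = p2 \<cdot> h" by (subst S2(18)) auto
      finally show ?thesis .
    qed
  qed
  then have "is_kernel C i2 f" using fi by (auto simp: is_kernel_def)
  then show ?thesis by blast
qed

lemma ex_cokernel: assumes f: "f \<in> Arr C" shows "\<exists>c. is_cokernel C c f"
proof -
  obtain R i p s q where sf: "split_factor f R i p s q" using split_factor_ex[OF f] by blast
  note [simp] = split_factorD[OF sf] f
  define e where "e = Ident C (Cod C f) \<oplus> (- 1) \<bullet> (i \<cdot> q)"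
  have [simp]: "e \<in> Arr C" "Dom C e = Cod C f" "Cod C e = Cod C f" by (simp_all add: e_def)
  obtain R2 i2 p2 s2 q2 where sf2: "split_factor e R2 i2 p2 s2 q2" using split_factor_ex[of e] by auto
  note S2 [simp] = split_factorD[OF sf2]
  have "e \<cdot> i = Zero C R (Cod C f)" by (simp add: e_def)
  then have "i2 \<cdot> (p2 \<cdot> i) = Zero C R (Cod C f)" by simp
  then have pi: "p2 \<cdot> i = Zero C R R2" using split_factor_zero_right[OF sf2, of "p2 \<cdot> i"] by simp
  have fi: "p2 \<cdot> f = Zero C (Dom C f) R2"
  proof -
    have "p2 \<cdot> f = (p2 \<cdot> i) \<cdot> p" by simp
    also have "\<dots> = Zero C (Dom C f) R2" unfolding pi by simp
    finally show ?thesis .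
  qed
  have "\<exists>!h'. h' \<in> hom C (Cod C p2) B \<and> h' \<cdot> p2 = h" if h: "h \<in> hom C (Cod C f) B" "h \<cdot> f = Zero C (Dom C f) B" for B h
  proof
    have [simp]: "h \<in> Arr C" "Dom C h = Cod C f" "Cod C h = B" "B \<in> Obj C" using h hom_obj by (auto simp: hom_def)
    have "(h \<cdot> i) \<cdot> p = Zero C (Dom C f) B" using h(2) by simp
    then have "h \<cdot> i = Zero C R B" using split_factor_zero_left[OF sf, of "h \<cdot> i"] by simp
    then have "h \<cdot> (i \<cdot> q) = Zero C (Cod C f) B" using comp_cancel[of h i _ q] by simp
    then have he: "h \<cdot> e = h" by (simp add: e_def)
    have hi: "h \<cdot> (i2 \<cdot> p2) = h" using he by simp
    show "h \<cdot> i2 \<in> hom C (Cod C p2) B \<and> (h \<cdot> i2) \<cdot> p2 = h" using hi by (simp add: hom_def)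
    show "h' = h \<cdot> i2" if "h' \<in> hom C (Cod C p2) B \<and> h' \<cdot> p2 = h" for h'
    proof -
      have [simp]: "h' \<in> Arr C" "Cod C h' = B" "Dom C h' = R2" and e: "h' \<cdot> p2 = h" using that by (auto simp: hom_def)
      have "h' = (h' \<cdot> p2) \<cdot> s2" by simp
      also have "\<dots> = (h \<cdot> (i2 \<cdot> p2)) \<cdot> s2" using e hi by simp
      also have "\<dots> = h \<cdot> (i2 \<cdot> (p2 \<cdot> s2))" by (simp del: S2(14,15,19))
      also have "\<dots> = h \<cdot> i2" by (subst S2(15)) simp
      finally show ?thesis .
    qed
  qed
  then have "is_cokernel C p2 f" using fi by (auto simp: is_cokernel_def)
  then show ?thesis by blast
qed

text \<open>In a split factorization \<open>m s p = m\<close>, so cancelling \<open>m\<close> gives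
  \<open>s p = 1\<close>; then \<open>s q\<close> is a retraction.\<close>

lemma monic_split:
  assumes m: "monic C m"
  obtains r where "r \<in> hom C (Cod C m) (Dom C m)" "r \<cdot> m = Ident C (Dom C m)"
proof -
  have [simp]: "m \<in> Arr C" using m by (simp add: monic_def)
  obtain R i p s q where sf: "split_factor m R i p s q" using split_factor_ex[of m] by auto
  note S[simp] = split_factorD[OF sf]
  have "m \<cdot> (s \<cdot> p) = (i \<cdot> p) \<cdot> (s \<cdot> p)" by simp
  also have "\<dots> = i \<cdot> (p \<cdot> (s \<cdot> p))" by (simp del: S(14,17,19))
  also have "\<dots> = m \<cdot> Ident C (Dom C m)" by (subst S(17)) auto
  finally have "m \<cdot> (s \<cdot> p) = m \<cdot> Ident C (Dom C m)" .
  then have sp: "s \<cdot> p = Ident C (Dom C m)" using m by (auto simp: monic_def hom_def)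
  have "(s \<cdot> q) \<cdot> m = s \<cdot> (q \<cdot> (i \<cdot> p))" by simp
  also have "\<dots> = s \<cdot> p" by (subst S(18)) auto
  finally show ?thesis using that[of "s \<cdot> q"] sp by (auto simp: hom_def)
qed

lemma epic_split:
  assumes m: "epic C m"
  obtains r where "r \<in> hom C (Cod C m) (Dom C m)" "m \<cdot> r = Ident C (Cod C m)"
proof -
  have [simp]: "m \<in> Arr C" using m by (simp add: epic_def)
  obtain R i p s q where sf: "split_factor m R i p s q" using split_factor_ex[of m] by auto
  note S[simp] = split_factorD[OF sf]
  have "(i \<cdot> q) \<cdot> m = i \<cdot> (q \<cdot> (i \<cdot> p))" by simp
  also have "\<dots> = Ident C (Cod C m) \<cdot> m" by (subst S(18)) auto
  finally have "(i \<cdot> q) \<cdot> m = Ident C (Cod C m) \<cdot> m" .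
  then have sp: "i \<cdot> q = Ident C (Cod C m)" using m by (auto simp: epic_def hom_def)
  have "m \<cdot> (s \<cdot> q) = (i \<cdot> p) \<cdot> (s \<cdot> q)" by simp
  also have "\<dots> = i \<cdot> (p \<cdot> (s \<cdot> q))" by (simp del: S(14,17,19))
  also have "\<dots> = i \<cdot> q" by (subst S(17)) auto
  finally show ?thesis using that[of "s \<cdot> q"] sp by (auto simp: hom_def)
qed

text \<open>With a retraction \<open>r\<close>, the mono \<open>m\<close> is the kernel of
  \<open>1 - m r\<close>.\<close>

lemma monic_normal: assumes m: "monic C m" shows "\<exists>f. is_kernel C m f"
proof -
  obtain r where r: "r \<in> hom C (Cod C m) (Dom C m)" "r \<cdot> m = Ident C (Dom C m)" using monic_split[OF m] .
  have [simp]: "m \<in> Arr C" "r \<in> Arr C" "Dom C r = Cod C m" "Cod C r = Dom C m" using m r by (auto simp: monic_def hom_def)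
  have "is_kernel C m (Ident C (Cod C m) \<oplus> (- 1) \<bullet> (m \<cdot> r))" (is "is_kernel C m ?e")
  proof -
    have "\<exists>!h'. h' \<in> hom C A (Dom C m) \<and> m \<cdot> h' = h" if h: "h \<in> hom C A (Cod C m)" "?e \<cdot> h = Zero C A (Cod C m)" for A h
    proof
      have [simp]: "h \<in> Arr C" "Dom C h = A" "Cod C h = Cod C m" using h by (auto simp: hom_def)
      have n: "h \<oplus> (-1) \<bullet> (m \<cdot> (r \<cdot> h)) = Zero C A (Cod C m)" using h(2) by simp
      have mrh: "h = m \<cdot> (r \<cdot> h)" by (rule add_minus_eq) (simp_all add: n)
      show "r \<cdot> h \<in> hom C A (Dom C m) \<and> m \<cdot> (r \<cdot> h) = h" using mrh by (simp add: hom_def)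
      show "h' = r \<cdot> h" if "h' \<in> hom C A (Dom C m) \<and> m \<cdot> h' = h" for h'
        using that comp_cancel[OF r(2), of h'] by (auto simp: hom_def)
    qed
    then show ?thesis by (auto simp: is_kernel_def r)
  qed
  then show ?thesis by blast
qed

lemma epic_normal: assumes m: "epic C m" shows "\<exists>f. is_cokernel C m f"
proof -
  obtain r where r: "r \<in> hom C (Cod C m) (Dom C m)" "m \<cdot> r = Ident C (Cod C m)" using epic_split[OF m] .
  have [simp]: "m \<in> Arr C" "r \<in> Arr C" "Dom C r = Cod C m" "Cod C r = Dom C m" using m r by (auto simp: epic_def hom_def)
  have mr [simp]: "x \<in> Arr C \<Longrightarrow> Cod C x = Cod C m \<Longrightarrow> m \<cdot> (r \<cdot> x) = x" for x
    using comp_cancel[OF r(2), of x] by simp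
  have "is_cokernel C m (Ident C (Dom C m) \<oplus> (- 1) \<bullet> (r \<cdot> m))" (is "is_cokernel C m ?e")
  proof -
    have "\<exists>!h'. h' \<in> hom C (Cod C m) B \<and> h' \<cdot> m = h" if h: "h \<in> hom C (Dom C m) B" "h \<cdot> ?e = Zero C (Dom C m) B" for B h
    proof
      have [simp]: "h \<in> Arr C" "Dom C h = Dom C m" "Cod C h = B" using h by (auto simp: hom_def)
      have n: "h \<oplus> (-1) \<bullet> (h \<cdot> (r \<cdot> m)) = Zero C (Dom C m) B" using h(2) by simp
      have mrh: "h = h \<cdot> (r \<cdot> m)" by (rule add_minus_eq) (simp_all add: n)
      show "h \<cdot> r \<in> hom C (Cod C m) B \<and> (h \<cdot> r) \<cdot> m = h" using mrh by (simp add: hom_def)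
      show "h' = h \<cdot> r" if "h' \<in> hom C (Cod C m) B \<and> h' \<cdot> m = h" for h'
      proof -
        have [simp]: "h' \<in> Arr C" "Dom C h' = Cod C m" and e: "h' \<cdot> m = h" using that by (auto simp: hom_def)
        have "h \<cdot> r = h' \<cdot> (m \<cdot> r)" unfolding e[symmetric] by (rule comp_assoc_arr) auto
        then show ?thesis using r(2) by simp
      qed
    qed
    then show ?thesis by (auto simp: is_cokernel_def)
  qed
  then show ?thesis by blast
qed

lemma abelian: "abelian_category C"
  by unfold_locales (auto intro: ex_zero_obj ex_sum ex_kernel ex_cokernel monic_normal epic_normal)

text \<open>A mono \<open>m\<close> into \<open>S l\<close> has a retraction \<open>r\<close>, and
  \<open>m r\<close> is a scalar \<open>c\<close> with \<open>c m = m\<close>. Either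
  \<open>c = 1\<close> and \<open>m\<close> is invertible, or \<open>m = 0\<close> and its source is
  a zero object.\<close>

lemma simple_S: "simple C (S l)"
proof -
  have "zero_obj C (Dom C m) \<or> iso_arr C m" if m: "monic C m" "Cod C m = S l" for m
  proof -
    obtain r where r: "r \<in> hom C (Cod C m) (Dom C m)" "r \<cdot> m = Ident C (Dom C m)" using monic_split[OF m(1)] .
    have [simp]: "m \<in> Arr C" "r \<in> Arr C" "Dom C r = S l" "Cod C m = S l" "Cod C r = Dom C m"
      using m r by (auto simp: monic_def hom_def)
    obtain c where c: "m \<cdot> r = c \<bullet> Ident C (S l)" using schur_scalar[of "m \<cdot> r" l] by (auto simp: hom_def)
    have e: "c \<bullet> m = m"
    proof -
      have "c \<bullet> m = (m \<cdot> r) \<cdot> m" unfolding c by simp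
      also have "\<dots> = m" by (simp add: r)
      finally show ?thesis .
    qed
    show ?thesis
    proof (cases "c = 1")
      case True
      then have "inverse_arrs C m r" using c r by (auto simp: inverse_arrs_def)
      then show ?thesis by (auto simp: iso_arr_def)
    next
      case False
      have "(c - 1) \<bullet> m = c \<bullet> m \<oplus> (- 1) \<bullet> m" using add_smult_arr[of m c "-1"] by simp
      also have "\<dots> = (c - 1) \<bullet> Zero C (Dom C m) (S l)" using e by simp
      finally have eq: "(c - 1) \<bullet> m = (c - 1) \<bullet> Zero C (Dom C m) (S l)" .
      have "m = Zero C (Dom C m) (S l)"
        by (rule smult_cancel[of _ _ "c - 1", OF _ _ _ eq]) (use False in simp_all)
      then have "r \<cdot> m = r \<cdot> Zero C (Dom C m) (S l)" by simp
      then have "Ident C (Dom C m) = Zero C (Dom C m) (Dom C m)" using r by simp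
      then show ?thesis by (intro disjI1 zero_objI) auto
    qed
  qed
  moreover have "\<not> zero_obj C (S l)"
    using zero_objD(2)[of "S l" "Ident C (S l)" "S l"] ident_nonzero[of l] by (auto simp: hom_def)
  ultimately show ?thesis by (auto simp: simple_def)
qed

text \<open>A decomposition of a nonzero object has a first summand. Its inclusion is a mono from a
  nonzero object into the simple object \<open>T\<close>, hence an isomorphism.\<close>

lemma simple_iso_S:
  assumes "simple C T" shows "\<exists>l. iso_obj C T (S l)"
proof -
  have T: "T \<in> Obj C" "\<not> zero_obj C T" using assms by (auto simp: simple_def)
  obtain d where d: "dec d T" using ex_dec T by blast
  note [simp] = decD[OF d]
  have "dlen d \<noteq> 0"
  proof
    assume "dlen d = 0"
    then have "Ident C T = Zero C T T" using dec_epi[OF d, of "Ident C T" T "Zero C T T"] T by (auto simp: hom_def)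
    then show False using zero_objI T by blast
  qed
  then have 0: "0 < dlen d" by simp
  have pi: "prj d 0 \<cdot> inc d 0 = Ident C (S (lab d ! 0))" using dec_prj_inc[OF d 0 0] by simp
  have "f = g" if "f \<in> hom C A (S (lab d ! 0))" "g \<in> hom C A (S (lab d ! 0))" "inc d 0 \<cdot> f = inc d 0 \<cdot> g" for A f g
  proof -
    have "f = prj d 0 \<cdot> (inc d 0 \<cdot> f)" "g = prj d 0 \<cdot> (inc d 0 \<cdot> g)"
      using that(1,2) comp_cancel[OF pi, of f] comp_cancel[OF pi, of g] 0 by (simp_all add: hom_def)
    then show ?thesis using that(3) by simp
  qed
  then have "monic C (inc d 0)" using 0 by (auto simp: monic_def)
  moreover have "\<not> zero_obj C (S (lab d ! 0))" using simple_S by (auto simp: simple_def)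
  ultimately have "iso_arr C (inc d 0)" using assms 0 by (auto simp: simple_def)
  then have "iso_obj C (S (lab d ! 0)) T" using 0 by (intro iso_objI[of "inc d 0"]) (auto simp: hom_def)
  then show ?thesis using iso_obj_sym by blast
qed

lemma S_not_iso:
  assumes "l \<noteq> m" shows "\<not> iso_obj C (S l) (S m)"
proof
  assume "iso_obj C (S l) (S m)"
  then obtain f where f: "f \<in> hom C (S l) (S m)" "iso_arr C f" by (auto simp: iso_obj_def)
  have "inv_arr C f \<cdot> f = Ident C (S l)" using inv_arr[OF f(2)] f by (auto simp: hom_def)
  moreover have "f = Zero C (S l) (S m)" using schur_zero assms f by blast
  ultimately have "Ident C (S l) = Zero C (S l) (S l)" using inv_arr[OF f(2)] f(1)
    by (auto simp: hom_def)
  then show False using ident_nonzero by blast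
qed

section \<open>Finite dimension of hom spaces\<close>

lemma hom_span_subset:
  assumes "A \<in> Obj C" "B \<in> Obj C" "X \<subseteq> hom C A B" shows "hom_span C A B X \<subseteq> hom C A B"
proof
  fix f assume "f \<in> hom_span C A B X"
  then show "f \<in> hom C A B" by (induction) (use assms in \<open>auto intro!: zero_hom add_hom smult_hom\<close>)
qed

lemma hom_span_add:
  assumes "A \<in> Obj C" "B \<in> Obj C" "X \<subseteq> hom C A B" "f \<in> hom_span C A B X" "g \<in> hom_span C A B X"
  shows "f \<oplus> g \<in> hom_span C A B X"
  using assms(4)
proof induction
  case span_zero
  have "g \<in> hom C A B" using assms hom_span_subset by blast
  then show ?case using assms by (auto simp: hom_def)
next
  case (span_step x h r)
  have "g \<in> hom C A B" "h \<in> hom C A B" "x \<in> hom C A B" using assms hom_span_subset span_step by blast+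
  then have "r \<bullet> x \<oplus> h \<oplus> g = r \<bullet> x \<oplus> (h \<oplus> g)" by (intro add_assoc) (auto intro: smult_hom)
  then show ?case using span_step hom_span.span_step by metis
qed

lemma hom_span_smult:
  assumes "A \<in> Obj C" "B \<in> Obj C" "X \<subseteq> hom C A B" "f \<in> X"
  shows "c \<bullet> f \<in> hom_span C A B X"
proof -
  have "f \<in> hom C A B" using assms by blast
  then have "c \<bullet> f = c \<bullet> f \<oplus> Zero C A B" by (auto simp: hom_def)
  then show ?thesis using hom_span.intros assms by metis
qed

lemma osum_span:
  assumes "A \<in> Obj C" "B \<in> Obj C" "X \<subseteq> hom C A B" "\<And>i. i < n \<Longrightarrow> f i \<in> hom_span C A B X"
  shows "osum A B f n \<in> hom_span C A B X"
  using assms(4) by (induction n) (auto intro!: hom_span.span_zero hom_span_add[OF assms(1-3)])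

text \<open>The spanning set consists of the matrix units \<open>inc d' i\<close> after
  \<open>prj d j\<close> with equal labels. Inserting resolutions of both identities expresses any
  arrow through them, the coefficients being given by Schur.\<close>

lemma finite_dim:
  assumes "A \<in> Obj C" "B \<in> Obj C"
  shows "\<exists>X. finite X \<and> X \<subseteq> hom C A B \<and> hom C A B = hom_span C A B X"
proof -
  obtain d d' where d: "dec d A" and d': "dec d' B" using ex_dec assms by blast
  note [simp] = decD[OF d] decD[OF d']
  define X where "X = (\<lambda>(i, j). inc d' i \<cdot> prj d j) ` {(i, j). i < dlen d' \<and> j < dlen d \<and> lab d' ! i = lab d ! j}"
  have "finite X" unfolding X_def
    by (rule finite_imageI, rule finite_subset[of _ "{..<dlen d'} \<times> {..<dlen d}"]) auto
  moreover have X: "X \<subseteq> hom C A B" unfolding X_def by (auto simp: hom_def)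
  moreover have "f \<in> hom_span C A B X" if f: "f \<in> hom C A B" for f
  proof -
    have [simp]: "f \<in> Arr C" "Dom C f = A" "Cod C f = B" using f by (auto simp: hom_def)
    have t: "inc d' i \<cdot> (prj d' i \<cdot> (f \<cdot> (inc d j \<cdot> prj d j))) \<in> hom_span C A B X" if ij: "i < dlen d'" "j < dlen d" for i j
    proof -
      let ?g = "prj d' i \<cdot> (f \<cdot> inc d j)"
      have g: "?g \<in> hom C (S (lab d ! j)) (S (lab d' ! i))" using ij by (simp add: hom_def)
      have eq: "inc d' i \<cdot> (prj d' i \<cdot> (f \<cdot> (inc d j \<cdot> prj d j))) = inc d' i \<cdot> (?g \<cdot> prj d j)"
        using ij by simp
      show ?thesis
      proof (cases "lab d' ! i = lab d ! j")
        case True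
        then obtain c where c: "?g = c \<bullet> Ident C (S (lab d ! j))" using schur_scalar g by metis
        have "inc d' i \<cdot> (?g \<cdot> prj d j) = c \<bullet> (inc d' i \<cdot> prj d j)" unfolding c using ij True by simp
        moreover have "inc d' i \<cdot> prj d j \<in> X" using ij True by (auto simp: X_def)
        ultimately show ?thesis unfolding eq using hom_span_smult[OF assms X] by simp
      next
        case False
        then have z: "?g = Zero C (S (lab d ! j)) (S (lab d' ! i))" using schur_zero g by metis
        have "inc d' i \<cdot> (?g \<cdot> prj d j) = Zero C A B" unfolding z using ij assms by simp
        then show ?thesis unfolding eq using hom_span.span_zero by simp
      qed
    qed
    have "f = osum A B (\<lambda>j. f \<cdot> (inc d j \<cdot> prj d j)) (dlen d)"
      using osum_comp(1)[of A A "dlen d" "\<lambda>j. inc d j \<cdot> prj d j" f B] assms f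
      by (auto simp: dec_complete[OF d] hom_def)
    also have "\<dots> = osum A B (\<lambda>j. osum A B (\<lambda>i. inc d' i \<cdot> (prj d' i \<cdot> (f \<cdot> (inc d j \<cdot> prj d j)))) (dlen d')) (dlen d)"
    proof (rule osum_cong)
      fix j assume j: "j < dlen d"
      have "f \<cdot> (inc d j \<cdot> prj d j) = osum B B (\<lambda>i. inc d' i \<cdot> prj d' i) (dlen d') \<cdot> (f \<cdot> (inc d j \<cdot> prj d j))"
        using j by (simp add: dec_complete[OF d'])
      also have "\<dots> = osum A B (\<lambda>i. (inc d' i \<cdot> prj d' i) \<cdot> (f \<cdot> (inc d j \<cdot> prj d j))) (dlen d')"
        using j assms by (intro osum_comp) (auto simp: hom_def)
      also have "\<dots> = osum A B (\<lambda>i. inc d' i \<cdot> (prj d' i \<cdot> (f \<cdot> (inc d j \<cdot> prj d j)))) (dlen d')"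
        using j by (intro osum_cong) simp
      finally show "f \<cdot> (inc d j \<cdot> prj d j) = \<dots>" .
    qed
    also have "\<dots> \<in> hom_span C A B X" by (intro osum_span[OF assms X] t)
    finally show ?thesis .
  qed
  ultimately have "hom C A B = hom_span C A B X" using hom_span_subset[OF assms X] by blast
  then show ?thesis using \<open>finite X\<close> X by blast
qed

end

section \<open>The linear category of block matrices\<close>

text \<open>Membership in \<open>Arr (fib_cat u)\<close>, stated without \<open>u\<close>, so that
  block matrices can be handled independently of the associativity and braiding parameters.\<close>

definition farr :: "'k::field fib_arr \<Rightarrow> bool" where
  "farr f \<longleftrightarrow> f = mk_arr (src f) (tgt f) (entry f)"

lemma mk_arr_sel [simp]:
  "src (mk_arr xs ys m) = xs" "tgt (mk_arr xs ys m) = ys"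
  "entry (mk_arr xs ys m) i j = (if i < length ys \<and> j < length xs \<and> ys ! i = xs ! j then m i j else 0)"
  by (simp_all add: mk_arr_def)

lemma farr_mk [simp]: "farr (mk_arr xs ys m)"
  by (auto simp: farr_def mk_arr_def fun_eq_iff)

lemma farr_entry_zero:
  assumes "farr f" "\<not> (i < length (tgt f) \<and> j < length (src f) \<and> tgt f ! i = src f ! j)"
  shows "entry f i j = 0"
proof -
  have "entry f i j = entry (mk_arr (src f) (tgt f) (entry f)) i j" using assms(1) by (simp add: farr_def)
  also have "\<dots> = 0" unfolding mk_arr_sel using assms(2) by argo
  finally show ?thesis .
qed

lemma farr_eqI:
  assumes "farr f" "farr g" "src f = src g" "tgt f = tgt g"
    and "\<And>i j. i < length (tgt g) \<Longrightarrow> j < length (src g) \<Longrightarrow> tgt g ! i = src g ! j \<Longrightarrow> entry f i j = entry g i j"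
  shows "f = g"
proof -
  have "entry f i j = entry g i j" for i j
    using assms farr_entry_zero[of f i j] farr_entry_zero[of g i j] by metis
  then have "entry f = entry g" by (simp add: fun_eq_iff)
  then show ?thesis using assms by (metis farr_def)
qed

lemma fib_cat_sel [simp]:
  "Obj (fib_cat u) = UNIV" "Arr (fib_cat u) = {f. farr f}" "Dom (fib_cat u) = src" "Cod (fib_cat u) = tgt"
  "Ident (fib_cat u) = fib_ident" "Comp (fib_cat u) = fib_comp"
  "Zero (fib_cat u) = (\<lambda>xs ys. mk_arr xs ys (\<lambda>i j. 0))"
  "Add (fib_cat u) = (\<lambda>f g. mk_arr (src f) (tgt f) (\<lambda>i j. entry f i j + entry g i j))"
  "Smult (fib_cat u) = (\<lambda>r f. mk_arr (src f) (tgt f) (\<lambda>i j. r * entry f i j))"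
  "TenO (fib_cat u) = fib_tenO" "TenA (fib_cat u) = fib_tenA" "Unit (fib_cat u) = [One]"
  "Assoc (fib_cat u) = fib_assoc u" "LUnit (fib_cat u) = fib_ident" "RUnit (fib_cat u) = fib_ident"
  "Braid (fib_cat u) = fib_braid u" "Twist (fib_cat u) = fib_twist u"
  by (simp_all add: fib_cat_def farr_def)

lemma hom_fib_cat: "f \<in> hom (fib_cat u) xs ys \<longleftrightarrow> farr f \<and> src f = xs \<and> tgt f = ys"
  by (simp add: hom_def)

lemma fib_ident_sel [simp]:
  "farr (fib_ident xs)" "src (fib_ident xs) = xs" "tgt (fib_ident xs) = xs"
  "entry (fib_ident xs) i j = (if i = j \<and> i < length xs then 1 else 0)"
  by (auto simp: fib_ident_def)

lemma fib_comp_sel [simp]: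
  "farr (fib_comp g f)" "src (fib_comp g f) = src f" "tgt (fib_comp g f) = tgt g"
  by (auto simp: fib_comp_def)

text \<open>The definition masks entries with unequal labels, but the plain sum is zero there
  anyway: along a nonzero product the labels at \<open>i\<close>, \<open>l\<close> and
  \<open>j\<close> coincide. So the formula holds at all indices.\<close>

lemma entry_comp:
  assumes "farr f" "farr g" "src g = tgt f"
  shows "entry (fib_comp g f) i j = (\<Sum>l < length (tgt f). entry g i l * entry f l j)"
proof (cases "i < length (tgt g) \<and> j < length (src f) \<and> tgt g ! i = src f ! j")
  case True
  then show ?thesis by (simp add: fib_comp_def)
next
  case False
  have "entry g i l * entry f l j = 0" if "l < length (tgt f)" for l
    using farr_entry_zero[of g i l] farr_entry_zero[of f l j] assms False by (metis mult_eq_0_iff)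
  then have "(\<Sum>l < length (tgt f). entry g i l * entry f l j) = 0" by (intro sum.neutral) auto
  then show ?thesis using False by (auto simp: fib_comp_def)
qed

lemma fib_comp_assoc:
  assumes "farr f" "farr g" "farr h" "src g = tgt f" "src h = tgt g"
  shows "fib_comp (fib_comp h g) f = fib_comp h (fib_comp g f)"
proof (rule farr_eqI)
  fix i j
  have "entry (fib_comp (fib_comp h g) f) i j =
      (\<Sum>l<length (tgt f). \<Sum>k<length (tgt g). entry h i k * entry g k l * entry f l j)"
    using assms by (simp add: entry_comp sum_distrib_right)
  also have "\<dots> = (\<Sum>k<length (tgt g). \<Sum>l<length (tgt f). entry h i k * entry g k l * entry f l j)"
    by (rule sum.swap)
  also have "\<dots> = entry (fib_comp h (fib_comp g f)) i j"
    using assms by (simp add: entry_comp sum_distrib_left mult.assoc)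
  finally show "entry (fib_comp (fib_comp h g) f) i j = entry (fib_comp h (fib_comp g f)) i j" .
qed (use assms in auto)

lemma fib_comp_ident:
  assumes "farr f"
  shows "fib_comp (fib_ident (tgt f)) f = f" "fib_comp f (fib_ident (src f)) = f"
proof -
  have *: "(if a then 1 else 0) * (c::'a) = (if a then c else 0)" "c * (if a then 1 else 0) = (if a then c else 0)"
    for a and c :: 'a by auto
  show "fib_comp (fib_ident (tgt f)) f = f"
    by (rule farr_eqI) (use assms in \<open>auto simp: entry_comp * cong: conj_cong\<close>)
  have "(\<Sum>l<n. entry f i l * (if l = j \<and> l < n then 1 else 0)) = (\<Sum>l<n. if l = j then entry f i l else 0)" for n i j
    by (rule sum.cong) auto
  then show "fib_comp f (fib_ident (src f)) = f"
    by (intro farr_eqI) (use assms in \<open>auto simp: entry_comp\<close>)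
qed

lemma entry_add_smult:
  assumes "farr f" "xs = src f" "ys = tgt f"
  shows "farr g \<Longrightarrow> src g = src f \<Longrightarrow> tgt g = tgt f \<Longrightarrow>
      entry (mk_arr xs ys (\<lambda>i j. entry f i j + entry g i j)) i j = entry f i j + entry g i j"
    and "entry (mk_arr xs ys (\<lambda>i j. r * entry f i j)) i j = r * entry f i j"
  using assms farr_entry_zero[of f i j] farr_entry_zero[of g i j] by auto

lemma fib_linear: "linear_category (fib_cat (u::'k::field))"
  by (unfold_locales; auto simp: hom_fib_cat fib_comp_assoc fib_comp_ident entry_comp entry_add_smult algebra_simps sum.distrib
      sum_distrib_left simp del: mk_arr_sel(3) intro!: farr_eqI; simp)

lemma entry_comp_col:
  assumes "farr f" "farr g" "src g = tgt f"
    and "\<And>l. l < length (tgt f) \<Longrightarrow> entry f l j = (if l = k then c else 0)"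
  shows "entry (fib_comp g f) i j = (if k < length (tgt f) then entry g i k * c else 0)"
proof -
  have "entry (fib_comp g f) i j = (\<Sum>l<length (tgt f). if l = k then entry g i k * c else 0)"
    unfolding entry_comp[OF assms(1-3)] using assms(4) by (intro sum.cong) auto
  then show ?thesis by simp
qed

definition fib_inc :: "fib list \<Rightarrow> nat \<Rightarrow> 'k::field fib_arr" where
  "fib_inc xs i = mk_arr [xs ! i] xs (\<lambda>a b. if a = i then 1 else 0)"

definition fib_prj :: "fib list \<Rightarrow> nat \<Rightarrow> 'k::field fib_arr" where
  "fib_prj xs i = mk_arr xs [xs ! i] (\<lambda>a b. if b = i then 1 else 0)"

lemma fib_inc_sel [simp]:
  "farr (fib_inc xs i)" "src (fib_inc xs i) = [xs ! i]" "tgt (fib_inc xs i) = xs"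
  "farr (fib_prj xs i)" "src (fib_prj xs i) = xs" "tgt (fib_prj xs i) = [xs ! i]"
  by (auto simp: fib_inc_def fib_prj_def)

lemma entry_fib_inc:
  "entry (fib_inc xs i) a b = (if a = i \<and> b = 0 \<and> i < length xs then 1 else 0)"
  "entry (fib_prj xs i) b a = (if a = i \<and> b = 0 \<and> i < length xs then 1 else 0)"
  by (auto simp: fib_inc_def fib_prj_def)

lemma entry_comp_inc:
  assumes "farr f" "src f = xs" "i < length xs"
  shows "entry (fib_comp f (fib_inc xs i)) a b = (if b = 0 then entry f a i else 0)"
proof -
  have "entry (fib_comp f (fib_inc xs i)) a b = (\<Sum>l<length xs. entry f a l * (if l = i \<and> b = 0 \<and> i < length xs then 1 else 0))"
    using assms by (simp add: entry_comp entry_fib_inc)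
  also have "\<dots> = (\<Sum>l<length xs. if l = i then (if b = 0 then entry f a i else 0) else 0)"
    using assms by (intro sum.cong) auto
  finally show ?thesis using assms by simp
qed

lemma fib_inc_epi:
  assumes "farr f" "farr g" "src f = xs" "src g = xs" "tgt f = tgt g"
    "\<And>i. i < length xs \<Longrightarrow> fib_comp f (fib_inc xs i) = fib_comp g (fib_inc xs i)"
  shows "f = g"
proof (rule farr_eqI)
  fix i j assume "j < length (src g)"
  then show "entry f i j = entry g i j"
    using assms(6)[of j] assms entry_comp_inc[of f xs j i 0] entry_comp_inc[of g xs j i 0] by simp
qed (use assms in auto)

abbreviation fib_dec :: "fib list \<Rightarrow> 'k::field fib_arr dec" where
  "fib_dec xs \<equiv> Dec xs (fib_inc xs) (fib_prj xs)"

abbreviation fib_simple :: "fib \<Rightarrow> fib list" where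
  "fib_simple l \<equiv> [l]"

lemma is_dec_fib_dec: "is_dec (fib_cat (u::'k::field)) fib_simple (fib_dec xs) xs"
proof -
  have "fib_comp (fib_prj xs i) (fib_inc xs j) =
      (if i = j then fib_ident [xs ! i] else mk_arr [xs ! j] [xs ! i] (\<lambda>i j. 0 :: 'k))"
    if "i < length xs" "j < length xs" for i j
    using that by (intro farr_eqI) (auto simp: entry_comp_inc entry_fib_inc)
  moreover have "f = g" if "farr f" "farr g" "src f = xs" "src g = xs" "tgt f = tgt g"
    "\<forall>i<length xs. fib_comp f (fib_inc xs i) = fib_comp g (fib_inc xs i)" for f g :: "'k fib_arr"
    using fib_inc_epi[of f g xs] that by blast
  ultimately show ?thesis by (auto simp: is_dec_def hom_fib_cat)
qed

lemma fib_simple_system: "simple_system (fib_cat (u::'k::field)) fib_simple"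
proof -
  interpret linear_category "fib_cat u" by (rule fib_linear)
  show ?thesis
  proof unfold_locales
    fix f :: "'k fib_arr" and l assume "f \<in> hom (fib_cat u) [l] [l]"
    then have "f = entry f 0 0 \<bullet>\<^bsub>fib_cat u\<^esub> Ident (fib_cat u) [l]"
      by (intro farr_eqI) (auto simp: hom_fib_cat)
    then show "\<exists>c. f = c \<bullet>\<^bsub>fib_cat u\<^esub> Ident (fib_cat u) [l]" by blast
  next
    fix f :: "'k fib_arr" and l m :: fib assume "l \<noteq> m" "f \<in> hom (fib_cat u) [l] [m]"
    then show "f = Zero (fib_cat u) [l] [m]" by (intro farr_eqI) (auto simp: hom_fib_cat)
  next
    fix l show "Ident (fib_cat u) [l] \<noteq> Zero (fib_cat u) [l] [l]"
      by (auto dest: arg_cong[of _ _ "\<lambda>f. entry f 0 0"])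
  next
    fix xs show "\<exists>d. is_dec (fib_cat u) fib_simple d xs" using is_dec_fib_dec by blast
  qed simp
qed

lemma fib_zero_obj: "zero_obj (fib_cat (u::'k::field)) []"
proof -
  interpret linear_category "fib_cat u" by (rule fib_linear)
  show ?thesis by (rule zero_objI) (auto intro!: farr_eqI)
qed

lemma fib_biproduct: "biproduct (fib_cat (u::'k::field)) (xs @ ys) xs ys"
proof -
  let ?n = "length xs" let ?P = "xs @ ys"
  define i where "i = mk_arr xs ?P (\<lambda>a b. if a = b then 1 else 0 :: 'k)"
  define j where "j = mk_arr ys ?P (\<lambda>a b. if a = ?n + b then 1 else 0 :: 'k)"
  define p where "p = mk_arr ?P xs (\<lambda>b a. if a = b then 1 else 0 :: 'k)"
  define q where "q = mk_arr ?P ys (\<lambda>b a. if a = ?n + b then 1 else 0 :: 'k)"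
  have f: "farr i" "farr j" "farr p" "farr q" by (simp_all add: i_def j_def p_def q_def)
  have s: "src i = xs" "tgt i = ?P" "src j = ys" "tgt j = ?P" "src p = ?P" "tgt p = xs" "src q = ?P" "tgt q = ys"
    by (simp_all add: i_def j_def p_def q_def)
  have e: "entry i a b = (if a = b \<and> b < ?n then 1 else 0)" "entry p b a = (if a = b \<and> b < ?n then 1 else 0)"
     "entry j a b = (if a = ?n + b \<and> b < length ys then 1 else 0)"
     "entry q b a = (if a = ?n + b \<and> b < length ys then 1 else 0)" for a b
    by (auto simp: i_def j_def p_def q_def nth_append)
  have ci: "entry (fib_comp g i) a b = (if b < ?n then entry g a b else 0)" if "farr g" "src g = ?P" for g a b
    using entry_comp_col[of i g b b "if b < ?n then 1 else 0" a] that f s e by auto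
  have cj: "entry (fib_comp g j) a b = (if b < length ys then entry g a (?n + b) else 0)" if "farr g" "src g = ?P" for g a b
    using entry_comp_col[of j g b "?n + b" "if b < length ys then 1 else 0" a] that f s e by auto
  have cp: "entry (fib_comp g p) a b = (if b < ?n then entry g a b else 0)" if "farr g" "src g = xs" for g a b
    using entry_comp_col[of p g b b "if b < ?n then 1 else 0" a] that f s e by auto
  have cq: "entry (fib_comp g q) a b = (if ?n \<le> b \<and> b < ?n + length ys then entry g a (b - ?n) else 0)"
    if "farr g" "src g = ys" for g a b
    using entry_comp_col[of q g b "b - ?n" "if ?n \<le> b then 1 else 0" a] that f s e by auto
  note ee = ci cj cp cq f s e
  have 1: "fib_comp p i = fib_ident xs" "fib_comp q j = fib_ident ys"
    "fib_comp p j = mk_arr ys xs (\<lambda>i j. 0)" "fib_comp q i = mk_arr xs ys (\<lambda>i j. 0)"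
    by (rule farr_eqI; auto simp: ee)+
  have "mk_arr ?P ?P (\<lambda>a b. entry (fib_comp i p) a b + entry (fib_comp j q) a b) = fib_ident ?P"
    by (rule farr_eqI) (auto simp: ee)
  note 2 = this
  let ?C = "fib_cat u"
  have h: "i \<in> hom ?C xs ?P" "j \<in> hom ?C ys ?P" "p \<in> hom ?C ?P xs" "q \<in> hom ?C ?P ys"
    using f s by (simp_all add: hom_fib_cat)
  show ?thesis unfolding biproduct_def
    by (intro conjI bexI[OF _ h(1)] bexI[OF _ h(2)] bexI[OF _ h(3)] bexI[OF _ h(4)]) (simp_all add: 1 2 f s)
qed

lemma fib_simple_system_sums: "simple_system_sums (fib_cat (u::'k::field)) fib_simple"
proof -
  interpret simple_system "fib_cat u" fib_simple by (rule fib_simple_system)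
  show ?thesis by unfold_locales (use fib_zero_obj fib_biproduct in blast)+
qed

lemma fib_semisimple: "semisimple_category (fib_cat (u::'k::field))"
proof -
  interpret simple_system_sums "fib_cat u" fib_simple by (rule fib_simple_system_sums)
  interpret abelian_category "fib_cat u" by (rule abelian)
  have "semisimple_obj (fib_cat u) xs" for xs
  proof (induction xs)
    case Nil
    then show ?case using fib_zero_obj by (rule semisimple_obj.intros)
  next
    case (Cons x xs)
    then show ?case using fib_biproduct[of u "[x]" xs] simple_S by (auto intro: semisimple_obj.intros)
  qed
  then show ?thesis by unfold_locales (use finite_dim in auto)
qed

section \<open>Tensor products of block matrices\<close>

lemma length_fib_tenO [simp]: "length (fib_tenO xs ys) = length (ten_basis xs ys)"
  by (simp add: fib_tenO_def)

lemma set_ten_basis: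
  "set (ten_basis xs ys) =
    (SIGMA i:{..<length xs}. SIGMA j:{..<length ys}. set (fuse (xs ! i) (ys ! j)))"
  by (force simp: ten_basis_def)

lemma distinct_fuse [simp]: "distinct (fuse x y)"
  by (cases x; cases y) auto

lemma distinct_concat_map_Pair:
  assumes "distinct xs" "\<And>x. x \<in> set xs \<Longrightarrow> distinct (f x)"
  shows "distinct (concat (map (\<lambda>x. map (Pair x) (f x)) xs))"
  using assms by (induction xs) (auto simp: distinct_map inj_on_def)

lemma distinct_ten_basis [simp]: "distinct (ten_basis xs ys)"
proof -
  have "ten_basis xs ys = concat (map (\<lambda>i. map (Pair i)
      (concat (map (\<lambda>j. map (Pair j) (fuse (xs ! i) (ys ! j))) [0..<length ys]))) [0..<length xs])"
    by (simp add: ten_basis_def map_concat comp_def)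
  then show ?thesis by (simp add: distinct_concat_map_Pair)
qed

text \<open>Matrix products sum over positions in a list of basis triples. This replaces positions
  by the triples themselves, where the single contributing term can be named.\<close>

lemma sum_nth_distinct:
  assumes "distinct L" shows "(\<Sum>l<length L. \<phi> (L ! l)) = (\<Sum>t\<in>set L. \<phi> t)"
proof -
  have "bij_betw ((!) L) {..<length L} (set L)" using assms by (intro bij_betw_nth) auto
  then show ?thesis by (rule sum.reindex_bij_betw)
qed

lemma sum_single_term:
  assumes "finite L" "\<And>r. r \<in> L \<Longrightarrow> r \<noteq> r0 \<Longrightarrow> \<phi> r = 0"
  shows "(\<Sum>r\<in>L. \<phi> r) = (if r0 \<in> L then \<phi> r0 else 0)"
proof -
  have "(\<Sum>r\<in>L. \<phi> r) = (\<Sum>r\<in>L. if r = r0 then \<phi> r0 else 0)" using assms(2) by (intro sum.cong) auto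
  then show ?thesis using assms(1) by simp
qed

lemma ten_basis_nth:
  assumes "p < length (ten_basis xs ys)" "ten_basis xs ys ! p = (i, j, z)"
  shows "i < length xs" "j < length ys" "z \<in> set (fuse (xs ! i) (ys ! j))" "fib_tenO xs ys ! p = z"
proof -
  have "(i, j, z) \<in> set (ten_basis xs ys)" using assms by (metis nth_mem)
  then show "i < length xs" "j < length ys" "z \<in> set (fuse (xs ! i) (ys ! j))" by (auto simp: set_ten_basis)
  show "fib_tenO xs ys ! p = z" using assms by (simp add: fib_tenO_def)
qed

text \<open>The entry of a tensor product as a function of basis triples rather than of their
  positions.\<close>

fun ten_entry :: "'k::field fib_arr \<Rightarrow> 'k fib_arr \<Rightarrow> nat \<times> nat \<times> fib \<Rightarrow> nat \<times> nat \<times> fib \<Rightarrow> 'k" where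
  "ten_entry f g (i, j, z) (i', j', z') = (if z = z' then entry f i i' * entry g j j' else 0)"

lemma fib_tenA_sel [simp]:
  "farr (fib_tenA f g)" "src (fib_tenA f g) = fib_tenO (src f) (src g)" "tgt (fib_tenA f g) = fib_tenO (tgt f) (tgt g)"
  by (auto simp: fib_tenA_def)

lemma entry_tenA:
  assumes "p < length (ten_basis (tgt f) (tgt g))" "q < length (ten_basis (src f) (src g))"
  shows "entry (fib_tenA f g) p q = ten_entry f g (ten_basis (tgt f) (tgt g) ! p) (ten_basis (src f) (src g) ! q)"
proof -
  obtain i j z i' j' z' where "ten_basis (tgt f) (tgt g) ! p = (i, j, z)" "ten_basis (src f) (src g) ! q = (i', j', z')"
    by (metis prod_cases3)
  then show ?thesis using assms by (auto simp: fib_tenA_def ten_basis_nth(4))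
qed

lemma farr_entry_eq:
  assumes "farr f" "entry f i j \<noteq> 0"
  shows "i < length (tgt f)" "j < length (src f)" "tgt f ! i = src f ! j"
  using assms farr_entry_zero by blast+

text \<open>The channel of the intermediate triple is forced to be \<open>z\<close> because fusion
  is multiplicity free, so the product of tensor products is a double sum over \<open>a\<close> and
  \<open>b\<close>, which factors into the two matrix products.\<close>

lemma fib_ten_comp:
  assumes "farr f" "farr f'" "farr g" "farr g'" "src f' = tgt f" "src g' = tgt g"
  shows "fib_tenA (fib_comp f' f) (fib_comp g' g) = fib_comp (fib_tenA f' g') (fib_tenA f g)"
proof (rule farr_eqI)
  fix p q assume "p < length (tgt (fib_comp (fib_tenA f' g') (fib_tenA f g)))"
    and "q < length (src (fib_comp (fib_tenA f' g') (fib_tenA f g)))"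
  then have p: "p < length (ten_basis (tgt f') (tgt g'))" and q: "q < length (ten_basis (src f) (src g))" by auto
  obtain i j z where P: "ten_basis (tgt f') (tgt g') ! p = (i, j, z)" by (metis prod_cases3)
  obtain i' j' z' where Q: "ten_basis (src f) (src g) ! q = (i', j', z')" by (metis prod_cases3)
  note bp = ten_basis_nth[OF p P]
  let ?xs = "tgt f" and ?ys = "tgt g"
  have "entry (fib_comp (fib_tenA f' g') (fib_tenA f g)) p q =
    (\<Sum>l<length (ten_basis ?xs ?ys). ten_entry f' g' (i, j, z) (ten_basis ?xs ?ys ! l) * ten_entry f g (ten_basis ?xs ?ys ! l) (i', j', z'))"
    using p q P Q assms by (subst entry_comp) (auto simp: entry_tenA)
  also have "\<dots> = (\<Sum>t\<in>set (ten_basis ?xs ?ys). ten_entry f' g' (i, j, z) t * ten_entry f g t (i', j', z'))"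
    by (rule sum_nth_distinct) simp
  also have "\<dots> = (\<Sum>a<length ?xs. \<Sum>b<length ?ys. \<Sum>c\<in>set (fuse (?xs ! a) (?ys ! b)).
      ten_entry f' g' (i, j, z) (a, b, c) * ten_entry f g (a, b, c) (i', j', z'))"
    by (simp add: set_ten_basis sum.Sigma case_prod_beta del: ten_entry.simps)
  also have "\<dots> = (\<Sum>a<length ?xs. \<Sum>b<length ?ys.
      if z = z' then entry f' i a * entry f a i' * (entry g' j b * entry g b j') else 0)"
  proof (intro sum.cong refl)
    fix a b
    have "(\<Sum>c\<in>set (fuse (?xs ! a) (?ys ! b)). ten_entry f' g' (i, j, z) (a, b, c) * ten_entry f g (a, b, c) (i', j', z')) =
        (if z \<in> set (fuse (?xs ! a) (?ys ! b)) then ten_entry f' g' (i, j, z) (a, b, z) * ten_entry f g (a, b, z) (i', j', z') else 0)"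
      by (rule sum_single_term) auto
    also have "\<dots> = (if z = z' then entry f' i a * entry f a i' * (entry g' j b * entry g b j') else 0)"
    proof (cases "entry f' i a = 0 \<or> entry g' j b = 0")
      case False
      \<comment> \<open>A nonzero entry joins equal labels, so the intermediate pair has the same
        labels as \<open>i\<close>, \<open>j\<close>, and the channel \<open>z\<close> is admissible
        there.\<close>
      then have "z \<in> set (fuse (?xs ! a) (?ys ! b))"
        using bp(3) farr_entry_eq[of f' i a] farr_entry_eq[of g' j b] assms by auto
      then show ?thesis by simp
    qed auto
    finally show "(\<Sum>c\<in>set (fuse (?xs ! a) (?ys ! b)). ten_entry f' g' (i, j, z) (a, b, c) * ten_entry f g (a, b, c) (i', j', z')) =
        (if z = z' then entry f' i a * entry f a i' * (entry g' j b * entry g b j') else 0)" .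
  qed
  also have "\<dots> = entry (fib_tenA (fib_comp f' f) (fib_comp g' g)) p q"
    using p q P Q assms by (auto simp: entry_tenA entry_comp sum_product)
  finally show "entry (fib_tenA (fib_comp f' f) (fib_comp g' g)) p q = entry (fib_comp (fib_tenA f' g') (fib_tenA f g)) p q" ..
qed (use assms in auto)

lemma fib_ten_ident: "fib_tenA (fib_ident xs) (fib_ident ys) = fib_ident (fib_tenO xs ys)"
proof (rule farr_eqI)
  fix p q assume "p < length (tgt (fib_ident (fib_tenO xs ys)))" "q < length (src (fib_ident (fib_tenO xs ys)))"
  then have p: "p < length (ten_basis xs ys)" and q: "q < length (ten_basis xs ys)" by auto
  obtain i j z where P: "ten_basis xs ys ! p = (i, j, z)" by (metis prod_cases3)
  obtain i' j' z' where Q: "ten_basis xs ys ! q = (i', j', z')" by (metis prod_cases3)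
  have "(i, j, z) = (i', j', z') \<longleftrightarrow> p = q" using p q P Q nth_eq_iff_index_eq[of "ten_basis xs ys" p q] by simp
  then show "entry (fib_tenA (fib_ident xs) (fib_ident ys)) p q = entry (fib_ident (fib_tenO xs ys)) p q"
    using p q P Q ten_basis_nth[OF p P] by (auto simp: entry_tenA)
qed auto

lemma ten_entry_linear:
  assumes "farr f"
  shows "farr f' \<Longrightarrow> src f' = src f \<Longrightarrow> tgt f' = tgt f \<Longrightarrow>
      ten_entry (mk_arr (src f) (tgt f) (\<lambda>i j. entry f i j + entry f' i j)) g t t' = ten_entry f g t t' + ten_entry f' g t t'"
    "farr f' \<Longrightarrow> src f' = src f \<Longrightarrow> tgt f' = tgt f \<Longrightarrow>
      ten_entry g (mk_arr (src f) (tgt f) (\<lambda>i j. entry f i j + entry f' i j)) t t' = ten_entry g f t t' + ten_entry g f' t t'"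
    "ten_entry (mk_arr (src f) (tgt f) (\<lambda>i j. r * entry f i j)) g t t' = r * ten_entry f g t t'"
    "ten_entry g (mk_arr (src f) (tgt f) (\<lambda>i j. r * entry f i j)) t t' = r * ten_entry g f t t'"
  using assms
  by (cases t; cases t'; simp add: entry_add_smult algebra_simps del: mk_arr_sel(3))+

section \<open>Associativity, braiding and twist with arbitrary coefficients\<close>

text \<open>The coefficients are a parameter because the same matrix occurs twice: with the explicit
  \<open>fib_F\<close>, and with the unknown coefficients of an arbitrary Fibonacci category, for
  which equations are still to be solved.\<close>

definition gen_assoc ::
  "(fib \<Rightarrow> fib \<Rightarrow> fib \<Rightarrow> fib \<Rightarrow> fib \<Rightarrow> fib \<Rightarrow> 'k) \<Rightarrow> fib list \<Rightarrow> fib list \<Rightarrow> fib list \<Rightarrow> 'k::field fib_arr" where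
  "gen_assoc F xs ys zs =
     mk_arr (fib_tenO (fib_tenO xs ys) zs) (fib_tenO xs (fib_tenO ys zs))
       (\<lambda>p q. case (ten_basis xs (fib_tenO ys zs) ! p, ten_basis (fib_tenO xs ys) zs ! q) of
          ((i, m, w), (n, l', w')) \<Rightarrow>
            (case (ten_basis ys zs ! m, ten_basis xs ys ! n) of
              ((j, l, t), (i', j', s)) \<Rightarrow>
                if i = i' \<and> j = j' \<and> l = l' then F (xs ! i) (ys ! j) (zs ! l) w t s else 0))"

text \<open>The last two arguments of the coefficient function are again the target channel and the
  source channel, hence in the opposite order: \<open>s\<close> and then \<open>t\<close>.\<close>

definition gen_assoc_inv ::
  "(fib \<Rightarrow> fib \<Rightarrow> fib \<Rightarrow> fib \<Rightarrow> fib \<Rightarrow> fib \<Rightarrow> 'k) \<Rightarrow> fib list \<Rightarrow> fib list \<Rightarrow> fib list \<Rightarrow> 'k::field fib_arr" where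
  "gen_assoc_inv F xs ys zs =
     mk_arr (fib_tenO xs (fib_tenO ys zs)) (fib_tenO (fib_tenO xs ys) zs)
       (\<lambda>q p. case (ten_basis xs (fib_tenO ys zs) ! p, ten_basis (fib_tenO xs ys) zs ! q) of
          ((i, m, w), (n, l', w')) \<Rightarrow>
            (case (ten_basis ys zs ! m, ten_basis xs ys ! n) of
              ((j, l, t), (i', j', s)) \<Rightarrow>
                if i = i' \<and> j = j' \<and> l = l' then F (xs ! i) (ys ! j) (zs ! l) w s t else 0))"

lemma fib_assoc_gen: "fib_assoc u = gen_assoc (fib_F (u + inverse u))"
  by (simp add: fun_eq_iff fib_assoc_def gen_assoc_def)

definition gen_braid :: "(fib \<Rightarrow> fib \<Rightarrow> fib \<Rightarrow> 'k) \<Rightarrow> fib list \<Rightarrow> fib list \<Rightarrow> 'k::field fib_arr" where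
  "gen_braid R xs ys = mk_arr (fib_tenO xs ys) (fib_tenO ys xs)
     (\<lambda>p q. case (ten_basis ys xs ! p, ten_basis xs ys ! q) of
        ((j, i, z), (i', j', z')) \<Rightarrow> if i = i' \<and> j = j' \<and> z = z' then R (xs ! i) (ys ! j) z else 0)"

lemma fib_braid_gen: "fib_braid u = gen_braid (fib_R u)"
  by (simp add: fun_eq_iff fib_braid_def gen_braid_def)

definition gen_twist :: "(fib \<Rightarrow> 'k) \<Rightarrow> fib list \<Rightarrow> 'k::field fib_arr" where
  "gen_twist T xs = mk_arr xs xs (\<lambda>i j. if i = j then T (xs ! i) else 0)"

lemma fib_twist_gen: "fib_twist u = gen_twist (\<lambda>x. case x of One \<Rightarrow> 1 | Tau \<Rightarrow> inverse (u ^ 2))"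
  by (simp add: fun_eq_iff fib_twist_def gen_twist_def)

lemma gen_sel [simp]:
  "farr (gen_assoc F xs ys zs)" "src (gen_assoc F xs ys zs) = fib_tenO (fib_tenO xs ys) zs"
  "tgt (gen_assoc F xs ys zs) = fib_tenO xs (fib_tenO ys zs)"
  "farr (gen_assoc_inv F xs ys zs)" "tgt (gen_assoc_inv F xs ys zs) = fib_tenO (fib_tenO xs ys) zs"
  "src (gen_assoc_inv F xs ys zs) = fib_tenO xs (fib_tenO ys zs)"
  "farr (gen_braid R xs ys)" "src (gen_braid R xs ys) = fib_tenO xs ys" "tgt (gen_braid R xs ys) = fib_tenO ys xs"
  "farr (gen_twist T xs)" "src (gen_twist T xs) = xs" "tgt (gen_twist T xs) = xs"
  by (simp_all add: gen_assoc_def gen_assoc_inv_def gen_braid_def gen_twist_def)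

text \<open>A flat index set for triple products: in \<open>(i, j, s, l, w)\<close> the label
  \<open>s\<close> is the intermediate channel of the first two factors and \<open>w\<close> the
  resulting simple summand. In \<open>rbasis\<close> the intermediate channel \<open>t\<close>
  belongs to the last two factors.\<close>

definition lbasis :: "fib list \<Rightarrow> fib list \<Rightarrow> fib list \<Rightarrow> (nat \<times> nat \<times> fib \<times> nat \<times> fib) list" where
  "lbasis xs ys zs = map (\<lambda>(n, l, w). case ten_basis xs ys ! n of (i, j, s) \<Rightarrow> (i, j, s, l, w))
     (ten_basis (fib_tenO xs ys) zs)"

definition rbasis :: "fib list \<Rightarrow> fib list \<Rightarrow> fib list \<Rightarrow> (nat \<times> nat \<times> nat \<times> fib \<times> fib) list" where
  "rbasis xs ys zs = map (\<lambda>(i, m, w). case ten_basis ys zs ! m of (j, l, t) \<Rightarrow> (i, j, l, t, w))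
     (ten_basis xs (fib_tenO ys zs))"

lemma length_lrbasis [simp]:
  "length (lbasis xs ys zs) = length (ten_basis (fib_tenO xs ys) zs)"
  "length (rbasis xs ys zs) = length (ten_basis xs (fib_tenO ys zs))"
  by (simp_all add: lbasis_def rbasis_def)

lemma set_lbasis:
  "(i, j, s, l, w) \<in> set (lbasis xs ys zs) \<longleftrightarrow> i < length xs \<and> j < length ys \<and> l < length zs \<and>
     s \<in> set (fuse (xs ! i) (ys ! j)) \<and> w \<in> set (fuse s (zs ! l))" (is "?l \<longleftrightarrow> ?r")
proof
  assume ?l
  then obtain n where n: "(n, l, w) \<in> set (ten_basis (fib_tenO xs ys) zs)" "ten_basis xs ys ! n = (i, j, s)"
    by (auto simp: lbasis_def split: prod.splits)
  then show ?r using ten_basis_nth[of n xs ys i j s] by (auto simp: set_ten_basis)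
next
  assume r: ?r
  then have "(i, j, s) \<in> set (ten_basis xs ys)" by (auto simp: set_ten_basis)
  then obtain n where n: "n < length (ten_basis xs ys)" "ten_basis xs ys ! n = (i, j, s)" by (metis in_set_conv_nth)
  then have "(n, l, w) \<in> set (ten_basis (fib_tenO xs ys) zs)" using r ten_basis_nth(4)[OF n] by (auto simp: set_ten_basis)
  then show ?l using n by (force simp: lbasis_def intro!: image_eqI[of _ _ "(n, l, w)"])
qed

lemma set_rbasis:
  "(i, j, l, t, w) \<in> set (rbasis xs ys zs) \<longleftrightarrow> i < length xs \<and> j < length ys \<and> l < length zs \<and>
     t \<in> set (fuse (ys ! j) (zs ! l)) \<and> w \<in> set (fuse (xs ! i) t)" (is "?l \<longleftrightarrow> ?r")
proof
  assume ?l
  then obtain m where n: "(i, m, w) \<in> set (ten_basis xs (fib_tenO ys zs))" "ten_basis ys zs ! m = (j, l, t)"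
    by (auto simp: rbasis_def split: prod.splits)
  then show ?r using ten_basis_nth[of m ys zs j l t] by (auto simp: set_ten_basis)
next
  assume r: ?r
  then have "(j, l, t) \<in> set (ten_basis ys zs)" by (auto simp: set_ten_basis)
  then obtain m where n: "m < length (ten_basis ys zs)" "ten_basis ys zs ! m = (j, l, t)" by (metis in_set_conv_nth)
  then have "(i, m, w) \<in> set (ten_basis xs (fib_tenO ys zs))" using r ten_basis_nth(4)[OF n] by (auto simp: set_ten_basis)
  then show ?l using n by (force simp: rbasis_def intro!: image_eqI[of _ _ "(i, m, w)"])
qed

lemma distinct_lrbasis [simp]: "distinct (lbasis xs ys zs)" "distinct (rbasis xs ys zs)"
proof -
  have inj: "n = n'" if "ten_basis xs ys ! n = ten_basis xs ys ! n'" "n < length (ten_basis xs ys)" "n' < length (ten_basis xs ys)" for n n' xs ys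
    using that nth_eq_iff_index_eq[of "ten_basis xs ys" n n'] by simp
  show "distinct (lbasis xs ys zs)" unfolding lbasis_def
    by (auto simp: distinct_map inj_on_def set_ten_basis split: prod.splits intro!: inj)
  show "distinct (rbasis xs ys zs)" unfolding rbasis_def
    by (auto simp: distinct_map inj_on_def set_ten_basis split: prod.splits intro!: inj)
qed

lemma lbasis_nth:
  assumes "q < length (ten_basis (fib_tenO xs ys) zs)" "lbasis xs ys zs ! q = (i, j, s, l, w)"
  shows "i < length xs" "j < length ys" "l < length zs" "s \<in> set (fuse (xs ! i) (ys ! j))" "w \<in> set (fuse s (zs ! l))"
    "fib_tenO (fib_tenO xs ys) zs ! q = w"
    "\<exists>n. n < length (ten_basis xs ys) \<and> ten_basis (fib_tenO xs ys) zs ! q = (n, l, w) \<and> ten_basis xs ys ! n = (i, j, s)"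
proof -
  have "(i, j, s, l, w) \<in> set (lbasis xs ys zs)" using assms by (metis length_lrbasis(1) nth_mem)
  then show "i < length xs" "j < length ys" "l < length zs" "s \<in> set (fuse (xs ! i) (ys ! j))" "w \<in> set (fuse s (zs ! l))"
    by (auto simp: set_lbasis)
  obtain n l' w' where n: "ten_basis (fib_tenO xs ys) zs ! q = (n, l', w')" by (metis prod_cases3)
  then have "ten_basis xs ys ! n = (i, j, s)" "l' = l" "w' = w"
    using assms by (auto simp: lbasis_def split: prod.splits)
  then show "\<exists>n. n < length (ten_basis xs ys) \<and> ten_basis (fib_tenO xs ys) zs ! q = (n, l, w) \<and> ten_basis xs ys ! n = (i, j, s)"
    using n ten_basis_nth(1)[OF assms(1) n] by auto
  show "fib_tenO (fib_tenO xs ys) zs ! q = w" using n \<open>w' = w\<close> assms(1) by (simp add: fib_tenO_def)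
qed

lemma rbasis_nth:
  assumes "p < length (ten_basis xs (fib_tenO ys zs))" "rbasis xs ys zs ! p = (i, j, l, t, w)"
  shows "i < length xs" "j < length ys" "l < length zs" "t \<in> set (fuse (ys ! j) (zs ! l))" "w \<in> set (fuse (xs ! i) t)"
    "fib_tenO xs (fib_tenO ys zs) ! p = w"
    "\<exists>m. m < length (ten_basis ys zs) \<and> ten_basis xs (fib_tenO ys zs) ! p = (i, m, w) \<and> ten_basis ys zs ! m = (j, l, t)"
proof -
  have "(i, j, l, t, w) \<in> set (rbasis xs ys zs)" using assms by (metis length_lrbasis(2) nth_mem)
  then show "i < length xs" "j < length ys" "l < length zs" "t \<in> set (fuse (ys ! j) (zs ! l))" "w \<in> set (fuse (xs ! i) t)"
    by (auto simp: set_rbasis)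
  obtain i' m w' where n: "ten_basis xs (fib_tenO ys zs) ! p = (i', m, w')" by (metis prod_cases3)
  then have "ten_basis ys zs ! m = (j, l, t)" "i' = i" "w' = w"
    using assms by (auto simp: rbasis_def split: prod.splits)
  then show "\<exists>m. m < length (ten_basis ys zs) \<and> ten_basis xs (fib_tenO ys zs) ! p = (i, m, w) \<and> ten_basis ys zs ! m = (j, l, t)"
    using n ten_basis_nth(2)[OF assms(1) n] by auto
  show "fib_tenO xs (fib_tenO ys zs) ! p = w" using n \<open>w' = w\<close> assms(1) by (simp add: fib_tenO_def)
qed

lemma lbasis_ex: obtains i j s l w where "lbasis xs ys zs ! q = (i, j, s, l, w)"
  by (metis prod_cases5)

lemma rbasis_ex: obtains i j l t w where "rbasis xs ys zs ! p = (i, j, l, t, w)"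
  by (metis prod_cases5)

lemma entry_gen_assoc:
  assumes "p < length (ten_basis xs (fib_tenO ys zs))" "q < length (ten_basis (fib_tenO xs ys) zs)"
    and "rbasis xs ys zs ! p = (i, j, l, t, w)" "lbasis xs ys zs ! q = (i', j', s, l', w')"
  shows "entry (gen_assoc F xs ys zs) p q =
      (if i = i' \<and> j = j' \<and> l = l' \<and> w = w' then F (xs ! i) (ys ! j) (zs ! l) w t s else 0)"
    and "entry (gen_assoc_inv F xs ys zs) q p =
      (if i = i' \<and> j = j' \<and> l = l' \<and> w = w' then F (xs ! i) (ys ! j) (zs ! l) w s t else 0)"
  using lbasis_nth(6,7)[OF assms(2,4)] rbasis_nth(6,7)[OF assms(1,3)] assms(1,2)
  by (auto simp: gen_assoc_def gen_assoc_inv_def)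

lemma entry_ten_left:
  assumes "p < length (ten_basis (fib_tenO (tgt f) (tgt g)) (tgt h))" "q < length (ten_basis (fib_tenO (src f) (src g)) (src h))"
    and "lbasis (tgt f) (tgt g) (tgt h) ! p = (i, j, s, l, w)" "lbasis (src f) (src g) (src h) ! q = (i', j', s', l', w')"
  shows "entry (fib_tenA (fib_tenA f g) h) p q =
     (if s = s' \<and> w = w' then entry f i i' * entry g j j' * entry h l l' else 0)"
  using lbasis_nth(7)[OF assms(1,3)] lbasis_nth(7)[OF assms(2,4)] assms(1,2)
  by (auto simp: entry_tenA)

lemma entry_ten_right:
  assumes "p < length (ten_basis (tgt f) (fib_tenO (tgt g) (tgt h)))" "q < length (ten_basis (src f) (fib_tenO (src g) (src h)))"
    and "rbasis (tgt f) (tgt g) (tgt h) ! p = (i, j, l, t, w)" "rbasis (src f) (src g) (src h) ! q = (i', j', l', t', w')"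
  shows "entry (fib_tenA f (fib_tenA g h)) p q =
     (if t = t' \<and> w = w' then entry f i i' * (entry g j j' * entry h l l') else 0)"
  using rbasis_nth(7)[OF assms(1,3)] rbasis_nth(7)[OF assms(2,4)] assms(1,2)
  by (auto simp: entry_tenA)

text \<open>The coefficient depends only on labels, and nonzero entries of \<open>f\<close>,
  \<open>g\<close>, \<open>h\<close> preserve labels. On either side only one intermediate index
  contributes, and both contributions are the coefficient times the product of the three
  entries.\<close>

lemma gen_assoc_natural:
  assumes "farr f" "farr g" "farr h"
  shows "fib_comp (gen_assoc F (tgt f) (tgt g) (tgt h)) (fib_tenA (fib_tenA f g) h) =
    fib_comp (fib_tenA f (fib_tenA g h)) (gen_assoc F (src f) (src g) (src h))" (is "?L = ?R")
proof (rule farr_eqI)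
  let ?xs = "src f" and ?ys = "src g" and ?zs = "src h" and ?xs' = "tgt f" and ?ys' = "tgt g" and ?zs' = "tgt h"
  fix p q assume "p < length (tgt ?R)" and "q < length (src ?R)"
  then have p: "p < length (ten_basis ?xs' (fib_tenO ?ys' ?zs'))" and q: "q < length (ten_basis (fib_tenO ?xs ?ys) ?zs)" by auto
  obtain i j l t w where P: "rbasis ?xs' ?ys' ?zs' ! p = (i, j, l, t, w)" by (rule rbasis_ex)
  obtain i0 j0 s0 l0 w0 where Q: "lbasis ?xs ?ys ?zs ! q = (i0, j0, s0, l0, w0)" by (rule lbasis_ex)
  define c where "c = entry f i i0 * entry g j j0 * entry h l l0"
  note bp = rbasis_nth(1-5)[OF p P] and bq = lbasis_nth(1-5)[OF q Q]
  define \<phi> where "\<phi> = (\<lambda>(a, b, s, d, v). (if i = a \<and> j = b \<and> l = d \<and> w = v then F (?xs' ! i) (?ys' ! j) (?zs' ! l) w t s else 0) *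
      (if s = s0 \<and> v = w0 then entry f a i0 * entry g b j0 * entry h d l0 else 0))"
  define \<psi> where "\<psi> = (\<lambda>(a, b, d, t', v). (if t = t' \<and> w = v then entry f i a * (entry g j b * entry h l d) else 0) *
      (if a = i0 \<and> b = j0 \<and> d = l0 \<and> v = w0 then F (?xs ! a) (?ys ! b) (?zs ! d) v t' s0 else 0))"
  have "entry ?L p q = (\<Sum>r<length (lbasis ?xs' ?ys' ?zs'). \<phi> (lbasis ?xs' ?ys' ?zs' ! r))"
  proof -
    have "entry (gen_assoc F ?xs' ?ys' ?zs') p r * entry (fib_tenA (fib_tenA f g) h) r q = \<phi> (lbasis ?xs' ?ys' ?zs' ! r)"
      if "r < length (ten_basis (fib_tenO ?xs' ?ys') ?zs')" for r
    proof -
      obtain a b s d v where r: "lbasis ?xs' ?ys' ?zs' ! r = (a, b, s, d, v)" by (rule lbasis_ex)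
      show ?thesis unfolding entry_gen_assoc[OF p that P r] entry_ten_left[OF that q r Q] r by (simp add: \<phi>_def)
    qed
    then show ?thesis by (subst entry_comp) (auto intro!: sum.cong)
  qed
  also have "\<dots> = sum \<phi> (set (lbasis ?xs' ?ys' ?zs'))" by (rule sum_nth_distinct) simp
  also have "\<dots> = (if (i, j, s0, l, w0) \<in> set (lbasis ?xs' ?ys' ?zs') then \<phi> (i, j, s0, l, w0) else 0)"
    by (rule sum_single_term) (auto simp: \<phi>_def split: if_splits)
  \<comment> \<open>The symmetric expression at which the two sides meet. Where \<open>c\<close> is
    nonzero, the labels at source and target coincide and the required channel is
    admissible.\<close>
  also have "\<dots> = (if w = w0 then F (?xs ! i0) (?ys ! j0) (?zs ! l0) w t s0 * c else 0)"
  proof (cases "c = 0")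
    case False
    then show ?thesis
      using bp bq farr_entry_eq[OF assms(1), of i i0] farr_entry_eq[OF assms(2), of j j0] farr_entry_eq[OF assms(3), of l l0]
      by (auto simp: c_def \<phi>_def set_lbasis)
  qed (auto simp: \<phi>_def c_def)
  also have "\<dots> = (if (i0, j0, l0, t, w) \<in> set (rbasis ?xs ?ys ?zs) then \<psi> (i0, j0, l0, t, w) else 0)"
  proof (cases "c = 0")
    case False
    then show ?thesis
      using bp bq farr_entry_eq[OF assms(1), of i i0] farr_entry_eq[OF assms(2), of j j0] farr_entry_eq[OF assms(3), of l l0]
      by (auto simp: c_def \<psi>_def set_rbasis)
  qed (auto simp: \<psi>_def c_def)
  also have "\<dots> = sum \<psi> (set (rbasis ?xs ?ys ?zs))"
    by (rule sum_single_term[symmetric]) (auto simp: \<psi>_def split: if_splits)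
  also have "\<dots> = (\<Sum>r<length (rbasis ?xs ?ys ?zs). \<psi> (rbasis ?xs ?ys ?zs ! r))" by (rule sum_nth_distinct[symmetric]) simp
  also have "\<dots> = entry ?R p q"
  proof -
    have "entry (fib_tenA f (fib_tenA g h)) p r * entry (gen_assoc F ?xs ?ys ?zs) r q = \<psi> (rbasis ?xs ?ys ?zs ! r)"
      if "r < length (ten_basis ?xs (fib_tenO ?ys ?zs))" for r
    proof -
      obtain a b d t' v where r: "rbasis ?xs ?ys ?zs ! r = (a, b, d, t', v)" by (rule rbasis_ex)
      show ?thesis unfolding entry_gen_assoc[OF that q r Q] entry_ten_right[OF p that P r] r by (simp add: \<psi>_def)
    qed
    then show ?thesis by (subst entry_comp) (auto intro!: sum.cong)
  qed
  finally show "entry ?L p q = entry ?R p q" .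
qed (use assms in auto)

lemma entry_gen_braid:
  assumes "p < length (ten_basis ys xs)" "q < length (ten_basis xs ys)"
    and "ten_basis ys xs ! p = (j, i, z)" "ten_basis xs ys ! q = (i', j', z')"
  shows "entry (gen_braid R xs ys) p q = (if i = i' \<and> j = j' \<and> z = z' then R (xs ! i) (ys ! j) z else 0)"
  using assms ten_basis_nth(4)[OF assms(1,3)] ten_basis_nth(4)[OF assms(2,4)] by (auto simp: gen_braid_def)

lemma fuse_commute: "fuse x y = fuse y x"
  by (cases x; cases y) auto

lemma gen_braid_natural:
  assumes "farr f" "farr g"
  shows "fib_comp (gen_braid R (tgt f) (tgt g)) (fib_tenA f g) =
    fib_comp (fib_tenA g f) (gen_braid R (src f) (src g))" (is "?L = ?R")
proof (rule farr_eqI)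
  let ?xs = "src f" and ?ys = "src g" and ?xs' = "tgt f" and ?ys' = "tgt g"
  fix p q assume "p < length (tgt ?R)" and "q < length (src ?R)"
  then have p: "p < length (ten_basis ?ys' ?xs')" and q: "q < length (ten_basis ?xs ?ys)" by auto
  obtain i j z where P: "ten_basis ?ys' ?xs' ! p = (j, i, z)" by (metis prod_cases3)
  obtain i0 j0 z0 where Q: "ten_basis ?xs ?ys ! q = (i0, j0, z0)" by (metis prod_cases3)
  define c where "c = entry f i i0 * entry g j j0"
  note bp = ten_basis_nth(1-3)[OF p P] and bq = ten_basis_nth(1-3)[OF q Q]
  define \<phi> where "\<phi> = (\<lambda>(a, b, v). (if i = a \<and> j = b \<and> z = v then R (?xs' ! i) (?ys' ! j) z else 0) *
      ten_entry f g (a, b, v) (i0, j0, z0))"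
  define \<psi> where "\<psi> = (\<lambda>(b, a, v). ten_entry g f (j, i, z) (b, a, v) *
      (if a = i0 \<and> b = j0 \<and> v = z0 then R (?xs ! a) (?ys ! b) v else 0))"
  have "entry ?L p q = (\<Sum>r<length (ten_basis ?xs' ?ys'). \<phi> (ten_basis ?xs' ?ys' ! r))"
  proof -
    have "entry (gen_braid R ?xs' ?ys') p r * entry (fib_tenA f g) r q = \<phi> (ten_basis ?xs' ?ys' ! r)"
      if "r < length (ten_basis ?xs' ?ys')" for r
    proof -
      obtain a b v where r: "ten_basis ?xs' ?ys' ! r = (a, b, v)" by (metis prod_cases3)
      show ?thesis unfolding entry_gen_braid[OF p that P r] entry_tenA[OF that q] r Q by (simp add: \<phi>_def)
    qed
    then show ?thesis by (subst entry_comp) (auto intro!: sum.cong)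
  qed
  also have "\<dots> = sum \<phi> (set (ten_basis ?xs' ?ys'))" by (rule sum_nth_distinct) simp
  also have "\<dots> = (if (i, j, z0) \<in> set (ten_basis ?xs' ?ys') then \<phi> (i, j, z0) else 0)"
    by (rule sum_single_term) (auto simp: \<phi>_def split: if_splits)
  also have "\<dots> = (if z = z0 then R (?xs ! i0) (?ys ! j0) z * c else 0)"
  proof (cases "c = 0")
    case False
    then show ?thesis
      using bp bq farr_entry_eq[OF assms(1), of i i0] farr_entry_eq[OF assms(2), of j j0]
      by (auto simp: c_def \<phi>_def set_ten_basis)
  qed (auto simp: \<phi>_def c_def)
  also have "\<dots> = (if (j0, i0, z) \<in> set (ten_basis ?ys ?xs) then \<psi> (j0, i0, z) else 0)"
  proof (cases "c = 0")
    case False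
    then show ?thesis
      using bp bq farr_entry_eq[OF assms(1), of i i0] farr_entry_eq[OF assms(2), of j j0]
      by (auto simp: c_def \<psi>_def set_ten_basis)
  qed (auto simp: \<psi>_def c_def)
  also have "\<dots> = sum \<psi> (set (ten_basis ?ys ?xs))"
    by (rule sum_single_term[symmetric]) (auto simp: \<psi>_def split: if_splits)
  also have "\<dots> = (\<Sum>r<length (ten_basis ?ys ?xs). \<psi> (ten_basis ?ys ?xs ! r))" by (rule sum_nth_distinct[symmetric]) simp
  also have "\<dots> = entry ?R p q"
  proof -
    have "entry (fib_tenA g f) p r * entry (gen_braid R ?xs ?ys) r q = \<psi> (ten_basis ?ys ?xs ! r)"
      if "r < length (ten_basis ?ys ?xs)" for r
    proof -
      obtain a b v where r: "ten_basis ?ys ?xs ! r = (b, a, v)" by (metis prod_cases3)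
      show ?thesis unfolding entry_gen_braid[OF that q r Q] entry_tenA[OF p that] r P by (simp add: \<psi>_def)
    qed
    then show ?thesis by (subst entry_comp) (auto intro!: sum.cong)
  qed
  finally show "entry ?L p q = entry ?R p q" .
qed (use assms in auto)

lemma gen_braid_inverse:
  assumes "\<And>x y z. z \<in> set (fuse x y) \<Longrightarrow> R' y x z * R x y z = 1"
  shows "fib_comp (gen_braid R' ys xs) (gen_braid R xs ys) = fib_ident (fib_tenO xs ys)"
proof (rule farr_eqI)
  fix p q assume "p < length (tgt (fib_ident (fib_tenO xs ys)))" and "q < length (src (fib_ident (fib_tenO xs ys)))"
  then have p: "p < length (ten_basis xs ys)" and q: "q < length (ten_basis xs ys)" by auto
  obtain i j z where P: "ten_basis xs ys ! p = (i, j, z)" by (metis prod_cases3)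
  obtain i0 j0 z0 where Q: "ten_basis xs ys ! q = (i0, j0, z0)" by (metis prod_cases3)
  note bp = ten_basis_nth(1-3)[OF p P] and bq = ten_basis_nth(1-3)[OF q Q]
  define \<phi> where "\<phi> = (\<lambda>(b, a, v). (if j = b \<and> i = a \<and> z = v then R' (ys ! j) (xs ! i) z else 0) *
      (if a = i0 \<and> b = j0 \<and> v = z0 then R (xs ! a) (ys ! b) v else 0))"
  have "entry (fib_comp (gen_braid R' ys xs) (gen_braid R xs ys)) p q = (\<Sum>r<length (ten_basis ys xs). \<phi> (ten_basis ys xs ! r))"
  proof -
    have "entry (gen_braid R' ys xs) p r * entry (gen_braid R xs ys) r q = \<phi> (ten_basis ys xs ! r)"
      if "r < length (ten_basis ys xs)" for r
    proof -
      obtain a b v where r: "ten_basis ys xs ! r = (b, a, v)" by (metis prod_cases3)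
      show ?thesis unfolding entry_gen_braid[OF p that P r] entry_gen_braid[OF that q r Q] r by (simp add: \<phi>_def)
    qed
    then show ?thesis by (subst entry_comp) (auto intro!: sum.cong)
  qed
  also have "\<dots> = sum \<phi> (set (ten_basis ys xs))" by (rule sum_nth_distinct) simp
  also have "\<dots> = (if (j0, i0, z0) \<in> set (ten_basis ys xs) then \<phi> (j0, i0, z0) else 0)"
    by (rule sum_single_term) (auto simp: \<phi>_def split: if_splits)
  also have "\<dots> = (if (i, j, z) = (i0, j0, z0) then 1 else 0)"
    using bp bq assms[of z0 "xs ! i0" "ys ! j0"] by (auto simp: \<phi>_def set_ten_basis fuse_commute)
  also have "\<dots> = entry (fib_ident (fib_tenO xs ys)) p q"
    using p q P Q nth_eq_iff_index_eq[of "ten_basis xs ys" p q] by auto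
  finally show "entry (fib_comp (gen_braid R' ys xs) (gen_braid R xs ys)) p q = entry (fib_ident (fib_tenO xs ys)) p q" .
qed auto

lemma sum_image_support:
  assumes "finite L" "inj_on h A" "h ` A \<subseteq> L" "\<And>r. r \<in> L \<Longrightarrow> r \<notin> h ` A \<Longrightarrow> \<phi> r = 0"
  shows "sum \<phi> L = (\<Sum>s\<in>A. \<phi> (h s))"
proof -
  have "sum \<phi> L = sum \<phi> (h ` A)" using assms by (intro sum.mono_neutral_right) auto
  then show ?thesis using assms(2) by (simp add: sum.reindex)
qed

text \<open>Both matrices preserve the positions \<open>i\<close>, \<open>j\<close>,
  \<open>l\<close> and the total \<open>w\<close>, so the big matrix product falls apart into
  products over the intermediate channel alone, which the hypothesis evaluates.\<close>

lemma gen_assoc_inverse: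
  assumes F: "\<And>x y z w t t'. t \<in> set (fuse y z) \<Longrightarrow> w \<in> set (fuse x t) \<Longrightarrow> t' \<in> set (fuse y z) \<Longrightarrow> w \<in> set (fuse x t') \<Longrightarrow>
      (\<Sum>s | s \<in> set (fuse x y) \<and> w \<in> set (fuse s z). F x y z w t s * F' x y z w s t') = (if t = t' then 1 else 0)"
  shows "fib_comp (gen_assoc F xs ys zs) (gen_assoc_inv F' xs ys zs) = fib_ident (fib_tenO xs (fib_tenO ys zs))" (is "?L = ?R")
proof (rule farr_eqI)
  fix p q assume "p < length (tgt ?R)" and "q < length (src ?R)"
  then have p: "p < length (ten_basis xs (fib_tenO ys zs))" and q: "q < length (ten_basis xs (fib_tenO ys zs))" by auto
  obtain i j l t w where P: "rbasis xs ys zs ! p = (i, j, l, t, w)" by (rule rbasis_ex)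
  obtain i0 j0 l0 t0 w0 where Q: "rbasis xs ys zs ! q = (i0, j0, l0, t0, w0)" by (rule rbasis_ex)
  note bp = rbasis_nth(1-5)[OF p P] and bq = rbasis_nth(1-5)[OF q Q]
  define \<phi> where "\<phi> = (\<lambda>(a, b, s, d, v). (if i = a \<and> j = b \<and> l = d \<and> w = v then F (xs ! i) (ys ! j) (zs ! l) w t s else 0) *
      (if i0 = a \<and> j0 = b \<and> l0 = d \<and> w0 = v then F' (xs ! i0) (ys ! j0) (zs ! l0) w0 s t0 else 0))"
  have "entry ?L p q = (\<Sum>r<length (lbasis xs ys zs). \<phi> (lbasis xs ys zs ! r))"
  proof -
    have "entry (gen_assoc F xs ys zs) p r * entry (gen_assoc_inv F' xs ys zs) r q = \<phi> (lbasis xs ys zs ! r)"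
      if "r < length (ten_basis (fib_tenO xs ys) zs)" for r
    proof -
      obtain a b s d v where r: "lbasis xs ys zs ! r = (a, b, s, d, v)" by (rule lbasis_ex)
      show ?thesis unfolding entry_gen_assoc(1)[OF p that P r] entry_gen_assoc(2)[OF q that Q r] r by (simp add: \<phi>_def)
    qed
    then show ?thesis by (subst entry_comp) (auto intro!: sum.cong)
  qed
  also have "\<dots> = sum \<phi> (set (lbasis xs ys zs))" by (rule sum_nth_distinct) simp
  also have "\<dots> = (\<Sum>s | s \<in> set (fuse (xs ! i) (ys ! j)) \<and> w \<in> set (fuse s (zs ! l)). \<phi> (i, j, s, l, w))"
    by (rule sum_image_support) (use bp in \<open>auto simp: set_lbasis \<phi>_def inj_on_def\<close>)
  also have "\<dots> = (if (i, j, l, t, w) = (i0, j0, l0, t0, w0) then 1 else 0)"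
    using F[of t "ys ! j" "zs ! l" w "xs ! i" t0] bp bq
    by (cases "i = i0 \<and> j = j0 \<and> l = l0 \<and> w = w0") (auto simp: \<phi>_def)
  also have "\<dots> = entry ?R p q"
    using p q P Q nth_eq_iff_index_eq[of "rbasis xs ys zs" p q] by auto
  finally show "entry ?L p q = entry ?R p q" .
qed auto

lemma gen_assoc_inverse':
  assumes F: "\<And>x y z w s s'. s \<in> set (fuse x y) \<Longrightarrow> w \<in> set (fuse s z) \<Longrightarrow> s' \<in> set (fuse x y) \<Longrightarrow> w \<in> set (fuse s' z) \<Longrightarrow>
      (\<Sum>t | t \<in> set (fuse y z) \<and> w \<in> set (fuse x t). F' x y z w s t * F x y z w t s') = (if s = s' then 1 else 0)"
  shows "fib_comp (gen_assoc_inv F' xs ys zs) (gen_assoc F xs ys zs) = fib_ident (fib_tenO (fib_tenO xs ys) zs)" (is "?L = ?R")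
proof (rule farr_eqI)
  fix p q assume "p < length (tgt ?R)" and "q < length (src ?R)"
  then have p: "p < length (ten_basis (fib_tenO xs ys) zs)" and q: "q < length (ten_basis (fib_tenO xs ys) zs)" by auto
  obtain i j s l w where P: "lbasis xs ys zs ! p = (i, j, s, l, w)" by (rule lbasis_ex)
  obtain i0 j0 s0 l0 w0 where Q: "lbasis xs ys zs ! q = (i0, j0, s0, l0, w0)" by (rule lbasis_ex)
  note bp = lbasis_nth(1-5)[OF p P] and bq = lbasis_nth(1-5)[OF q Q]
  define \<phi> where "\<phi> = (\<lambda>(a, b, d, t, v). (if a = i \<and> b = j \<and> d = l \<and> v = w then F' (xs ! a) (ys ! b) (zs ! d) v s t else 0) *
      (if a = i0 \<and> b = j0 \<and> d = l0 \<and> v = w0 then F (xs ! a) (ys ! b) (zs ! d) v t s0 else 0))"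
  have "entry ?L p q = (\<Sum>r<length (rbasis xs ys zs). \<phi> (rbasis xs ys zs ! r))"
  proof -
    have "entry (gen_assoc_inv F' xs ys zs) p r * entry (gen_assoc F xs ys zs) r q = \<phi> (rbasis xs ys zs ! r)"
      if "r < length (ten_basis xs (fib_tenO ys zs))" for r
    proof -
      obtain a b d t v where r: "rbasis xs ys zs ! r = (a, b, d, t, v)" by (rule rbasis_ex)
      show ?thesis unfolding entry_gen_assoc(2)[OF that p r P] entry_gen_assoc(1)[OF that q r Q] r by (simp add: \<phi>_def)
    qed
    then show ?thesis by (subst entry_comp) (auto intro!: sum.cong)
  qed
  also have "\<dots> = sum \<phi> (set (rbasis xs ys zs))" by (rule sum_nth_distinct) simp
  also have "\<dots> = (\<Sum>t | t \<in> set (fuse (ys ! j) (zs ! l)) \<and> w \<in> set (fuse (xs ! i) t). \<phi> (i, j, l, t, w))"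
    by (rule sum_image_support) (use bp in \<open>auto simp: set_rbasis \<phi>_def inj_on_def\<close>)
  also have "\<dots> = (if (i, j, s, l, w) = (i0, j0, s0, l0, w0) then 1 else 0)"
    using F[of s "xs ! i" "ys ! j" w "zs ! l" s0] bp bq
    by (cases "i = i0 \<and> j = j0 \<and> l = l0 \<and> w = w0") (auto simp: \<phi>_def)
  also have "\<dots> = entry ?R p q"
    using p q P Q nth_eq_iff_index_eq[of "lbasis xs ys zs" p q] by auto
  finally show "entry ?L p q = entry ?R p q" .
qed auto

lemma entry_comp_gen_twist:
  assumes "farr f"
  shows "entry (fib_comp f (gen_twist T (src f))) i j = entry f i j * (if j < length (src f) then T (src f ! j) else 0)"
    and "entry (fib_comp (gen_twist T (tgt f)) f) i j = (if i < length (tgt f) then T (tgt f ! i) else 0) * entry f i j"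
proof -
  show "entry (fib_comp f (gen_twist T (src f))) i j = entry f i j * (if j < length (src f) then T (src f ! j) else 0)"
    using entry_comp_col[of "gen_twist T (src f)" f j j "if j < length (src f) then T (src f ! j) else 0" i] assms
      farr_entry_zero[OF assms, of i j] by (auto simp: gen_twist_def)
  have "entry (fib_comp (gen_twist T (tgt f)) f) i j =
      (\<Sum>l<length (tgt f). if l = i then T (tgt f ! i) * entry f i j else 0)"
    unfolding entry_comp[OF assms gen_sel(10) gen_sel(11)] by (intro sum.cong) (auto simp: gen_twist_def)
  then show "entry (fib_comp (gen_twist T (tgt f)) f) i j = (if i < length (tgt f) then T (tgt f ! i) else 0) * entry f i j"
    by simp
qed

lemma gen_twist_natural:
  assumes "farr f" shows "fib_comp (gen_twist T (tgt f)) f = fib_comp f (gen_twist T (src f))"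
  by (rule farr_eqI) (use assms in \<open>auto simp: entry_comp_gen_twist\<close>)

section \<open>Reduction of coherence to simple objects\<close>

text \<open>Each coherence axiom holds as soon as it holds on simple objects. There both sides are
  matrices of size at most five, and the axioms become polynomial equations in the coefficients.\<close>

lemma ten_basis_eval:
  "ten_basis [] ys = []"
  "ten_basis [x] [y] = map (\<lambda>z. (0, 0, z)) (fuse x y)"
  "ten_basis [x] [y, y'] = map (\<lambda>z. (0, 0, z)) (fuse x y) @ map (\<lambda>z. (0, 1, z)) (fuse x y')"
  "ten_basis [x] [y, y', y''] = map (\<lambda>z. (0, 0, z)) (fuse x y) @ map (\<lambda>z. (0, 1, z)) (fuse x y') @ map (\<lambda>z. (0, 2, z)) (fuse x y'')"
  "ten_basis [x, x'] [y] = map (\<lambda>z. (0, 0, z)) (fuse x y) @ map (\<lambda>z. (1, 0, z)) (fuse x' y)"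
  "ten_basis [x, x', x''] [y] = map (\<lambda>z. (0, 0, z)) (fuse x y) @ map (\<lambda>z. (1, 0, z)) (fuse x' y) @ map (\<lambda>z. (2, 0, z)) (fuse x'' y)"
  "ten_basis [x, x'] [y, y'] = map (\<lambda>z. (0, 0, z)) (fuse x y) @ map (\<lambda>z. (0, 1, z)) (fuse x y') @
      map (\<lambda>z. (1, 0, z)) (fuse x' y) @ map (\<lambda>z. (1, 1, z)) (fuse x' y')"
  by (simp_all add: ten_basis_def upt_rec numeral_2_eq_2)

lemma fib_tenO_eval: "fib_tenO xs ys = map (\<lambda>t. snd (snd t)) (ten_basis xs ys)"
  by (simp add: fib_tenO_def case_prod_beta)

lemma farr_eq_iff:
  assumes "farr f" "farr g" "src f = src g" "tgt f = tgt g"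
  shows "f = g \<longleftrightarrow> (\<forall>i<length (tgt g). \<forall>j<length (src g). entry f i j = entry g i j)"
  using assms by (auto intro: farr_eqI)

section \<open>The coherence equations on simple objects\<close>

definition pentagon_at where
 "pentagon_at F x y z v \<longleftrightarrow>
 fib_comp (gen_assoc F [x] [y] (fib_tenO [z] [v])) (gen_assoc F (fib_tenO [x] [y]) [z] [v]) = fib_comp (fib_comp (fib_tenA (fib_ident [x]) (gen_assoc F [y] [z] [v])) (gen_assoc F [x] (fib_tenO [y] [z]) [v])) (fib_tenA (gen_assoc F [x] [y] [z]) (fib_ident [v]))"

definition hexagon_right_at where
  "hexagon_right_at F R x y z \<longleftrightarrow>
   fib_comp (fib_comp (gen_assoc F [y] [z] [x]) (gen_braid R [x] (fib_tenO [y] [z]))) (gen_assoc F [x] [y] [z]) =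
   fib_comp (fib_comp (fib_tenA (fib_ident [y]) (gen_braid R [x] [z])) (gen_assoc F [y] [x] [z]))
     (fib_tenA (gen_braid R [x] [y]) (fib_ident [z]))"

definition hexagon_left_at where
  "hexagon_left_at F' R x y z \<longleftrightarrow>
   fib_comp (fib_comp (gen_assoc_inv F' [z] [x] [y]) (gen_braid R (fib_tenO [x] [y]) [z])) (gen_assoc_inv F' [x] [y] [z]) =
   fib_comp (fib_comp (fib_tenA (gen_braid R [x] [z]) (fib_ident [y])) (gen_assoc_inv F' [x] [z] [y]))
     (fib_tenA (fib_ident [x]) (gen_braid R [y] [z]))"

definition twist_at where
  "twist_at R T x y \<longleftrightarrow> gen_twist T (fib_tenO [x] [y]) =
     fib_comp (fib_comp (fib_tenA (gen_twist T [x]) (gen_twist T [y])) (gen_braid R [y] [x])) (gen_braid R [x] [y])"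

lemma forall_less_Suc: "(\<forall>i<Suc n. P i) \<longleftrightarrow> (\<forall>i<n. P i) \<and> P n"
  by (auto simp: less_Suc_eq)



lemmas matrix_eval = farr_eq_iff entry_comp ten_basis_eval fib_tenO_eval gen_assoc_def gen_assoc_inv_def
  gen_braid_def gen_twist_def fib_tenA_def forall_less_Suc numeral_eq_Suc nth_Cons'

lemma pentagon_at_fib:
  assumes "a * a = a + (1::'k::field)" shows "pentagon_at (fib_F a) x y z v"
proof (cases "x = Tau \<and> y = Tau \<and> z = Tau \<and> v = Tau")
  case True
  have "pentagon_at (fib_F a) Tau Tau Tau Tau"
    apply (simp add: pentagon_at_def matrix_eval fib_F_def)
    using assms by algebra
  then show ?thesis using True by simp
next
  case False
  then show ?thesis using assms
    by (cases x; cases y; cases z; cases v; simp add: pentagon_at_def matrix_eval fib_F_def)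
qed

lemma hexagon_right_at_fib:
  assumes "u \<noteq> 0" "(u + inverse u) * (u + inverse u) = (u + inverse u) + (1::'k::field)"
  shows "hexagon_right_at (fib_F (u + inverse u)) (fib_R u) x y z"
proof -
  \<comment> \<open>Treating the inverse as a second variable bound by \<open>u * w = 1\<close>
    makes all equations polynomial, so that ideal membership decides them.\<close>
  define w where "w = inverse u"
  have uw: "u * w = 1" using assms by (simp add: w_def)
  have r: "(u + w) * (u + w) = (u + w) + 1" using assms by (simp add: w_def)
  have "hexagon_right_at (fib_F (u + w)) (fib_R u) x y z"
  proof (cases "x = Tau \<and> y = Tau \<and> z = Tau")
    case True
    have "hexagon_right_at (fib_F (u + w)) (fib_R u) Tau Tau Tau"
      apply (simp add: hexagon_right_at_def matrix_eval fib_F_def fib_R_def)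
      apply (intro conjI)
      using uw r by algebra+
    then show ?thesis using True by simp
  next
    case False
    then show ?thesis
      by (cases x; cases y; cases z; simp add: hexagon_right_at_def matrix_eval fib_F_def fib_R_def)
  qed
  then show ?thesis by (simp add: w_def)
qed

lemma hexagon_left_at_fib:
  assumes "u \<noteq> 0" "(u + inverse u) * (u + inverse u) = (u + inverse u) + (1::'k::field)"
  shows "hexagon_left_at (fib_F (u + inverse u)) (fib_R u) x y z"
proof -
  define w where "w = inverse u"
  have uw: "u * w = 1" using assms by (simp add: w_def)
  have r: "(u + w) * (u + w) = (u + w) + 1" using assms by (simp add: w_def)
  have "hexagon_left_at (fib_F (u + w)) (fib_R u) x y z"
  proof (cases "x = Tau \<and> y = Tau \<and> z = Tau")
    case True
    have "hexagon_left_at (fib_F (u + w)) (fib_R u) Tau Tau Tau"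
      apply (simp add: hexagon_left_at_def matrix_eval fib_F_def fib_R_def)
      apply (intro conjI)
      using uw r by algebra+
    then show ?thesis using True by simp
  next
    case False
    then show ?thesis
      by (cases x; cases y; cases z; simp add: hexagon_left_at_def matrix_eval fib_F_def fib_R_def)
  qed
  then show ?thesis by (simp add: w_def)
qed

lemma twist_at_fib:
  assumes "u \<noteq> 0" shows "twist_at (fib_R u) (\<lambda>x. case x of One \<Rightarrow> 1 | Tau \<Rightarrow> inverse (u ^ 2)) x y"
  using assms
  by (cases x; cases y; simp add: twist_at_def matrix_eval fib_R_def field_simps)


section \<open>Testing equations of block matrices on arrows out of simple objects\<close>

notation fib_comp (infixr "\<circ>\<^sub>f" 60) and fib_tenA (infixr "\<otimes>\<^sub>f" 70)

text \<open>Every coordinate inclusion is required to factor through a member of the family. This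
  yields joint cancellability, and in this form it passes to tensor products by the interchange
  law.\<close>

definition generating :: "'k::field fib_arr set \<Rightarrow> fib list \<Rightarrow> bool" where
  "generating Fam xs \<longleftrightarrow> (\<forall>a\<in>Fam. farr a \<and> tgt a = xs) \<and>
     (\<forall>i<length xs. \<exists>a\<in>Fam. \<exists>c. farr c \<and> tgt c = src a \<and> src c = [xs ! i] \<and> fib_inc xs i = a \<circ>\<^sub>f c)"

lemma generating_epi:
  assumes "generating Fam xs" "farr f" "farr g" "src f = xs" "src g = xs" "tgt f = tgt g"
    "\<And>a. a \<in> Fam \<Longrightarrow> f \<circ>\<^sub>f a = g \<circ>\<^sub>f a"
  shows "f = g"
proof (rule fib_inc_epi[OF assms(2-6)])
  fix i assume "i < length xs"
  then obtain a c where a: "a \<in> Fam" "farr a" "tgt a = xs" and c: "farr c" "tgt c = src a" "fib_inc xs i = a \<circ>\<^sub>f c"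
    using assms(1) unfolding generating_def by blast
  have "f \<circ>\<^sub>f fib_inc xs i = (f \<circ>\<^sub>f a) \<circ>\<^sub>f c" "g \<circ>\<^sub>f fib_inc xs i = (g \<circ>\<^sub>f a) \<circ>\<^sub>f c"
    using a c assms(2-5) by (simp_all add: fib_comp_assoc)
  then show "f \<circ>\<^sub>f fib_inc xs i = g \<circ>\<^sub>f fib_inc xs i" using assms(7) a by simp
qed

definition incs :: "fib list \<Rightarrow> 'k::field fib_arr set" where
  "incs xs = {a. farr a \<and> tgt a = xs \<and> (\<exists>x. src a = [x])}"

lemma generating_incs: "generating (incs xs) xs"
  unfolding generating_def
proof (intro conjI ballI allI impI)
  fix i assume "i < length xs"
  show "\<exists>a\<in>incs xs. \<exists>c. farr c \<and> tgt c = src a \<and> src c = [xs ! i] \<and> fib_inc xs i = a \<circ>\<^sub>f c"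
  proof (intro bexI exI conjI)
    show "fib_inc xs i = fib_inc xs i \<circ>\<^sub>f fib_ident [xs ! i]"
      by (metis fib_comp_ident(2) fib_inc_sel(1,2))
  qed (auto simp: incs_def)
qed (auto simp: incs_def)

text \<open>A summand of \<open>xs\<close> \<otimes> \<open>ys\<close> lies in the product of two
  single summands, as the channel \<open>z\<close>; the arrow \<open>c\<close> is the inclusion of
  that channel.\<close>

lemma fib_inc_ten:
  assumes "r < length (ten_basis xs ys)" "ten_basis xs ys ! r = (i, j, z)"
  shows "\<exists>c. farr c \<and> src c = [z] \<and> tgt c = fib_tenO [xs ! i] [ys ! j] \<and>
    fib_inc (fib_tenO xs ys) r = (fib_inc xs i \<otimes>\<^sub>f fib_inc ys j) \<circ>\<^sub>f c"
proof -
  let ?x = "xs ! i" and ?y = "ys ! j"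
  note b = ten_basis_nth[OF assms]
  obtain k where k: "k < length (fuse ?x ?y)" "fuse ?x ?y ! k = z" using b(3) by (auto simp: in_set_conv_nth)
  have len: "length (ten_basis [?x] [?y]) = length (fuse ?x ?y)" and sing: "fib_tenO [?x] [?y] = fuse ?x ?y"
    by (simp_all add: fib_tenO_eval ten_basis_eval comp_def)
  have tb: "ten_basis [?x] [?y] ! k = (0, 0, z)" using k by (simp add: ten_basis_eval)
  define c where "c = mk_arr [z] (fib_tenO [?x] [?y]) (\<lambda>p q. if p = k then 1 else 0 :: 'a)"
  have c: "farr c" "src c = [z]" "tgt c = fib_tenO [?x] [?y]" by (simp_all add: c_def)
  have ec: "entry c p 0 = (if p = k then 1 else 0)" if "p < length (tgt c)" for p
    using that k by (auto simp: c_def len sing)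
  have "fib_inc (fib_tenO xs ys) r = (fib_inc xs i \<otimes>\<^sub>f fib_inc ys j) \<circ>\<^sub>f c"
  proof (rule farr_eqI)
    fix p q assume "p < length (tgt ((fib_inc xs i \<otimes>\<^sub>f fib_inc ys j) \<circ>\<^sub>f c))" "q < length (src ((fib_inc xs i \<otimes>\<^sub>f fib_inc ys j) \<circ>\<^sub>f c))"
    then have p: "p < length (ten_basis xs ys)" and q: "q = 0" by (auto simp: c)
    obtain i' j' z' where P: "ten_basis xs ys ! p = (i', j', z')" by (metis prod_cases3)
    have "entry ((fib_inc xs i \<otimes>\<^sub>f fib_inc ys j) \<circ>\<^sub>f c) p 0 = entry (fib_inc xs i \<otimes>\<^sub>f fib_inc ys j) p k"
      using entry_comp_col[of c "fib_inc xs i \<otimes>\<^sub>f fib_inc ys j" 0 k 1 p] ec c k by (simp add: len)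
    also have "\<dots> = (if p = r then 1 else 0)"
      using p k P tb b(1,2) assms nth_eq_iff_index_eq[of "ten_basis xs ys" p r]
      by (auto simp: entry_tenA len entry_fib_inc)
    finally show "entry (fib_inc (fib_tenO xs ys) r) p q = entry ((fib_inc xs i \<otimes>\<^sub>f fib_inc ys j) \<circ>\<^sub>f c) p q"
      using p q assms(1) by (simp add: entry_fib_inc)
  qed (use c b(4) in auto)
  then show ?thesis using c by blast
qed

lemma generating_ten:
  assumes A: "generating A xs" and B: "generating B ys"
  shows "generating {a \<otimes>\<^sub>f b |a b. a \<in> A \<and> b \<in> B} (fib_tenO xs ys)"
  unfolding generating_def
proof (intro conjI ballI allI impI)
  fix h assume "h \<in> {a \<otimes>\<^sub>f b |a b. a \<in> A \<and> b \<in> B}"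
  then show "farr h" "tgt h = fib_tenO xs ys" using A B by (auto simp: generating_def)
next
  fix r assume "r < length (fib_tenO xs ys)"
  then have r: "r < length (ten_basis xs ys)" by simp
  obtain i j z where R: "ten_basis xs ys ! r = (i, j, z)" by (metis prod_cases3)
  note b = ten_basis_nth[OF r R]
  obtain k where k: "farr k" "src k = [z]" "tgt k = fib_tenO [xs ! i] [ys ! j]"
    and e: "fib_inc (fib_tenO xs ys) r = (fib_inc xs i \<otimes>\<^sub>f fib_inc ys j) \<circ>\<^sub>f (k :: 'a fib_arr)"
    using fib_inc_ten[OF r R] by blast
  obtain a c where a: "a \<in> A" "farr a" and c: "farr c" "tgt c = src a" "src c = [xs ! i]" "fib_inc xs i = a \<circ>\<^sub>f c"
    using A b(1) unfolding generating_def by blast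
  obtain a' c' where a': "a' \<in> B" "farr a'" and c': "farr c'" "tgt c' = src a'" "src c' = [ys ! j]" "fib_inc ys j = a' \<circ>\<^sub>f c'"
    using B b(2) unfolding generating_def by blast
  have "fib_inc (fib_tenO xs ys) r = (a \<otimes>\<^sub>f a') \<circ>\<^sub>f ((c \<otimes>\<^sub>f c') \<circ>\<^sub>f k)"
    using a a' c c' k by (simp add: e fib_ten_comp fib_comp_assoc)
  then show "\<exists>h\<in>{a \<otimes>\<^sub>f b |a b. a \<in> A \<and> b \<in> B}. \<exists>c. farr c \<and> tgt c = src h \<and> src c = [fib_tenO xs ys ! r] \<and>
      fib_inc (fib_tenO xs ys) r = h \<circ>\<^sub>f c"
    using a a' c c' k b(4)
    by (intro bexI[of _ "a \<otimes>\<^sub>f a'"] exI[of _ "(c \<otimes>\<^sub>f c') \<circ>\<^sub>f k"]) auto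
qed

lemma ten_comp_slide:
  assumes "farr f" "farr g" "farr f'" "farr g'" "farr h" "src f = tgt g" "src f' = tgt g'" "f \<circ>\<^sub>f g = f' \<circ>\<^sub>f g'"
  shows "(f \<otimes>\<^sub>f fib_ident (tgt h)) \<circ>\<^sub>f (g \<otimes>\<^sub>f h) = (f' \<otimes>\<^sub>f h) \<circ>\<^sub>f (g' \<otimes>\<^sub>f fib_ident (src h))"
    and "(fib_ident (tgt h) \<otimes>\<^sub>f f) \<circ>\<^sub>f (h \<otimes>\<^sub>f g) = (h \<otimes>\<^sub>f f') \<circ>\<^sub>f (fib_ident (src h) \<otimes>\<^sub>f g')"
  using assms by (simp_all add: fib_ten_comp[symmetric] fib_comp_ident)

lemma gen_assoc_naturalI:
  assumes "farr f" "farr g" "farr h" "tgt f = xs" "tgt g = ys" "tgt h = zs" "src f = xs'" "src g = ys'" "src h = zs'"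
  shows "gen_assoc F xs ys zs \<circ>\<^sub>f ((f \<otimes>\<^sub>f g) \<otimes>\<^sub>f h) = (f \<otimes>\<^sub>f (g \<otimes>\<^sub>f h)) \<circ>\<^sub>f gen_assoc F xs' ys' zs'"
  using gen_assoc_natural[of f g h F] assms by simp

lemma gen_braid_naturalI:
  assumes "farr f" "farr g" "tgt f = xs" "tgt g = ys" "src f = xs'" "src g = ys'"
  shows "gen_braid R xs ys \<circ>\<^sub>f (f \<otimes>\<^sub>f g) = (g \<otimes>\<^sub>f f) \<circ>\<^sub>f gen_braid R xs' ys'"
  using gen_braid_natural[of f g R] assms by simp

text \<open>Composites are kept nested to the right, so an equation between two-fold composites has
  to be applied in front of a tail \<open>k\<close>.\<close>

lemma comp_replace:
  assumes "f \<circ>\<^sub>f g = f' \<circ>\<^sub>f g'" "farr f" "farr g" "farr f'" "farr g'" "farr k" "src f = tgt g" "src f' = tgt g'" "src g = tgt k"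
  shows "f \<circ>\<^sub>f (g \<circ>\<^sub>f k) = f' \<circ>\<^sub>f (g' \<circ>\<^sub>f k)"
proof -
  have "src g' = src g" using arg_cong[OF assms(1), of src] by simp
  then show ?thesis using assms fib_comp_assoc[of k g f] fib_comp_assoc[of k g' f'] by simp
qed

text \<open>It suffices to compare both sides after a tensor product of four arrows out of simple
  objects. Naturality moves these arrows across all constraints, which leaves the constraints at the
  simple sources; there the hypothesis applies, and naturality moves the arrows back along the other
  path.\<close>

lemma gen_pentagon:
  assumes "\<And>x y z v. pentagon_at F x y z v"
  shows "gen_assoc F xs ys (fib_tenO zs vs) \<circ>\<^sub>f gen_assoc F (fib_tenO xs ys) zs vs =
    ((fib_ident xs \<otimes>\<^sub>f gen_assoc F ys zs vs) \<circ>\<^sub>f gen_assoc F xs (fib_tenO ys zs) vs) \<circ>\<^sub>f (gen_assoc F xs ys zs \<otimes>\<^sub>f fib_ident vs)"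
    (is "?L = ?R")
proof (rule generating_epi[OF generating_ten[OF generating_ten[OF generating_ten[OF generating_incs generating_incs] generating_incs] generating_incs]])
  fix h :: "'a fib_arr" assume "h \<in> {a \<otimes>\<^sub>f b |a b. a \<in> {a \<otimes>\<^sub>f b |a b. a \<in> {a \<otimes>\<^sub>f b |a b. a \<in> incs xs \<and> b \<in> incs ys} \<and> b \<in> incs zs} \<and> b \<in> incs vs}"
  then obtain a b c d x y z v where h: "h = ((a \<otimes>\<^sub>f b) \<otimes>\<^sub>f c) \<otimes>\<^sub>f d"
    and a [simp]: "farr a" "farr b" "farr c" "farr d" "tgt a = xs" "tgt b = ys" "tgt c = zs" "tgt d = vs"
      "src a = [x]" "src b = [y]" "src c = [z]" "src d = [v]"
    unfolding incs_def by blast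
  let ?A = "gen_assoc F"
  let ?T = "a \<otimes>\<^sub>f (b \<otimes>\<^sub>f (c \<otimes>\<^sub>f d))"
  have "?L \<circ>\<^sub>f h = ?A xs ys (fib_tenO zs vs) \<circ>\<^sub>f (?A (fib_tenO xs ys) zs vs \<circ>\<^sub>f (((a \<otimes>\<^sub>f b) \<otimes>\<^sub>f c) \<otimes>\<^sub>f d))"
    unfolding h by (rule fib_comp_assoc) auto
  also have "\<dots> = ?A xs ys (fib_tenO zs vs) \<circ>\<^sub>f (((a \<otimes>\<^sub>f b) \<otimes>\<^sub>f (c \<otimes>\<^sub>f d)) \<circ>\<^sub>f ?A (fib_tenO [x] [y]) [z] [v])"
    by (subst gen_assoc_naturalI[where xs' = "fib_tenO [x] [y]" and ys' = "[z]" and zs' = "[v]"]) auto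
  also have "\<dots> = ?T \<circ>\<^sub>f (?A [x] [y] (fib_tenO [z] [v]) \<circ>\<^sub>f ?A (fib_tenO [x] [y]) [z] [v])"
    by (rule comp_replace[OF gen_assoc_naturalI]) auto
  also have "\<dots> = ?T \<circ>\<^sub>f (((fib_ident [x] \<otimes>\<^sub>f ?A [y] [z] [v]) \<circ>\<^sub>f ?A [x] (fib_tenO [y] [z]) [v]) \<circ>\<^sub>f (?A [x] [y] [z] \<otimes>\<^sub>f fib_ident [v]))"
    using assms[of x y z v] by (simp add: pentagon_at_def)
  also have "\<dots> = ?T \<circ>\<^sub>f ((fib_ident [x] \<otimes>\<^sub>f ?A [y] [z] [v]) \<circ>\<^sub>f (?A [x] (fib_tenO [y] [z]) [v] \<circ>\<^sub>f (?A [x] [y] [z] \<otimes>\<^sub>f fib_ident [v])))"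
    by (subst fib_comp_assoc) auto
  also have "\<dots> = (fib_ident xs \<otimes>\<^sub>f ?A ys zs vs) \<circ>\<^sub>f ((a \<otimes>\<^sub>f ((b \<otimes>\<^sub>f c) \<otimes>\<^sub>f d)) \<circ>\<^sub>f (?A [x] (fib_tenO [y] [z]) [v] \<circ>\<^sub>f (?A [x] [y] [z] \<otimes>\<^sub>f fib_ident [v])))"
    using ten_comp_slide(2)[of "?A ys zs vs" "(b \<otimes>\<^sub>f c) \<otimes>\<^sub>f d" "b \<otimes>\<^sub>f (c \<otimes>\<^sub>f d)" "?A [y] [z] [v]" a]
      gen_assoc_naturalI[of b c d ys zs vs "[y]" "[z]" "[v]" F]
    by (intro comp_replace) auto
  also have "\<dots> = (fib_ident xs \<otimes>\<^sub>f ?A ys zs vs) \<circ>\<^sub>f (?A xs (fib_tenO ys zs) vs \<circ>\<^sub>f (((a \<otimes>\<^sub>f (b \<otimes>\<^sub>f c)) \<otimes>\<^sub>f d) \<circ>\<^sub>f (?A [x] [y] [z] \<otimes>\<^sub>f fib_ident [v])))"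
    by (rule arg_cong[OF comp_replace[OF gen_assoc_naturalI[symmetric]]]) auto
  also have "\<dots> = (fib_ident xs \<otimes>\<^sub>f ?A ys zs vs) \<circ>\<^sub>f (?A xs (fib_tenO ys zs) vs \<circ>\<^sub>f ((?A xs ys zs \<otimes>\<^sub>f fib_ident vs) \<circ>\<^sub>f h))"
    using ten_comp_slide(1)[of "?A xs ys zs" "(a \<otimes>\<^sub>f b) \<otimes>\<^sub>f c" "a \<otimes>\<^sub>f (b \<otimes>\<^sub>f c)" "?A [x] [y] [z]" d]
      gen_assoc_naturalI[of a b c xs ys zs "[x]" "[y]" "[z]" F]
    unfolding h by simp
  also have "\<dots> = ?R \<circ>\<^sub>f h" by (simp add: fib_comp_assoc h)
  finally show "?L \<circ>\<^sub>f h = ?R \<circ>\<^sub>f h" .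
qed auto

lemma gen_hexagon_right:
  assumes "\<And>x y z. hexagon_right_at F R x y z"
  shows "(gen_assoc F ys zs xs \<circ>\<^sub>f gen_braid R xs (fib_tenO ys zs)) \<circ>\<^sub>f gen_assoc F xs ys zs =
    ((fib_ident ys \<otimes>\<^sub>f gen_braid R xs zs) \<circ>\<^sub>f gen_assoc F ys xs zs) \<circ>\<^sub>f (gen_braid R xs ys \<otimes>\<^sub>f fib_ident zs)"
    (is "?L = ?R")
proof (rule generating_epi[OF generating_ten[OF generating_ten[OF generating_incs generating_incs] generating_incs]])
  fix h :: "'a fib_arr" assume "h \<in> {a \<otimes>\<^sub>f b |a b. a \<in> {a \<otimes>\<^sub>f b |a b. a \<in> incs xs \<and> b \<in> incs ys} \<and> b \<in> incs zs}"
  then obtain a b c x y z where h: "h = (a \<otimes>\<^sub>f b) \<otimes>\<^sub>f c"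
    and a [simp]: "farr a" "farr b" "farr c" "tgt a = xs" "tgt b = ys" "tgt c = zs"
      "src a = [x]" "src b = [y]" "src c = [z]"
    unfolding incs_def by blast
  let ?A = "gen_assoc F" and ?C = "gen_braid R"
  let ?T = "b \<otimes>\<^sub>f (c \<otimes>\<^sub>f a)"
  have "?L \<circ>\<^sub>f h = ?A ys zs xs \<circ>\<^sub>f (?C xs (fib_tenO ys zs) \<circ>\<^sub>f (?A xs ys zs \<circ>\<^sub>f ((a \<otimes>\<^sub>f b) \<otimes>\<^sub>f c)))"
    unfolding h by (simp add: fib_comp_assoc)
  also have "\<dots> = ?A ys zs xs \<circ>\<^sub>f (?C xs (fib_tenO ys zs) \<circ>\<^sub>f ((a \<otimes>\<^sub>f (b \<otimes>\<^sub>f c)) \<circ>\<^sub>f ?A [x] [y] [z]))"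
    by (subst gen_assoc_naturalI[of a b c xs ys zs "[x]" "[y]" "[z]"]) auto
  also have "\<dots> = ?A ys zs xs \<circ>\<^sub>f (((b \<otimes>\<^sub>f c) \<otimes>\<^sub>f a) \<circ>\<^sub>f (?C [x] (fib_tenO [y] [z]) \<circ>\<^sub>f ?A [x] [y] [z]))"
    by (rule arg_cong[OF comp_replace[OF gen_braid_naturalI]]) auto
  also have "\<dots> = ?T \<circ>\<^sub>f (?A [y] [z] [x] \<circ>\<^sub>f (?C [x] (fib_tenO [y] [z]) \<circ>\<^sub>f ?A [x] [y] [z]))"
    by (rule comp_replace[OF gen_assoc_naturalI]) auto
  also have "\<dots> = ?T \<circ>\<^sub>f ((?A [y] [z] [x] \<circ>\<^sub>f ?C [x] (fib_tenO [y] [z])) \<circ>\<^sub>f ?A [x] [y] [z])"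
    by (simp add: fib_comp_assoc)
  also have "\<dots> = ?T \<circ>\<^sub>f (((fib_ident [y] \<otimes>\<^sub>f ?C [x] [z]) \<circ>\<^sub>f ?A [y] [x] [z]) \<circ>\<^sub>f (?C [x] [y] \<otimes>\<^sub>f fib_ident [z]))"
    using assms[of x y z] by (simp add: hexagon_right_at_def)
  also have "\<dots> = ?T \<circ>\<^sub>f ((fib_ident [y] \<otimes>\<^sub>f ?C [x] [z]) \<circ>\<^sub>f (?A [y] [x] [z] \<circ>\<^sub>f (?C [x] [y] \<otimes>\<^sub>f fib_ident [z])))"
    by (simp add: fib_comp_assoc)
  also have "\<dots> = (fib_ident ys \<otimes>\<^sub>f ?C xs zs) \<circ>\<^sub>f ((b \<otimes>\<^sub>f (a \<otimes>\<^sub>f c)) \<circ>\<^sub>f (?A [y] [x] [z] \<circ>\<^sub>f (?C [x] [y] \<otimes>\<^sub>f fib_ident [z])))"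
    using ten_comp_slide(2)[of "?C xs zs" "a \<otimes>\<^sub>f c" "c \<otimes>\<^sub>f a" "?C [x] [z]" b] gen_braid_naturalI[of a c xs zs "[x]" "[z]" R]
    by (intro comp_replace) auto
  also have "\<dots> = (fib_ident ys \<otimes>\<^sub>f ?C xs zs) \<circ>\<^sub>f (?A ys xs zs \<circ>\<^sub>f (((b \<otimes>\<^sub>f a) \<otimes>\<^sub>f c) \<circ>\<^sub>f (?C [x] [y] \<otimes>\<^sub>f fib_ident [z])))"
    by (rule arg_cong[OF comp_replace[OF gen_assoc_naturalI[symmetric]]]) auto
  also have "\<dots> = (fib_ident ys \<otimes>\<^sub>f ?C xs zs) \<circ>\<^sub>f (?A ys xs zs \<circ>\<^sub>f ((?C xs ys \<otimes>\<^sub>f fib_ident zs) \<circ>\<^sub>f h))"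
    using ten_comp_slide(1)[of "?C xs ys" "a \<otimes>\<^sub>f b" "b \<otimes>\<^sub>f a" "?C [x] [y]" c] gen_braid_naturalI[of a b xs ys "[x]" "[y]" R]
    unfolding h by simp
  also have "\<dots> = ?R \<circ>\<^sub>f h" by (simp add: fib_comp_assoc h)
  finally show "?L \<circ>\<^sub>f h = ?R \<circ>\<^sub>f h" .
qed auto

text \<open>The argument is that of the other hexagon, with naturality of the inverse constraint as
  the hypothesis \<open>nat\<close>. It is supplied in \<open>fib_balanced\<close>, where
  \<open>gen_assoc_inv\<close> is known to invert a natural constraint.\<close>

lemma gen_hexagon_left:
  assumes "\<And>x y z. hexagon_left_at F' R x y z"
    and nat: "\<And>f g h xs ys zs xs' ys' zs'. farr f \<Longrightarrow> farr g \<Longrightarrow> farr h \<Longrightarrow> tgt f = xs \<Longrightarrow> tgt g = ys \<Longrightarrow> tgt h = zs \<Longrightarrow>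
      src f = xs' \<Longrightarrow> src g = ys' \<Longrightarrow> src h = zs' \<Longrightarrow>
      gen_assoc_inv F' xs ys zs \<circ>\<^sub>f (f \<otimes>\<^sub>f (g \<otimes>\<^sub>f h)) = ((f \<otimes>\<^sub>f g) \<otimes>\<^sub>f h) \<circ>\<^sub>f gen_assoc_inv F' xs' ys' zs'"
  shows "(gen_assoc_inv F' zs xs ys \<circ>\<^sub>f gen_braid R (fib_tenO xs ys) zs) \<circ>\<^sub>f gen_assoc_inv F' xs ys zs =
    ((gen_braid R xs zs \<otimes>\<^sub>f fib_ident ys) \<circ>\<^sub>f gen_assoc_inv F' xs zs ys) \<circ>\<^sub>f (fib_ident xs \<otimes>\<^sub>f gen_braid R ys zs)"
    (is "?L = ?R")
proof (rule generating_epi[OF generating_ten[OF generating_incs generating_ten[OF generating_incs generating_incs]]])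
  fix h :: "'a fib_arr" assume "h \<in> {a \<otimes>\<^sub>f b |a b. a \<in> incs xs \<and> b \<in> {a \<otimes>\<^sub>f b |a b. a \<in> incs ys \<and> b \<in> incs zs}}"
  then obtain a b c x y z where h: "h = a \<otimes>\<^sub>f (b \<otimes>\<^sub>f c)"
    and a [simp]: "farr a" "farr b" "farr c" "tgt a = xs" "tgt b = ys" "tgt c = zs"
      "src a = [x]" "src b = [y]" "src c = [z]"
    unfolding incs_def by blast
  let ?A = "gen_assoc_inv F'" and ?C = "gen_braid R"
  let ?T = "(c \<otimes>\<^sub>f a) \<otimes>\<^sub>f b"
  have "?L \<circ>\<^sub>f h = ?A zs xs ys \<circ>\<^sub>f (?C (fib_tenO xs ys) zs \<circ>\<^sub>f (?A xs ys zs \<circ>\<^sub>f (a \<otimes>\<^sub>f (b \<otimes>\<^sub>f c))))"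
    unfolding h by (simp add: fib_comp_assoc)
  also have "\<dots> = ?A zs xs ys \<circ>\<^sub>f (?C (fib_tenO xs ys) zs \<circ>\<^sub>f (((a \<otimes>\<^sub>f b) \<otimes>\<^sub>f c) \<circ>\<^sub>f ?A [x] [y] [z]))"
    by (subst nat[of a b c xs ys zs "[x]" "[y]" "[z]"]) auto
  also have "\<dots> = ?A zs xs ys \<circ>\<^sub>f ((c \<otimes>\<^sub>f (a \<otimes>\<^sub>f b)) \<circ>\<^sub>f (?C (fib_tenO [x] [y]) [z] \<circ>\<^sub>f ?A [x] [y] [z]))"
    by (rule arg_cong[OF comp_replace[OF gen_braid_naturalI]]) auto
  also have "\<dots> = ?T \<circ>\<^sub>f (?A [z] [x] [y] \<circ>\<^sub>f (?C (fib_tenO [x] [y]) [z] \<circ>\<^sub>f ?A [x] [y] [z]))"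
    by (rule comp_replace[OF nat]) auto
  also have "\<dots> = ?T \<circ>\<^sub>f ((?A [z] [x] [y] \<circ>\<^sub>f ?C (fib_tenO [x] [y]) [z]) \<circ>\<^sub>f ?A [x] [y] [z])"
    by (simp add: fib_comp_assoc)
  also have "\<dots> = ?T \<circ>\<^sub>f (((?C [x] [z] \<otimes>\<^sub>f fib_ident [y]) \<circ>\<^sub>f ?A [x] [z] [y]) \<circ>\<^sub>f (fib_ident [x] \<otimes>\<^sub>f ?C [y] [z]))"
    using assms(1)[of x y z] by (simp add: hexagon_left_at_def)
  also have "\<dots> = ?T \<circ>\<^sub>f ((?C [x] [z] \<otimes>\<^sub>f fib_ident [y]) \<circ>\<^sub>f (?A [x] [z] [y] \<circ>\<^sub>f (fib_ident [x] \<otimes>\<^sub>f ?C [y] [z])))"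
    by (simp add: fib_comp_assoc)
  also have "\<dots> = (?C xs zs \<otimes>\<^sub>f fib_ident ys) \<circ>\<^sub>f (((a \<otimes>\<^sub>f c) \<otimes>\<^sub>f b) \<circ>\<^sub>f (?A [x] [z] [y] \<circ>\<^sub>f (fib_ident [x] \<otimes>\<^sub>f ?C [y] [z])))"
    using ten_comp_slide(1)[of "?C xs zs" "a \<otimes>\<^sub>f c" "c \<otimes>\<^sub>f a" "?C [x] [z]" b] gen_braid_naturalI[of a c xs zs "[x]" "[z]" R]
    by (intro comp_replace) auto
  also have "\<dots> = (?C xs zs \<otimes>\<^sub>f fib_ident ys) \<circ>\<^sub>f (?A xs zs ys \<circ>\<^sub>f ((a \<otimes>\<^sub>f (c \<otimes>\<^sub>f b)) \<circ>\<^sub>f (fib_ident [x] \<otimes>\<^sub>f ?C [y] [z])))"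
    by (rule arg_cong[OF comp_replace[OF nat[symmetric]]]) auto
  also have "\<dots> = (?C xs zs \<otimes>\<^sub>f fib_ident ys) \<circ>\<^sub>f (?A xs zs ys \<circ>\<^sub>f ((fib_ident xs \<otimes>\<^sub>f ?C ys zs) \<circ>\<^sub>f h))"
    using ten_comp_slide(2)[of "?C ys zs" "b \<otimes>\<^sub>f c" "c \<otimes>\<^sub>f b" "?C [y] [z]" a] gen_braid_naturalI[of b c ys zs "[y]" "[z]" R]
    unfolding h by simp
  also have "\<dots> = ?R \<circ>\<^sub>f h" by (simp add: fib_comp_assoc h)
  finally show "?L \<circ>\<^sub>f h = ?R \<circ>\<^sub>f h" .
qed auto

lemma gen_twist_ten:
  assumes "\<And>x y. twist_at R T x y"
  shows "gen_twist T (fib_tenO xs ys) =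
    ((gen_twist T xs \<otimes>\<^sub>f gen_twist T ys) \<circ>\<^sub>f gen_braid R ys xs) \<circ>\<^sub>f gen_braid R xs ys" (is "?L = ?R")
proof (rule generating_epi[OF generating_ten[OF generating_incs generating_incs]])
  fix h :: "'a fib_arr" assume "h \<in> {a \<otimes>\<^sub>f b |a b. a \<in> incs xs \<and> b \<in> incs ys}"
  then obtain a b x y where h: "h = a \<otimes>\<^sub>f b"
    and a [simp]: "farr a" "farr b" "tgt a = xs" "tgt b = ys" "src a = [x]" "src b = [y]"
    unfolding incs_def by blast
  let ?C = "gen_braid R" and ?T = "gen_twist T"
  have "?L \<circ>\<^sub>f h = h \<circ>\<^sub>f ?T (fib_tenO [x] [y])"
    using gen_twist_natural[of h T] by (simp add: h)
  also have "\<dots> = h \<circ>\<^sub>f ((?T [x] \<otimes>\<^sub>f ?T [y]) \<circ>\<^sub>f (?C [y] [x] \<circ>\<^sub>f ?C [x] [y]))"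
    using assms[of x y] by (simp add: twist_at_def fib_comp_assoc)
  also have "\<dots> = (?T xs \<otimes>\<^sub>f ?T ys) \<circ>\<^sub>f (h \<circ>\<^sub>f (?C [y] [x] \<circ>\<^sub>f ?C [x] [y]))"
    unfolding h using gen_twist_natural[of a T] gen_twist_natural[of b T]
    by (intro comp_replace) (auto simp: fib_ten_comp[symmetric])
  also have "\<dots> = (?T xs \<otimes>\<^sub>f ?T ys) \<circ>\<^sub>f (?C ys xs \<circ>\<^sub>f ((b \<otimes>\<^sub>f a) \<circ>\<^sub>f ?C [x] [y]))"
    unfolding h by (rule arg_cong[OF comp_replace[OF gen_braid_naturalI[symmetric]]]) auto
  also have "\<dots> = (?T xs \<otimes>\<^sub>f ?T ys) \<circ>\<^sub>f (?C ys xs \<circ>\<^sub>f (?C xs ys \<circ>\<^sub>f h))"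
    unfolding h by (subst gen_braid_naturalI[of a b xs ys "[x]" "[y]" R]) auto
  also have "\<dots> = ?R \<circ>\<^sub>f h" by (simp add: fib_comp_assoc h)
  finally show "?L \<circ>\<^sub>f h = ?R \<circ>\<^sub>f h" .
qed auto

lemma fuse_One [simp]: "fuse x One = [x]"
  by (cases x) auto

lemma ten_basis_One:
  "ten_basis xs [One] = map (\<lambda>i. (i, 0, xs ! i)) [0..<length xs]"
  "ten_basis [One] xs = map (\<lambda>i. (0, i, xs ! i)) [0..<length xs]"
  by (simp_all add: ten_basis_def)

lemma fib_tenO_One [simp]: "fib_tenO xs [One] = xs" "fib_tenO [One] xs = xs"
  by (simp_all add: fib_tenO_def ten_basis_One comp_def map_nth)

lemma fib_tenA_One:
  assumes "farr f" shows "f \<otimes>\<^sub>f fib_ident [One] = f" "fib_ident [One] \<otimes>\<^sub>f f = f"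
  by (rule farr_eqI; use assms in \<open>simp add: entry_tenA ten_basis_One\<close>)+

lemma generating_One: "generating {fib_ident [One]} [One]"
proof -
  have e: "fib_ident [One] \<circ>\<^sub>f fib_ident [One] = fib_ident [One]"
    using fib_comp_ident(1)[of "fib_ident [One]"] by simp
  have "fib_inc [One] 0 = fib_ident [One] \<circ>\<^sub>f fib_ident [One]"
    unfolding e by (rule farr_eqI) (auto simp: entry_fib_inc)
  then show ?thesis by (auto simp: generating_def intro!: exI[of _ "fib_ident [One]"])
qed

text \<open>The unit list is strict, so the triangle amounts to this constraint being an identity.
  The identity of \<open>[One]\<close> alone generates \<open>[One]\<close>, so only the outer
  factors have to be tested.\<close>

lemma gen_triangle:
  assumes "\<And>x z w t s. F x One z w t s = 1"
  shows "gen_assoc F xs [One] zs = fib_ident (fib_tenO xs zs)"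
proof -
  have "gen_assoc F xs [One] zs = fib_ident (fib_tenO (fib_tenO xs [One]) zs)" (is "?L = ?R")
  proof (rule generating_epi[OF generating_ten[OF generating_ten[OF generating_incs generating_One] generating_incs]])
    fix h :: "'a fib_arr" assume "h \<in> {a \<otimes>\<^sub>f b |a b. a \<in> {a \<otimes>\<^sub>f b |a b. a \<in> incs xs \<and> b \<in> {fib_ident [One]}} \<and> b \<in> incs zs}"
    then obtain a c x z where h: "h = (a \<otimes>\<^sub>f fib_ident [One]) \<otimes>\<^sub>f c"
      and a [simp]: "farr a" "farr c" "tgt a = xs" "tgt c = zs" "src a = [x]" "src c = [z]"
      unfolding incs_def by blast
    have s: "gen_assoc F [x] [One] [z] = fib_ident (fib_tenO [x] [z])"
      by (cases x; cases z; simp add: matrix_eval assms)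
    have "a \<otimes>\<^sub>f (fib_ident [One] \<otimes>\<^sub>f c) = h" by (simp add: h fib_tenA_One)
    then show "?L \<circ>\<^sub>f h = ?R \<circ>\<^sub>f h" using fib_comp_ident[of h] gen_assoc_naturalI[of a "fib_ident [One]" c xs "[One]" zs "[x]" "[One]" "[z]" F]
      by (simp add: h s)
  qed auto
  then show ?thesis by simp
qed

section \<open>The balanced category of block matrices\<close>

lemma sum_Collect_fib: "(\<Sum>s | P s. \<phi> s) = (if P One then \<phi> One else 0) + (if P Tau then \<phi> Tau else 0 :: 'a::comm_monoid_add)"
proof -
  have u: "finite (UNIV :: fib set)" "(UNIV :: fib set) = {One, Tau}" using fib.exhaust by (auto intro: finite_subset[of _ "{One, Tau}"])
  have "(\<Sum>s | P s. \<phi> s) = (\<Sum>s\<in>UNIV. if P s then \<phi> s else 0)"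
    using sum.inter_filter[OF u(1), of \<phi> P] by simp
  then show ?thesis by (simp add: u(2))
qed

text \<open>On the channel \<open>X\<close> the coefficients form the matrix with rows
  \<open>(a, 1)\<close> and \<open>(-a, -a)\<close>, whose square is \<open>a*a - a = 1\<close>
  times the identity. So the same coefficients describe the inverse constraint.\<close>

lemma fib_F_square:
  assumes "a * a = a + (1::'k::field)"
  shows "t \<in> set (fuse y z) \<Longrightarrow> w \<in> set (fuse x t) \<Longrightarrow> t' \<in> set (fuse y z) \<Longrightarrow> w \<in> set (fuse x t') \<Longrightarrow>
      (\<Sum>s | s \<in> set (fuse x y) \<and> w \<in> set (fuse s z). fib_F a x y z w t s * fib_F a x y z w s t') = (if t = t' then 1 else 0)"
    and "s \<in> set (fuse x y) \<Longrightarrow> w \<in> set (fuse s z) \<Longrightarrow> s' \<in> set (fuse x y) \<Longrightarrow> w \<in> set (fuse s' z) \<Longrightarrow>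
      (\<Sum>t | t \<in> set (fuse y z) \<and> w \<in> set (fuse x t). fib_F a x y z w s t * fib_F a x y z w t s') = (if s = s' then 1 else 0)"
proof -
  have d: "a * a - a = 1" using assms by simp
  show "t \<in> set (fuse y z) \<Longrightarrow> w \<in> set (fuse x t) \<Longrightarrow> t' \<in> set (fuse y z) \<Longrightarrow> w \<in> set (fuse x t') \<Longrightarrow>
      (\<Sum>s | s \<in> set (fuse x y) \<and> w \<in> set (fuse s z). fib_F a x y z w t s * fib_F a x y z w s t') = (if t = t' then 1 else 0)"
    and "s \<in> set (fuse x y) \<Longrightarrow> w \<in> set (fuse s z) \<Longrightarrow> s' \<in> set (fuse x y) \<Longrightarrow> w \<in> set (fuse s' z) \<Longrightarrow>
      (\<Sum>t | t \<in> set (fuse y z) \<and> w \<in> set (fuse x t). fib_F a x y z w s t * fib_F a x y z w t s') = (if s = s' then 1 else 0)"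
  unfolding sum_Collect_fib
  by (cases x; cases y; cases z; cases w; cases t; cases t'; simp add: fib_F_def d)
    (cases x; cases y; cases z; cases w; cases s; cases s'; simp add: fib_F_def d)
qed

lemma fib_monoidal:
  assumes "u \<noteq> 0" "(u + inverse u) * (u + inverse u) = (u + inverse u) + (1::'k::field)"
  shows "monoidal_category (fib_cat u)"
proof -
  interpret linear_category "fib_cat u" by (rule fib_linear)
  show ?thesis
  proof unfold_locales
    fix A B D :: "fib list"
    show "iso_arr (fib_cat u) (Assoc (fib_cat u) A B D)"
      unfolding iso_arr_def
      by (rule exI[of _ "gen_assoc_inv (fib_F (u + inverse u)) A B D"])
        (simp add: inverse_arrs_def hom_fib_cat fib_assoc_gen gen_assoc_inverse gen_assoc_inverse' fib_F_square assms(2))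
  next
    fix A B D E :: "fib list"
    show "Assoc (fib_cat u) A B (D \<odot>\<^bsub>fib_cat u\<^esub> E) \<cdot>\<^bsub>fib_cat u\<^esub> Assoc (fib_cat u) (A \<odot>\<^bsub>fib_cat u\<^esub> B) D E =
       (Ident (fib_cat u) A \<otimes>\<^bsub>fib_cat u\<^esub> Assoc (fib_cat u) B D E) \<cdot>\<^bsub>fib_cat u\<^esub> Assoc (fib_cat u) A (B \<odot>\<^bsub>fib_cat u\<^esub> D) E \<cdot>\<^bsub>fib_cat u\<^esub>
         (Assoc (fib_cat u) A B D \<otimes>\<^bsub>fib_cat u\<^esub> Ident (fib_cat u) E)"
      using gen_pentagon[OF pentagon_at_fib[OF assms(2)], of A B D E] by (simp add: fib_assoc_gen)
  next
    fix A B :: "fib list"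
    have "inverse_arrs (fib_cat u) (fib_ident A) (fib_ident A)" for A
      using fib_comp_ident[of "fib_ident A"] by (auto simp: inverse_arrs_def hom_fib_cat)
    then show "iso_arr (fib_cat u) (LUnit (fib_cat u) A)" "iso_arr (fib_cat u) (RUnit (fib_cat u) A)"
      by (auto simp: iso_arr_def)
    have "gen_assoc (fib_F (u + inverse u)) A [One] B = fib_ident (fib_tenO A B)"
      by (rule gen_triangle) (simp add: fib_F_def)
    then show "(Ident (fib_cat u) A \<otimes>\<^bsub>fib_cat u\<^esub> LUnit (fib_cat u) B) \<cdot>\<^bsub>fib_cat u\<^esub> Assoc (fib_cat u) A (Unit (fib_cat u)) B =
        RUnit (fib_cat u) A \<otimes>\<^bsub>fib_cat u\<^esub> Ident (fib_cat u) B"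
      using fib_comp_ident[of "fib_ident (fib_tenO A B)"] by (simp add: fib_assoc_gen fib_ten_ident)
  next
    fix f g h :: "'k fib_arr" and A A' B B' D D'
    assume "f \<in> hom (fib_cat u) A A'" "g \<in> hom (fib_cat u) B B'" "h \<in> hom (fib_cat u) D D'"
    then show "Assoc (fib_cat u) A' B' D' \<cdot>\<^bsub>fib_cat u\<^esub> (f \<otimes>\<^bsub>fib_cat u\<^esub> g \<otimes>\<^bsub>fib_cat u\<^esub> h) =
        (f \<otimes>\<^bsub>fib_cat u\<^esub> (g \<otimes>\<^bsub>fib_cat u\<^esub> h)) \<cdot>\<^bsub>fib_cat u\<^esub> Assoc (fib_cat u) A B D"
      using gen_assoc_natural[of f g h "fib_F (u + inverse u)"] by (simp add: hom_fib_cat fib_assoc_gen)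
  qed (auto simp: hom_fib_cat fib_ten_comp fib_ten_ident fib_assoc_gen fib_tenA_One fib_comp_ident
      entry_tenA ten_entry_linear intro!: farr_eqI)
qed

lemma fib_balanced:
  assumes u: "u \<noteq> 0" "(u + inverse u) * (u + inverse u) = (u + inverse u) + (1::'k::field)"
  shows "balanced_category (fib_cat u)"
proof -
  interpret monoidal_category "fib_cat u" by (rule fib_monoidal[OF assms])
  let ?C = "fib_cat u" and ?F = "fib_F (u + inverse u)" and ?A = "gen_assoc (fib_F (u + inverse u))"
    and ?A' = "gen_assoc_inv (fib_F (u + inverse u))"
  have inv: "inverse_arrs ?C (?A A B D) (?A' A B D)" for A B D
    by (simp add: inverse_arrs_def hom_fib_cat gen_assoc_inverse gen_assoc_inverse' fib_F_square u(2))
  have inv': "inv_arr ?C (fib_assoc u A B D) = ?A' A B D" for A B D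
    using inv_arr_eqI[OF inv] by (simp add: fib_assoc_gen)
  \<comment> \<open>Naturality of the inverse: compose the naturality square of \<open>?A\<close>
    with inverses at both ends.\<close>
  have nat: "?A' xs ys zs \<circ>\<^sub>f (f \<otimes>\<^sub>f (g \<otimes>\<^sub>f h)) = ((f \<otimes>\<^sub>f g) \<otimes>\<^sub>f h) \<circ>\<^sub>f ?A' xs' ys' zs'"
    if [simp]: "farr f" "farr g" "farr h" "tgt f = xs" "tgt g = ys" "tgt h = zs" "src f = xs'" "src g = ys'" "src h = zs'"
    for f g h :: "'k fib_arr" and xs ys zs xs' ys' zs'
  proof -
    have i1: "?A xs' ys' zs' \<circ>\<^sub>f ?A' xs' ys' zs' = fib_ident (fib_tenO xs' (fib_tenO ys' zs'))"
     and i2: "?A' xs ys zs \<circ>\<^sub>f ?A xs ys zs = fib_ident (fib_tenO (fib_tenO xs ys) zs)"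
      using inv[of xs' ys' zs'] inv[of xs ys zs] by (simp_all add: inverse_arrs_def)
    have "?A' xs ys zs \<circ>\<^sub>f (f \<otimes>\<^sub>f (g \<otimes>\<^sub>f h)) = ?A' xs ys zs \<circ>\<^sub>f ((f \<otimes>\<^sub>f (g \<otimes>\<^sub>f h)) \<circ>\<^sub>f (?A xs' ys' zs' \<circ>\<^sub>f ?A' xs' ys' zs'))"
      using fib_comp_ident(2)[of "f \<otimes>\<^sub>f (g \<otimes>\<^sub>f h)"] by (simp add: i1)
    also have "\<dots> = ?A' xs ys zs \<circ>\<^sub>f (?A xs ys zs \<circ>\<^sub>f (((f \<otimes>\<^sub>f g) \<otimes>\<^sub>f h) \<circ>\<^sub>f ?A' xs' ys' zs'))"
      by (rule arg_cong[OF comp_replace[OF gen_assoc_naturalI[symmetric]]]) auto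
    also have "\<dots> = (?A' xs ys zs \<circ>\<^sub>f ?A xs ys zs) \<circ>\<^sub>f (((f \<otimes>\<^sub>f g) \<otimes>\<^sub>f h) \<circ>\<^sub>f ?A' xs' ys' zs')"
      by (rule fib_comp_assoc[symmetric]) auto
    also have "\<dots> = ((f \<otimes>\<^sub>f g) \<otimes>\<^sub>f h) \<circ>\<^sub>f ?A' xs' ys' zs'"
      using fib_comp_ident(1)[of "((f \<otimes>\<^sub>f g) \<otimes>\<^sub>f h) \<circ>\<^sub>f ?A' xs' ys' zs'"] by (simp add: i2)
    finally show ?thesis .
  qed
  have R: "inverse (fib_R u y x z) * fib_R u x y z = 1" "fib_R u x y z * inverse (fib_R u y x z) = 1" for x y z
    using u by (cases x; cases y; cases z; simp add: fib_R_def)+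
  show ?thesis
  proof unfold_locales
    fix A B :: "fib list"
    show "iso_arr ?C (Braid ?C A B)"
      unfolding iso_arr_def
      by (rule exI[of _ "gen_braid (\<lambda>x y z. inverse (fib_R u x y z)) B A"])
        (simp add: inverse_arrs_def hom_fib_cat fib_braid_gen gen_braid_inverse R)
    show "Twist ?C (A \<odot>\<^bsub>?C\<^esub> B) = (Twist ?C A \<otimes>\<^bsub>?C\<^esub> Twist ?C B) \<cdot>\<^bsub>?C\<^esub> Braid ?C B A \<cdot>\<^bsub>?C\<^esub> Braid ?C A B"
      using gen_twist_ten[OF twist_at_fib[OF u(1)], of A B] by (simp add: fib_twist_gen fib_braid_gen)
  next
    fix A B D :: "fib list"
    show "Assoc ?C B D A \<cdot>\<^bsub>?C\<^esub> Braid ?C A (B \<odot>\<^bsub>?C\<^esub> D) \<cdot>\<^bsub>?C\<^esub> Assoc ?C A B D =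
      (Ident ?C B \<otimes>\<^bsub>?C\<^esub> Braid ?C A D) \<cdot>\<^bsub>?C\<^esub> Assoc ?C B A D \<cdot>\<^bsub>?C\<^esub> (Braid ?C A B \<otimes>\<^bsub>?C\<^esub> Ident ?C D)"
      using gen_hexagon_right[OF hexagon_right_at_fib[OF u], of B D A] by (simp add: fib_assoc_gen fib_braid_gen)
    show "inv_arr ?C (Assoc ?C D A B) \<cdot>\<^bsub>?C\<^esub> Braid ?C (A \<odot>\<^bsub>?C\<^esub> B) D \<cdot>\<^bsub>?C\<^esub> inv_arr ?C (Assoc ?C A B D) =
      (Braid ?C A D \<otimes>\<^bsub>?C\<^esub> Ident ?C B) \<cdot>\<^bsub>?C\<^esub> inv_arr ?C (Assoc ?C A D B) \<cdot>\<^bsub>?C\<^esub> (Ident ?C A \<otimes>\<^bsub>?C\<^esub> Braid ?C B D)"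
      unfolding fib_cat_sel inv' fib_braid_gen
      by (rule gen_hexagon_left[OF hexagon_left_at_fib[OF u]]) (rule nat)
  next
    fix f g :: "'k fib_arr" and A A' B B'
    assume "f \<in> hom ?C A A'" "g \<in> hom ?C B B'"
    then show "Braid ?C A' B' \<cdot>\<^bsub>?C\<^esub> (f \<otimes>\<^bsub>?C\<^esub> g) = (g \<otimes>\<^bsub>?C\<^esub> f) \<cdot>\<^bsub>?C\<^esub> Braid ?C A B"
      using gen_braid_natural[of f g "fib_R u"] by (simp add: hom_fib_cat fib_braid_gen)
  next
    fix A :: "fib list"
    let ?T = "\<lambda>x. case x of One \<Rightarrow> 1 | Tau \<Rightarrow> inverse (u ^ 2)"
    let ?T' = "\<lambda>x. case x of One \<Rightarrow> 1 | Tau \<Rightarrow> u ^ 2"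
    have *: "?T x * ?T' x = 1" "?T' x * ?T x = 1" for x using u by (cases x; simp)+
    have "gen_twist ?T A \<circ>\<^sub>f gen_twist ?T' A = fib_ident A" "gen_twist ?T' A \<circ>\<^sub>f gen_twist ?T A = fib_ident A"
      using entry_comp_gen_twist(2)[of "gen_twist ?T' A" ?T] entry_comp_gen_twist(2)[of "gen_twist ?T A" ?T'] *
      by (auto intro!: farr_eqI simp: gen_twist_def)
    then show "iso_arr ?C (Twist ?C A)"
      unfolding iso_arr_def
      by (intro exI[of _ "gen_twist ?T' A"]) (simp add: inverse_arrs_def hom_fib_cat fib_twist_gen)
  next
    fix f :: "'k fib_arr" and A B assume "f \<in> hom ?C A B"
    then show "Twist ?C B \<cdot>\<^bsub>?C\<^esub> f = f \<cdot>\<^bsub>?C\<^esub> Twist ?C A"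
      using gen_twist_natural[of f] by (auto simp: hom_fib_cat fib_twist_gen)
  next
    show "Twist ?C (Unit ?C) = Ident ?C (Unit ?C)"
      by (intro farr_eqI) (auto simp: fib_twist_gen gen_twist_def)
  qed (auto simp: hom_fib_cat fib_braid_gen fib_twist_gen)
qed

lemma fib_fibonacci:
  assumes "u \<noteq> 0" "(u + inverse u) * (u + inverse u) = (u + inverse u) + (1::'k::field)"
  shows "fibonacci_category (fib_cat u)"
proof -
  interpret monoidal_category "fib_cat u" by (rule fib_monoidal[OF assms])
  interpret semisimple_category "fib_cat u" by (rule fib_semisimple)
  interpret simple_system_sums "fib_cat u" fib_simple by (rule fib_simple_system_sums)
  show ?thesis
  proof unfold_locales
    show "simple (fib_cat u) (Unit (fib_cat u))" using simple_S[of One] by simp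
    have "iso_obj (fib_cat u) S [One] \<or> iso_obj (fib_cat u) S [Tau]" if "simple (fib_cat u) S" for S
      using simple_iso_S[OF that] by (metis fib.exhaust)
    moreover have "fib_tenO [Tau] [Tau] = [One, Tau]" by (simp add: fib_tenO_eval ten_basis_eval)
    ultimately show "\<exists>X. simple (fib_cat u) X \<and> \<not> iso_obj (fib_cat u) X (Unit (fib_cat u)) \<and>
      (\<forall>S. simple (fib_cat u) S \<longrightarrow> iso_obj (fib_cat u) S (Unit (fib_cat u)) \<or> iso_obj (fib_cat u) S X) \<and>
      (\<exists>P. biproduct (fib_cat u) P (Unit (fib_cat u)) X \<and> iso_obj (fib_cat u) (X \<odot>\<^bsub>fib_cat u\<^esub> X) P)"
      using simple_S[of Tau] S_not_iso[of Tau One] fib_biproduct[of u "[One]" "[Tau]"] iso_obj_refl[of "[One, Tau]"]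
      by (intro exI[of _ "[Tau]"]) auto
  qed
qed

section \<open>Schur's lemma and decompositions in a Fibonacci category\<close>

context monoidal_category
begin

lemma ten_obj_arr [simp]: "A \<in> Obj C \<Longrightarrow> B \<in> Obj C \<Longrightarrow> A \<odot> B \<in> Obj C"
  by (rule ten_obj)

lemma ten_arr [simp]:
  assumes "f \<in> Arr C" "g \<in> Arr C"
  shows "f \<otimes> g \<in> Arr C" "Dom C (f \<otimes> g) = Dom C f \<odot> Dom C g" "Cod C (f \<otimes> g) = Cod C f \<odot> Cod C g"
  using ten_hom[of f "Dom C f" "Cod C f" g "Dom C g" "Cod C g"] assms by (auto simp: hom_def)

lemma ten_ident_arr [simp]: "A \<in> Obj C \<Longrightarrow> B \<in> Obj C \<Longrightarrow> Ident C A \<otimes> Ident C B = Ident C (A \<odot> B)"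
  by (rule ten_ident)

text \<open>The interchange law read so that composites of tensor products are merged. The primed
  variant does the same in front of a tail, as needed for composites nested to the right.\<close>

lemma ten_comp_arr:
  assumes "f \<in> Arr C" "f' \<in> Arr C" "g \<in> Arr C" "g' \<in> Arr C" "Cod C f = Dom C f'" "Cod C g = Dom C g'"
  shows "(f' \<otimes> g') \<cdot> (f \<otimes> g) = (f' \<cdot> f) \<otimes> (g' \<cdot> g)"
  using ten_comp[of f "Dom C f" "Cod C f" f' "Cod C f'" g "Dom C g" "Cod C g" g' "Cod C g'"] assms by (auto simp: hom_def)

lemma ten_comp_arr':
  assumes "f \<in> Arr C" "f' \<in> Arr C" "g \<in> Arr C" "g' \<in> Arr C" "Cod C f = Dom C f'" "Cod C g = Dom C g'"
    and "h \<in> Arr C" "Cod C h = Dom C f \<odot> Dom C g"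
  shows "(f' \<otimes> g') \<cdot> ((f \<otimes> g) \<cdot> h) = ((f' \<cdot> f) \<otimes> (g' \<cdot> g)) \<cdot> h"
  using comp_cancel[OF ten_comp_arr[OF assms(1-6)], of h] assms by simp

lemma ten_smult_arr [simp]:
  assumes "f \<in> Arr C" "g \<in> Arr C"
  shows "(r \<bullet> f) \<otimes> g = r \<bullet> (f \<otimes> g)" "f \<otimes> (r \<bullet> g) = r \<bullet> (f \<otimes> g)"
  using ten_smult_left[of f "Dom C f" "Cod C f" g "Dom C g" "Cod C g"]
    ten_smult_right[of f "Dom C f" "Cod C f" g "Dom C g" "Cod C g"] assms by (auto simp: hom_def)

lemma ten_zero_arr [simp]:
  assumes "A \<in> Obj C" "B \<in> Obj C" "g \<in> Arr C"
  shows "Zero C A B \<otimes> g = Zero C (A \<odot> Dom C g) (B \<odot> Cod C g)"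
    "g \<otimes> Zero C A B = Zero C (Dom C g \<odot> A) (Cod C g \<odot> B)"
  using ten_smult_arr[of "Zero C A B" g 0] ten_smult_arr[of g "Zero C A B" 0] assms by auto

lemma ten_add_arr:
  assumes "f \<in> Arr C" "f' \<in> Arr C" "Dom C f = Dom C f'" "Cod C f = Cod C f'" "g \<in> Arr C"
  shows "(f \<oplus> f') \<otimes> g = (f \<otimes> g) \<oplus> (f' \<otimes> g)" "g \<otimes> (f \<oplus> f') = (g \<otimes> f) \<oplus> (g \<otimes> f')"
  using ten_add_left[of f "Dom C f" "Cod C f" f' g "Dom C g" "Cod C g"]
    ten_add_right[of g "Dom C g" "Cod C g" f "Dom C f" "Cod C f" f'] assms by (auto simp: hom_def)

lemma unit_obj_arr [simp]: "Unit C \<in> Obj C"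
  by (rule unit_obj)

lemma assoc_arr [simp]:
  assumes "A \<in> Obj C" "B \<in> Obj C" "D \<in> Obj C"
  shows "Assoc C A B D \<in> Arr C" "Dom C (Assoc C A B D) = A \<odot> B \<odot> D" "Cod C (Assoc C A B D) = A \<odot> (B \<odot> D)"
  using assoc_hom[OF assms] by (auto simp: hom_def)

lemma assoc_nat:
  assumes "f \<in> Arr C" "g \<in> Arr C" "h \<in> Arr C" "Cod C f = A" "Cod C g = B" "Cod C h = D"
  shows "Assoc C A B D \<cdot> (f \<otimes> g \<otimes> h) = (f \<otimes> (g \<otimes> h)) \<cdot> Assoc C (Dom C f) (Dom C g) (Dom C h)"
  using assoc_natural[of f "Dom C f" "Cod C f" g "Dom C g" "Cod C g" h "Dom C h" "Cod C h"] assms by (auto simp: hom_def)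

lemma unit_arr [simp]:
  assumes "A \<in> Obj C"
  shows "LUnit C A \<in> Arr C" "Dom C (LUnit C A) = Unit C \<odot> A" "Cod C (LUnit C A) = A"
    "RUnit C A \<in> Arr C" "Dom C (RUnit C A) = A \<odot> Unit C" "Cod C (RUnit C A) = A"
  using lunit_hom[OF assms] runit_hom[OF assms] by (auto simp: hom_def)

lemma unit_nat:
  assumes "f \<in> Arr C" "Dom C f = A" "Cod C f = B"
  shows "LUnit C B \<cdot> (Ident C (Unit C) \<otimes> f) = f \<cdot> LUnit C A" "RUnit C B \<cdot> (f \<otimes> Ident C (Unit C)) = f \<cdot> RUnit C A"
  using lunit_natural[of f A B] runit_natural[of f A B] assms by (auto simp: hom_def)

end

section \<open>Schur's lemma\<close>

context abelian_category
begin

lemma kernel_monic: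
  assumes "is_kernel C k f" shows "monic C k"
proof -
  have k: "f \<in> Arr C" "k \<in> Arr C" "Cod C k = Dom C f" "f \<cdot> k = Zero C (Dom C k) (Cod C f)"
    and u: "\<And>A h. h \<in> hom C A (Dom C f) \<Longrightarrow> f \<cdot> h = Zero C A (Cod C f) \<Longrightarrow> \<exists>!h'. h' \<in> hom C A (Dom C k) \<and> k \<cdot> h' = h"
    using assms unfolding is_kernel_def by blast+
  have "g = h" if gh: "g \<in> hom C A (Dom C k)" "h \<in> hom C A (Dom C k)" "k \<cdot> g = k \<cdot> h" for A g h
  proof -
    have "f \<cdot> (k \<cdot> g) = Zero C A (Cod C f)" using comp_cancel[OF k(4), of g] gh k by (auto simp: hom_def)
    moreover have "k \<cdot> g \<in> hom C A (Dom C f)" using gh k by (auto simp: hom_def)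
    ultimately show ?thesis using u[of "k \<cdot> g" A] gh by metis
  qed
  then show ?thesis using k by (auto simp: monic_def)
qed

text \<open>The kernel of \<open>f\<close> is a mono into \<open>S\<close>. It is not invertible,
  since \<open>f\<close> is nonzero, so its source is zero and \<open>f\<close> is monic; a mono
  from a nonzero object into a simple one is invertible.\<close>

lemma simple_arr_iso:
  assumes S: "simple C S" and T: "simple C T" and f: "f \<in> hom C S T" and nz: "f \<noteq> Zero C S T"
  shows "iso_arr C f"
proof -
  have [simp]: "f \<in> Arr C" "Dom C f = S" "Cod C f = T" "S \<in> Obj C" "T \<in> Obj C" using f S T by (auto simp: hom_def simple_def)
  obtain k where k: "is_kernel C k f" using ex_kernel[of f] by auto
  then have [simp]: "k \<in> Arr C" "Cod C k = S" and fk: "f \<cdot> k = Zero C (Dom C k) T" by (auto simp: is_kernel_def)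
  have "\<not> iso_arr C k"
  proof
    assume "iso_arr C k"
    then have "f = (f \<cdot> k) \<cdot> inv_arr C k" using inv_arr[of k] by simp
    also have "\<dots> = Zero C S T" unfolding fk using inv_arr[OF \<open>iso_arr C k\<close>] by simp
    finally show False using nz by simp
  qed
  then have z: "zero_obj C (Dom C k)" using S kernel_monic[OF k] by (auto simp: simple_def)
  have "g = h" if "g \<in> hom C A S" "h \<in> hom C A S" "f \<cdot> g = f \<cdot> h" for A g h
  proof -
    have [simp]: "g \<in> Arr C" "h \<in> Arr C" "Dom C g = A" "Dom C h = A" "Cod C g = S" "Cod C h = S"
      using that by (auto simp: hom_def)
    have [simp]: "A \<in> Obj C" using hom_obj that by blast
    have "f \<cdot> (g \<oplus> (- 1) \<bullet> h) = Zero C A T" using that(3) by simp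
    moreover have "g \<oplus> (- 1) \<bullet> h \<in> hom C A S" by (simp add: hom_def)
    ultimately obtain h' where h': "h' \<in> hom C A (Dom C k)" "k \<cdot> h' = g \<oplus> (- 1) \<bullet> h"
      using k unfolding is_kernel_def by (metis \<open>Cod C f = T\<close> \<open>Dom C f = S\<close>)
    have "h' = Zero C A (Dom C k)" using zero_objD(3)[OF z h'(1)] .
    then have "g \<oplus> (- 1) \<bullet> h = Zero C A S" using h' by simp
    then show ?thesis by (intro add_minus_eq[of g h]) auto
  qed
  then have "monic C f" by (auto simp: monic_def)
  then show ?thesis using T S by (auto simp: simple_def)
qed

end

text \<open>A homogeneous linear system with more unknowns than equations has a nonzero solution;
  Gaussian elimination by induction on the equations.\<close>

lemma underdetermined_system:
  fixes M :: "'i \<Rightarrow> 'j \<Rightarrow> 'k::field"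
  assumes "finite I" "finite J" "card I < card J"
  shows "\<exists>v. (\<exists>j\<in>J. v j \<noteq> 0) \<and> (\<forall>i\<in>I. (\<Sum>j\<in>J. M i j * v j) = 0)"
  using assms
proof (induction I arbitrary: J M rule: finite_induct)
  case empty
  then have "J \<noteq> {}" by auto
  then show ?case by (intro exI[of _ "\<lambda>_. 1"]) auto
next
  case (insert i I)
  show ?case
  proof (cases "\<forall>j\<in>J. M i j = 0")
    case True
    have "card I < card J" using insert by simp
    then obtain v where "\<exists>j\<in>J. v j \<noteq> 0" "\<forall>i\<in>I. (\<Sum>j\<in>J. M i j * v j) = 0" using insert.IH[of J M] insert.prems by blast
    then show ?thesis using True by (intro exI[of _ v]) auto
  next
    case False
    then obtain m where m: "m \<in> J" "M i m \<noteq> 0" by blast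
    \<comment> \<open>Equation \<open>i\<close> is solved for the unknown \<open>m\<close>, whose
      coefficient is the pivot, and substituted into the other equations. Afterwards the value of
      \<open>v'\<close> at \<open>m\<close> is the one that satisfies equation
      \<open>i\<close>.\<close>
    define M' where "M' a j = M a j - M a m * M i j / M i m" for a j
    have "card I < card (J - {m})" using insert m by (simp add: card_Diff_singleton)
    then obtain v where v: "\<exists>j\<in>J - {m}. v j \<noteq> 0" "\<forall>i\<in>I. (\<Sum>j\<in>J - {m}. M' i j * v j) = 0"
      using insert.IH[of "J - {m}" M'] insert.prems by auto
    define s where "s = (\<Sum>j\<in>J - {m}. M i j * v j)"
    define v' where "v' = v(m := - s / M i m)"
    have sum: "(\<Sum>j\<in>J. M a j * v' j) = M a m * (- s / M i m) + (\<Sum>j\<in>J - {m}. M a j * v j)" for a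
      using insert.prems m by (simp add: sum.remove[of J m] v'_def)
    have "(\<Sum>j\<in>J. M i j * v' j) = 0" unfolding sum using m by (simp add: s_def)
    moreover have "(\<Sum>j\<in>J. M a j * v' j) = 0" if "a \<in> I" for a
    proof -
      have "0 = (\<Sum>j\<in>J - {m}. M a j * v j - M a m * M i j / M i m * v j)"
        using v(2) that by (simp add: M'_def left_diff_distrib)
      also have "\<dots> = (\<Sum>j\<in>J - {m}. M a j * v j) - M a m / M i m * s"
        by (simp add: sum_subtractf s_def sum_distrib_left mult_ac)
      finally show ?thesis unfolding sum by simp
    qed
    moreover have "\<exists>j\<in>J. v' j \<noteq> 0" using v(1) by (auto simp: v'_def)
    ultimately show ?thesis by (intro exI[of _ v']) auto
  qed
qed

context linear_category
begin

lemma osum_add: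
  assumes "A \<in> Obj C" "B \<in> Obj C" "\<And>i. i < n \<Longrightarrow> f i \<in> hom C A B" "\<And>i. i < n \<Longrightarrow> g i \<in> hom C A B"
  shows "osum A B f n \<oplus> osum A B g n = osum A B (\<lambda>i. f i \<oplus> g i) n"
  using assms(3,4)
proof (induction n)
  case (Suc n)
  have "osum A B f n \<in> hom C A B" "osum A B g n \<in> hom C A B" "f n \<in> hom C A B" "g n \<in> hom C A B"
    using Suc.prems assms(1,2) by (auto intro!: osum_hom)
  then have "osum A B f (Suc n) \<oplus> osum A B g (Suc n) = (osum A B f n \<oplus> osum A B g n) \<oplus> (f n \<oplus> g n)"
    by (auto simp: hom_def add_ac_arr)
  then show ?case using Suc by simp
qed (use assms in simp)

lemma osum_scale:
  assumes "A \<in> Obj C" "B \<in> Obj C" "\<And>i. i < n \<Longrightarrow> f i \<in> hom C A B"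
  shows "r \<bullet> osum A B f n = osum A B (\<lambda>i. r \<bullet> f i) n"
  using assms by (intro osum_map) (auto simp: hom_def smult_add_arr)

text \<open>A member of the span may use generators in any order and repeatedly; collecting them
  over an enumeration gives one coefficient per index.\<close>

lemma hom_span_osum:
  assumes "A \<in> Obj C" "B \<in> Obj C" "X = x ` {..<n}" "X \<subseteq> hom C A B" "f \<in> hom_span C A B X"
  shows "\<exists>c. f = osum A B (\<lambda>i. c i \<bullet> x i) n"
  using assms(5)
proof induction
  case span_zero
  have "osum A B (\<lambda>i. 0 \<bullet> x i) n = Zero C A B"
    using assms by (intro osum_zero) (auto simp: hom_def)
  then show ?case by (intro exI[of _ "\<lambda>_. 0"]) simp
next
  case (span_step h g r)
  obtain c where c: "g = osum A B (\<lambda>i. c i \<bullet> x i) n" using span_step by blast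
  obtain k where k: "k < n" "h = x k" using span_step assms by auto
  have x: "x i \<in> hom C A B" if "i < n" for i using that assms by auto
  have "r \<bullet> h = osum A B (\<lambda>i. (if i = k then r else 0) \<bullet> x i) n"
    using k x assms(1,2) osum_single[of A B k n "\<lambda>i. (if i = k then r else 0) \<bullet> x i"]
    by (auto simp: hom_def)
  then have "r \<bullet> h \<oplus> g = osum A B (\<lambda>i. (if i = k then r else 0) \<bullet> x i \<oplus> c i \<bullet> x i) n"
    unfolding c using x assms(1,2) by (simp only:, intro osum_add) (auto intro: smult_hom)
  also have "\<dots> = osum A B (\<lambda>i. ((if i = k then r else 0) + c i) \<bullet> x i) n"
    using x by (intro osum_cong) (auto simp: hom_def add_smult_arr)
  finally show ?case by (intro exI[of _ "\<lambda>i. (if i = k then r else 0) + c i"])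
qed

text \<open>The value of a polynomial at the endomorphism \<open>f\<close>, by Horner's
  scheme.\<close>

definition peval :: "'o \<Rightarrow> 'm \<Rightarrow> 'k poly \<Rightarrow> 'm" where
  "peval A f p = fold_coeffs (\<lambda>a g. (a \<bullet> Ident C A) \<oplus> (f \<cdot> g)) p (Zero C A A)"

lemma peval_simps:
  assumes "A \<in> Obj C" "f \<in> hom C A A"
  shows "peval A f 0 = Zero C A A" "peval A f (pCons a p) = (a \<bullet> Ident C A) \<oplus> (f \<cdot> peval A f p)"
proof -
  show 0: "peval A f 0 = Zero C A A" by (simp add: peval_def)
  show "peval A f (pCons a p) = (a \<bullet> Ident C A) \<oplus> (f \<cdot> peval A f p)"
  proof (cases "a = 0 \<and> p = 0")
    case True
    then show ?thesis using 0 assms by (auto simp: hom_def)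
  next
    case False
    then show ?thesis by (auto simp: peval_def fold_coeffs_pCons_not_0_0_eq fold_coeffs_pCons_coeff_not_0_eq)
  qed
qed

lemma peval_hom:
  assumes "A \<in> Obj C" "f \<in> hom C A A" shows "peval A f p \<in> hom C A A"
  by (induction p) (use assms in \<open>auto simp: peval_simps hom_def\<close>)

lemma peval_add:
  assumes "A \<in> Obj C" "f \<in> hom C A A" shows "peval A f (p + q) = peval A f p \<oplus> peval A f q"
proof (induction p q rule: poly_induct2)
  case (pCons a p b q)
  have h: "peval A f p \<in> hom C A A" "peval A f q \<in> hom C A A" by (auto intro: peval_hom assms)
  show ?case using assms pCons h by (simp add: peval_simps add_smult_arr hom_def add_ac_arr)
qed (use assms in \<open>auto simp: peval_simps\<close>)

lemma peval_smult:
  assumes "A \<in> Obj C" "f \<in> hom C A A" shows "peval A f (smult r p) = r \<bullet> peval A f p"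
proof (induction p)
  case (pCons a p)
  have h: "peval A f p \<in> hom C A A" by (auto intro: peval_hom assms)
  show ?case using assms pCons h by (simp add: peval_simps smult_add_arr hom_def)
qed (use assms in \<open>auto simp: peval_simps\<close>)

lemma peval_sum:
  assumes "A \<in> Obj C" "f \<in> hom C A A"
  shows "peval A f (\<Sum>j<n. smult (v j) (p j)) = osum A A (\<lambda>j. v j \<bullet> peval A f (p j)) n"
  by (induction n) (use assms in \<open>auto simp: peval_simps peval_add peval_smult\<close>)

text \<open>The \<open>n + 1\<close> powers of \<open>f\<close> up to \<open>f^n\<close> lie in a
  space spanned by \<open>n\<close> arrows, so they satisfy a nontrivial linear relation, whose
  coefficients are those of \<open>p\<close>.\<close>

lemma annihilating_poly:
  assumes A: "A \<in> Obj C" "f \<in> hom C A A" and X: "finite X" "X \<subseteq> hom C A A" "hom C A A = hom_span C A A X"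
  shows "\<exists>p. p \<noteq> 0 \<and> peval A f p = Zero C A A"
proof -
  obtain x n where x: "X = x ` {..<n::nat}" using X(1) finite_imp_nat_seg_image_inj_on[of X] by (auto simp: lessThan_def)
  have xh: "x i \<in> hom C A A" if "i < n" for i using that x X by auto
  have "\<exists>c. peval A f (monom 1 j) = osum A A (\<lambda>i. c i \<bullet> x i) n" for j
    by (rule hom_span_osum[OF A(1) A(1) x X(2)]) (use X(3) peval_hom[OF A] in blast)
  then obtain c where c: "\<And>j. peval A f (monom 1 j) = osum A A (\<lambda>i. c j i \<bullet> x i) n" by metis
  obtain v :: "nat \<Rightarrow> 'k" where v: "\<exists>j\<in>{..<Suc n}. v j \<noteq> 0" "\<forall>i\<in>{..<n}. (\<Sum>j<Suc n. c j i * v j) = 0"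
    using underdetermined_system[of "{..<n}" "{..<Suc n}" "\<lambda>i j. c j i"] by auto
  have eq: "osum A A (\<lambda>j. v j \<bullet> osum A A (\<lambda>i. c j i \<bullet> x i) n) m = osum A A (\<lambda>i. (\<Sum>j<m. c j i * v j) \<bullet> x i) n" for m
  proof (induction m)
    case 0
    show ?case using A xh by (auto simp: hom_def intro!: osum_zero[symmetric])
  next
    case (Suc m)
    have "v m \<bullet> osum A A (\<lambda>i. c m i \<bullet> x i) n = osum A A (\<lambda>i. v m \<bullet> (c m i \<bullet> x i)) n"
      using A xh by (intro osum_scale) (auto intro: smult_hom)
    then have "osum A A (\<lambda>j. v j \<bullet> osum A A (\<lambda>i. c j i \<bullet> x i) n) (Suc m) =
       osum A A (\<lambda>i. (\<Sum>j<m. c j i * v j) \<bullet> x i) n \<oplus> osum A A (\<lambda>i. v m \<bullet> (c m i \<bullet> x i)) n"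
      using Suc by simp
    also have "\<dots> = osum A A (\<lambda>i. (\<Sum>j<m. c j i * v j) \<bullet> x i \<oplus> v m \<bullet> (c m i \<bullet> x i)) n"
      using A xh by (intro osum_add) (auto intro: smult_hom)
    also have "\<dots> = osum A A (\<lambda>i. (\<Sum>j<Suc m. c j i * v j) \<bullet> x i) n"
      using xh by (intro osum_cong) (auto simp: hom_def add_smult_arr mult.commute)
    finally show ?case .
  qed
  define p where "p = (\<Sum>j<Suc n. smult (v j) (monom 1 j))"
  have cf: "coeff p j = (if j < Suc n then v j else 0)" for j
  proof -
    have "coeff p j = (\<Sum>i<Suc n. if i = j then v i else 0)"
      by (simp add: p_def coeff_sum smult_monom)
    then show ?thesis by (simp del: sum.lessThan_Suc)
  qed
  have "p \<noteq> 0" using v(1) cf by (metis coeff_0 lessThan_iff)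
  moreover have "peval A f p = osum A A (\<lambda>i. (\<Sum>j<Suc n. c j i * v j) \<bullet> x i) n"
    unfolding p_def peval_sum[OF A] c by (rule eq)
  then have "peval A f p = Zero C A A"
    using v(2) xh A by (simp only:, intro osum_zero) (auto simp: hom_def simp del: sum.lessThan_Suc)
  ultimately show ?thesis by blast
qed

end

text \<open>From an annihilating polynomial \<open>p = (x - z) q\<close> either \<open>f - z\<close>
  is zero, and \<open>f\<close> is a scalar, or it is invertible and \<open>q\<close> annihilates
  \<open>f\<close> with smaller degree. A nonzero constant cannot annihilate, as \<open>S\<close> is
  not a zero object. Closedness is a hypothesis on polynomials because the locale fixes only a
  field.\<close>

lemma (in abelian_category) schur_closed:
  fixes f
  assumes closed: "\<And>p :: 'k poly. 0 < degree p \<Longrightarrow> \<exists>z. poly p z = 0"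
    and S: "simple C S" and f: "f \<in> hom C S S"
    and fin: "\<exists>X. finite X \<and> X \<subseteq> hom C S S \<and> hom C S S = hom_span C S S X"
  shows "\<exists>c. f = c \<bullet> Ident C S"
proof -
  have SO: "S \<in> Obj C" using S by (simp add: simple_def)
  have fs [simp]: "f \<in> Arr C" "Dom C f = S" "Cod C f = S" "S \<in> Obj C" using f SO by (auto simp: hom_def)
  obtain p where "p \<noteq> 0" "peval S f p = Zero C S S" using annihilating_poly[OF SO f] fin by blast
  then show ?thesis
  proof (induction "degree p" arbitrary: p rule: less_induct)
    case less
    show ?case
    proof (cases "degree p = 0")
      case True
      then obtain a where a: "p = [:a:]" by (rule degree_eq_zeroE)
      then have eq: "a \<bullet> Ident C S = a \<bullet> Zero C S S" using less.prems SO f by (simp add: peval_simps)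
      have "Ident C S = Zero C S S"
        by (rule smult_cancel[of _ _ a, OF _ _ _ eq]) (use less.prems(1) a in simp_all)
      then show ?thesis using zero_objI[of S] S by (auto simp: simple_def)
    next
      case False
      then obtain z where "poly p z = 0" using closed by blast
      then obtain q where q: "p = [:- z, 1:] * q" by (auto simp: poly_eq_0_iff_dvd)
      have q0: "q \<noteq> 0" using less.prems q by auto
      have [simp]: "peval S f q \<in> Arr C" "Dom C (peval S f q) = S" "Cod C (peval S f q) = S"
        using peval_hom[OF SO f, of q] by (auto simp: hom_def)
      define g where "g = f \<oplus> (- z) \<bullet> Ident C S"
      have g: "g \<in> hom C S S" by (simp add: g_def hom_def)
      have pe: "p = smult (- z) q + pCons 0 q" by (simp add: q)
      have "peval S f p = (- z) \<bullet> peval S f q \<oplus> f \<cdot> peval S f q"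
        unfolding pe peval_add[OF SO f] peval_smult[OF SO f] peval_simps(2)[OF SO f] by simp
      then have gq: "g \<cdot> peval S f q = Zero C S S"
        using less.prems by (simp add: g_def add_commute_arr)
      show ?thesis
      proof (cases "g = Zero C S S")
        case True
        have "f = (f \<oplus> (- z) \<bullet> Ident C S) \<oplus> z \<bullet> Ident C S"
          by (simp add: add_assoc_arr add_smult_arr[symmetric])
        also have "\<dots> = z \<bullet> Ident C S" using True by (simp add: g_def)
        finally show ?thesis by blast
      next
        case False
        then have iso: "iso_arr C g" using simple_arr_iso[OF S S g] by blast
        have "peval S f q = inv_arr C g \<cdot> (g \<cdot> peval S f q)" using inv_arr_cancel(1)[OF iso, of "peval S f q"] g by (simp add: hom_def)
        also have "\<dots> = Zero C S S" unfolding gq using inv_arr[OF iso] g by (simp add: hom_def)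
        finally have "peval S f q = Zero C S S" .
        moreover have "degree q < degree p" unfolding q using q0 by (subst degree_mult_eq) auto
        ultimately show ?thesis using less.hyps q0 by blast
      qed
    qed
  qed
qed

text \<open>Adds one simple summand in front of a decomposition. It serves two inductions:
  decomposing a given semisimple object, and constructing an object with prescribed labels.\<close>

lemma (in linear_category) is_dec_biproduct:
  assumes P: "biproduct C P T A" and iso: "g \<in> hom C (S l) T" "iso_arr C g" and d: "is_dec C S d A"
  shows "\<exists>d'. is_dec C S d' P \<and> lab d' = l # lab d"
proof -
  obtain i j p q where h: "P \<in> Obj C" "T \<in> Obj C" "A \<in> Obj C" "i \<in> hom C T P" "j \<in> hom C A P" "p \<in> hom C P T" "q \<in> hom C P A"
    and e: "p \<cdot> i = Ident C T" "q \<cdot> j = Ident C A" "p \<cdot> j = Zero C A T" "q \<cdot> i = Zero C T A"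
    and sum: "(i \<cdot> p) \<oplus> (j \<cdot> q) = Ident C P" using P by (elim biproductE)
  note I = inv_arr[OF iso(2)] inv_arr_cancel[OF iso(2)]
  have [simp]: "P \<in> Obj C" "T \<in> Obj C" "A \<in> Obj C" "i \<in> Arr C" "j \<in> Arr C" "p \<in> Arr C" "q \<in> Arr C" "Dom C i = T" "Dom C j = A"
    "Cod C i = P" "Cod C j = P" "Dom C p = P" "Dom C q = P" "Cod C p = T" "Cod C q = A" "g \<in> Arr C" "Dom C g = S l" "Cod C g = T"
    "S l \<in> Obj C"
    using h iso(1) hom_obj[OF iso(1)] by (auto simp: hom_def)
  note [simp] = I[simplified] e
  have [simp]: "x \<in> Arr C \<Longrightarrow> Cod C x = T \<Longrightarrow> p \<cdot> (i \<cdot> x) = x"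
     "x \<in> Arr C \<Longrightarrow> Cod C x = T \<Longrightarrow> q \<cdot> (i \<cdot> x) = Zero C (Dom C x) A"
     "y \<in> Arr C \<Longrightarrow> Cod C y = A \<Longrightarrow> p \<cdot> (j \<cdot> y) = Zero C (Dom C y) T"
     "y \<in> Arr C \<Longrightarrow> Cod C y = A \<Longrightarrow> q \<cdot> (j \<cdot> y) = y" for x y
    using comp_cancel[OF e(1), of x] comp_cancel[OF e(4), of x] comp_cancel[OF e(3), of y] comp_cancel[OF e(2), of y]
    by auto
  let ?n = "length (lab d)"
  have dh: "inc d m \<in> hom C (S (lab d ! m)) A" "prj d m \<in> hom C A (S (lab d ! m))" if "m < ?n" for m
    using d that unfolding is_dec_def by blast+
  have [simp]: "inc d m \<in> Arr C" "Dom C (inc d m) = S (lab d ! m)" "Cod C (inc d m) = A"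
    "prj d m \<in> Arr C" "Dom C (prj d m) = A" "Cod C (prj d m) = S (lab d ! m)" "S (lab d ! m) \<in> Obj C" if "m < ?n" for m
    using dh[OF that] hom_obj[OF dh(1)[OF that]] by (auto simp: hom_def)
  have dpi: "prj d a \<cdot> inc d b = (if a = b then Ident C (S (lab d ! a)) else Zero C (S (lab d ! b)) (S (lab d ! a)))"
    if "a < ?n" "b < ?n" for a b
    using d that unfolding is_dec_def by blast
  have depi: "x = y" if "x \<in> hom C A B" "y \<in> hom C A B" "\<forall>m<?n. x \<cdot> inc d m = y \<cdot> inc d m" for x y B
    using d that unfolding is_dec_def by blast
  define D where "D = Dec (l # lab d) (\<lambda>n. case n of 0 \<Rightarrow> i \<cdot> g | Suc m \<Rightarrow> j \<cdot> inc d m)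
      (\<lambda>n. case n of 0 \<Rightarrow> inv_arr C g \<cdot> p | Suc m \<Rightarrow> prj d m \<cdot> q)"
  have all: "(\<forall>n<Suc k. Q n) \<longleftrightarrow> Q 0 \<and> (\<forall>n<k. Q (Suc n))" for Q k
    by (metis Suc_less_eq gr0_conv_Suc not_gr_zero zero_less_Suc)
  have "is_dec C S D P"
    unfolding is_dec_def
  proof (intro conjI allI impI ballI)
    show "P \<in> Obj C" by simp
    fix m assume "m < length (lab D)"
    then show "inc D m \<in> hom C (S (lab D ! m)) P" "prj D m \<in> hom C P (S (lab D ! m))"
      by (auto simp: D_def hom_def split: nat.split)
  next
    fix a b assume "a < length (lab D)" "b < length (lab D)"
    then show "prj D a \<cdot> inc D b = (if a = b then Ident C (S (lab D ! a)) else Zero C (S (lab D ! b)) (S (lab D ! a)))"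
      by (auto simp: D_def dpi split: nat.split)
  next
    fix B x y assume x: "x \<in> hom C P B" and y: "y \<in> hom C P B" and eq: "\<forall>m<length (lab D). x \<cdot> inc D m = y \<cdot> inc D m"
    have [simp]: "x \<in> Arr C" "y \<in> Arr C" "Dom C x = P" "Dom C y = P" "Cod C x = B" "Cod C y = B" using x y by (auto simp: hom_def)
    have 0: "x \<cdot> (i \<cdot> g) = y \<cdot> (i \<cdot> g)" and 1: "\<forall>m<?n. x \<cdot> (j \<cdot> inc d m) = y \<cdot> (j \<cdot> inc d m)"
      using eq by (auto simp: D_def all)
    have xi: "x \<cdot> i = y \<cdot> i"
    proof -
      have "x \<cdot> i = (x \<cdot> (i \<cdot> g)) \<cdot> inv_arr C g" by simp
      also have "\<dots> = (y \<cdot> (i \<cdot> g)) \<cdot> inv_arr C g" by (simp only: 0)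
      also have "\<dots> = y \<cdot> i" by simp
      finally show ?thesis .
    qed
    have xj: "x \<cdot> j = y \<cdot> j" using 1 by (intro depi[of _ B]) (auto simp: hom_def)
    have "x = x \<cdot> ((i \<cdot> p) \<oplus> (j \<cdot> q))" "y = y \<cdot> ((i \<cdot> p) \<oplus> (j \<cdot> q))" unfolding sum by simp_all
    then have "x = ((x \<cdot> i) \<cdot> p) \<oplus> ((x \<cdot> j) \<cdot> q)" "y = ((y \<cdot> i) \<cdot> p) \<oplus> ((y \<cdot> j) \<cdot> q)" by simp_all
    then show "x = y" unfolding xi xj by simp
  qed
  then show ?thesis by (auto simp: D_def)
qed

lemma (in fibonacci_category) ex_simple_system:
  assumes closed: "\<And>p :: 'k poly. 0 < degree p \<Longrightarrow> \<exists>z. poly p z = 0"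
  shows "\<exists>S. simple_system C S \<and> S One = Unit C \<and> simple C (S Tau) \<and>
    (\<exists>P. biproduct C P (S One) (S Tau) \<and> iso_obj C (S Tau \<odot> S Tau) P) \<and> (\<forall>T. simple C T \<longrightarrow> (\<exists>l. iso_obj C T (S l)))"
proof -
  obtain X where X: "simple C X" "\<not> iso_obj C X (Unit C)" "\<And>S. simple C S \<Longrightarrow> iso_obj C S (Unit C) \<or> iso_obj C S X"
    "\<exists>P. biproduct C P (Unit C) X \<and> iso_obj C (X \<odot> X) P" using fibonacci_object by blast
  \<comment> \<open>The representative of \<open>One\<close> is the unit itself and not just an
    isomorphic object, so that the unit constraints have simple objects as sources and
    targets.\<close>
  define S where "S = (\<lambda>l. case l of One \<Rightarrow> Unit C | Tau \<Rightarrow> X)"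
  have S[simp]: "S One = Unit C" "S Tau = X" by (simp_all add: S_def)
  have simp: "simple C (S l)" for l using unit_simple X(1) by (cases l) auto
  then have SO: "S l \<in> Obj C" for l by (auto simp: simple_def)
  have iso: "\<exists>l. iso_obj C T (S l)" if "simple C T" for T using X(3)[OF that] S by metis
  have "\<exists>d. is_dec C S d A" if "A \<in> Obj C" for A
    using semisimple[OF that]
  proof induction
    case (empty_sum Z)
    have "is_dec C S (Dec [] undefined undefined) Z"
      unfolding is_dec_def using zero_objD(1)[OF empty_sum] zero_objD(2)[OF empty_sum] by (metis dec.sel(1) list.size(3) not_less0)
    then show ?case by blast
  next
    case (add_summand T A P)
    obtain l where "iso_obj C T (S l)" using iso add_summand by blast
    then obtain g where "g \<in> hom C (S l) T" "iso_arr C g" using iso_obj_sym unfolding iso_obj_def by blast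
    then show ?case using is_dec_biproduct[OF add_summand(3), of g S l] add_summand(4) by blast
  qed
  moreover have "f = Zero C (S l) (S m)" if "l \<noteq> m" "f \<in> hom C (S l) (S m)" for l m f
  proof (rule ccontr)
    assume "f \<noteq> Zero C (S l) (S m)"
    then have "iso_obj C (S l) (S m)" using simple_arr_iso[OF simp simp that(2)] that(2) iso_objI by blast
    then show False using that(1) X(2) iso_obj_sym by (cases l; cases m) auto
  qed
  moreover have "Ident C (S l) \<noteq> Zero C (S l) (S l)" for l
    using zero_objI[OF SO, of l] simp[of l] by (auto simp: simple_def)
  moreover have "\<exists>c. f = c \<bullet> Ident C (S l)" if "f \<in> hom C (S l) (S l)" for l f
    using schur_closed[OF closed simp that finite_dim[OF SO SO]] .
  ultimately have "simple_system C S" using SO by unfold_locales auto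
  then show ?thesis using X iso by (intro exI[of _ S]) auto
qed

section \<open>Matrices of arrows with respect to decompositions\<close>

context simple_system
begin

definition mat :: "'m dec \<Rightarrow> 'm dec \<Rightarrow> 'm \<Rightarrow> 'k fib_arr" where
  "mat d d' f = mk_arr (lab d) (lab d') (\<lambda>i j. coef (prj d' i \<cdot> (f \<cdot> inc d j)))"

lemma mat_sel [simp]: "farr (mat d d' f)" "src (mat d d' f) = lab d" "tgt (mat d d' f) = lab d'"
  by (simp_all add: mat_def)

lemma prj_arr_inc_hom:
  assumes "dec d A" "dec d' B" "f \<in> hom C A B" "i < dlen d'" "j < dlen d"
  shows "prj d' i \<cdot> (f \<cdot> inc d j) \<in> hom C (S (lab d ! j)) (S (lab d' ! i))"
proof -
  note [simp] = decD[OF assms(1)] decD[OF assms(2)]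
  show ?thesis using assms(3-5) by (auto simp: hom_def)
qed

text \<open>The resolution of the identity of \<open>B\<close> is inserted between \<open>g\<close>
  and \<open>f\<close>; by Schur, a composite through a simple object with another label has
  coefficient zero.\<close>

lemma mat_comp:
  assumes d: "dec d A" "dec d' B" "dec d'' E" and f: "f \<in> hom C A B" and g: "g \<in> hom C B E"
  shows "mat d d'' (g \<cdot> f) = fib_comp (mat d' d'' g) (mat d d' f)"
proof (rule farr_eqI)
  note [simp] = decD[OF d(1)] decD[OF d(2)] decD[OF d(3)]
  have [simp]: "f \<in> Arr C" "Dom C f = A" "Cod C f = B" "g \<in> Arr C" "Dom C g = B" "Cod C g = E"
    using f g by (auto simp: hom_def)
  fix i j assume "i < length (tgt (fib_comp (mat d' d'' g) (mat d d' f)))" "j < length (src (fib_comp (mat d' d'' g) (mat d d' f)))"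
    and "tgt (fib_comp (mat d' d'' g) (mat d d' f)) ! i = src (fib_comp (mat d' d'' g) (mat d d' f)) ! j"
  then have i: "i < dlen d''" and j: "j < dlen d" and l: "lab d'' ! i = lab d ! j" by auto
  let ?S = "S (lab d ! j)"
  have "prj d'' i \<cdot> ((g \<cdot> f) \<cdot> inc d j) = (prj d'' i \<cdot> g) \<cdot> (osum B B (\<lambda>l. inc d' l \<cdot> prj d' l) (dlen d') \<cdot> (f \<cdot> inc d j))"
    using i j by (simp add: dec_complete[OF d(2)])
  also have "osum B B (\<lambda>l. inc d' l \<cdot> prj d' l) (dlen d') \<cdot> (f \<cdot> inc d j) =
      osum ?S B (\<lambda>l. (inc d' l \<cdot> prj d' l) \<cdot> (f \<cdot> inc d j)) (dlen d')"
    using j by (intro osum_comp) (auto simp: hom_def)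
  also have "(prj d'' i \<cdot> g) \<cdot> \<dots> = osum ?S ?S (\<lambda>l. (prj d'' i \<cdot> g) \<cdot> ((inc d' l \<cdot> prj d' l) \<cdot> (f \<cdot> inc d j))) (dlen d')"
    using i j l by (intro osum_comp) (auto simp: hom_def)
  also have "\<dots> = osum ?S ?S (\<lambda>l. (prj d'' i \<cdot> (g \<cdot> inc d' l)) \<cdot> (prj d' l \<cdot> (f \<cdot> inc d j))) (dlen d')"
    using i j by (intro osum_cong) simp
  finally have "coef (prj d'' i \<cdot> ((g \<cdot> f) \<cdot> inc d j)) =
      (\<Sum>l<dlen d'. coef ((prj d'' i \<cdot> (g \<cdot> inc d' l)) \<cdot> (prj d' l \<cdot> (f \<cdot> inc d j))))"
    using i j l by (simp only:, intro coef_osum) (auto simp: hom_def)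
  also have "\<dots> = (\<Sum>l<dlen d'. entry (mat d' d'' g) i l * entry (mat d d' f) l j)"
  proof (rule sum.cong[OF refl])
    fix k assume k: "k \<in> {..<dlen d'}"
    show "coef ((prj d'' i \<cdot> (g \<cdot> inc d' k)) \<cdot> (prj d' k \<cdot> (f \<cdot> inc d j))) = entry (mat d' d'' g) i k * entry (mat d d' f) k j"
      using coef_comp[OF prj_arr_inc_hom[OF d(1,2) f, of k j], of "prj d'' i \<cdot> (g \<cdot> inc d' k)"]
        prj_arr_inc_hom[OF d(2,3) g, of i k] i j k l by (auto simp: mat_def)
  qed
  also have "\<dots> = entry (fib_comp (mat d' d'' g) (mat d d' f)) i j" by (simp add: entry_comp)
  finally show "entry (mat d d'' (g \<cdot> f)) i j = entry (fib_comp (mat d' d'' g) (mat d d' f)) i j"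
    using i j l by (simp add: mat_def)
qed auto

lemma mat_ident:
  assumes d: "dec d A" shows "mat d d (Ident C A) = fib_ident (lab d)"
proof (rule farr_eqI)
  note [simp] = decD[OF d]
  fix i j assume "i < length (tgt (fib_ident (lab d)))" "j < length (src (fib_ident (lab d)))"
    "tgt (fib_ident (lab d)) ! i = src (fib_ident (lab d)) ! j"
  then show "entry (mat d d (Ident C A)) i j = entry (fib_ident (lab d)) i j"
    by (simp add: mat_def dec_prj_inc[OF d])
qed auto

lemma mat_inj:
  assumes d: "dec d A" "dec d' B" and f: "f \<in> hom C A B" "g \<in> hom C A B" and eq: "mat d d' f = mat d d' g"
  shows "f = g"
proof (rule dec_epi[OF d(1) f])
  note [simp] = decD[OF d(1)] decD[OF d(2)]
  fix j assume j: "j < dlen d"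
  show "f \<cdot> inc d j = g \<cdot> inc d j"
  proof (rule dec_mono[OF d(2)])
    show "f \<cdot> inc d j \<in> hom C (S (lab d ! j)) B" "g \<cdot> inc d j \<in> hom C (S (lab d ! j)) B" using j f by (auto simp: hom_def)
    fix i assume i: "i < dlen d'"
    show "prj d' i \<cdot> (f \<cdot> inc d j) = prj d' i \<cdot> (g \<cdot> inc d j)"
    proof (cases "lab d' ! i = lab d ! j")
      case True
      have "entry (mat d d' f) i j = entry (mat d d' g) i j" by (simp add: eq)
      then have "coef (prj d' i \<cdot> (f \<cdot> inc d j)) = coef (prj d' i \<cdot> (g \<cdot> inc d j))" using i j True by (simp add: mat_def)
      then show ?thesis using coef_hom prj_arr_inc_hom[OF d f(1) i j] prj_arr_inc_hom[OF d f(2) i j] True by metis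
    next
      case False
      then show ?thesis using schur_zero prj_arr_inc_hom[OF d f(1) i j] prj_arr_inc_hom[OF d f(2) i j] by metis
    qed
  qed
qed

lemma mat_add_smult:
  assumes d: "dec d A" "dec d' B" and f: "f \<in> hom C A B"
  shows "g \<in> hom C A B \<Longrightarrow> mat d d' (f \<oplus> g) = mk_arr (lab d) (lab d') (\<lambda>i j. entry (mat d d' f) i j + entry (mat d d' g) i j)"
    and "mat d d' (r \<bullet> f) = mk_arr (lab d) (lab d') (\<lambda>i j. r * entry (mat d d' f) i j)"
proof -
  note [simp] = decD[OF d(1)] decD[OF d(2)]
  have [simp]: "f \<in> Arr C" "Dom C f = A" "Cod C f = B" using f by (auto simp: hom_def)
  have "coef (prj d' i \<cdot> (r \<bullet> f \<cdot> inc d j)) = r * coef (prj d' i \<cdot> (f \<cdot> inc d j))"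
    if "i < dlen d'" "j < dlen d" "lab d' ! i = lab d ! j" for i j
    using that coef_smult[of "prj d' i \<cdot> (f \<cdot> inc d j)" "lab d ! j" r] by (simp add: hom_def)
  then show "mat d d' (r \<bullet> f) = mk_arr (lab d) (lab d') (\<lambda>i j. r * entry (mat d d' f) i j)"
    by (intro farr_eqI) (auto simp: mat_def)
  assume g: "g \<in> hom C A B"
  have [simp]: "g \<in> Arr C" "Dom C g = A" "Cod C g = B" using g by (auto simp: hom_def)
  have "coef (prj d' i \<cdot> ((f \<oplus> g) \<cdot> inc d j)) = coef (prj d' i \<cdot> (f \<cdot> inc d j)) + coef (prj d' i \<cdot> (g \<cdot> inc d j))"
    if "i < dlen d'" "j < dlen d" "lab d' ! i = lab d ! j" for i j
    using that coef_add[of "prj d' i \<cdot> (f \<cdot> inc d j)" "lab d ! j" "prj d' i \<cdot> (g \<cdot> inc d j)"] by (simp add: hom_def)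
  then show "mat d d' (f \<oplus> g) = mk_arr (lab d) (lab d') (\<lambda>i j. entry (mat d d' f) i j + entry (mat d d' g) i j)"
    by (intro farr_eqI) (auto simp: mat_def)
qed

lemma mat_surj:
  assumes d: "dec d A" "dec d' B" and m: "farr m" "src m = lab d" "tgt m = lab d'"
  shows "\<exists>f \<in> hom C A B. mat d d' f = m"
proof -
  note D [simp] = decD[OF d(1)] decD[OF d(2)]
  \<comment> \<open>The arrow is assembled from matrix units scaled by the entries of
    \<open>m\<close>. For unequal labels the matrix unit would not be a composable pair, hence the
    zero arrow.\<close>
  define e where "e i j = (if lab d' ! i = lab d ! j then entry m i j \<bullet> (inc d' i \<cdot> prj d j) else Zero C A B)" for i j
  have e: "e i j \<in> hom C A B" if "i < dlen d'" "j < dlen d" for i j using that by (simp add: e_def hom_def)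
  define f where "f = osum A B (\<lambda>j. osum A B (\<lambda>i. e i j) (dlen d')) (dlen d)"
  have inner: "osum A B (\<lambda>i. e i j) (dlen d') \<in> hom C A B" if "j < dlen d" for j
    using e that by (intro osum_hom) auto
  have f: "f \<in> hom C A B" unfolding f_def by (rule osum_hom) (use inner in auto)
  have pe: "prj d' a \<cdot> (e i j \<cdot> inc d b) = (if a = i \<and> j = b then entry m i j \<bullet> Ident C (S (lab d ! b)) else Zero C (S (lab d ! b)) (S (lab d' ! a)))"
    if "i < dlen d'" "j < dlen d" "a < dlen d'" "b < dlen d" "lab d' ! a = lab d ! b" for i j a b
    using that by (auto simp: e_def dec_prj_inc[OF d(1)] dec_prj_inc[OF d(2)] farr_entry_zero[OF m(1)] m)
  have ent: "prj d' a \<cdot> (f \<cdot> inc d b) = entry m a b \<bullet> Ident C (S (lab d ! b))"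
    if ab: "a < dlen d'" "b < dlen d" "lab d' ! a = lab d ! b" for a b
  proof -
    let ?S = "S (lab d ! b)"
    have L: "prj d' a \<cdot> (osum A B g n \<cdot> inc d b) = osum ?S ?S (\<lambda>i. prj d' a \<cdot> (g i \<cdot> inc d b)) n"
      if "\<And>i. i < n \<Longrightarrow> g i \<in> hom C A B" for g n
      using that ab by (intro osum_map[where L = "\<lambda>h. prj d' a \<cdot> (h \<cdot> inc d b)"]) (auto simp: hom_def)
    have "prj d' a \<cdot> (f \<cdot> inc d b) = osum ?S ?S (\<lambda>j. prj d' a \<cdot> (osum A B (\<lambda>i. e i j) (dlen d') \<cdot> inc d b)) (dlen d)"
      unfolding f_def by (rule L) (use inner in auto)
    also have "\<dots> = osum ?S ?S (\<lambda>j. osum ?S ?S (\<lambda>i. prj d' a \<cdot> (e i j \<cdot> inc d b)) (dlen d')) (dlen d)"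
      by (intro osum_cong L) (use e in auto)
    also have "\<dots> = osum ?S ?S (\<lambda>j. osum ?S ?S (\<lambda>i. if a = i \<and> j = b then entry m i j \<bullet> Ident C ?S else Zero C ?S ?S) (dlen d')) (dlen d)"
      using ab by (intro osum_cong) (simp add: pe)
    also have "\<dots> = osum ?S ?S (\<lambda>i. if a = i \<and> b = b then entry m i b \<bullet> Ident C ?S else Zero C ?S ?S) (dlen d')"
      using ab by (intro osum_single osum_hom) (auto simp: hom_def intro!: osum_zero)
    also have "\<dots> = entry m a b \<bullet> Ident C ?S"
      using ab osum_single[of ?S ?S a "dlen d'" "\<lambda>i. if a = i \<and> b = b then entry m i b \<bullet> Ident C ?S else Zero C ?S ?S"]
      by (simp add: hom_def)
    finally show ?thesis .
  qed
  have "mat d d' f = m"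
  proof (rule farr_eqI)
    fix a b assume "a < length (tgt m)" "b < length (src m)" "tgt m ! a = src m ! b"
    then show "entry (mat d d' f) a b = entry m a b"
      using ent[of a b] coef_eqI[OF ent[of a b]] m by (simp add: mat_def)
  qed (use m in auto)
  then show ?thesis using f by blast
qed

end

text \<open>A choice of gauge: inclusions and projections for the two summands of \<open>X\<close>
  \<otimes> \<open>X\<close>. As for decompositions, completeness is the joint cancellability of the
  inclusions.\<close>

locale fib_frame = monoidal_category C + simple_system C S
  for C :: "('o, 'm, 'k :: field, 'x) moncat_scheme" (structure) and S :: "fib \<Rightarrow> 'o" +
  fixes iX pX :: "fib \<Rightarrow> 'm"
  assumes S_One: "S One = Unit C"
    and iX_hom: "iX z \<in> hom C (S z) (S Tau \<odot> S Tau)"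
    and pX_hom: "pX z \<in> hom C (S Tau \<odot> S Tau) (S z)"
    and pX_iX: "pX z \<cdot> iX z' = (if z = z' then Ident C (S z) else Zero C (S z') (S z))"
    and iX_epi: "f \<in> hom C (S Tau \<odot> S Tau) B \<Longrightarrow> g \<in> hom C (S Tau \<odot> S Tau) B \<Longrightarrow>
      (\<And>z. f \<cdot> iX z = g \<cdot> iX z) \<Longrightarrow> f = g"
begin

text \<open>The inclusion of the summand \<open>z\<close>. If a factor is the unit, it is the
  inverse of a unit constraint. For \<open>I\<close> \<otimes> \<open>I\<close> both constraints are
  candidates and the left one is taken; that they agree is \<open>unit_constraints\<close>.\<close>

definition iota :: "fib \<Rightarrow> fib \<Rightarrow> fib \<Rightarrow> 'm" where
  "iota x y z = (if x = One then inv_arr C (LUnit C (S y)) else if y = One then inv_arr C (RUnit C (S x)) else iX z)"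

definition proj :: "fib \<Rightarrow> fib \<Rightarrow> fib \<Rightarrow> 'm" where
  "proj x y z = (if x = One then LUnit C (S y) else if y = One then RUnit C (S x) else pX z)"

lemma lunit_inv [simp]:
  assumes "A \<in> Obj C"
  shows "inv_arr C (LUnit C A) \<in> Arr C" "Dom C (inv_arr C (LUnit C A)) = A" "Cod C (inv_arr C (LUnit C A)) = Unit C \<odot> A"
    "LUnit C A \<cdot> inv_arr C (LUnit C A) = Ident C A" "inv_arr C (LUnit C A) \<cdot> LUnit C A = Ident C (Unit C \<odot> A)"
    "inv_arr C (RUnit C A) \<in> Arr C" "Dom C (inv_arr C (RUnit C A)) = A" "Cod C (inv_arr C (RUnit C A)) = A \<odot> Unit C"
    "RUnit C A \<cdot> inv_arr C (RUnit C A) = Ident C A" "inv_arr C (RUnit C A) \<cdot> RUnit C A = Ident C (A \<odot> Unit C)"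
  using inv_arr[OF lunit_iso[OF assms]] inv_arr[OF runit_iso[OF assms]] assms by simp_all

lemma unit_inv_cancel [simp]:
  assumes "A \<in> Obj C" "f \<in> Arr C"
  shows "Cod C f = A \<Longrightarrow> LUnit C A \<cdot> (inv_arr C (LUnit C A) \<cdot> f) = f"
    "Cod C f = A \<Longrightarrow> RUnit C A \<cdot> (inv_arr C (RUnit C A) \<cdot> f) = f"
    "Cod C f = Unit C \<odot> A \<Longrightarrow> inv_arr C (LUnit C A) \<cdot> (LUnit C A \<cdot> f) = f"
    "Cod C f = A \<odot> Unit C \<Longrightarrow> inv_arr C (RUnit C A) \<cdot> (RUnit C A \<cdot> f) = f"
  using inv_arr_cancel[OF lunit_iso[OF assms(1)], of f] inv_arr_cancel[OF runit_iso[OF assms(1)], of f] assms by simp_all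

lemma iota_arr [simp]:
  assumes "z \<in> set (fuse x y)"
  shows "iota x y z \<in> Arr C" "Dom C (iota x y z) = S z" "Cod C (iota x y z) = S x \<odot> S y"
    "proj x y z \<in> Arr C" "Dom C (proj x y z) = S x \<odot> S y" "Cod C (proj x y z) = S z"
  using assms homE[OF iX_hom[of z]] homE[OF pX_hom[of z]] S_One
  by (cases x; cases y; auto simp: iota_def proj_def)+

lemma proj_iota:
  assumes "z \<in> set (fuse x y)" "z' \<in> set (fuse x y)"
  shows "proj x y z \<cdot> iota x y z' = (if z = z' then Ident C (S z) else Zero C (S z') (S z))"
  using assms S_One pX_iX[of z z'] by (cases x; cases y; auto simp: iota_def proj_def)

lemma iota_epi:
  assumes "f \<in> hom C (S x \<odot> S y) B" "g \<in> hom C (S x \<odot> S y) B"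
    "\<And>z. z \<in> set (fuse x y) \<Longrightarrow> f \<cdot> iota x y z = g \<cdot> iota x y z"
  shows "f = g"
proof (cases "x = Tau \<and> y = Tau")
  case True
  have "z \<in> set (fuse Tau Tau)" for z by (cases z) auto
  then show ?thesis using True assms iX_epi[of f B g] by (simp add: iota_def)
next
  case False
  then obtain z u where z: "z \<in> set (fuse x y)" and u: "u \<in> Arr C" "Cod C u = Dom C (iota x y z)" "Dom C u = S x \<odot> S y"
    "iota x y z \<cdot> u = Ident C (S x \<odot> S y)"
  proof (cases x)
    case One
    then show ?thesis using S_One by (intro that[of y "LUnit C (S y)"]) (auto simp: iota_def)
  next
    case Tau
    then have "y = One" using False by (cases y) auto
    then show ?thesis using S_One Tau by (intro that[of Tau "RUnit C (S Tau)"]) (auto simp: iota_def)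
  qed
  have "f = (f \<cdot> iota x y z) \<cdot> u" using assms(1) z u by (auto simp: hom_def)
  also have "\<dots> = (g \<cdot> iota x y z) \<cdot> u" using assms(3)[OF z] by simp
  also have "\<dots> = g" using assms(2) z u by (auto simp: hom_def)
  finally show ?thesis .
qed

text \<open>Tensoring with a fixed arrow is additive, so the resolutions of the identities of
  \<open>B\<close> and then of \<open>A\<close> can be inserted one factor at a time.\<close>

lemma ten_epi:
  assumes d: "dec d A" "dec d' B" and f: "f \<in> hom C (A \<odot> B) T" "g \<in> hom C (A \<odot> B) T"
    and eq: "\<And>i j. i < dlen d \<Longrightarrow> j < dlen d' \<Longrightarrow> f \<cdot> (inc d i \<otimes> inc d' j) = g \<cdot> (inc d i \<otimes> inc d' j)"
  shows "f = g"
proof -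
  note [simp] = decD[OF d(1)] decD[OF d(2)]
  have T: "T \<in> Obj C" using hom_obj f by blast
  have fg: "f \<in> Arr C" "Dom C f = A \<odot> B" "Cod C f = T" "g \<in> Arr C" "Dom C g = A \<odot> B" "Cod C g = T"
    using f by (auto simp: hom_def)
  have 1: "h \<cdot> (x \<otimes> Ident C B) = osum (Dom C x \<odot> B) T (\<lambda>j. (h \<cdot> (x \<otimes> inc d' j)) \<cdot> (Ident C (Dom C x) \<otimes> prj d' j)) (dlen d')"
    if h: "h \<in> hom C (A \<odot> B) T" and x: "x \<in> Arr C" "Cod C x = A" for h x
  proof -
    have [simp]: "h \<in> Arr C" "Dom C h = A \<odot> B" "Cod C h = T" using h by (auto simp: hom_def)
    note [simp] = T x
    have "h \<cdot> (x \<otimes> Ident C B) = h \<cdot> (x \<otimes> osum B B (\<lambda>j. inc d' j \<cdot> prj d' j) (dlen d'))" by (simp add: dec_complete[OF d(2)])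
    also have "\<dots> = osum (Dom C x \<odot> B) T (\<lambda>j. h \<cdot> (x \<otimes> (inc d' j \<cdot> prj d' j))) (dlen d')"
      by (intro osum_map[where L = "\<lambda>k. h \<cdot> (x \<otimes> k)"]) (auto simp: hom_def ten_add_arr)
    also have "\<dots> = osum (Dom C x \<odot> B) T (\<lambda>j. (h \<cdot> (x \<otimes> inc d' j)) \<cdot> (Ident C (Dom C x) \<otimes> prj d' j)) (dlen d')"
      by (intro osum_cong) (simp add: ten_comp_arr)
    finally show ?thesis .
  qed
  have 2: "f \<cdot> (inc d i \<otimes> Ident C B) = g \<cdot> (inc d i \<otimes> Ident C B)" if i: "i < dlen d" for i
    using 1[OF f(1), of "inc d i"] 1[OF f(2), of "inc d i"] i eq by (auto intro!: osum_cong)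
  have 3: "h = osum (A \<odot> B) T (\<lambda>i. (h \<cdot> (inc d i \<otimes> Ident C B)) \<cdot> (prj d i \<otimes> Ident C B)) (dlen d)"
    if h: "h \<in> hom C (A \<odot> B) T" for h
  proof -
    have [simp]: "h \<in> Arr C" "Dom C h = A \<odot> B" "Cod C h = T" using h by (auto simp: hom_def)
    note [simp] = T
    have "h = h \<cdot> (osum A A (\<lambda>j. inc d j \<cdot> prj d j) (dlen d) \<otimes> Ident C B)" by (simp add: dec_complete[OF d(1)])
    also have "\<dots> = osum (A \<odot> B) T (\<lambda>j. h \<cdot> ((inc d j \<cdot> prj d j) \<otimes> Ident C B)) (dlen d)"
      by (intro osum_map[where L = "\<lambda>k. h \<cdot> (k \<otimes> Ident C B)"]) (auto simp: hom_def ten_add_arr)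
    also have "\<dots> = osum (A \<odot> B) T (\<lambda>i. (h \<cdot> (inc d i \<otimes> Ident C B)) \<cdot> (prj d i \<otimes> Ident C B)) (dlen d)"
      by (intro osum_cong) (simp add: ten_comp_arr)
    finally show ?thesis .
  qed
  have "f = osum (A \<odot> B) T (\<lambda>i. (f \<cdot> (inc d i \<otimes> Ident C B)) \<cdot> (prj d i \<otimes> Ident C B)) (dlen d)"
    by (rule 3[OF f(1)])
  also have "\<dots> = osum (A \<odot> B) T (\<lambda>i. (g \<cdot> (inc d i \<otimes> Ident C B)) \<cdot> (prj d i \<otimes> Ident C B)) (dlen d)"
    by (rule osum_cong) (simp only: 2)
  also have "\<dots> = g" by (rule 3[OF f(2), symmetric])
  finally show ?thesis .
qed

text \<open>The order of summands is that of \<open>ten_basis\<close>, so the labels are literally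
  the tensor product of the label lists. Matrices with respect to these decompositions therefore
  have the sources and targets prescribed by \<open>fib_cat\<close>.\<close>

definition ten_dec :: "'m dec \<Rightarrow> 'm dec \<Rightarrow> 'm dec" where
  "ten_dec d d' = Dec (fib_tenO (lab d) (lab d'))
     (\<lambda>r. case ten_basis (lab d) (lab d') ! r of (i, j, z) \<Rightarrow> (inc d i \<otimes> inc d' j) \<cdot> iota (lab d ! i) (lab d' ! j) z)
     (\<lambda>r. case ten_basis (lab d) (lab d') ! r of (i, j, z) \<Rightarrow> proj (lab d ! i) (lab d' ! j) z \<cdot> (prj d i \<otimes> prj d' j))"

lemma lab_ten_dec [simp]: "lab (ten_dec d d') = fib_tenO (lab d) (lab d')"
  by (simp add: ten_dec_def)

lemma ten_dec_nth:
  assumes "ten_basis (lab d) (lab d') ! r = (i, j, z)"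
  shows "inc (ten_dec d d') r = (inc d i \<otimes> inc d' j) \<cdot> iota (lab d ! i) (lab d' ! j) z"
    "prj (ten_dec d d') r = proj (lab d ! i) (lab d' ! j) z \<cdot> (prj d i \<otimes> prj d' j)"
  using assms by (simp_all add: ten_dec_def)

lemma ten_dec:
  assumes d: "dec d A" "dec d' B"
  shows "dec (ten_dec d d') (A \<odot> B)"
  unfolding is_dec_def
proof (intro conjI allI impI ballI)
  note [simp] = decD[OF d(1)] decD[OF d(2)]
  show "A \<odot> B \<in> Obj C" by simp
  {
    fix r assume "r < dlen (ten_dec d d')"
    then have r: "r < length (ten_basis (lab d) (lab d'))" by simp
    obtain i j z where R: "ten_basis (lab d) (lab d') ! r = (i, j, z)" by (metis prod_cases3)
    note b = ten_basis_nth[OF r R]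
    show "inc (ten_dec d d') r \<in> hom C (S (lab (ten_dec d d') ! r)) (A \<odot> B)"
      "prj (ten_dec d d') r \<in> hom C (A \<odot> B) (S (lab (ten_dec d d') ! r))"
      using b by (simp_all add: ten_dec_nth[OF R] hom_def)
  }
  {
    fix r r' assume "r < dlen (ten_dec d d')" "r' < dlen (ten_dec d d')"
    then have r: "r < length (ten_basis (lab d) (lab d'))" and r': "r' < length (ten_basis (lab d) (lab d'))" by auto
    obtain i j z where R: "ten_basis (lab d) (lab d') ! r = (i, j, z)" by (metis prod_cases3)
    obtain i' j' z' where R': "ten_basis (lab d) (lab d') ! r' = (i', j', z')" by (metis prod_cases3)
    note b = ten_basis_nth[OF r R] and b' = ten_basis_nth[OF r' R']
    have eq: "r = r' \<longleftrightarrow> (i, j, z) = (i', j', z')"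
      using r r' R R' nth_eq_iff_index_eq[of "ten_basis (lab d) (lab d')" r r'] by simp
    have "prj (ten_dec d d') r \<cdot> inc (ten_dec d d') r' =
        proj (lab d ! i) (lab d' ! j) z \<cdot> (((prj d i \<cdot> inc d i') \<otimes> (prj d' j \<cdot> inc d' j')) \<cdot> iota (lab d ! i') (lab d' ! j') z')"
      using b b' by (simp add: ten_dec_nth[OF R] ten_dec_nth[OF R'] ten_comp_arr')
    then show "prj (ten_dec d d') r \<cdot> inc (ten_dec d d') r' =
        (if r = r' then Ident C (S (lab (ten_dec d d') ! r)) else Zero C (S (lab (ten_dec d d') ! r')) (S (lab (ten_dec d d') ! r)))"
      unfolding eq using b b'
      by (cases "i = i'"; cases "j = j'") (auto simp: dec_prj_inc[OF d(1)] dec_prj_inc[OF d(2)] proj_iota)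
  }
  {
    fix T f g assume f: "f \<in> hom C (A \<odot> B) T" and g: "g \<in> hom C (A \<odot> B) T"
      and eq: "\<forall>r<dlen (ten_dec d d'). f \<cdot> inc (ten_dec d d') r = g \<cdot> inc (ten_dec d d') r"
    have [simp]: "f \<in> Arr C" "Dom C f = A \<odot> B" "Cod C f = T" "g \<in> Arr C" "Dom C g = A \<odot> B" "Cod C g = T"
      using f g by (auto simp: hom_def)
    show "f = g"
    proof (rule ten_epi[OF d f g])
      fix i j assume ij: "i < dlen d" "j < dlen d'"
      show "f \<cdot> (inc d i \<otimes> inc d' j) = g \<cdot> (inc d i \<otimes> inc d' j)"
      proof (rule iota_epi)
        show "f \<cdot> (inc d i \<otimes> inc d' j) \<in> hom C (S (lab d ! i) \<odot> S (lab d' ! j)) T"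
          "g \<cdot> (inc d i \<otimes> inc d' j) \<in> hom C (S (lab d ! i) \<odot> S (lab d' ! j)) T" using ij by (auto simp: hom_def)
        fix z assume z: "z \<in> set (fuse (lab d ! i) (lab d' ! j))"
        then have "(i, j, z) \<in> set (ten_basis (lab d) (lab d'))" using ij by (auto simp: set_ten_basis)
        then obtain r where r: "r < length (ten_basis (lab d) (lab d'))" "ten_basis (lab d) (lab d') ! r = (i, j, z)"
          by (metis in_set_conv_nth)
        have "f \<cdot> inc (ten_dec d d') r = g \<cdot> inc (ten_dec d d') r" using eq r by simp
        then show "(f \<cdot> (inc d i \<otimes> inc d' j)) \<cdot> iota (lab d ! i) (lab d' ! j) z = (g \<cdot> (inc d i \<otimes> inc d' j)) \<cdot> iota (lab d ! i) (lab d' ! j) z"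
          using z ij by (simp add: ten_dec_nth[OF r(2)])
      qed
    qed
  }
qed

text \<open>Between two simple summands \<open>f\<close> and \<open>g\<close> are scalars or zero,
  so their tensor product is the product of the scalars, seen through matching inclusions and
  projections of the channel.\<close>

lemma mat_ten:
  assumes d: "dec d A" "dec d' B" "dec e A'" "dec e' B'" and f: "f \<in> hom C A A'" and g: "g \<in> hom C B B'"
  shows "mat (ten_dec d d') (ten_dec e e') (f \<otimes> g) = fib_tenA (mat d e f) (mat d' e' g)"
proof (rule farr_eqI)
  note [simp] = decD[OF d(1)] decD[OF d(2)] decD[OF d(3)] decD[OF d(4)]
  have [simp]: "f \<in> Arr C" "Dom C f = A" "Cod C f = A'" "g \<in> Arr C" "Dom C g = B" "Cod C g = B'"
    using f g by (auto simp: hom_def)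
  fix p q assume "p < length (tgt (fib_tenA (mat d e f) (mat d' e' g)))" "q < length (src (fib_tenA (mat d e f) (mat d' e' g)))"
     "tgt (fib_tenA (mat d e f) (mat d' e' g)) ! p = src (fib_tenA (mat d e f) (mat d' e' g)) ! q"
  then have p: "p < length (ten_basis (lab e) (lab e'))" and q: "q < length (ten_basis (lab d) (lab d'))"
    and l: "fib_tenO (lab e) (lab e') ! p = fib_tenO (lab d) (lab d') ! q" by auto
  obtain i j z where P: "ten_basis (lab e) (lab e') ! p = (i, j, z)" by (metis prod_cases3)
  obtain i' j' z' where Q: "ten_basis (lab d) (lab d') ! q = (i', j', z')" by (metis prod_cases3)
  note b = ten_basis_nth[OF p P] and b' = ten_basis_nth[OF q Q]
  have z: "z' = z" using l b b' by simp
  let ?F = "prj e i \<cdot> (f \<cdot> inc d i')" and ?G = "prj e' j \<cdot> (g \<cdot> inc d' j')"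
  have F: "?F \<in> hom C (S (lab d ! i')) (S (lab e ! i))" and G: "?G \<in> hom C (S (lab d' ! j')) (S (lab e' ! j))"
    using b b' by (auto simp: hom_def)
  have "prj (ten_dec e e') p \<cdot> ((f \<otimes> g) \<cdot> inc (ten_dec d d') q) =
      proj (lab e ! i) (lab e' ! j) z \<cdot> ((?F \<otimes> ?G) \<cdot> iota (lab d ! i') (lab d' ! j') z)" (is "_ = ?R")
    using b b' z by (simp add: ten_dec_nth[OF P] ten_dec_nth[OF Q] ten_comp_arr')
  moreover have "coef ?R = (if lab e ! i = lab d ! i' \<and> lab e' ! j = lab d' ! j' then coef ?F * coef ?G else 0)"
  proof (cases "lab e ! i = lab d ! i' \<and> lab e' ! j = lab d' ! j'")
    case True
    have F': "?F = coef ?F \<bullet> Ident C (S (lab d ! i'))" and G': "?G = coef ?G \<bullet> Ident C (S (lab d' ! j'))"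
      using F G True coef_hom by metis+
    have "?R = (coef ?F * coef ?G) \<bullet> Ident C (S z)"
      apply (subst F', subst G')
      using True b b' z by (simp add: proj_iota mult.commute)
    then show ?thesis using True coef_eqI by auto
  next
    case False
    then have "?F = Zero C (S (lab d ! i')) (S (lab e ! i)) \<or> ?G = Zero C (S (lab d' ! j')) (S (lab e' ! j))"
      using schur_zero F G by metis
    then have "?R = Zero C (S z) (S z)"
      using b b' z F G by (elim disjE) (simp_all add: hom_def)
    then show ?thesis using False by auto
  qed
  ultimately show "entry (mat (ten_dec d d') (ten_dec e e') (f \<otimes> g)) p q = entry (fib_tenA (mat d e f) (mat d' e' g)) p q"
    using p q P Q l z b(1,2) b'(1,2) by (simp add: mat_def[of "ten_dec d d'"] entry_tenA) (simp add: mat_def)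
qed auto

text \<open>The F-symbols (6j-symbols) of the category in the chosen gauge: \<open>s\<close> is the
  channel of the left bracketing, \<open>t\<close> that of the right one, and \<open>w\<close> the
  total.\<close>

definition Fc :: "fib \<Rightarrow> fib \<Rightarrow> fib \<Rightarrow> fib \<Rightarrow> fib \<Rightarrow> fib \<Rightarrow> 'k" where
  "Fc x y z w t s = coef (proj x t w \<cdot> ((Ident C (S x) \<otimes> proj y z t) \<cdot> (Assoc C (S x) (S y) (S z) \<cdot>
     ((iota x y s \<otimes> Ident C (S z)) \<cdot> iota s z w))))"

lemma ten_dec_left:
  assumes d: "dec dA A" "dec dB B" "dec dD E"
    and q: "q < length (ten_basis (fib_tenO (lab dA) (lab dB)) (lab dD))" "lbasis (lab dA) (lab dB) (lab dD) ! q = (i, j, s, l, w)"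
  shows "inc (ten_dec (ten_dec dA dB) dD) q =
    (inc dA i \<otimes> inc dB j \<otimes> inc dD l) \<cdot> ((iota (lab dA ! i) (lab dB ! j) s \<otimes> Ident C (S (lab dD ! l))) \<cdot> iota s (lab dD ! l) w)"
proof -
  note [simp] = decD[OF d(1)] decD[OF d(2)] decD[OF d(3)]
  obtain n where n: "n < length (ten_basis (lab dA) (lab dB))" "ten_basis (fib_tenO (lab dA) (lab dB)) (lab dD) ! q = (n, l, w)"
    "ten_basis (lab dA) (lab dB) ! n = (i, j, s)" using lbasis_nth(7)[OF q] by blast
  note b = lbasis_nth(1-5)[OF q]
  have "fib_tenO (lab dA) (lab dB) ! n = s" using ten_basis_nth(4)[OF n(1,3)] .
  then show ?thesis
    using b ten_dec_nth(1)[of "ten_dec dA dB" dD q n l w] n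
    by (simp add: ten_dec_nth(1)[OF n(3)] ten_comp_arr')
qed

lemma ten_dec_right:
  assumes d: "dec dA A" "dec dB B" "dec dD E"
    and p: "p < length (ten_basis (lab dA) (fib_tenO (lab dB) (lab dD)))" "rbasis (lab dA) (lab dB) (lab dD) ! p = (i, j, l, t, w)"
  shows "prj (ten_dec dA (ten_dec dB dD)) p =
    proj (lab dA ! i) t w \<cdot> ((Ident C (S (lab dA ! i)) \<otimes> proj (lab dB ! j) (lab dD ! l) t) \<cdot> (prj dA i \<otimes> (prj dB j \<otimes> prj dD l)))"
proof -
  note [simp] = decD[OF d(1)] decD[OF d(2)] decD[OF d(3)]
  obtain m where m: "m < length (ten_basis (lab dB) (lab dD))" "ten_basis (lab dA) (fib_tenO (lab dB) (lab dD)) ! p = (i, m, w)"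
    "ten_basis (lab dB) (lab dD) ! m = (j, l, t)" using rbasis_nth(7)[OF p] by blast
  note b = rbasis_nth(1-5)[OF p]
  have "fib_tenO (lab dB) (lab dD) ! m = t" using ten_basis_nth(4)[OF m(1,3)] .
  then show ?thesis
    using b ten_dec_nth(2)[of dA "ten_dec dB dD" p i m w] m
    by (simp add: ten_dec_nth(2)[OF m(3)] ten_comp_arr)
qed

text \<open>Naturality carries the three inclusions across the constraint. They then meet the
  projections, which leaves the constraint on simple objects if the positions agree and zero
  otherwise.\<close>

lemma mat_assoc:
  assumes d: "dec dA A" "dec dB B" "dec dD E"
  shows "mat (ten_dec (ten_dec dA dB) dD) (ten_dec dA (ten_dec dB dD)) (Assoc C A B E) = gen_assoc Fc (lab dA) (lab dB) (lab dD)"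
proof (rule farr_eqI)
  note [simp] = decD[OF d(1)] decD[OF d(2)] decD[OF d(3)]
  let ?M = "gen_assoc Fc (lab dA) (lab dB) (lab dD)"
  fix p q assume "p < length (tgt ?M)" "q < length (src ?M)" "tgt ?M ! p = src ?M ! q"
  then have p: "p < length (ten_basis (lab dA) (fib_tenO (lab dB) (lab dD)))"
    and q: "q < length (ten_basis (fib_tenO (lab dA) (lab dB)) (lab dD))"
    and eq: "fib_tenO (lab dA) (fib_tenO (lab dB) (lab dD)) ! p = fib_tenO (fib_tenO (lab dA) (lab dB)) (lab dD) ! q" by auto
  obtain i j l t w where P: "rbasis (lab dA) (lab dB) (lab dD) ! p = (i, j, l, t, w)" by (rule rbasis_ex)
  obtain i' j' s l' w' where Q: "lbasis (lab dA) (lab dB) (lab dD) ! q = (i', j', s, l', w')" by (rule lbasis_ex)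
  note b = rbasis_nth(1-6)[OF p P] and b' = lbasis_nth(1-6)[OF q Q]
  have w: "w' = w" using eq b b' by simp
  let ?x = "lab dA ! i" and ?y = "lab dB ! j" and ?z = "lab dD ! l"
  let ?x' = "lab dA ! i'" and ?y' = "lab dB ! j'" and ?z' = "lab dD ! l'"
  define P I where "P = proj ?x t w \<cdot> (Ident C (S ?x) \<otimes> proj ?y ?z t)" and "I = (iota ?x' ?y' s \<otimes> Ident C (S ?z')) \<cdot> iota s ?z' w"
  have I [simp]: "I \<in> Arr C" "Dom C I = S w" "Cod C I = S ?x' \<odot> S ?y' \<odot> S ?z'"
    and P' [simp]: "P \<in> Arr C" "Dom C P = S ?x \<odot> (S ?y \<odot> S ?z)" "Cod C P = S w"
    using b b' w by (simp_all add: I_def P_def)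
  have nat: "Assoc C A B E \<cdot> ((inc dA i' \<otimes> inc dB j' \<otimes> inc dD l') \<cdot> h) =
      (inc dA i' \<otimes> (inc dB j' \<otimes> inc dD l')) \<cdot> (Assoc C (S ?x') (S ?y') (S ?z') \<cdot> h)"
    if "h \<in> Arr C" "Cod C h = S ?x' \<odot> S ?y' \<odot> S ?z'" for h
    using that b' comp_cancel[OF assoc_nat[of "inc dA i'" "inc dB j'" "inc dD l'" A B E], of h] by simp
  have "prj (ten_dec dA (ten_dec dB dD)) p \<cdot> (Assoc C A B E \<cdot> inc (ten_dec (ten_dec dA dB) dD) q) =
      P \<cdot> (((prj dA i \<cdot> inc dA i') \<otimes> ((prj dB j \<cdot> inc dB j') \<otimes> (prj dD l \<cdot> inc dD l'))) \<cdot> (Assoc C (S ?x') (S ?y') (S ?z') \<cdot> I))" (is "_ = ?R")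
  proof -
    have "prj (ten_dec dA (ten_dec dB dD)) p = P \<cdot> (prj dA i \<otimes> (prj dB j \<otimes> prj dD l))"
      using b by (simp add: ten_dec_right[OF d p P] P_def)
    moreover have "inc (ten_dec (ten_dec dA dB) dD) q = (inc dA i' \<otimes> inc dB j' \<otimes> inc dD l') \<cdot> I"
      using b' w by (simp add: ten_dec_left[OF d q Q] I_def)
    ultimately show ?thesis using b b' by (simp add: nat ten_comp_arr' ten_comp_arr)
  qed
  moreover have "coef ?R = (if i = i' \<and> j = j' \<and> l = l' then Fc ?x ?y ?z w t s else 0)"
  proof (cases "i = i' \<and> j = j' \<and> l = l'")
    case True
    then show ?thesis using b b' w by (simp add: dec_prj_inc[OF d(1)] dec_prj_inc[OF d(2)] dec_prj_inc[OF d(3)] Fc_def P_def I_def)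
  next
    case False
    have "?R = Zero C (S w) (S w)" using False b b' w
      by (cases "i = i'"; cases "j = j'"; cases "l = l'") (simp_all add: dec_prj_inc[OF d(1)] dec_prj_inc[OF d(2)] dec_prj_inc[OF d(3)])
    then show ?thesis using False by auto
  qed
  ultimately show "entry (mat (ten_dec (ten_dec dA dB) dD) (ten_dec dA (ten_dec dB dD)) (Assoc C A B E)) p q = entry ?M p q"
    using p q eq w entry_gen_assoc(1)[OF p q P Q, of Fc] by (simp add: mat_def)
qed auto

definition unit_dec :: "fib \<Rightarrow> 'm dec" where
  "unit_dec x = Dec [x] (\<lambda>_. Ident C (S x)) (\<lambda>_. Ident C (S x))"

lemma lab_unit_dec [simp]: "lab (unit_dec x) = [x]"
  by (simp add: unit_dec_def)

lemma unit_dec: "dec (unit_dec x) (S x)"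
  unfolding is_dec_def unit_dec_def by (auto simp: hom_def)

lemma mat_lunit:
  assumes d: "dec d A"
  shows "mat (ten_dec (unit_dec One) d) d (LUnit C A) = fib_ident (lab d)"
proof (rule farr_eqI)
  note [simp] = decD[OF d]
  fix p q assume "p < length (tgt (fib_ident (lab d)))" "q < length (src (fib_ident (lab d)))" "tgt (fib_ident (lab d)) ! p = src (fib_ident (lab d)) ! q"
  then have p: "p < dlen d" and q: "q < dlen d" and l: "lab d ! p = lab d ! q" by auto
  have Q: "ten_basis (lab (unit_dec One)) (lab d) ! q = (0, q, lab d ! q)" using q by (simp add: ten_basis_One)
  have nat: "LUnit C A \<cdot> ((Ident C (Unit C) \<otimes> inc d q) \<cdot> h) = inc d q \<cdot> (LUnit C (S (lab d ! q)) \<cdot> h)"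
    if "h \<in> Arr C" "Cod C h = Unit C \<odot> S (lab d ! q)" for h
    using that comp_cancel[OF unit_nat(1)[of "inc d q" "S (lab d ! q)" A], of h] q by simp
  have "prj d p \<cdot> (LUnit C A \<cdot> inc (ten_dec (unit_dec One) d) q) = prj d p \<cdot> inc d q"
    using q p by (simp add: ten_dec_nth(1)[OF Q] iota_def S_One nat) (simp add: unit_dec_def iota_def S_One nat)
  then show "entry (mat (ten_dec (unit_dec One) d) d (LUnit C A)) p q = entry (fib_ident (lab d)) p q"
    using p q l by (simp add: mat_def dec_prj_inc[OF d])
qed auto

text \<open>The hypothesis \<open>lr\<close> is used at a summand \<open>One\<close>: there
  \<open>iota\<close> was defined through the left constraint, while the right one has to cancel
  it.\<close>

lemma mat_runit:
  assumes d: "dec d A" and lr: "LUnit C (Unit C) = RUnit C (Unit C)"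
  shows "mat (ten_dec d (unit_dec One)) d (RUnit C A) = fib_ident (lab d)"
proof (rule farr_eqI)
  note [simp] = decD[OF d]
  fix p q assume "p < length (tgt (fib_ident (lab d)))" "q < length (src (fib_ident (lab d)))" "tgt (fib_ident (lab d)) ! p = src (fib_ident (lab d)) ! q"
  then have p: "p < dlen d" and q: "q < dlen d" and l: "lab d ! p = lab d ! q" by auto
  have Q: "ten_basis (lab d) (lab (unit_dec One)) ! q = (q, 0, lab d ! q)" using q by (simp add: ten_basis_One)
  have nat: "RUnit C A \<cdot> ((inc d q \<otimes> Ident C (Unit C)) \<cdot> h) = inc d q \<cdot> (RUnit C (S (lab d ! q)) \<cdot> h)"
    if "h \<in> Arr C" "Cod C h = S (lab d ! q) \<odot> Unit C" for h
    using that comp_cancel[OF unit_nat(2)[of "inc d q" "S (lab d ! q)" A], of h] q by simp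
  have io: "iota x One x = inv_arr C (RUnit C (S x))" for x
    using lr by (cases x) (auto simp: iota_def S_One)
  have "prj d p \<cdot> (RUnit C A \<cdot> inc (ten_dec d (unit_dec One)) q) = prj d p \<cdot> inc d q"
    using q p by (simp add: ten_dec_nth(1)[OF Q] io S_One) (simp add: unit_dec_def io S_One nat)
  then show "entry (mat (ten_dec d (unit_dec One)) d (RUnit C A)) p q = entry (fib_ident (lab d)) p q"
    using p q l by (simp add: mat_def dec_prj_inc[OF d])
qed auto

end

section \<open>Braiding and twist as matrices\<close>

locale braided_frame = fib_frame C S iX pX + balanced_category C
  for C :: "('o, 'm, 'k :: field, 'x) balcat_scheme" (structure) and S :: "fib \<Rightarrow> 'o" and iX pX
begin

lemma braid_arr [simp]:
  assumes "A \<in> Obj C" "B \<in> Obj C"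
  shows "Braid C A B \<in> Arr C" "Dom C (Braid C A B) = A \<odot> B" "Cod C (Braid C A B) = B \<odot> A"
  using braid_hom[OF assms] by (auto simp: hom_def)

lemma braid_nat:
  assumes "f \<in> Arr C" "g \<in> Arr C" "Cod C f = A" "Cod C g = B"
  shows "Braid C A B \<cdot> (f \<otimes> g) = (g \<otimes> f) \<cdot> Braid C (Dom C f) (Dom C g)"
  using braid_natural[of f "Dom C f" "Cod C f" g "Dom C g" "Cod C g"] assms by (auto simp: hom_def)

lemma twist_arr [simp]:
  assumes "A \<in> Obj C"
  shows "Twist C A \<in> Arr C" "Dom C (Twist C A) = A" "Cod C (Twist C A) = A"
  using twist_hom[OF assms] by (auto simp: hom_def)

lemma twist_nat: "f \<in> Arr C \<Longrightarrow> Dom C f = A \<Longrightarrow> Cod C f = B \<Longrightarrow> Twist C B \<cdot> f = f \<cdot> Twist C A"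
  using twist_natural[of f A B] by (auto simp: hom_def)

text \<open>The R-symbols in the chosen gauge.\<close>

definition Rc :: "fib \<Rightarrow> fib \<Rightarrow> fib \<Rightarrow> 'k" where
  "Rc x y z = coef (proj y x z \<cdot> (Braid C (S x) (S y) \<cdot> iota x y z))"

definition Tc :: "fib \<Rightarrow> 'k" where
  "Tc x = coef (Twist C (S x))"

lemma mat_braid:
  assumes d: "dec dA A" "dec dB B"
  shows "mat (ten_dec dA dB) (ten_dec dB dA) (Braid C A B) = gen_braid Rc (lab dA) (lab dB)"
proof (rule farr_eqI)
  note [simp] = decD[OF d(1)] decD[OF d(2)]
  let ?M = "gen_braid Rc (lab dA) (lab dB)"
  fix p q assume "p < length (tgt ?M)" "q < length (src ?M)" "tgt ?M ! p = src ?M ! q"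
  then have p: "p < length (ten_basis (lab dB) (lab dA))" and q: "q < length (ten_basis (lab dA) (lab dB))"
    and l: "fib_tenO (lab dB) (lab dA) ! p = fib_tenO (lab dA) (lab dB) ! q" by auto
  obtain i j z where P: "ten_basis (lab dB) (lab dA) ! p = (j, i, z)" by (metis prod_cases3)
  obtain i' j' z' where Q: "ten_basis (lab dA) (lab dB) ! q = (i', j', z')" by (metis prod_cases3)
  note b = ten_basis_nth[OF p P] and b' = ten_basis_nth[OF q Q]
  have z: "z' = z" using l b b' by simp
  have nat: "Braid C A B \<cdot> ((inc dA i' \<otimes> inc dB j') \<cdot> h) = (inc dB j' \<otimes> inc dA i') \<cdot> (Braid C (S (lab dA ! i')) (S (lab dB ! j')) \<cdot> h)"
    if "h \<in> Arr C" "Cod C h = S (lab dA ! i') \<odot> S (lab dB ! j')" for h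
    using that comp_cancel[OF braid_nat[of "inc dA i'" "inc dB j'" A B], of h] b' by simp
  have "prj (ten_dec dB dA) p \<cdot> (Braid C A B \<cdot> inc (ten_dec dA dB) q) =
      proj (lab dB ! j) (lab dA ! i) z \<cdot> (((prj dB j \<cdot> inc dB j') \<otimes> (prj dA i \<cdot> inc dA i')) \<cdot>
         (Braid C (S (lab dA ! i')) (S (lab dB ! j')) \<cdot> iota (lab dA ! i') (lab dB ! j') z))" (is "_ = ?R")
    using b b' z by (simp add: ten_dec_nth(1)[OF Q] ten_dec_nth(2)[OF P] nat ten_comp_arr')
  moreover have "coef ?R = (if i = i' \<and> j = j' then Rc (lab dA ! i) (lab dB ! j) z else 0)"
  proof (cases "i = i' \<and> j = j'")
    case True
    then show ?thesis using b b' z by (simp add: dec_prj_inc[OF d(1)] dec_prj_inc[OF d(2)] Rc_def)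
  next
    case False
    have "?R = Zero C (S z) (S z)" using False b b' z
      by (cases "i = i'"; cases "j = j'") (simp_all add: dec_prj_inc[OF d(1)] dec_prj_inc[OF d(2)])
    then show ?thesis using False by auto
  qed
  ultimately show "entry (mat (ten_dec dA dB) (ten_dec dB dA) (Braid C A B)) p q = entry ?M p q"
    using p q l z entry_gen_braid[OF p q P Q, of Rc] by (simp add: mat_def)
qed auto

lemma mat_twist:
  assumes d: "dec d A"
  shows "mat d d (Twist C A) = gen_twist Tc (lab d)"
proof (rule farr_eqI)
  note [simp] = decD[OF d]
  let ?M = "gen_twist Tc (lab d)"
  fix p q assume "p < length (tgt ?M)" "q < length (src ?M)" "tgt ?M ! p = src ?M ! q"
  then have p: "p < dlen d" and q: "q < dlen d" and l: "lab d ! p = lab d ! q" by auto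
  have "prj d p \<cdot> (Twist C A \<cdot> inc d q) = (prj d p \<cdot> inc d q) \<cdot> Twist C (S (lab d ! q))"
    using p q twist_nat[of "inc d q" "S (lab d ! q)" A] by simp
  then show "entry (mat d d (Twist C A)) p q = entry ?M p q"
    using p q l by (simp add: mat_def dec_prj_inc[OF d] gen_twist_def Tc_def)
qed auto

end

section \<open>The equations satisfied by the structure constants\<close>

context fib_frame
begin

text \<open>Each vertex of the pentagon gets the tensor decomposition that follows its bracketing.
  Relative to these, every edge has the matrix of a single constraint, and the equality of the two
  paths becomes an equality of matrix products.\<close>

lemma Fc_pentagon: "pentagon_at Fc x y z v"
proof -
  note u = unit_dec
  note [simp] = S_obj
  have "mat (ten_dec (ten_dec (ten_dec (unit_dec x) (unit_dec y)) (unit_dec z)) (unit_dec v)) (ten_dec (unit_dec x) (ten_dec (unit_dec y) (ten_dec (unit_dec z) (unit_dec v))))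
      (Assoc C (S x) (S y) (S z \<odot> S v) \<cdot> Assoc C (S x \<odot> S y) (S z) (S v)) =
    mat (ten_dec (ten_dec (ten_dec (unit_dec x) (unit_dec y)) (unit_dec z)) (unit_dec v)) (ten_dec (unit_dec x) (ten_dec (unit_dec y) (ten_dec (unit_dec z) (unit_dec v))))
      (((Ident C (S x) \<otimes> Assoc C (S y) (S z) (S v)) \<cdot> Assoc C (S x) (S y \<odot> S z) (S v)) \<cdot> (Assoc C (S x) (S y) (S z) \<otimes> Ident C (S v)))"
    by (subst pentagon) simp_all
  also have "mat (ten_dec (ten_dec (ten_dec (unit_dec x) (unit_dec y)) (unit_dec z)) (unit_dec v)) (ten_dec (unit_dec x) (ten_dec (unit_dec y) (ten_dec (unit_dec z) (unit_dec v))))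
      (Assoc C (S x) (S y) (S z \<odot> S v) \<cdot> Assoc C (S x \<odot> S y) (S z) (S v)) =
     fib_comp (gen_assoc Fc [x] [y] (fib_tenO [z] [v])) (gen_assoc Fc (fib_tenO [x] [y]) [z] [v])"
    using mat_comp[of "ten_dec (ten_dec (ten_dec (unit_dec x) (unit_dec y)) (unit_dec z)) (unit_dec v)" _ "ten_dec (ten_dec (unit_dec x) (unit_dec y)) (ten_dec (unit_dec z) (unit_dec v))" _
        "ten_dec (unit_dec x) (ten_dec (unit_dec y) (ten_dec (unit_dec z) (unit_dec v)))"]
      mat_assoc[OF u u ten_dec[OF u u], of x y z v] mat_assoc[OF ten_dec[OF u u] u u, of x y z v]
    by (simp add: ten_dec u hom_def)
  also have "mat (ten_dec (ten_dec (ten_dec (unit_dec x) (unit_dec y)) (unit_dec z)) (unit_dec v)) (ten_dec (unit_dec x) (ten_dec (unit_dec y) (ten_dec (unit_dec z) (unit_dec v))))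
      (((Ident C (S x) \<otimes> Assoc C (S y) (S z) (S v)) \<cdot> Assoc C (S x) (S y \<odot> S z) (S v)) \<cdot> (Assoc C (S x) (S y) (S z) \<otimes> Ident C (S v))) =
     fib_comp (fib_comp (fib_tenA (fib_ident [x]) (gen_assoc Fc [y] [z] [v])) (gen_assoc Fc [x] (fib_tenO [y] [z]) [v]))
       (fib_tenA (gen_assoc Fc [x] [y] [z]) (fib_ident [v]))"
  proof -
    let ?d0 = "ten_dec (ten_dec (ten_dec (unit_dec x) (unit_dec y)) (unit_dec z)) (unit_dec v)"
    let ?d1 = "ten_dec (ten_dec (unit_dec x) (ten_dec (unit_dec y) (unit_dec z))) (unit_dec v)"
    let ?d2 = "ten_dec (unit_dec x) (ten_dec (ten_dec (unit_dec y) (unit_dec z)) (unit_dec v))"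
    let ?d3 = "ten_dec (unit_dec x) (ten_dec (unit_dec y) (ten_dec (unit_dec z) (unit_dec v)))"
    have D: "dec ?d0 (S x \<odot> S y \<odot> S z \<odot> S v)" "dec ?d1 (S x \<odot> (S y \<odot> S z) \<odot> S v)"
      "dec ?d2 (S x \<odot> ((S y \<odot> S z) \<odot> S v))" "dec ?d3 (S x \<odot> (S y \<odot> (S z \<odot> S v)))"
      by (intro ten_dec u)+
    have 1: "mat ?d0 ?d1 (Assoc C (S x) (S y) (S z) \<otimes> Ident C (S v)) = fib_tenA (gen_assoc Fc [x] [y] [z]) (fib_ident [v])"
      using mat_ten[OF ten_dec[OF ten_dec[OF u u] u] u ten_dec[OF u ten_dec[OF u u]] u, of "Assoc C (S x) (S y) (S z)" x y z x y z "Ident C (S v)" v v]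
        mat_assoc[OF u u u, of x y z] mat_ident[OF u, of v] by (simp add: hom_def)
    have 2: "mat ?d1 ?d2 (Assoc C (S x) (S y \<odot> S z) (S v)) = gen_assoc Fc [x] (fib_tenO [y] [z]) [v]"
      using mat_assoc[OF u ten_dec[OF u u] u, of x y z v] by simp
    have 3: "mat ?d2 ?d3 (Ident C (S x) \<otimes> Assoc C (S y) (S z) (S v)) = fib_tenA (fib_ident [x]) (gen_assoc Fc [y] [z] [v])"
      using mat_ten[OF u ten_dec[OF ten_dec[OF u u] u] u ten_dec[OF u ten_dec[OF u u]], of "Ident C (S x)" x x "Assoc C (S y) (S z) (S v)" y z v y z v]
        mat_assoc[OF u u u, of y z v] mat_ident[OF u, of x] by (simp add: hom_def)
    show ?thesis
      using mat_comp[OF D(1,2,4), of "Assoc C (S x) (S y) (S z) \<otimes> Ident C (S v)"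
          "(Ident C (S x) \<otimes> Assoc C (S y) (S z) (S v)) \<cdot> Assoc C (S x) (S y \<odot> S z) (S v)"]
        mat_comp[OF D(2,3,4), of "Assoc C (S x) (S y \<odot> S z) (S v)" "Ident C (S x) \<otimes> Assoc C (S y) (S z) (S v)"]
      by (simp add: hom_def 1 2 3)
  qed
  finally show ?thesis by (simp add: pentagon_at_def)
qed

lemma Fc_left_inverse: "\<exists>N. farr N \<and> src N = fib_tenO [x] (fib_tenO [y] [z]) \<and> tgt N = fib_tenO (fib_tenO [x] [y]) [z] \<and>
    fib_comp N (gen_assoc Fc [x] [y] [z]) = fib_ident (fib_tenO (fib_tenO [x] [y]) [z])"
proof -
  note u = unit_dec
  let ?d0 = "ten_dec (ten_dec (unit_dec x) (unit_dec y)) (unit_dec z)" and ?d1 = "ten_dec (unit_dec x) (ten_dec (unit_dec y) (unit_dec z))"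
  have D: "dec ?d0 (S x \<odot> S y \<odot> S z)" "dec ?d1 (S x \<odot> (S y \<odot> S z))" by (intro ten_dec u)+
  have iso: "iso_arr C (Assoc C (S x) (S y) (S z))" by (intro assoc_iso) auto
  show ?thesis
    using mat_comp[OF D(1,2,1), of "Assoc C (S x) (S y) (S z)" "inv_arr C (Assoc C (S x) (S y) (S z))"]
      inv_arr[OF iso] mat_assoc[OF u u u, of x y z] mat_ident[OF D(1)]
    by (intro exI[of _ "mat ?d1 ?d0 (inv_arr C (Assoc C (S x) (S y) (S z)))"]) (simp add: hom_def)
qed

text \<open>If one factor is the unit, there is only one intermediate channel for each total
  \<open>w\<close>. The blocks of the invertible matrix are then 1 by 1, so their entries are
  nonzero.\<close>

lemma Fc_nonzero:
  assumes "x = One \<or> y = One \<or> z = One" "s \<in> set (fuse x y)" "w \<in> set (fuse s z)" "t \<in> set (fuse y z)" "w \<in> set (fuse x t)"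
  shows "Fc x y z w t s \<noteq> 0"
proof -
  obtain N where N: "farr N" "src N = fib_tenO [x] (fib_tenO [y] [z])" "tgt N = fib_tenO (fib_tenO [x] [y]) [z]"
    and e: "fib_comp N (gen_assoc Fc [x] [y] [z]) = fib_ident (fib_tenO (fib_tenO [x] [y]) [z])"
    using Fc_left_inverse by blast
  show ?thesis
    using assms N e by (cases x; cases y; cases z; auto simp: matrix_eval)
qed

text \<open>The triangle replaces the associator with the left constraint by the right constraint at
  the unit, so the coefficient measures the ratio of the two.\<close>

lemma Fc_unit_ratio:
  assumes r: "RUnit C (Unit C) = r \<bullet> LUnit C (Unit C)"
  shows "Fc One One z z z One = r"
proof -
  have [simp]: "Unit C = S One" by (simp add: S_One)
  have tri: "(Ident C (S One) \<otimes> LUnit C (S z)) \<cdot> (Assoc C (S One) (S One) (S z) \<cdot> h) = (RUnit C (S One) \<otimes> Ident C (S z)) \<cdot> h"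
    if "h \<in> Arr C" "Cod C h = S One \<odot> S One \<odot> S z" for h
    using that comp_cancel[OF triangle[of "S One" "S z"], of h] by simp
  show ?thesis unfolding Fc_def
    by (rule coef_eqI[of _ _ z]) (use r in \<open>simp add: proj_def iota_def tri ten_comp_arr'\<close>)
qed

text \<open>By Schur the two constraints at the unit differ by a scalar \<open>r\<close>, which is
  the associator coefficient on units. The pentagon on four units has two such factors on one side
  and three on the other; as \<open>r\<close> is nonzero, \<open>r = 1\<close>.\<close>

lemma unit_constraints: "LUnit C (Unit C) = RUnit C (Unit C)"
proof -
  have [simp]: "Unit C = S One" by (simp add: S_One)
  have "RUnit C (S One) \<cdot> inv_arr C (LUnit C (S One)) \<in> hom C (S One) (S One)" by (simp add: hom_def)
  then obtain r where "RUnit C (S One) \<cdot> inv_arr C (LUnit C (S One)) = r \<bullet> Ident C (S One)" using schur_scalar by blast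
  then have "(RUnit C (S One) \<cdot> inv_arr C (LUnit C (S One))) \<cdot> LUnit C (S One) = (r \<bullet> Ident C (S One)) \<cdot> LUnit C (S One)" by simp
  then have r: "RUnit C (S One) = r \<bullet> LUnit C (S One)" by simp
  have F: "Fc One One One One One One = r" using Fc_unit_ratio[of r One] r by simp
  have "r \<noteq> 0" using Fc_nonzero[of One One One One One One] F by simp
  moreover have "r * r = r * r * r" using Fc_pentagon[of One One One One] F by (simp add: pentagon_at_def matrix_eval)
  ultimately have "r = 1" by simp
  then show ?thesis using r by simp
qed

lemma iota_unit_right: "iota x One x = inv_arr C (RUnit C (S x))" "proj x One x = RUnit C (S x)"
  using unit_constraints by (cases x; auto simp: iota_def proj_def S_One)+

lemma Fc_middle: "w \<in> set (fuse x z) \<Longrightarrow> Fc x One z w z x = 1"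
proof -
  assume w: "w \<in> set (fuse x z)"
  have [simp]: "Unit C = S One" by (simp add: S_One)
  have tri: "(Ident C (S x) \<otimes> LUnit C (S z)) \<cdot> (Assoc C (S x) (S One) (S z) \<cdot> h) = (RUnit C (S x) \<otimes> Ident C (S z)) \<cdot> h"
    if "h \<in> Arr C" "Cod C h = S x \<odot> S One \<odot> S z" for h
    using that comp_cancel[OF triangle[of "S x" "S z"], of h] by simp
  have p: "proj One z z = LUnit C (S z)" by (simp add: proj_def)
  show ?thesis unfolding Fc_def
    by (rule coef_eqI[of _ _ w]) (use w in \<open>simp add: p iota_unit_right tri ten_comp_arr' proj_iota\<close>)
qed

text \<open>In a pentagon with two adjacent units at one end, the coefficients with a unit in the
  middle are 1, and what remains says that the wanted coefficient is idempotent. It is also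
  nonzero.\<close>

lemma Fc_left_right:
  assumes "w \<in> set (fuse y z)"
  shows "Fc One y z w w y = 1" "Fc y z One w z w = 1"
proof -
  have m [simp]: "Fc One One One One One One = 1" "Fc One One Tau Tau Tau One = 1" "Fc Tau One One Tau One Tau = 1"
    "Fc Tau One Tau One Tau Tau = 1" "Fc Tau One Tau Tau Tau Tau = 1"
    using Fc_middle[of One One One] Fc_middle[of Tau One Tau] Fc_middle[of Tau Tau One] Fc_middle[of One Tau Tau] Fc_middle[of Tau Tau Tau]
    by simp_all
  have nz: "Fc One y z w w y \<noteq> 0" "Fc y z One w z w \<noteq> 0"
    using assms by (intro Fc_nonzero; simp)+
  have "Fc One y z w w y * Fc One y z w w y = Fc One y z w w y"
    using Fc_pentagon[of One One y z] nz assms by (cases y; cases z; auto simp: pentagon_at_def matrix_eval)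
  then show "Fc One y z w w y = 1" using nz by simp
  have "Fc y z One w z w * Fc y z One w z w = Fc y z One w z w"
    using Fc_pentagon[of y z One One] nz assms by (cases y; cases z; auto simp: pentagon_at_def matrix_eval)
  then show "Fc y z One w z w = 1" using nz by simp
qed

lemma Fc_unit:
  assumes "x = One \<or> y = One \<or> z = One" "s \<in> set (fuse x y)" "w \<in> set (fuse s z)" "t \<in> set (fuse y z)" "w \<in> set (fuse x t)"
  shows "Fc x y z w t s = 1"
  using assms(1)
proof (elim disjE)
  assume "x = One" then show ?thesis using assms Fc_left_right(1)[of w y z] by simp
next
  assume "y = One" then show ?thesis using assms Fc_middle[of w x z] by (cases x) auto
next
  assume "z = One" then show ?thesis using assms Fc_left_right(2)[of w x y] by (cases y) auto
qed

text \<open>The block of the associator on the channel \<open>X\<close> has rows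
  \<open>(p, q)\<close> and \<open>(r, s)\<close>, ordered with \<open>Tau\<close> before
  \<open>One\<close>, and \<open>g\<close> is the 1 by 1 block on the unit channel. Only the product
  of \<open>q\<close> and \<open>r\<close> is determined, since rescaling the inclusion of the unit
  into \<open>X\<close> \<otimes> \<open>X\<close> changes them separately.\<close>

lemma Fc_solution:
  defines "p \<equiv> Fc Tau Tau Tau Tau Tau Tau" and "q \<equiv> Fc Tau Tau Tau Tau Tau One"
    and "r \<equiv> Fc Tau Tau Tau Tau One Tau" and "s \<equiv> Fc Tau Tau Tau Tau One One" and "g \<equiv> Fc Tau Tau Tau One Tau Tau"
  shows "g = 1" "s = - p" "q * r = - p" "p * p = p + 1" "p \<noteq> 0" "q \<noteq> 0"
proof -
  have f: "Fc Tau Tau One One Tau One = 1" "Fc Tau Tau One Tau Tau Tau = 1" "Fc Tau One Tau One Tau Tau = 1"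
     "Fc Tau One Tau Tau Tau Tau = 1" "Fc One Tau Tau One One Tau = 1" "Fc One Tau Tau Tau Tau Tau = 1"
    by (rule Fc_unit; simp)+
  have "pentagon_at Fc Tau Tau Tau Tau \<longleftrightarrow> s * s + r * g * q = 1 \<and> s * r + r * g * p = 0 \<and> s * s + r * p * q = 0 \<and> s = r * q * g \<and>
     r = s * r + r * p * p \<and> s = g * r * q \<and> r * q = g * s * g \<and> (p = 0 \<or> r = 0 \<or> g = 1) \<and>
     q * s + p * g * q = 0 \<and> g * g = q * r + p * g * p \<and> q = q * s + p * p * q \<and>
     (p = 0 \<or> q = 0 \<or> g = 1) \<and> p * p = q * r + p * p * p"
    by (simp add: pentagon_at_def matrix_eval f p_def[symmetric] q_def[symmetric] r_def[symmetric] s_def[symmetric] g_def[symmetric])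
  with Fc_pentagon[of Tau Tau Tau Tau]
  have e: "s * s + r * g * q = 1" "s = r * q * g" "q * s + p * g * q = 0" "p = 0 \<or> r = 0 \<or> g = 1" by blast+
  \<comment> \<open>If \<open>s = 0\<close>, then \<open>r q g = 0\<close> by the second equation,
    while the first one says that this product is 1.\<close>
  have s0: "s \<noteq> 0" using e(1,2) by auto
  then show q0: "q \<noteq> 0" using e(2) by auto
  have r0: "r \<noteq> 0" using s0 e(2) by auto
  have "q * (s + p * g) = 0" using e(3) by (simp add: algebra_simps)
  then have sp: "s = - (p * g)" using q0 by (simp add: add_eq_0_iff)
  then show p0: "p \<noteq> 0" using s0 by auto
  then show g1: "g = 1" using r0 e(4) by blast
  then show sp': "s = - p" using sp by simp
  then show rq: "q * r = - p" using e(2) g1 by (simp add: mult.commute)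
  have "(- p) * (- p) + - p = 1" using e(1) sp' rq g1 by (simp add: mult.commute)
  then show "p * p = p + 1" by (simp add: algebra_simps)
qed

end

context braided_frame
begin

lemma Rc_hexagon: "hexagon_right_at Fc Rc x y z"
proof -
  note u = unit_dec
  let ?d0 = "ten_dec (ten_dec (unit_dec x) (unit_dec y)) (unit_dec z)"
  let ?d1 = "ten_dec (unit_dec x) (ten_dec (unit_dec y) (unit_dec z))"
  let ?d2 = "ten_dec (ten_dec (unit_dec y) (unit_dec z)) (unit_dec x)"
  let ?d3 = "ten_dec (unit_dec y) (ten_dec (unit_dec z) (unit_dec x))"
  let ?e1 = "ten_dec (ten_dec (unit_dec y) (unit_dec x)) (unit_dec z)"
  let ?e2 = "ten_dec (unit_dec y) (ten_dec (unit_dec x) (unit_dec z))"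
  have D: "dec ?d0 (S x \<odot> S y \<odot> S z)" "dec ?d1 (S x \<odot> (S y \<odot> S z))" "dec ?d2 (S y \<odot> S z \<odot> S x)" "dec ?d3 (S y \<odot> (S z \<odot> S x))"
    "dec ?e1 (S y \<odot> S x \<odot> S z)" "dec ?e2 (S y \<odot> (S x \<odot> S z))" by (intro ten_dec u)+
  have l: "mat ?d0 ?d3 (Assoc C (S y) (S z) (S x) \<cdot> Braid C (S x) (S y \<odot> S z) \<cdot> Assoc C (S x) (S y) (S z)) =
     fib_comp (fib_comp (gen_assoc Fc [y] [z] [x]) (gen_braid Rc [x] (fib_tenO [y] [z]))) (gen_assoc Fc [x] [y] [z])"
    using mat_comp[OF D(1,2,4), of "Assoc C (S x) (S y) (S z)" "Assoc C (S y) (S z) (S x) \<cdot> Braid C (S x) (S y \<odot> S z)"]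
      mat_comp[OF D(2,3,4), of "Braid C (S x) (S y \<odot> S z)" "Assoc C (S y) (S z) (S x)"]
      mat_assoc[OF u u u, of x y z] mat_assoc[OF u u u, of y z x] mat_braid[OF u ten_dec[OF u u], of x y z]
    by (simp add: hom_def)
  have r: "mat ?d0 ?d3 ((Ident C (S y) \<otimes> Braid C (S x) (S z)) \<cdot> Assoc C (S y) (S x) (S z) \<cdot> (Braid C (S x) (S y) \<otimes> Ident C (S z))) =
     fib_comp (fib_comp (fib_tenA (fib_ident [y]) (gen_braid Rc [x] [z])) (gen_assoc Fc [y] [x] [z]))
       (fib_tenA (gen_braid Rc [x] [y]) (fib_ident [z]))"
  proof -
    have 1: "mat ?d0 ?e1 (Braid C (S x) (S y) \<otimes> Ident C (S z)) = fib_tenA (gen_braid Rc [x] [y]) (fib_ident [z])"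
      using mat_ten[OF ten_dec[OF u u] u ten_dec[OF u u] u, of "Braid C (S x) (S y)" x y y x "Ident C (S z)" z z]
        mat_braid[OF u u, of x y] mat_ident[OF u, of z] by (simp add: hom_def)
    have 2: "mat ?e2 ?d3 (Ident C (S y) \<otimes> Braid C (S x) (S z)) = fib_tenA (fib_ident [y]) (gen_braid Rc [x] [z])"
      using mat_ten[OF u ten_dec[OF u u] u ten_dec[OF u u], of "Ident C (S y)" y y "Braid C (S x) (S z)" x z z x]
        mat_braid[OF u u, of x z] mat_ident[OF u, of y] by (simp add: hom_def)
    show ?thesis
      using mat_comp[OF D(1,5,4), of "Braid C (S x) (S y) \<otimes> Ident C (S z)" "(Ident C (S y) \<otimes> Braid C (S x) (S z)) \<cdot> Assoc C (S y) (S x) (S z)"]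
        mat_comp[OF D(5,6,4), of "Assoc C (S y) (S x) (S z)" "Ident C (S y) \<otimes> Braid C (S x) (S z)"] mat_assoc[OF u u u, of y x z]
      by (simp add: hom_def 1 2)
  qed
  show ?thesis unfolding hexagon_right_at_def l[symmetric] r[symmetric]
    by (subst hexagon_right) simp_all
qed

lemma Tc_twist: "twist_at Rc Tc x y"
proof -
  note u = unit_dec
  let ?d = "ten_dec (unit_dec x) (unit_dec y)" and ?e = "ten_dec (unit_dec y) (unit_dec x)"
  have D: "dec ?d (S x \<odot> S y)" "dec ?e (S y \<odot> S x)" by (intro ten_dec u)+
  have "mat ?d ?d (Twist C (S x \<odot> S y)) = gen_twist Tc (fib_tenO [x] [y])"
    using mat_twist[OF D(1)] by simp
  moreover have "mat ?d ?d ((Twist C (S x) \<otimes> Twist C (S y)) \<cdot> Braid C (S y) (S x) \<cdot> Braid C (S x) (S y)) =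
     fib_comp (fib_comp (fib_tenA (gen_twist Tc [x]) (gen_twist Tc [y])) (gen_braid Rc [y] [x])) (gen_braid Rc [x] [y])"
    using mat_comp[OF D(1,2,1), of "Braid C (S x) (S y)" "(Twist C (S x) \<otimes> Twist C (S y)) \<cdot> Braid C (S y) (S x)"]
      mat_comp[OF D(2,1,1), of "Braid C (S y) (S x)" "Twist C (S x) \<otimes> Twist C (S y)"]
      mat_ten[OF u u u u, of "Twist C (S x)" x x "Twist C (S y)" y y] mat_twist[OF u, of x] mat_twist[OF u, of y]
      mat_braid[OF u u, of x y] mat_braid[OF u u, of y x]
    by (simp add: hom_def)
  ultimately show ?thesis unfolding twist_at_def by (subst (asm) twist_ten) simp_all
qed

lemma Rc_nonzero:
  assumes "z \<in> set (fuse x y)" shows "Rc x y z \<noteq> 0"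
proof -
  note u = unit_dec
  let ?d = "ten_dec (unit_dec x) (unit_dec y)" and ?e = "ten_dec (unit_dec y) (unit_dec x)"
  have D: "dec ?d (S x \<odot> S y)" "dec ?e (S y \<odot> S x)" by (intro ten_dec u)+
  have iso: "iso_arr C (Braid C (S x) (S y))" by (intro braid_iso) auto
  define N where "N = mat ?e ?d (inv_arr C (Braid C (S x) (S y)))"
  have N: "farr N" "src N = fib_tenO [y] [x]" "tgt N = fib_tenO [x] [y]" by (simp_all add: N_def)
  have "fib_comp N (gen_braid Rc [x] [y]) = fib_ident (fib_tenO [x] [y])"
    using mat_comp[OF D(1,2,1), of "Braid C (S x) (S y)" "inv_arr C (Braid C (S x) (S y))"]
      inv_arr[OF iso] mat_braid[OF u u, of x y] mat_ident[OF D(1)] by (simp add: hom_def N_def)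
  then show ?thesis using assms N by (cases x; cases y; cases z; auto simp: matrix_eval)
qed

text \<open>A hexagon with unit factors equates the coefficient with its square, and it is
  invertible.\<close>

lemma Rc_unit:
  assumes "x = One \<or> y = One" "z \<in> set (fuse x y)" shows "Rc x y z = 1"
proof -
  have 1: "Rc x One x = 1" for x
    using Rc_hexagon[of x One One] Rc_nonzero[of x x One]
    by (cases x; simp add: hexagon_right_at_def matrix_eval Fc_unit)
  have "Rc One Tau Tau = 1"
    using Rc_hexagon[of One Tau Tau] Rc_nonzero[of Tau One Tau]
    by (simp add: hexagon_right_at_def matrix_eval Fc_unit)
  then show ?thesis using 1 assms by (cases x; cases y; auto)
qed

text \<open>On the unit channel, where \<open>g = 1\<close>, the hexagon gives the value
  \<open>u * u\<close> for the coefficient at \<open>One\<close>. The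
  \<open>Tau\<close>-\<open>Tau\<close> entry on the channel \<open>X\<close> reads
  \<open>q r + p u p = u p u\<close>; with \<open>q r = - p\<close> and
  \<open>p * p = p + 1\<close>, a factor \<open>p\<close> cancels.\<close>

lemma Rc_solution:
  defines "p \<equiv> Fc Tau Tau Tau Tau Tau Tau" and "u \<equiv> Rc Tau Tau Tau"
  shows "Rc Tau Tau One = u * u" "p * u = u * u + 1"
proof -
  define q r s g e where "q = Fc Tau Tau Tau Tau Tau One" and "r = Fc Tau Tau Tau Tau One Tau"
    and "s = Fc Tau Tau Tau Tau One One" and "g = Fc Tau Tau Tau One Tau Tau" and "e = Rc Tau Tau One"
  note sol = Fc_solution[folded p_def q_def r_def s_def g_def]
  have u: "Rc One Tau Tau = 1" "Rc Tau One Tau = 1" by (rule Rc_unit; simp)+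
  have "hexagon_right_at Fc Rc Tau Tau Tau \<longleftrightarrow> s * s + r * u * q = e * s * e \<and> s * r + r * u * p = e * r * u \<and>
     (g = 0 \<or> g * e = u * u) \<and> q * s + p * u * q = u * q * e \<and> q * r + p * u * p = u * p * u"
    by (simp add: hexagon_right_at_def matrix_eval u p_def[symmetric] q_def[symmetric] r_def[symmetric] s_def[symmetric] g_def[symmetric]
       u_def[symmetric] e_def[symmetric] Fc_unit)
  with Rc_hexagon[of Tau Tau Tau] have E: "g = 0 \<or> g * e = u * u" "q * r + p * u * p = u * p * u" by blast+
  show "Rc Tau Tau One = u * u" using E(1) sol(1) by (simp add: e_def)
  have "- p + p * u * p = u * p * u" using E(2) sol(3) by simp
  then have "p * (p * u) = p * (u * u + 1)" by (simp add: algebra_simps)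
  then show "p * u = u * u + 1" using sol(5) by simp
qed

text \<open>The summand \<open>X\<close> of \<open>X\<close> \<otimes> \<open>X\<close> turns the
  balancing axiom into \<open>T = T T u u\<close>, where \<open>T\<close> is nonzero because the
  twist is invertible.\<close>

lemma Tc_solution: "Tc One = 1" "Tc Tau * (Rc Tau Tau Tau * Rc Tau Tau Tau) = 1"
proof -
  define u where "u = Rc Tau Tau Tau"
  show T1: "Tc One = 1" unfolding Tc_def using twist_unit coef_ident[of One] by (simp add: S_One)
  have "Twist C (S Tau) = Tc Tau \<bullet> Ident C (S Tau)" unfolding Tc_def by (rule coef_hom) (simp add: hom_def)
  moreover have "Twist C (S Tau) \<noteq> Zero C (S Tau) (S Tau)"
  proof
    assume z: "Twist C (S Tau) = Zero C (S Tau) (S Tau)"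
    have iso: "iso_arr C (Twist C (S Tau))" by (rule twist_iso) simp
    have "Ident C (S Tau) = Zero C (S Tau) (S Tau)" using inv_arr[OF iso] by (simp add: z)
    then show False using ident_nonzero by blast
  qed
  ultimately have "Tc Tau \<noteq> 0" by auto
  moreover have "Tc Tau = 0 \<or> Tc Tau * (u * u) = 1"
    using Tc_twist[of Tau Tau] T1 by (auto simp: twist_at_def matrix_eval u_def mult.assoc)
  ultimately show "Tc Tau * (Rc Tau Tau Tau * Rc Tau Tau Tau) = 1" by (simp add: u_def)
qed

end

section \<open>The equivalence with the category of block matrices\<close>

text \<open>Only admissible channels occur in the matrix. Elsewhere \<open>fib_F\<close> has a
  default value, whereas nothing is known about \<open>Fc\<close>, so the two can be compared only
  on admissible channels.\<close>

lemma gen_assoc_cong: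
  assumes "\<And>x y z w t s. s \<in> set (fuse x y) \<Longrightarrow> w \<in> set (fuse s z) \<Longrightarrow> t \<in> set (fuse y z) \<Longrightarrow> w \<in> set (fuse x t) \<Longrightarrow>
    F x y z w t s = F' x y z w t s"
  shows "gen_assoc F xs ys zs = gen_assoc F' xs ys zs"
proof (rule farr_eqI)
  fix p q assume "p < length (tgt (gen_assoc F' xs ys zs))" "q < length (src (gen_assoc F' xs ys zs))"
  then have p: "p < length (ten_basis xs (fib_tenO ys zs))" and q: "q < length (ten_basis (fib_tenO xs ys) zs)" by auto
  obtain i j l t w where P: "rbasis xs ys zs ! p = (i, j, l, t, w)" by (rule rbasis_ex)
  obtain i' j' s l' w' where Q: "lbasis xs ys zs ! q = (i', j', s, l', w')" by (rule lbasis_ex)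
  show "entry (gen_assoc F xs ys zs) p q = entry (gen_assoc F' xs ys zs) p q"
    unfolding entry_gen_assoc(1)[OF p q P Q] using assms rbasis_nth(1-5)[OF p P] lbasis_nth(1-5)[OF q Q] by auto
qed auto

lemma gen_braid_cong:
  assumes "\<And>x y z. z \<in> set (fuse x y) \<Longrightarrow> R x y z = R' x y z"
  shows "gen_braid R xs ys = gen_braid R' xs ys"
proof (rule farr_eqI)
  fix p q assume "p < length (tgt (gen_braid R' xs ys))" "q < length (src (gen_braid R' xs ys))"
  then have p: "p < length (ten_basis ys xs)" and q: "q < length (ten_basis xs ys)" by auto
  obtain i j z where P: "ten_basis ys xs ! p = (j, i, z)" by (metis prod_cases3)
  obtain i' j' z' where Q: "ten_basis xs ys ! q = (i', j', z')" by (metis prod_cases3)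
  show "entry (gen_braid R xs ys) p q = entry (gen_braid R' xs ys) p q"
    unfolding entry_gen_braid[OF p q P Q] using assms ten_basis_nth(1-3)[OF q Q] by auto
qed auto

context fib_frame
begin

text \<open>The coefficient \<open>q\<close> contains the inclusion of the unit into
  \<open>X\<close> \<otimes> \<open>X\<close> once and otherwise only projections to
  \<open>X\<close> and unit constraints, so it is linear in the rescaling factor. Rescaling by its
  inverse makes it 1.\<close>

lemma rescaled_frame:
  assumes "a \<noteq> 0"
  defines "iX' \<equiv> (\<lambda>z. case z of One \<Rightarrow> a \<bullet> iX One | Tau \<Rightarrow> iX Tau)"
    and "pX' \<equiv> (\<lambda>z. case z of One \<Rightarrow> inverse a \<bullet> pX One | Tau \<Rightarrow> pX Tau)"
  shows "fib_frame C S iX' pX'" "fib_frame.Fc C S iX' pX' Tau Tau Tau Tau Tau One = a * Fc Tau Tau Tau Tau Tau One"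
proof -
  have [simp]: "iX z \<in> Arr C" "Dom C (iX z) = S z" "Cod C (iX z) = S Tau \<odot> S Tau"
    "pX z \<in> Arr C" "Dom C (pX z) = S Tau \<odot> S Tau" "Cod C (pX z) = S z" for z
    using iX_hom[of z] pX_hom[of z] by (auto simp: hom_def)
  show fr: "fib_frame C S iX' pX'"
  proof unfold_locales
    show "S One = Unit C" by (rule S_One)
    show "iX' z \<in> hom C (S z) (S Tau \<odot> S Tau)" "pX' z \<in> hom C (S Tau \<odot> S Tau) (S z)" for z
      by (cases z; simp add: iX'_def pX'_def hom_def)+
    show "pX' z \<cdot> iX' z' = (if z = z' then Ident C (S z) else Zero C (S z') (S z))" for z z'
      using assms(1) by (cases z; cases z'; simp add: iX'_def pX'_def pX_iX)
    fix f g B assume f: "f \<in> hom C (S Tau \<odot> S Tau) B" "g \<in> hom C (S Tau \<odot> S Tau) B" and eq: "\<And>z. f \<cdot> iX' z = g \<cdot> iX' z"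
    show "f = g"
    proof (rule iX_epi[OF f])
      fix z show "f \<cdot> iX z = g \<cdot> iX z"
      proof (cases z)
        case One
        have e: "a \<bullet> (f \<cdot> iX One) = a \<bullet> (g \<cdot> iX One)" using eq[of One] f by (simp add: iX'_def hom_def)
        show ?thesis unfolding One by (rule smult_cancel[OF _ _ assms(1) e]) (use f in \<open>auto simp: hom_def\<close>)
      next
        case Tau
        then show ?thesis using eq[of Tau] by (simp add: iX'_def)
      qed
    qed
  qed
  interpret N: fib_frame C S iX' pX' by (rule fr)
  have n: "N.iota Tau Tau One = a \<bullet> iX One" "N.iota One Tau Tau = inv_arr C (LUnit C (S Tau))" "N.proj Tau Tau Tau = pX Tau"
    unfolding N.iota_def N.proj_def by (simp_all add: iX'_def pX'_def)
  have o: "iota Tau Tau One = iX One" "iota One Tau Tau = inv_arr C (LUnit C (S Tau))" "proj Tau Tau Tau = pX Tau"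
    by (simp_all add: iota_def proj_def)
  let ?G = "pX Tau \<cdot> ((Ident C (S Tau) \<otimes> pX Tau) \<cdot> (Assoc C (S Tau) (S Tau) (S Tau) \<cdot> ((iX One \<otimes> Ident C (S Tau)) \<cdot> inv_arr C (LUnit C (S Tau)))))"
  have "?G \<in> hom C (S Tau) (S Tau)" by (simp add: hom_def S_One)
  then have "coef (a \<bullet> ?G) = a * coef ?G" by (rule coef_smult)
  then show "N.Fc Tau Tau Tau Tau Tau One = a * Fc Tau Tau Tau Tau Tau One"
    by (simp add: N.Fc_def Fc_def n o S_One)
qed

end

lemma (in fibonacci_category) ex_fib_frame:
  assumes closed: "\<And>p :: 'k poly. 0 < degree p \<Longrightarrow> \<exists>z. poly p z = 0"
  shows "\<exists>S iX pX. fib_frame C S iX pX \<and> fib_frame.Fc C S iX pX Tau Tau Tau Tau Tau One = 1"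
proof -
  obtain S P where ss: "simple_system C S" and S1: "S One = Unit C" and P: "biproduct C P (S One) (S Tau)" and iso: "iso_obj C (S Tau \<odot> S Tau) P"
    using ex_simple_system[OF closed] by blast
  interpret simple_system C S by (rule ss)
  obtain i j p q where h: "P \<in> Obj C" "S One \<in> Obj C" "S Tau \<in> Obj C" "i \<in> hom C (S One) P" "j \<in> hom C (S Tau) P" "p \<in> hom C P (S One)" "q \<in> hom C P (S Tau)"
    and e: "p \<cdot> i = Ident C (S One)" "q \<cdot> j = Ident C (S Tau)" "p \<cdot> j = Zero C (S Tau) (S One)" "q \<cdot> i = Zero C (S One) (S Tau)"
    and sum: "(i \<cdot> p) \<oplus> (j \<cdot> q) = Ident C P" using P by (elim biproductE)
  obtain g where g: "g \<in> hom C (S Tau \<odot> S Tau) P" "iso_arr C g" using iso by (auto simp: iso_obj_def)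
  have [simp]: "P \<in> Obj C" "i \<in> Arr C" "j \<in> Arr C" "p \<in> Arr C" "q \<in> Arr C" "Dom C i = S One" "Dom C j = S Tau"
    "Cod C i = P" "Cod C j = P" "Dom C p = P" "Dom C q = P" "Cod C p = S One" "Cod C q = S Tau" "g \<in> Arr C" "Dom C g = S Tau \<odot> S Tau" "Cod C g = P"
    using h g(1) by (auto simp: hom_def)
  note I = inv_arr[OF g(2)] inv_arr_cancel[OF g(2)]
  note [simp] = I[simplified]
  \<comment> \<open>The structure maps of the biproduct \<open>P\<close>, transported along the
    isomorphism \<open>g\<close> to \<open>X\<close> \<otimes> \<open>X\<close>.\<close>
  define iX where "iX z = (case z of One \<Rightarrow> inv_arr C g \<cdot> i | Tau \<Rightarrow> inv_arr C g \<cdot> j)" for z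
  define pX where "pX z = (case z of One \<Rightarrow> p \<cdot> g | Tau \<Rightarrow> q \<cdot> g)" for z
  have fr: "fib_frame C S iX pX"
  proof unfold_locales
    show "iX z \<in> hom C (S z) (S Tau \<odot> S Tau)" "pX z \<in> hom C (S Tau \<odot> S Tau) (S z)" for z
      by (cases z; simp add: iX_def pX_def hom_def)+
    show "pX z \<cdot> iX z' = (if z = z' then Ident C (S z) else Zero C (S z') (S z))" for z z'
      by (cases z; cases z'; simp add: iX_def pX_def e)
    fix x y B assume x: "x \<in> hom C (S Tau \<odot> S Tau) B" and y: "y \<in> hom C (S Tau \<odot> S Tau) B" and eq: "\<And>z. x \<cdot> iX z = y \<cdot> iX z"
    have [simp]: "x \<in> Arr C" "Dom C x = S Tau \<odot> S Tau" "Cod C x = B" "y \<in> Arr C" "Dom C y = S Tau \<odot> S Tau" "Cod C y = B"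
      using x y by (auto simp: hom_def)
    have exp: "v = ((v \<cdot> iX One) \<cdot> pX One) \<oplus> ((v \<cdot> iX Tau) \<cdot> pX Tau)" if v: "v \<in> hom C (S Tau \<odot> S Tau) B" for v
    proof -
      have [simp]: "v \<in> Arr C" "Dom C v = S Tau \<odot> S Tau" "Cod C v = B" using v by (auto simp: hom_def)
      have "v = v \<cdot> (inv_arr C g \<cdot> (((i \<cdot> p) \<oplus> (j \<cdot> q)) \<cdot> g))" unfolding sum by simp
      also have "\<dots> = ((v \<cdot> iX One) \<cdot> pX One) \<oplus> ((v \<cdot> iX Tau) \<cdot> pX Tau)"
        by (simp add: iX_def pX_def)
      finally show ?thesis .
    qed
    have "x = ((y \<cdot> iX One) \<cdot> pX One) \<oplus> ((y \<cdot> iX Tau) \<cdot> pX Tau)" using exp[OF x] by (simp only: eq)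
    also have "\<dots> = y" by (rule exp[OF y, symmetric])
    finally show "x = y" .
  qed (simp add: S1)
  interpret fib_frame C S iX pX by (rule fr)
  have q0: "Fc Tau Tau Tau Tau Tau One \<noteq> 0" by (rule Fc_solution)
  have "inverse (Fc Tau Tau Tau Tau Tau One) \<noteq> 0" using q0 by simp
  from rescaled_frame[OF this] q0 show ?thesis by (intro exI conjI) auto
qed

text \<open>In this gauge \<open>q = 1\<close>, hence \<open>r = - p\<close> and
  \<open>s = - p\<close>: exactly the coefficients \<open>fib_F\<close> at \<open>p\<close>.\<close>

locale normal_frame = braided_frame C S iX pX + abelian_category C
  for C :: "('o, 'm, 'k :: field, 'x) balcat_scheme" (structure) and S :: "fib \<Rightarrow> 'o" and iX pX +
  assumes normalized: "Fc Tau Tau Tau Tau Tau One = 1"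
begin

definition braid_root :: 'k where "braid_root = Rc Tau Tau Tau"

abbreviation "u \<equiv> braid_root"

lemma root_nonzero: "u \<noteq> 0"
  unfolding braid_root_def by (rule Rc_nonzero) simp

lemma Fc_root: "Fc Tau Tau Tau Tau Tau Tau = u + inverse u"
proof -
  have "Fc Tau Tau Tau Tau Tau Tau * u = u * u + 1" unfolding braid_root_def by (rule Rc_solution(2))
  then show ?thesis using root_nonzero by (simp add: field_simps)
qed

lemma root_equation: "(u + inverse u) * (u + inverse u) = (u + inverse u) + 1"
  using Fc_solution(4) by (simp only: Fc_root)

lemma gen_assoc_Fc: "gen_assoc Fc = fib_assoc u"
proof (intro ext)
  fix xs ys zs
  have "Fc x y z w t s = fib_F (u + inverse u) x y z w t s"
    if v: "s \<in> set (fuse x y)" "w \<in> set (fuse s z)" "t \<in> set (fuse y z)" "w \<in> set (fuse x t)" for x y z w t s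
  proof (cases "x = Tau \<and> y = Tau \<and> z = Tau")
    case True
    then show ?thesis using v Fc_solution normalized Fc_root
      by (cases w; cases t; cases s) (auto simp: fib_F_def)
  next
    case False
    then have "x = One \<or> y = One \<or> z = One" by (metis fib.exhaust)
    then show ?thesis using Fc_unit v False by (auto simp: fib_F_def)
  qed
  then show "gen_assoc Fc xs ys zs = fib_assoc u xs ys zs" unfolding fib_assoc_gen by (rule gen_assoc_cong)
qed

lemma gen_braid_Rc: "gen_braid Rc = fib_braid u"
proof (intro ext)
  fix xs ys
  have "Rc x y z = fib_R u x y z" if v: "z \<in> set (fuse x y)" for x y z
  proof (cases "x = Tau \<and> y = Tau")
    case True
    then show ?thesis using Rc_solution(1) by (cases z) (auto simp: fib_R_def braid_root_def power2_eq_square)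
  next
    case False
    then have "x = One \<or> y = One" by (metis fib.exhaust)
    then show ?thesis using Rc_unit v False by (auto simp: fib_R_def)
  qed
  then show "gen_braid Rc xs ys = fib_braid u xs ys" unfolding fib_braid_gen by (rule gen_braid_cong)
qed

lemma Tc_root: "Tc Tau = inverse (u ^ 2)"
proof -
  have "Tc Tau * (u * u) = 1" using Tc_solution(2) by (simp add: braid_root_def)
  then show ?thesis using root_nonzero by (simp add: field_simps power2_eq_square)
qed

lemma gen_twist_Tc: "gen_twist Tc = fib_twist u"
proof -
  have "Tc = (\<lambda>x. case x of One \<Rightarrow> 1 | Tau \<Rightarrow> inverse (u ^ 2))"
    using Tc_solution(1) Tc_root by (auto simp: fun_eq_iff split: fib.split)
  then show ?thesis by (simp add: fib_twist_gen)
qed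

definition DC :: "'o \<Rightarrow> 'm dec" where "DC A = (SOME d. dec d A)"

lemma DC: "A \<in> Obj C \<Longrightarrow> dec (DC A) A"
  unfolding DC_def by (rule someI_ex) (rule ex_dec)

text \<open>Essential surjectivity: every list of labels comes from an object, built up by
  biproducts with simple objects.\<close>

lemma ex_object: "\<exists>A d. dec d A \<and> lab d = xs"
proof (induction xs)
  case Nil
  obtain Z where Z: "zero_obj C Z" using ex_zero by blast
  have "dec (Dec [] undefined undefined) Z"
    unfolding is_dec_def using zero_objD(1)[OF Z] zero_objD(2)[OF Z] by (metis dec.sel(1) list.size(3) not_less0)
  then show ?case by (metis dec.sel(1))
next
  case (Cons x xs)
  then obtain A d where d: "dec d A" "lab d = xs" by blast
  have A: "A \<in> Obj C" using decD(1)[OF d(1)] .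
  obtain P where P: "biproduct C P (S x) A" using ex_biproduct[of "S x" A] A by auto
  have "inverse_arrs C (Ident C (S x)) (Ident C (S x))" by (auto simp: inverse_arrs_def hom_def)
  then have "iso_arr C (Ident C (S x))" by (rule iso_arrI)
  then show ?case using is_dec_biproduct[OF P _ _ d(1), of "Ident C (S x)" x] d(2) by (auto simp: hom_def)
qed

definition GP :: "fib list \<Rightarrow> 'o \<times> 'm dec" where
  "GP xs = (SOME P. dec (snd P) (fst P) \<and> lab (snd P) = xs)"

abbreviation "GO xs \<equiv> fst (GP xs)"
abbreviation "GD xs \<equiv> snd (GP xs)"

lemma GP: "dec (GD xs) (GO xs)" "lab (GD xs) = xs"
proof -
  have "\<exists>P. dec (snd P) (fst P) \<and> lab (snd P) = xs" using ex_object[of xs] by force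
  then have "dec (GD xs) (GO xs) \<and> lab (GD xs) = xs" unfolding GP_def by (rule someI_ex)
  then show "dec (GD xs) (GO xs)" "lab (GD xs) = xs" by auto
qed

definition realize :: "'m dec \<Rightarrow> 'o \<Rightarrow> 'm dec \<Rightarrow> 'o \<Rightarrow> 'k fib_arr \<Rightarrow> 'm" where
  "realize d A d' B m = (SOME f. f \<in> hom C A B \<and> mat d d' f = m)"

lemma realize:
  assumes "dec d A" "dec d' B" "farr m" "src m = lab d" "tgt m = lab d'"
  shows "realize d A d' B m \<in> hom C A B" "mat d d' (realize d A d' B m) = m"
proof -
  have "\<exists>f. f \<in> hom C A B \<and> mat d d' f = m" using mat_surj[OF assms] by blast
  then have "realize d A d' B m \<in> hom C A B \<and> mat d d' (realize d A d' B m) = m" unfolding realize_def by (rule someI_ex)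
  then show "realize d A d' B m \<in> hom C A B" "mat d d' (realize d A d' B m) = m" by auto
qed

lemma realize_eqI:
  assumes "dec d A" "dec d' B" "f \<in> hom C A B" "mat d d' f = m"
  shows "realize d A d' B m = f"
proof -
  have "farr m" "src m = lab d" "tgt m = lab d'" using assms(4) by auto
  from realize[OF assms(1,2) this] show ?thesis using mat_inj[OF assms(1,2) _ assms(3)] assms(4) by blast
qed

text \<open>The matrix of an identity with respect to two decompositions of one object is a change
  of basis; exchanging the decompositions inverts it.\<close>

lemma iso_mat_ident:
  assumes "dec d A" "dec d' A" shows "iso_arr (fib_cat u) (mat d d' (Ident C A))"
proof -
  have A: "Ident C A \<in> hom C A A" using decD(1)[OF assms(1)] by (simp add: hom_def)
  have "Ident C A \<cdot> Ident C A = Ident C A" using decD(1)[OF assms(1)] by simp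
  then have "inverse_arrs (fib_cat u) (mat d d' (Ident C A)) (mat d' d (Ident C A))"
    using mat_comp[OF assms(1,2,1) A A] mat_comp[OF assms(2,1,2) A A] mat_ident[OF assms(1)] mat_ident[OF assms(2)]
    by (simp add: inverse_arrs_def hom_fib_cat)
  then show ?thesis by (auto simp: iso_arr_def)
qed

definition FA :: "'m \<Rightarrow> 'k fib_arr" where "FA f = mat (DC (Dom C f)) (DC (Cod C f)) f"

lemma FA: "f \<in> hom C A B \<Longrightarrow> FA f = mat (DC A) (DC B) f"
  by (auto simp: FA_def hom_def)

text \<open>The tensor structure at \<open>A\<close>, \<open>B\<close> is the change of basis from
  the tensor decomposition to the chosen one. By \<open>mat_comp\<close> and \<open>mat_ten\<close>,
  both sides of each axiom collapse to the matrix of one arrow between the same pair of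
  decompositions.\<close>

lemma balanced_functor:
  "braided_balanced_functor C (fib_cat u) (\<lambda>A. lab (DC A)) FA
     (\<lambda>A B. mat (ten_dec (DC A) (DC B)) (DC (A \<odot> B)) (Ident C (A \<odot> B))) (mat (unit_dec One) (DC (Unit C)) (Ident C (Unit C)))"
proof -
  interpret D: balanced_category "fib_cat u" by (rule fib_balanced[OF root_nonzero root_equation])
  have I: "Ident C A \<in> hom C A A" if "A \<in> Obj C" for A using that by (simp add: hom_def)
  have mc: "fib_comp (mat d' d'' g) (mat d d' f) = mat d d'' (g \<cdot> f)"
    if "dec d A" "dec d' B" "dec d'' E" "f \<in> Arr C" "Dom C f = A" "Cod C f = B" "g \<in> Arr C" "Dom C g = B" "Cod C g = E" for d d' d'' f g A B E
    using that mat_comp[OF that(1-3), of f g] by (simp add: hom_def)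
  have mt: "fib_tenA (mat d e f) (mat d' e' g) = mat (ten_dec d d') (ten_dec e e') (f \<otimes> g)"
    if "dec d A" "dec d' B" "dec e A'" "dec e' B'" "f \<in> Arr C" "Dom C f = A" "Cod C f = A'" "g \<in> Arr C" "Dom C g = B" "Cod C g = B'"
    for d d' e e' f g A B A' B'
    using that mat_ten[OF that(1-4), of f g] by (simp add: hom_def)
  have ud: "dec (unit_dec One) (Unit C)" using unit_dec[of One] by (simp add: S_One)
  show ?thesis
  proof unfold_locales
    fix f A B assume "f \<in> hom C A B"
    then show "FA f \<in> hom (fib_cat u) (lab (DC A)) (lab (DC B))" by (simp add: FA hom_fib_cat)
  next
    fix A assume A: "A \<in> Obj C"
    show "FA (Ident C A) = Ident (fib_cat u) (lab (DC A))" using mat_ident[OF DC[OF A]] FA[OF I[OF A]] by simp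
    show "FA (Twist C A) = Twist (fib_cat u) (lab (DC A))"
      using mat_twist[OF DC[OF A]] FA[of "Twist C A" A A] A by (simp add: gen_twist_Tc hom_def)
    show "FA (LUnit C A) \<cdot>\<^bsub>fib_cat u\<^esub> mat (ten_dec (DC (Unit C)) (DC A)) (DC (Unit C \<odot> A)) (Ident C (Unit C \<odot> A)) \<cdot>\<^bsub>fib_cat u\<^esub>
        (mat (unit_dec One) (DC (Unit C)) (Ident C (Unit C)) \<otimes>\<^bsub>fib_cat u\<^esub> Ident (fib_cat u) (lab (DC A))) = LUnit (fib_cat u) (lab (DC A))"
      using A FA[of "LUnit C A" "Unit C \<odot> A" A] mat_lunit[OF DC[OF A]]
      by (simp add: hom_def mc[OF ten_dec[OF DC DC] DC DC] mt[OF ud DC DC DC] mc[OF ten_dec[OF ud DC] ten_dec[OF DC DC] DC] mat_ident[OF DC, symmetric])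
    show "FA (RUnit C A) \<cdot>\<^bsub>fib_cat u\<^esub> mat (ten_dec (DC A) (DC (Unit C))) (DC (A \<odot> Unit C)) (Ident C (A \<odot> Unit C)) \<cdot>\<^bsub>fib_cat u\<^esub>
        (Ident (fib_cat u) (lab (DC A)) \<otimes>\<^bsub>fib_cat u\<^esub> mat (unit_dec One) (DC (Unit C)) (Ident C (Unit C))) = RUnit (fib_cat u) (lab (DC A))"
      using A FA[of "RUnit C A" "A \<odot> Unit C" A] mat_runit[OF DC[OF A] unit_constraints]
      by (simp add: hom_def mc[OF ten_dec[OF DC DC] DC DC] mt[OF DC ud DC DC] mc[OF ten_dec[OF DC ud] ten_dec[OF DC DC] DC] mat_ident[OF DC, symmetric])
  next
    fix f A B g E assume f: "f \<in> hom C A B" and g: "g \<in> hom C B E"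
    show "FA (g \<cdot> f) = FA g \<cdot>\<^bsub>fib_cat u\<^esub> FA f"
      using mat_comp[OF DC DC DC f g] FA[OF f] FA[OF g] FA[OF comp_hom[OF f g]] hom_obj[OF f] hom_obj[OF g] by simp
  next
    fix f g A B assume f: "f \<in> hom C A B" and g: "g \<in> hom C A B"
    show "FA (f \<oplus> g) = FA f \<oplus>\<^bsub>fib_cat u\<^esub> FA g"
      using mat_add_smult(1)[OF DC DC f g] FA[OF f] FA[OF g] FA[OF add_hom[OF f g]] hom_obj[OF f] by simp
  next
    fix f A B r assume f: "f \<in> hom C A B"
    show "FA (r \<bullet> f) = r \<bullet>\<^bsub>fib_cat u\<^esub> FA f"
      using mat_add_smult(2)[OF DC DC f, of r] FA[OF f] FA[OF smult_hom[OF f]] hom_obj[OF f] by simp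
  next
    fix A B assume A: "A \<in> Obj C" and B: "B \<in> Obj C"
    show "mat (ten_dec (DC A) (DC B)) (DC (A \<odot> B)) (Ident C (A \<odot> B)) \<in>
       hom (fib_cat u) (lab (DC A) \<odot>\<^bsub>fib_cat u\<^esub> lab (DC B)) (lab (DC (A \<odot> B)))" by (simp add: hom_fib_cat)
    show "iso_arr (fib_cat u) (mat (ten_dec (DC A) (DC B)) (DC (A \<odot> B)) (Ident C (A \<odot> B)))"
      using A B by (intro iso_mat_ident ten_dec DC) auto
    show "FA (Braid C A B) \<cdot>\<^bsub>fib_cat u\<^esub> mat (ten_dec (DC A) (DC B)) (DC (A \<odot> B)) (Ident C (A \<odot> B)) =
        mat (ten_dec (DC B) (DC A)) (DC (B \<odot> A)) (Ident C (B \<odot> A)) \<cdot>\<^bsub>fib_cat u\<^esub> Braid (fib_cat u) (lab (DC A)) (lab (DC B))"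
      using A B FA[of "Braid C A B" "A \<odot> B" "B \<odot> A"] mat_braid[OF DC DC, of A B]
      by (simp add: hom_def gen_braid_Rc[symmetric] mat_braid[OF DC DC, symmetric] mc[OF ten_dec[OF DC DC] DC DC] mc[OF ten_dec[OF DC DC] ten_dec[OF DC DC] DC])
  next
    fix f g A A' B B' assume f: "f \<in> hom C A A'" and g: "g \<in> hom C B B'"
    note o = hom_obj[OF f] hom_obj[OF g]
    have [simp]: "f \<in> Arr C" "Dom C f = A" "Cod C f = A'" "g \<in> Arr C" "Dom C g = B" "Cod C g = B'" using f g by (auto simp: hom_def)
    show "mat (ten_dec (DC A') (DC B')) (DC (A' \<odot> B')) (Ident C (A' \<odot> B')) \<cdot>\<^bsub>fib_cat u\<^esub> (FA f \<otimes>\<^bsub>fib_cat u\<^esub> FA g) =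
       FA (f \<otimes> g) \<cdot>\<^bsub>fib_cat u\<^esub> mat (ten_dec (DC A) (DC B)) (DC (A \<odot> B)) (Ident C (A \<odot> B))"
      using o FA[OF f] FA[OF g] FA[OF ten_hom[OF f g]]
      by (simp add: mt[OF DC DC DC DC] mc[OF ten_dec[OF DC DC] ten_dec[OF DC DC] DC] mc[OF ten_dec[OF DC DC] DC DC])
  next
    show "mat (unit_dec One) (DC (Unit C)) (Ident C (Unit C)) \<in> hom (fib_cat u) (Unit (fib_cat u)) (lab (DC (Unit C)))"
      by (simp add: hom_fib_cat)
    show "iso_arr (fib_cat u) (mat (unit_dec One) (DC (Unit C)) (Ident C (Unit C)))"
      by (intro iso_mat_ident ud DC) simp
  next
    fix A B E assume O: "A \<in> Obj C" "B \<in> Obj C" "E \<in> Obj C"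
    show "FA (Assoc C A B E) \<cdot>\<^bsub>fib_cat u\<^esub> mat (ten_dec (DC (A \<odot> B)) (DC E)) (DC (A \<odot> B \<odot> E)) (Ident C (A \<odot> B \<odot> E)) \<cdot>\<^bsub>fib_cat u\<^esub>
        (mat (ten_dec (DC A) (DC B)) (DC (A \<odot> B)) (Ident C (A \<odot> B)) \<otimes>\<^bsub>fib_cat u\<^esub> Ident (fib_cat u) (lab (DC E))) =
      mat (ten_dec (DC A) (DC (B \<odot> E))) (DC (A \<odot> (B \<odot> E))) (Ident C (A \<odot> (B \<odot> E))) \<cdot>\<^bsub>fib_cat u\<^esub>
        (Ident (fib_cat u) (lab (DC A)) \<otimes>\<^bsub>fib_cat u\<^esub> mat (ten_dec (DC B) (DC E)) (DC (B \<odot> E)) (Ident C (B \<odot> E))) \<cdot>\<^bsub>fib_cat u\<^esub>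
        Assoc (fib_cat u) (lab (DC A)) (lab (DC B)) (lab (DC E))"
    proof -
      note dA = DC[OF O(1)] and dB = DC[OF O(2)] and dE = DC[OF O(3)]
      have dAB: "dec (DC (A \<odot> B)) (A \<odot> B)" and dBE: "dec (DC (B \<odot> E)) (B \<odot> E)" and dl: "dec (DC (A \<odot> B \<odot> E)) (A \<odot> B \<odot> E)"
        and dr: "dec (DC (A \<odot> (B \<odot> E))) (A \<odot> (B \<odot> E))" using O by (auto intro!: DC)
      have 1: "fib_tenA (mat (ten_dec (DC A) (DC B)) (DC (A \<odot> B)) (Ident C (A \<odot> B))) (fib_ident (lab (DC E))) =
        mat (ten_dec (ten_dec (DC A) (DC B)) (DC E)) (ten_dec (DC (A \<odot> B)) (DC E)) (Ident C (A \<odot> B \<odot> E))"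
        using O mt[OF ten_dec[OF dA dB] dE dAB dE, of "Ident C (A \<odot> B)" "Ident C E"] by (simp add: mat_ident[OF dE])
      have 2: "fib_tenA (fib_ident (lab (DC A))) (mat (ten_dec (DC B) (DC E)) (DC (B \<odot> E)) (Ident C (B \<odot> E))) =
        mat (ten_dec (DC A) (ten_dec (DC B) (DC E))) (ten_dec (DC A) (DC (B \<odot> E))) (Ident C (A \<odot> (B \<odot> E)))"
        using O mt[OF dA ten_dec[OF dB dE] dA dBE, of "Ident C A" "Ident C (B \<odot> E)"] by (simp add: mat_ident[OF dA])
      show ?thesis
        using O FA[of "Assoc C A B E" "A \<odot> B \<odot> E" "A \<odot> (B \<odot> E)"]
        by (simp add: hom_def 1 2 gen_assoc_Fc[symmetric] mat_assoc[OF dA dB dE, symmetric]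
            mc[OF ten_dec[OF dAB dE] dl dr] mc[OF ten_dec[OF ten_dec[OF dA dB] dE] ten_dec[OF dAB dE] dr]
            mc[OF ten_dec[OF dA ten_dec[OF dB dE]] ten_dec[OF dA dBE] dr]
            mc[OF ten_dec[OF ten_dec[OF dA dB] dE] ten_dec[OF dA ten_dec[OF dB dE]] dr])
    qed
  qed auto
qed

definition GA :: "'k fib_arr \<Rightarrow> 'm" where
  "GA m = realize (GD (src m)) (GO (src m)) (GD (tgt m)) (GO (tgt m)) m"

lemma GA:
  assumes "farr m" shows "GA m \<in> hom C (GO (src m)) (GO (tgt m))" "mat (GD (src m)) (GD (tgt m)) (GA m) = m"
  using realize[OF GP(1) GP(1), of m "src m" "tgt m"] assms by (simp_all add: GA_def GP(2))

text \<open>The quasi-inverse sends a list to a chosen object with these labels and a matrix to the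
  unique arrow that it represents. Naturality is checked on matrices and reflected by
  \<open>mat_inj\<close>.\<close>

lemma equivalence: "is_equivalence C (fib_cat u) (\<lambda>A. lab (DC A)) FA"
proof -
  interpret F: braided_balanced_functor C "fib_cat u" "\<lambda>A. lab (DC A)" FA "\<lambda>A B. mat (ten_dec (DC A) (DC B)) (DC (A \<odot> B)) (Ident C (A \<odot> B))"
     "mat (unit_dec One) (DC (Unit C)) (Ident C (Unit C))" by (rule balanced_functor)
  have GI: "GA m = f" if "f \<in> hom C (GO (src m)) (GO (tgt m))" "mat (GD (src m)) (GD (tgt m)) f = m" for m f
    unfolding GA_def by (rule realize_eqI[OF GP(1) GP(1) that])
  have G: "cat_functor (fib_cat u) C GO GA"
  proof unfold_locales
    fix xs show "GO xs \<in> Obj C" using decD(1)[OF GP(1)] .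
    show "GA (Ident (fib_cat u) xs) = Ident C (GO xs)"
      using GI[of "Ident C (GO xs)" "fib_ident xs"] mat_ident[OF GP(1)] GP(2) decD(1)[OF GP(1)] by (simp add: hom_def)
  next
    fix f xs ys assume "f \<in> hom (fib_cat u) xs ys"
    then show "GA f \<in> hom C (GO xs) (GO ys)" using GA(1)[of f] by (auto simp: hom_fib_cat)
  next
    fix f xs ys g zs assume f: "f \<in> hom (fib_cat u) xs ys" and g: "g \<in> hom (fib_cat u) ys zs"
    have fg: "farr f" "src f = xs" "tgt f = ys" "farr g" "src g = ys" "tgt g = zs" using f g by (auto simp: hom_fib_cat)
    have a: "GA f \<in> hom C (GO xs) (GO ys)" "GA g \<in> hom C (GO ys) (GO zs)" using GA(1)[of f] GA(1)[of g] fg by auto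
    show "GA (g \<cdot>\<^bsub>fib_cat u\<^esub> f) = GA g \<cdot> GA f"
      using GI[of "GA g \<cdot> GA f" "fib_comp g f"] mat_comp[OF GP(1) GP(1) GP(1) a] GA(2)[of f] GA(2)[of g] fg comp_hom[OF a] by simp
  qed
  \<comment> \<open>The two objects have decompositions with the same labels, so the identity matrix
    represents an isomorphism between them.\<close>
  define \<eta> where "\<eta> A = realize (DC A) A (GD (lab (DC A))) (GO (lab (DC A))) (fib_ident (lab (DC A)))" for A
  have eta: "\<eta> A \<in> hom C A (GO (lab (DC A)))" "mat (DC A) (GD (lab (DC A))) (\<eta> A) = fib_ident (lab (DC A))" if "A \<in> Obj C" for A
    using realize[OF DC[OF that] GP(1), of "fib_ident (lab (DC A))" "lab (DC A)"] GP(2) by (simp_all add: \<eta>_def)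
  have eta_iso: "iso_arr C (\<eta> A)" if A: "A \<in> Obj C" for A
  proof -
    let ?xs = "lab (DC A)"
    define h where "h = realize (GD ?xs) (GO ?xs) (DC A) A (fib_ident ?xs)"
    have h: "h \<in> hom C (GO ?xs) A" "mat (GD ?xs) (DC A) h = fib_ident ?xs"
      using realize[OF GP(1) DC[OF A], of "fib_ident ?xs" ?xs] GP(2) by (simp_all add: h_def)
    have ii: "fib_comp (fib_ident ?xs) (fib_ident ?xs) = (fib_ident ?xs :: 'k fib_arr)" by (metis fib_comp_ident(1) fib_ident_sel(1,3))
    have "h \<cdot> \<eta> A = Ident C A"
      by (rule mat_inj[OF DC[OF A] DC[OF A] comp_hom[OF eta(1)[OF A] h(1)] ident_hom[OF A]])
        (use mat_comp[OF DC[OF A] GP(1) DC[OF A] eta(1)[OF A] h(1)] h(2) eta(2)[OF A] mat_ident[OF DC[OF A]] ii in simp)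
    moreover have "\<eta> A \<cdot> h = Ident C (GO ?xs)"
      by (rule mat_inj[OF GP(1) GP(1) comp_hom[OF h(1) eta(1)[OF A]] ident_hom[OF decD(1)[OF GP(1)]]])
        (use mat_comp[OF GP(1) DC[OF A] GP(1) h(1) eta(1)[OF A]] h(2) eta(2)[OF A] mat_ident[OF GP(1)] GP(2) ii in simp)
    ultimately show ?thesis using inverse_arrsI[OF eta(1)[OF A] h(1)] iso_arrI by blast
  qed
  have "natural_iso C C (\<lambda>A. A) (\<lambda>f. f) (\<lambda>A. GO (lab (DC A))) (\<lambda>f. GA (FA f)) \<eta>"
    unfolding natural_iso_def
  proof (intro conjI ballI)
    fix f assume f: "f \<in> Arr C"
    let ?A = "Dom C f" and ?B = "Cod C f"
    have A: "?A \<in> Obj C" and B: "?B \<in> Obj C" and fh: "f \<in> hom C ?A ?B" using f by (auto simp: hom_def)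
    have g: "GA (FA f) \<in> hom C (GO (lab (DC ?A))) (GO (lab (DC ?B)))" "mat (GD (lab (DC ?A))) (GD (lab (DC ?B))) (GA (FA f)) = FA f"
      using GA[of "FA f"] by (simp_all add: FA_def)
    have fi: "fib_comp (fib_ident (lab (DC ?B))) (FA f) = FA f" "fib_comp (FA f) (fib_ident (lab (DC ?A))) = FA f"
      using fib_comp_ident[of "FA f"] by (simp_all add: FA_def)
    show "\<eta> ?B \<cdot> f = GA (FA f) \<cdot> \<eta> ?A"
      by (rule mat_inj[OF DC[OF A] GP(1) comp_hom[OF fh eta(1)[OF B]] comp_hom[OF eta(1)[OF A] g(1)]])
        (use mat_comp[OF DC[OF A] DC[OF B] GP(1) fh eta(1)[OF B]] mat_comp[OF DC[OF A] GP(1) GP(1) eta(1)[OF A] g(1)]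
          eta(2)[OF A] eta(2)[OF B] g(2) FA[OF fh] fi in simp)
  qed (use eta eta_iso in auto)
  moreover have "natural_iso (fib_cat u) (fib_cat u) (\<lambda>xs. lab (DC (GO xs))) (\<lambda>m. FA (GA m)) (\<lambda>xs. xs) (\<lambda>m. m)
      (\<lambda>xs. mat (DC (GO xs)) (GD xs) (Ident C (GO xs)))"
    unfolding natural_iso_def
  proof (intro conjI ballI)
    fix xs
    have G: "GO xs \<in> Obj C" using decD(1)[OF GP(1)] .
    show "mat (DC (GO xs)) (GD xs) (Ident C (GO xs)) \<in> hom (fib_cat u) (lab (DC (GO xs))) xs" by (simp add: hom_fib_cat GP(2))
    show "iso_arr (fib_cat u) (mat (DC (GO xs)) (GD xs) (Ident C (GO xs)))" by (rule iso_mat_ident[OF DC[OF G] GP(1)])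
  next
    fix m assume "m \<in> Arr (fib_cat u)"
    then have m: "farr m" by simp
    let ?A = "GO (src m)" and ?B = "GO (tgt m)"
    have A: "?A \<in> Obj C" and B: "?B \<in> Obj C" using decD(1)[OF GP(1)] by auto
    note g = GA[OF m]
    have "fib_comp (mat (DC ?B) (GD (tgt m)) (Ident C ?B)) (FA (GA m)) = mat (DC ?A) (GD (tgt m)) (GA m)"
      using mat_comp[OF DC[OF A] DC[OF B] GP(1) g(1) ident_hom[OF B]] FA[OF g(1)] comp_ident_left[OF g(1)] by simp
    moreover have "fib_comp m (mat (DC ?A) (GD (src m)) (Ident C ?A)) = mat (DC ?A) (GD (tgt m)) (GA m)"
      using mat_comp[OF DC[OF A] GP(1) GP(1) ident_hom[OF A] g(1)] g(2) comp_ident_right[OF g(1)] by simp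
    ultimately show "mat (DC (GO (Cod (fib_cat u) m))) (GD (Cod (fib_cat u) m)) (Ident C (GO (Cod (fib_cat u) m))) \<cdot>\<^bsub>fib_cat u\<^esub> FA (GA m) =
        m \<cdot>\<^bsub>fib_cat u\<^esub> mat (DC (GO (Dom (fib_cat u) m))) (GD (Dom (fib_cat u) m)) (Ident C (GO (Dom (fib_cat u) m)))" by simp
  qed
  ultimately show ?thesis unfolding is_equivalence_def using G F.cat_functor_axioms by blast
qed

lemma balanced_equivalent_root: "balanced_equivalent C (fib_cat u)"
  unfolding balanced_equivalent_def using balanced_functor equivalence by blast

end

section \<open>Duality and modularity\<close>

context fib_frame
begin

lemma dec_extend:
  assumes d: "dec d A" and f: "\<And>j. j < dlen d \<Longrightarrow> f j \<in> hom C (S (lab d ! j)) B" and B: "B \<in> Obj C"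
  shows "\<exists>h \<in> hom C A B. \<forall>j < dlen d. h \<cdot> inc d j = f j"
proof -
  note [simp] = decD[OF d]
  have fs [simp]: "f j \<in> Arr C" "Dom C (f j) = S (lab d ! j)" "Cod C (f j) = B" if "j < dlen d" for j using f[OF that] by (auto simp: hom_def)
  define h where "h = osum A B (\<lambda>j. f j \<cdot> prj d j) (dlen d)"
  have h: "h \<in> hom C A B" unfolding h_def using B by (intro osum_hom) (auto simp: hom_def)
  have "h \<cdot> inc d k = f k" if k: "k < dlen d" for k
  proof -
    have "h \<cdot> inc d k = osum (S (lab d ! k)) B (\<lambda>j. (f j \<cdot> prj d j) \<cdot> inc d k) (dlen d)"
      unfolding h_def using k B by (intro osum_comp) (auto simp: hom_def)
    also have "\<dots> = (f k \<cdot> prj d k) \<cdot> inc d k"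
      using k B by (intro osum_single) (auto simp: hom_def dec_prj_inc[OF d])
    finally show ?thesis using k by (simp add: dec_prj_inc[OF d])
  qed
  then show ?thesis using h by blast
qed

lemma dec_coextend:
  assumes d: "dec d A" and f: "\<And>j. j < dlen d \<Longrightarrow> f j \<in> hom C B (S (lab d ! j))" and B: "B \<in> Obj C"
  shows "\<exists>h \<in> hom C B A. \<forall>j < dlen d. prj d j \<cdot> h = f j"
proof -
  note [simp] = decD[OF d]
  have fs [simp]: "f j \<in> Arr C" "Cod C (f j) = S (lab d ! j)" "Dom C (f j) = B" if "j < dlen d" for j using f[OF that] by (auto simp: hom_def)
  define h where "h = osum B A (\<lambda>j. inc d j \<cdot> f j) (dlen d)"
  have h: "h \<in> hom C B A" unfolding h_def using B by (intro osum_hom) (auto simp: hom_def)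
  have "prj d k \<cdot> h = f k" if k: "k < dlen d" for k
  proof -
    have "prj d k \<cdot> h = osum B (S (lab d ! k)) (\<lambda>j. prj d k \<cdot> (inc d j \<cdot> f j)) (dlen d)"
      unfolding h_def using k B by (intro osum_comp) (auto simp: hom_def)
    also have "\<dots> = prj d k \<cdot> (inc d k \<cdot> f k)"
    proof (rule osum_single)
      fix j assume j: "j < dlen d" "j \<noteq> k"
      have "prj d k \<cdot> (inc d j \<cdot> f j) = (prj d k \<cdot> inc d j) \<cdot> f j" using j k by simp
      also have "\<dots> = Zero C B (S (lab d ! k))" using j k by (simp add: dec_prj_inc[OF d] del: comp_assoc_arr)
      finally show "prj d k \<cdot> (inc d j \<cdot> f j) = Zero C B (S (lab d ! k))" .
    qed (use k B in \<open>auto simp: hom_def\<close>)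
    also have "\<dots> = (prj d k \<cdot> inc d k) \<cdot> f k" using k by simp
    also have "\<dots> = f k" using k by (simp add: dec_prj_inc[OF d] del: comp_assoc_arr)
    finally show ?thesis .
  qed
  then show ?thesis using h by blast
qed

lemma One_fuse [simp]: "One \<in> set (fuse x y) \<longleftrightarrow> x = y"
  by (cases x; cases y) auto

text \<open>By Schur an arrow to the unit vanishes on every channel but \<open>One\<close>, and that
  channel is present exactly when the labels agree. A pairing of decomposed objects is thus given by
  scalars between equal labels.\<close>

lemma hom_to_unit:
  assumes f: "f \<in> hom C (S x \<odot> S y) (S One)"
  shows "x \<noteq> y \<Longrightarrow> f = Zero C (S x \<odot> S y) (S One)" "x = y \<Longrightarrow> \<exists>c. f = c \<bullet> proj x y One"
proof -
  have [simp]: "f \<in> Arr C" "Dom C f = S x \<odot> S y" "Cod C f = S One" using f by (auto simp: hom_def)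
  have nz: "f \<cdot> iota x y z = Zero C (S z) (S One)" if "z \<in> set (fuse x y)" "z \<noteq> One" for z
    by (rule schur_zero) (use that in \<open>auto simp: hom_def\<close>)
  show "f = Zero C (S x \<odot> S y) (S One)" if "x \<noteq> y"
  proof (rule iota_epi[OF f])
    fix z assume z: "z \<in> set (fuse x y)"
    then have "z \<noteq> One" using that by auto
    then show "f \<cdot> iota x y z = Zero C (S x \<odot> S y) (S One) \<cdot> iota x y z" using nz z by simp
  qed (simp add: hom_def)
  show "\<exists>c. f = c \<bullet> proj x y One" if xy: "x = y"
  proof -
    have "f \<cdot> iota x y One \<in> hom C (S One) (S One)" using xy by (simp add: hom_def)
    then obtain c where c: "f \<cdot> iota x y One = c \<bullet> Ident C (S One)" using schur_scalar by blast
    have "f = c \<bullet> proj x y One"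
    proof (rule iota_epi[OF f])
      show "c \<bullet> proj x y One \<in> hom C (S x \<odot> S y) (S One)" using xy by (simp add: hom_def)
      fix z assume z: "z \<in> set (fuse x y)"
      show "f \<cdot> iota x y z = c \<bullet> proj x y One \<cdot> iota x y z"
        using c nz[OF z] z xy by (cases "z = One") (simp_all add: proj_iota)
    qed
    then show ?thesis by blast
  qed
qed

lemma ten_mono:
  assumes d: "dec d B" and f: "f \<in> hom C T (S l \<odot> B)" "g \<in> hom C T (S l \<odot> B)"
    and eq: "\<And>j. j < dlen d \<Longrightarrow> (Ident C (S l) \<otimes> prj d j) \<cdot> f = (Ident C (S l) \<otimes> prj d j) \<cdot> g"
  shows "f = g"
proof (rule dec_mono[OF ten_dec[OF unit_dec d] f])
  note [simp] = decD[OF d]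
  have [simp]: "f \<in> Arr C" "Cod C f = S l \<odot> B" "g \<in> Arr C" "Cod C g = S l \<odot> B" using f by (auto simp: hom_def)
  fix r assume "r < dlen (ten_dec (unit_dec l) d)"
  then have r: "r < length (ten_basis (lab (unit_dec l)) (lab d))" by simp
  obtain i j z where R: "ten_basis (lab (unit_dec l)) (lab d) ! r = (i, j, z)" by (metis prod_cases3)
  note b = ten_basis_nth[OF r R]
  have i: "i = 0" using b by simp
  have p: "prj (unit_dec l) k = Ident C (S l)" for k by (simp add: unit_dec_def)
  show "prj (ten_dec (unit_dec l) d) r \<cdot> f = prj (ten_dec (unit_dec l) d) r \<cdot> g"
    using b eq[of j] by (simp add: ten_dec_nth[OF R] p i)
qed

lemma hom_from_unit:
  assumes f: "f \<in> hom C (S One) (S x \<odot> S y)"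
  shows "x \<noteq> y \<Longrightarrow> f = Zero C (S One) (S x \<odot> S y)" "x = y \<Longrightarrow> \<exists>c. f = c \<bullet> iota x y One"
proof -
  have [simp]: "f \<in> Arr C" "Cod C f = S x \<odot> S y" "Dom C f = S One" using f by (auto simp: hom_def)
  have nz: "proj x y z \<cdot> f = Zero C (S One) (S z)" if "z \<in> set (fuse x y)" "z \<noteq> One" for z
    by (rule schur_zero) (use that in \<open>auto simp: hom_def\<close>)
  have mono: "g = h" if g: "g \<in> hom C (S One) (S x \<odot> S y)" "h \<in> hom C (S One) (S x \<odot> S y)"
    and eq: "\<And>z. z \<in> set (fuse x y) \<Longrightarrow> proj x y z \<cdot> g = proj x y z \<cdot> h" for g h
  proof (rule dec_mono[OF ten_dec[OF unit_dec unit_dec] g])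
    have [simp]: "g \<in> Arr C" "Cod C g = S x \<odot> S y" "h \<in> Arr C" "Cod C h = S x \<odot> S y" using g by (auto simp: hom_def)
    fix r assume "r < dlen (ten_dec (unit_dec x) (unit_dec y))"
    then have r: "r < length (ten_basis (lab (unit_dec x)) (lab (unit_dec y)))" by simp
    obtain i j z where R: "ten_basis (lab (unit_dec x)) (lab (unit_dec y)) ! r = (i, j, z)" by (metis prod_cases3)
    note b = ten_basis_nth[OF r R]
    have "i = 0" "j = 0" using b by auto
    then show "prj (ten_dec (unit_dec x) (unit_dec y)) r \<cdot> g = prj (ten_dec (unit_dec x) (unit_dec y)) r \<cdot> h"
      using b eq[of z] by (simp add: ten_dec_nth[OF R]) (simp add: unit_dec_def)
  qed
  show "f = Zero C (S One) (S x \<odot> S y)" if "x \<noteq> y"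
  proof (rule mono[OF f])
    fix z assume z: "z \<in> set (fuse x y)"
    then have "z \<noteq> One" using that by auto
    then show "proj x y z \<cdot> f = proj x y z \<cdot> Zero C (S One) (S x \<odot> S y)" using nz z by simp
  qed (simp add: hom_def)
  show "\<exists>c. f = c \<bullet> iota x y One" if xy: "x = y"
  proof -
    have "proj x y One \<cdot> f \<in> hom C (S One) (S One)" using xy by (simp add: hom_def)
    then obtain c where c: "proj x y One \<cdot> f = c \<bullet> Ident C (S One)" using schur_scalar by blast
    have "f = c \<bullet> iota x y One"
    proof (rule mono[OF f])
      show "c \<bullet> iota x y One \<in> hom C (S One) (S x \<odot> S y)" using xy by (simp add: hom_def)
      fix z assume z: "z \<in> set (fuse x y)"
      show "proj x y z \<cdot> f = proj x y z \<cdot> (c \<bullet> iota x y One)"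
        using c nz[OF z] z xy by (cases "z = One") (simp_all add: proj_iota)
    qed
    then show ?thesis by blast
  qed
qed

lemma assoc_inv [simp]:
  assumes "A \<in> Obj C" "B \<in> Obj C" "D \<in> Obj C"
  shows "inv_arr C (Assoc C A B D) \<in> Arr C" "Dom C (inv_arr C (Assoc C A B D)) = A \<odot> (B \<odot> D)"
    "Cod C (inv_arr C (Assoc C A B D)) = A \<odot> B \<odot> D"
  using inv_arr[OF assoc_iso[OF assms]] assms by simp_all

lemma assoc_inv_nat:
  assumes "f \<in> Arr C" "g \<in> Arr C" "h \<in> Arr C" "Cod C f = A" "Cod C g = B" "Cod C h = D"
  shows "inv_arr C (Assoc C A B D) \<cdot> (f \<otimes> (g \<otimes> h)) = (f \<otimes> g \<otimes> h) \<cdot> inv_arr C (Assoc C (Dom C f) (Dom C g) (Dom C h))"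
proof -
  have o: "A \<in> Obj C" "B \<in> Obj C" "D \<in> Obj C" "Dom C f \<in> Obj C" "Dom C g \<in> Obj C" "Dom C h \<in> Obj C" using assms by auto
  note i = inv_arr[OF assoc_iso[OF o(1-3)]] inv_arr[OF assoc_iso[OF o(4-6)]]
  note ic = inv_arr_cancel[OF assoc_iso[OF o(1-3)]]
  have "inv_arr C (Assoc C A B D) \<cdot> (f \<otimes> (g \<otimes> h)) =
     inv_arr C (Assoc C A B D) \<cdot> ((f \<otimes> (g \<otimes> h)) \<cdot> (Assoc C (Dom C f) (Dom C g) (Dom C h) \<cdot> inv_arr C (Assoc C (Dom C f) (Dom C g) (Dom C h))))"
    using assms o by (simp add: i)
  also have "\<dots> = inv_arr C (Assoc C A B D) \<cdot> ((Assoc C A B D \<cdot> (f \<otimes> g \<otimes> h)) \<cdot> inv_arr C (Assoc C (Dom C f) (Dom C g) (Dom C h)))"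
    using assms o by (simp add: assoc_nat)
  also have "\<dots> = (f \<otimes> g \<otimes> h) \<cdot> inv_arr C (Assoc C (Dom C f) (Dom C g) (Dom C h))"
    using assms o ic(1)[of "(f \<otimes> g \<otimes> h) \<cdot> inv_arr C (Assoc C (Dom C f) (Dom C g) (Dom C h))"] by simp
  finally show ?thesis .
qed

end

section \<open>Self-duality of all objects and the ribbon structure\<close>

context normal_frame
begin

sublocale simple_system_sums C S
  by unfold_locales (rule ex_zero, rule ex_biproduct)

text \<open>The raw projection and inclusion of the unit in \<open>X\<close> \<otimes>
  \<open>X\<close> satisfy the zigzag identity only up to their associator coefficient
  \<open>-a\<close>. This factor compensates for it; as \<open>a * a = a + 1\<close>, its value at
  \<open>Tau\<close> is \<open>1 - a\<close>.\<close>

definition qdim :: "fib \<Rightarrow> 'k" where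
  "qdim l = (case l of One \<Rightarrow> 1 | Tau \<Rightarrow> - inverse (u + inverse u))"

definition ev0 :: "fib \<Rightarrow> 'm" where "ev0 l = proj l l One"
definition coev0 :: "fib \<Rightarrow> 'm" where "coev0 l = qdim l \<bullet> iota l l One"

lemma ev0_arr [simp]:
  "ev0 l \<in> Arr C" "Dom C (ev0 l) = S l \<odot> S l" "Cod C (ev0 l) = Unit C"
  "coev0 l \<in> Arr C" "Dom C (coev0 l) = Unit C" "Cod C (coev0 l) = S l \<odot> S l"
  by (simp_all add: ev0_def coev0_def S_One)

lemma trace_root_nonzero: "u + inverse u \<noteq> 0"
  using Fc_solution(5) by (simp add: Fc_root)

lemma qdim_F: "qdim l * fib_F (u + inverse u) l l l l One One = 1"
proof -
  define a where "a = u + inverse u"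
  have "a \<noteq> 0" using trace_root_nonzero by (simp add: a_def)
  then show ?thesis unfolding qdim_def a_def[symmetric] by (cases l) (simp_all add: fib_F_def)
qed

lemma qdim_nonzero: "qdim l \<noteq> 0"
  using qdim_F[of l] by auto

lemma Fc_fib: "Fc l l l l One One = fib_F (u + inverse u) l l l l One One"
  using Fc_unit[of l l l One l One] Fc_solution(2) Fc_root by (cases l) (auto simp: fib_F_def)

text \<open>After the unit constraints are removed, the zigzag composite is by definition the
  F-symbol with both channels \<open>One\<close>, which \<open>qdim l\<close> inverts.\<close>

lemma zigzag0_left:
  "RUnit C (S l) \<cdot> ((Ident C (S l) \<otimes> ev0 l) \<cdot> (Assoc C (S l) (S l) (S l) \<cdot> (coev0 l \<otimes> Ident C (S l)))) = LUnit C (S l)"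
proof -
  let ?G = "RUnit C (S l) \<cdot> ((Ident C (S l) \<otimes> ev0 l) \<cdot> (Assoc C (S l) (S l) (S l) \<cdot> ((iota l l One \<otimes> Ident C (S l)) \<cdot> inv_arr C (LUnit C (S l)))))"
  have G: "?G \<in> hom C (S l) (S l)" by (simp add: hom_def S_One)
  have "proj l One l = RUnit C (S l)" "iota One l l = inv_arr C (LUnit C (S l))"
    using iota_unit_right(2)[of l] by (simp_all add: iota_def)
  then have "Fc l l l l One One = coef ?G" by (simp add: Fc_def ev0_def)
  then have e: "?G = fib_F (u + inverse u) l l l l One One \<bullet> Ident C (S l)" using coef_hom[OF G] Fc_fib by simp
  have "RUnit C (S l) \<cdot> ((Ident C (S l) \<otimes> ev0 l) \<cdot> (Assoc C (S l) (S l) (S l) \<cdot> (coev0 l \<otimes> Ident C (S l)))) =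
      (qdim l \<bullet> ?G) \<cdot> LUnit C (S l)" by (simp add: coev0_def S_One)
  also have "\<dots> = LUnit C (S l)" unfolding e using qdim_F[of l] by simp
  finally show ?thesis .
qed

text \<open>The matrix of the inverse arrow is a left inverse and the explicit matrix a right
  inverse of the same matrix, so they coincide.\<close>

lemma mat_assoc_inv:
  "mat (ten_dec (unit_dec x) (ten_dec (unit_dec y) (unit_dec z))) (ten_dec (ten_dec (unit_dec x) (unit_dec y)) (unit_dec z))
     (inv_arr C (Assoc C (S x) (S y) (S z))) = gen_assoc_inv (fib_F (u + inverse u)) [x] [y] [z]" (is "?N = ?A'")
proof -
  note ud = unit_dec
  let ?d0 = "ten_dec (ten_dec (unit_dec x) (unit_dec y)) (unit_dec z)" and ?d1 = "ten_dec (unit_dec x) (ten_dec (unit_dec y) (unit_dec z))"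
  have D: "dec ?d0 (S x \<odot> S y \<odot> S z)" "dec ?d1 (S x \<odot> (S y \<odot> S z))" by (intro ten_dec ud)+
  let ?A = "gen_assoc (fib_F (u + inverse u)) [x] [y] [z]"
  have iso: "iso_arr C (Assoc C (S x) (S y) (S z))" by (intro assoc_iso) auto
  have NA: "fib_comp ?N ?A = fib_ident (fib_tenO (fib_tenO [x] [y]) [z])"
    using mat_comp[OF D(1,2,1), of "Assoc C (S x) (S y) (S z)" "inv_arr C (Assoc C (S x) (S y) (S z))"]
      inv_arr[OF iso] mat_assoc[OF ud ud ud, of x y z] mat_ident[OF D(1)]
    by (simp add: hom_def gen_assoc_Fc fib_assoc_gen)
  have AA: "fib_comp ?A ?A' = fib_ident (fib_tenO [x] (fib_tenO [y] [z]))"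
    by (rule gen_assoc_inverse) (rule fib_F_square(1)[OF root_equation])
  have "?N = fib_comp ?N (fib_comp ?A ?A')" unfolding AA using fib_comp_ident(2)[of ?N] by simp
  also have "\<dots> = fib_comp (fib_comp ?N ?A) ?A'" by (rule fib_comp_assoc[symmetric]) auto
  also have "\<dots> = ?A'" unfolding NA using fib_comp_ident(1)[of ?A'] by simp
  finally show ?thesis .
qed

text \<open>The same computation with the inverse associator. Because the F-matrix is its own
  inverse, the coefficient and hence the correction \<open>qdim l\<close> are those of the other
  zigzag.\<close>

lemma zigzag0_right:
  "LUnit C (S l) \<cdot> ((ev0 l \<otimes> Ident C (S l)) \<cdot> (inv_arr C (Assoc C (S l) (S l) (S l)) \<cdot> (Ident C (S l) \<otimes> coev0 l))) = RUnit C (S l)"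
proof -
  let ?d0 = "ten_dec (ten_dec (unit_dec l) (unit_dec l)) (unit_dec l)" and ?d1 = "ten_dec (unit_dec l) (ten_dec (unit_dec l) (unit_dec l))"
  let ?G = "LUnit C (S l) \<cdot> ((ev0 l \<otimes> Ident C (S l)) \<cdot> (inv_arr C (Assoc C (S l) (S l) (S l)) \<cdot> ((Ident C (S l) \<otimes> iota l l One) \<cdot> inv_arr C (RUnit C (S l)))))"
  have G: "?G \<in> hom C (S l) (S l)" by (simp add: hom_def S_One)
  \<comment> \<open>Since \<open>fuse Tau Tau\<close> lists \<open>One\<close> first, position 0 is
    in every case the summand whose intermediate channel is the unit.\<close>
  have t: "ten_basis [l] [l] ! 0 = (0, 0, One)" "ten_basis [l] (fib_tenO [l] [l]) ! 0 = (0, 0, l)" "ten_basis (fib_tenO [l] [l]) [l] ! 0 = (0, 0, l)"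
    "fib_tenO [l] [l] ! 0 = One" "0 < length (ten_basis [l] (fib_tenO [l] [l]))" "0 < length (ten_basis (fib_tenO [l] [l]) [l])"
    "fib_tenO (fib_tenO [l] [l]) [l] ! 0 = l" "fib_tenO [l] (fib_tenO [l] [l]) ! 0 = l"
    by (cases l; simp add: fib_tenO_eval ten_basis_eval)+
  have U: "inc (unit_dec l) 0 = Ident C (S l)" "prj (unit_dec l) 0 = Ident C (S l)" by (simp_all add: unit_dec_def)
  have p: "proj One l l = LUnit C (S l)" by (simp add: proj_def)
  have in1: "inc (ten_dec (unit_dec l) (unit_dec l)) 0 = iota l l One" "prj (ten_dec (unit_dec l) (unit_dec l)) 0 = proj l l One"
    using ten_dec_nth[of "unit_dec l" "unit_dec l" 0 0 0 One] t by (simp_all add: U)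
  have "prj ?d0 0 = proj One l l \<cdot> (proj l l One \<otimes> Ident C (S l))"
    using ten_dec_nth(2)[of "ten_dec (unit_dec l) (unit_dec l)" "unit_dec l" 0 0 0 l] t by (simp add: in1 U)
  moreover have "inc ?d1 0 = (Ident C (S l) \<otimes> iota l l One) \<cdot> iota l One l"
    using ten_dec_nth(1)[of "unit_dec l" "ten_dec (unit_dec l) (unit_dec l)" 0 0 0 l] t by (simp add: in1 U)
  ultimately have "prj ?d0 0 \<cdot> (inv_arr C (Assoc C (S l) (S l) (S l)) \<cdot> inc ?d1 0) = ?G"
    by (simp add: p iota_unit_right ev0_def S_One)
  then have "coef ?G = entry (mat ?d1 ?d0 (inv_arr C (Assoc C (S l) (S l) (S l)))) 0 0"
    using t by (simp add: mat_def)
  also have "\<dots> = fib_F (u + inverse u) l l l l One One"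
    unfolding mat_assoc_inv by (cases l) (simp_all add: gen_assoc_inv_def fib_tenO_eval ten_basis_eval)
  finally have e: "?G = fib_F (u + inverse u) l l l l One One \<bullet> Ident C (S l)" using coef_hom[OF G] by simp
  have "LUnit C (S l) \<cdot> ((ev0 l \<otimes> Ident C (S l)) \<cdot> (inv_arr C (Assoc C (S l) (S l) (S l)) \<cdot> (Ident C (S l) \<otimes> coev0 l))) =
      (qdim l \<bullet> ?G) \<cdot> RUnit C (S l)" by (simp add: coev0_def S_One)
  also have "\<dots> = RUnit C (S l)" unfolding e using qdim_F[of l] by simp
  finally show ?thesis .
qed

text \<open>Evaluation and coevaluation pair each summand with itself in the standard way. Tested on
  the inclusion of the summand \<open>m\<close>, a zigzag keeps only the term \<open>j = m\<close>,
  where it is the zigzag of a simple object.\<close>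

lemma self_dual:
  assumes A: "A \<in> Obj C" shows "\<exists>ev coev. left_dual C A A ev coev"
proof -
  obtain d where d: "dec d A" using ex_dec A by blast
  note [simp] = decD[OF d]
  note ud = unit_dec[of One, unfolded S_One]
  have iu: "inc (unit_dec One) i = Ident C (Unit C)" for i by (simp add: unit_dec_def S_One)
  define ev where "ev = osum (A \<odot> A) (Unit C) (\<lambda>j. ev0 (lab d ! j) \<cdot> (prj d j \<otimes> prj d j)) (dlen d)"
  define coev where "coev = osum (Unit C) (A \<odot> A) (\<lambda>j. (inc d j \<otimes> inc d j) \<cdot> coev0 (lab d ! j)) (dlen d)"
  have evh: "ev \<in> hom C (A \<odot> A) (Unit C)" unfolding ev_def by (rule osum_hom) (auto simp: hom_def)
  have coevh: "coev \<in> hom C (Unit C) (A \<odot> A)" unfolding coev_def by (rule osum_hom) (auto simp: hom_def)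
  have [simp]: "ev \<in> Arr C" "Dom C ev = A \<odot> A" "Cod C ev = Unit C" "coev \<in> Arr C" "Dom C coev = Unit C" "Cod C coev = A \<odot> A"
    using evh coevh by (auto simp: hom_def)
  have ev: "ev \<cdot> (inc d i \<otimes> inc d m) = (if i = m then ev0 (lab d ! m) else Zero C (S (lab d ! i) \<odot> S (lab d ! m)) (Unit C))"
    if im: "i < dlen d" "m < dlen d" for i m
  proof -
    let ?T = "S (lab d ! i) \<odot> S (lab d ! m)"
    have "ev \<cdot> (inc d i \<otimes> inc d m) = osum ?T (Unit C) (\<lambda>j. (ev0 (lab d ! j) \<cdot> (prj d j \<otimes> prj d j)) \<cdot> (inc d i \<otimes> inc d m)) (dlen d)"
      unfolding ev_def using im by (intro osum_comp) (auto simp: hom_def)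
    also have "\<dots> = osum ?T (Unit C) (\<lambda>j. if j = m then (if i = m then ev0 (lab d ! m) else Zero C ?T (Unit C)) else Zero C ?T (Unit C)) (dlen d)"
      using im by (intro osum_cong) (auto simp: ten_comp_arr dec_prj_inc[OF d])
    also have "\<dots> = (if m = m then (if i = m then ev0 (lab d ! m) else Zero C ?T (Unit C)) else Zero C ?T (Unit C))"
      using im by (intro osum_single) (auto simp: hom_def)
    finally show ?thesis by simp
  qed
  have "RUnit C A \<cdot> ((Ident C A \<otimes> ev) \<cdot> (Assoc C A A A \<cdot> (coev \<otimes> Ident C A))) = LUnit C A"
  proof (rule ten_epi[OF ud d])
    fix i m assume "m < dlen d"
    then have m: "m < dlen d" .
    let ?x = "lab d ! m"
    let ?L = "\<lambda>g. RUnit C A \<cdot> ((Ident C A \<otimes> ev) \<cdot> (Assoc C A A A \<cdot> (g \<otimes> inc d m)))"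
    have L: "?L ((inc d j \<otimes> inc d j) \<cdot> coev0 (lab d ! j)) = (if j = m then inc d m \<cdot> LUnit C (S ?x) else Zero C (Unit C \<odot> S ?x) A)"
      if j: "j < dlen d" for j
    proof -
      let ?y = "lab d ! j"
      have nat: "Assoc C A A A \<cdot> ((inc d j \<otimes> inc d j \<otimes> inc d m) \<cdot> h) = (inc d j \<otimes> (inc d j \<otimes> inc d m)) \<cdot> (Assoc C (S ?y) (S ?y) (S ?x) \<cdot> h)"
        if "h \<in> Arr C" "Cod C h = S ?y \<odot> S ?y \<odot> S ?x" for h
        using that j m comp_cancel[OF assoc_nat[of "inc d j" "inc d j" "inc d m" A A A], of h] by simp
      have "((inc d j \<otimes> inc d j) \<cdot> coev0 ?y) \<otimes> inc d m = (inc d j \<otimes> inc d j \<otimes> inc d m) \<cdot> (coev0 ?y \<otimes> Ident C (S ?x))"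
        using j m by (simp add: ten_comp_arr)
      then have "?L ((inc d j \<otimes> inc d j) \<cdot> coev0 ?y) =
         RUnit C A \<cdot> ((inc d j \<otimes> (ev \<cdot> (inc d j \<otimes> inc d m))) \<cdot> (Assoc C (S ?y) (S ?y) (S ?x) \<cdot> (coev0 ?y \<otimes> Ident C (S ?x))))"
        using j m by (simp add: nat ten_comp_arr' del: ten_ident_arr)
      also have "\<dots> = (if j = m then inc d m \<cdot> LUnit C (S ?x) else Zero C (Unit C \<odot> S ?x) A)"
      proof (cases "j = m")
        case True
        have "inc d m \<otimes> ev0 ?x = (inc d m \<otimes> Ident C (Unit C)) \<cdot> (Ident C (S ?x) \<otimes> ev0 ?x)" using m by (simp add: ten_comp_arr)
        moreover have "RUnit C A \<cdot> ((inc d m \<otimes> Ident C (Unit C)) \<cdot> h) = inc d m \<cdot> (RUnit C (S ?x) \<cdot> h)"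
          if "h \<in> Arr C" "Cod C h = S ?x \<odot> Unit C" for h
          using that m comp_cancel[OF unit_nat(2)[of "inc d m" "S ?x" A], of h] by simp
        ultimately show ?thesis using True m ev[OF m m] zigzag0_left[of ?x] by simp
      next
        case False
        then show ?thesis using j m by (simp add: ev)
      qed
      finally show ?thesis .
    qed
    have "(RUnit C A \<cdot> ((Ident C A \<otimes> ev) \<cdot> (Assoc C A A A \<cdot> (coev \<otimes> Ident C A)))) \<cdot> (inc (unit_dec One) i \<otimes> inc d m) = ?L coev"
      using m by (simp add: iu ten_comp_arr)
    also have "\<dots> = osum (Unit C \<odot> S ?x) A (\<lambda>j. ?L ((inc d j \<otimes> inc d j) \<cdot> coev0 (lab d ! j))) (dlen d)"
      unfolding coev_def using m by (intro osum_map[where L = ?L]) (auto simp: hom_def ten_add_arr)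
    also have "\<dots> = osum (Unit C \<odot> S ?x) A (\<lambda>j. if j = m then inc d m \<cdot> LUnit C (S ?x) else Zero C (Unit C \<odot> S ?x) A) (dlen d)"
      by (rule osum_cong) (rule L)
    also have "\<dots> = (if m = m then inc d m \<cdot> LUnit C (S ?x) else Zero C (Unit C \<odot> S ?x) A)"
      using m by (intro osum_single) (auto simp: hom_def)
    also have "\<dots> = LUnit C A \<cdot> (inc (unit_dec One) i \<otimes> inc d m)" using m unit_nat(1)[of "inc d m" "S ?x" A] by (simp add: iu)
    finally show "(RUnit C A \<cdot> ((Ident C A \<otimes> ev) \<cdot> (Assoc C A A A \<cdot> (coev \<otimes> Ident C A)))) \<cdot> (inc (unit_dec One) i \<otimes> inc d m) =
      LUnit C A \<cdot> (inc (unit_dec One) i \<otimes> inc d m)" .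
  qed (auto simp: hom_def)
  moreover have "LUnit C A \<cdot> ((ev \<otimes> Ident C A) \<cdot> (inv_arr C (Assoc C A A A) \<cdot> (Ident C A \<otimes> coev))) = RUnit C A"
  proof (rule ten_epi[OF d ud])
    fix m i assume "m < dlen d"
    then have m: "m < dlen d" .
    let ?x = "lab d ! m"
    let ?L = "\<lambda>g. LUnit C A \<cdot> ((ev \<otimes> Ident C A) \<cdot> (inv_arr C (Assoc C A A A) \<cdot> (inc d m \<otimes> g)))"
    have L: "?L ((inc d j \<otimes> inc d j) \<cdot> coev0 (lab d ! j)) = (if j = m then inc d m \<cdot> RUnit C (S ?x) else Zero C (S ?x \<odot> Unit C) A)"
      if j: "j < dlen d" for j
    proof -
      let ?y = "lab d ! j"
      have nat: "inv_arr C (Assoc C A A A) \<cdot> ((inc d m \<otimes> (inc d j \<otimes> inc d j)) \<cdot> h) = (inc d m \<otimes> inc d j \<otimes> inc d j) \<cdot> (inv_arr C (Assoc C (S ?x) (S ?y) (S ?y)) \<cdot> h)"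
        if "h \<in> Arr C" "Cod C h = S ?x \<odot> (S ?y \<odot> S ?y)" for h
        using that j m comp_cancel[OF assoc_inv_nat[of "inc d m" "inc d j" "inc d j" A A A], of h] by simp
      have "inc d m \<otimes> ((inc d j \<otimes> inc d j) \<cdot> coev0 ?y) = (inc d m \<otimes> (inc d j \<otimes> inc d j)) \<cdot> (Ident C (S ?x) \<otimes> coev0 ?y)"
        using j m by (simp add: ten_comp_arr)
      then have "?L ((inc d j \<otimes> inc d j) \<cdot> coev0 ?y) =
         LUnit C A \<cdot> (((ev \<cdot> (inc d m \<otimes> inc d j)) \<otimes> inc d j) \<cdot> (inv_arr C (Assoc C (S ?x) (S ?y) (S ?y)) \<cdot> (Ident C (S ?x) \<otimes> coev0 ?y)))"
        using j m by (simp add: nat ten_comp_arr' del: ten_ident_arr)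
      also have "\<dots> = (if j = m then inc d m \<cdot> RUnit C (S ?x) else Zero C (S ?x \<odot> Unit C) A)"
      proof (cases "j = m")
        case True
        have "ev0 ?x \<otimes> inc d m = (Ident C (Unit C) \<otimes> inc d m) \<cdot> (ev0 ?x \<otimes> Ident C (S ?x))" using m by (simp add: ten_comp_arr)
        moreover have "LUnit C A \<cdot> ((Ident C (Unit C) \<otimes> inc d m) \<cdot> h) = inc d m \<cdot> (LUnit C (S ?x) \<cdot> h)"
          if "h \<in> Arr C" "Cod C h = Unit C \<odot> S ?x" for h
          using that m comp_cancel[OF unit_nat(1)[of "inc d m" "S ?x" A], of h] by simp
        ultimately show ?thesis using True m ev[OF m m] zigzag0_right[of ?x] by simp
      next
        case False
        then show ?thesis using j m by (simp add: ev)
      qed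
      finally show ?thesis .
    qed
    have "(LUnit C A \<cdot> ((ev \<otimes> Ident C A) \<cdot> (inv_arr C (Assoc C A A A) \<cdot> (Ident C A \<otimes> coev)))) \<cdot> (inc d m \<otimes> inc (unit_dec One) i) = ?L coev"
      using m by (simp add: iu ten_comp_arr)
    also have "\<dots> = osum (S ?x \<odot> Unit C) A (\<lambda>j. ?L ((inc d j \<otimes> inc d j) \<cdot> coev0 (lab d ! j))) (dlen d)"
      unfolding coev_def using m by (intro osum_map[where L = ?L]) (auto simp: hom_def ten_add_arr)
    also have "\<dots> = osum (S ?x \<odot> Unit C) A (\<lambda>j. if j = m then inc d m \<cdot> RUnit C (S ?x) else Zero C (S ?x \<odot> Unit C) A) (dlen d)"
      by (rule osum_cong) (rule L)
    also have "\<dots> = (if m = m then inc d m \<cdot> RUnit C (S ?x) else Zero C (S ?x \<odot> Unit C) A)"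
      using m by (intro osum_single) (auto simp: hom_def)
    also have "\<dots> = RUnit C A \<cdot> (inc d m \<otimes> inc (unit_dec One) i)" using m unit_nat(2)[of "inc d m" "S ?x" A] by (simp add: iu)
    finally show "(LUnit C A \<cdot> ((ev \<otimes> Ident C A) \<cdot> (inv_arr C (Assoc C A A A) \<cdot> (Ident C A \<otimes> coev)))) \<cdot> (inc d m \<otimes> inc (unit_dec One) i) =
      RUnit C A \<cdot> (inc d m \<otimes> inc (unit_dec One) i)" .
  qed (auto simp: hom_def)
  ultimately have "left_dual C A A ev coev"
    using evh coevh A by (simp add: left_dual_def)
  then show ?thesis by blast
qed

lemma rigid_C: "rigid C"
  unfolding rigid_def using self_dual by blast

lemma left_dualD:
  assumes "left_dual C A D ev coev"
  shows "A \<in> Obj C" "D \<in> Obj C" "ev \<in> Arr C" "Dom C ev = D \<odot> A" "Cod C ev = Unit C"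
    "coev \<in> Arr C" "Dom C coev = Unit C" "Cod C coev = A \<odot> D"
    "RUnit C A \<cdot> ((Ident C A \<otimes> ev) \<cdot> (Assoc C A D A \<cdot> (coev \<otimes> Ident C A))) = LUnit C A"
    "LUnit C D \<cdot> ((ev \<otimes> Ident C D) \<cdot> (inv_arr C (Assoc C D A D) \<cdot> (Ident C D \<otimes> coev))) = RUnit C D"
proof -
  show s [simp]: "A \<in> Obj C" "D \<in> Obj C" "ev \<in> Arr C" "Dom C ev = D \<odot> A" "Cod C ev = Unit C"
    "coev \<in> Arr C" "Dom C coev = Unit C" "Cod C coev = A \<odot> D"
    using assms by (auto simp: left_dual_def hom_def)
  show "RUnit C A \<cdot> ((Ident C A \<otimes> ev) \<cdot> (Assoc C A D A \<cdot> (coev \<otimes> Ident C A))) = LUnit C A"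
    "LUnit C D \<cdot> ((ev \<otimes> Ident C D) \<cdot> (inv_arr C (Assoc C D A D) \<cdot> (Ident C D \<otimes> coev))) = RUnit C D"
    using assms s by (simp_all add: left_dual_def)
qed

lemma twist_S: "Twist C (S l) = Tc l \<bullet> Ident C (S l)"
  unfolding Tc_def by (rule coef_hom) (simp add: hom_def)

text \<open>The twist acts on a simple summand by a scalar that depends on its label alone, and
  evaluation vanishes between different labels. So the twist can be moved through \<open>ev\<close>
  from \<open>A\<close> to \<open>D\<close>, after which the zigzag identity straightens the dual
  arrow to the twist of \<open>D\<close>.\<close>

lemma twist_dual_arr:
  assumes dual: "left_dual C A D ev coev"
  shows "Twist C D = dual_arr C A D ev coev (Twist C A)"
proof -
  note [simp] = left_dualD(1-8)[OF dual]
  obtain dA dD where d: "dec dA A" "dec dD D" using ex_dec[of A] ex_dec[of D] by auto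
  note [simp] = decD[OF d(1)] decD[OF d(2)]
  have sl: "ev \<cdot> (Twist C D \<otimes> Ident C A) = ev \<cdot> (Ident C D \<otimes> Twist C A)"
  proof (rule ten_epi[OF d(2,1)])
    fix j i assume j: "j < dlen dD" and i: "i < dlen dA"
    let ?y = "lab dD ! j" and ?x = "lab dA ! i"
    have g: "ev \<cdot> (inc dD j \<otimes> inc dA i) \<in> hom C (S ?y \<odot> S ?x) (S One)" using i j by (simp add: hom_def S_One)
    have l: "(ev \<cdot> (Twist C D \<otimes> Ident C A)) \<cdot> (inc dD j \<otimes> inc dA i) = Tc ?y \<bullet> (ev \<cdot> (inc dD j \<otimes> inc dA i))"
      using i j twist_nat[of "inc dD j" "S ?y" D] by (simp add: ten_comp_arr twist_S)
    have r: "(ev \<cdot> (Ident C D \<otimes> Twist C A)) \<cdot> (inc dD j \<otimes> inc dA i) = Tc ?x \<bullet> (ev \<cdot> (inc dD j \<otimes> inc dA i))"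
      using i j twist_nat[of "inc dA i" "S ?x" A] by (simp add: ten_comp_arr twist_S)
    show "(ev \<cdot> (Twist C D \<otimes> Ident C A)) \<cdot> (inc dD j \<otimes> inc dA i) = (ev \<cdot> (Ident C D \<otimes> Twist C A)) \<cdot> (inc dD j \<otimes> inc dA i)"
    proof (cases "?y = ?x")
      case True
      show ?thesis unfolding l r using True by simp
    next
      case False
      show ?thesis unfolding l r hom_to_unit(1)[OF g False] by simp
    qed
  qed (auto simp: hom_def)
  have nat: "inv_arr C (Assoc C D A D) \<cdot> ((Twist C D \<otimes> Ident C (A \<odot> D)) \<cdot> h) = (Twist C D \<otimes> Ident C A \<otimes> Ident C D) \<cdot> (inv_arr C (Assoc C D A D) \<cdot> h)"
    if "h \<in> Arr C" "Cod C h = D \<odot> (A \<odot> D)" for h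
    using that comp_cancel[OF assoc_inv_nat[of "Twist C D" "Ident C A" "Ident C D" D A D], of h] by simp
  have "dual_arr C A D ev coev (Twist C A) =
      LUnit C D \<cdot> (((ev \<cdot> (Ident C D \<otimes> Twist C A)) \<otimes> Ident C D) \<cdot> (inv_arr C (Assoc C D A D) \<cdot> ((Ident C D \<otimes> coev) \<cdot> inv_arr C (RUnit C D))))"
    unfolding dual_arr_def by (simp add: ten_comp_arr')
  also have "\<dots> = LUnit C D \<cdot> ((ev \<otimes> Ident C D) \<cdot> ((Twist C D \<otimes> Ident C A \<otimes> Ident C D) \<cdot> (inv_arr C (Assoc C D A D) \<cdot> ((Ident C D \<otimes> coev) \<cdot> inv_arr C (RUnit C D)))))"
    unfolding sl[symmetric] by (simp add: ten_comp_arr')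
  also have "\<dots> = LUnit C D \<cdot> ((ev \<otimes> Ident C D) \<cdot> (inv_arr C (Assoc C D A D) \<cdot> ((Twist C D \<otimes> Ident C (A \<odot> D)) \<cdot> ((Ident C D \<otimes> coev) \<cdot> inv_arr C (RUnit C D)))))"
    by (simp add: nat)
  also have "\<dots> = (LUnit C D \<cdot> ((ev \<otimes> Ident C D) \<cdot> (inv_arr C (Assoc C D A D) \<cdot> (Ident C D \<otimes> coev)))) \<cdot> ((Twist C D \<otimes> Ident C (Unit C)) \<cdot> inv_arr C (RUnit C D))"
    by (simp add: ten_comp_arr')
  also have "\<dots> = (RUnit C D \<cdot> (Twist C D \<otimes> Ident C (Unit C))) \<cdot> inv_arr C (RUnit C D)" unfolding left_dualD(10)[OF dual] by simp
  also have "\<dots> = Twist C D" using unit_nat(2)[of "Twist C D" D D] by simp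
  finally show ?thesis ..
qed

lemma ribbon: "ribbon_category C"
  by unfold_locales (rule rigid_C, rule twist_dual_arr)

text \<open>The loop of \<open>S l\<close> closed by the braiding alone. Multiplied by the twist
  \<open>Tc l\<close> it is the dimension of \<open>S l\<close>.\<close>

definition kappa :: "fib \<Rightarrow> 'k" where "kappa l = Rc l l One * qdim l"

lemma ev0_braid_coev0: "ev0 l \<cdot> (Braid C (S l) (S l) \<cdot> coev0 l) = kappa l \<bullet> Ident C (Unit C)"
proof -
  let ?G = "proj l l One \<cdot> (Braid C (S l) (S l) \<cdot> iota l l One)"
  have "?G = Rc l l One \<bullet> Ident C (S One)" unfolding Rc_def by (rule coef_hom) (simp add: hom_def)
  then show ?thesis by (simp add: ev0_def coev0_def kappa_def S_One mult.commute)
qed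

text \<open>Cut at \<open>S l\<close>, the two halves \<open>ev (1 \<otimes> a)\<close> and \<open>(b \<otimes> 1) coev\<close> of the loop factor through the
  standard duality of \<open>S l\<close> via \<open>\<phi> : D \<rightarrow> S l\<close> and \<open>\<psi> : S l \<rightarrow> D\<close>, and the zigzag identity shows that
  \<open>\<phi> \<psi>\<close> and \<open>b a\<close> are the same scalar.\<close>

lemma trace_factor:
  assumes dual: "left_dual C A D ev coev" and a: "a \<in> hom C (S l) A" and b: "b \<in> hom C A (S l)"
  shows "ev \<cdot> (Braid C A D \<cdot> (((a \<cdot> b) \<otimes> Ident C D) \<cdot> coev)) = (coef (b \<cdot> a) * kappa l) \<bullet> Ident C (Unit C)"
proof -
  note [simp] = left_dualD(1-8)[OF dual]
  obtain d where d: "dec d D" using ex_dec[of D] by auto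
  note [simp] = decD[OF d]
  have [simp]: "a \<in> Arr C" "Dom C a = S l" "Cod C a = A" "b \<in> Arr C" "Dom C b = A" "Cod C b = S l"
    using a b by (auto simp: hom_def)
  have iu: "inc (unit_dec l) i = Ident C (S l)" for i by (simp add: unit_dec_def)
  \<comment> \<open>On each summand of \<open>D\<close> the arrow to the unit is zero or a multiple
    of the standard evaluation. These multiples are the components of the map from \<open>D\<close>
    to \<open>S l\<close>.\<close>
  obtain \<phi> where \<phi>: "\<phi> \<in> hom C D (S l)" "ev \<cdot> (Ident C D \<otimes> a) = ev0 l \<cdot> (\<phi> \<otimes> Ident C (S l))"
  proof -
    have "\<exists>f. f \<in> hom C (S (lab d ! j)) (S l) \<and> ev \<cdot> (inc d j \<otimes> a) = ev0 l \<cdot> (f \<otimes> Ident C (S l))" if j: "j < dlen d" for j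
    proof -
      let ?y = "lab d ! j"
      have g: "ev \<cdot> (inc d j \<otimes> a) \<in> hom C (S ?y \<odot> S l) (S One)" using j by (simp add: hom_def S_One)
      show ?thesis
      proof (cases "?y = l")
        case True
        then obtain c where "ev \<cdot> (inc d j \<otimes> a) = c \<bullet> proj ?y l One" using hom_to_unit(2)[OF g] by blast
        then show ?thesis using True by (intro exI[of _ "c \<bullet> Ident C (S l)"]) (simp add: hom_def ev0_def)
      next
        case False
        then show ?thesis using hom_to_unit(1)[OF g False]
          by (intro exI[of _ "Zero C (S ?y) (S l)"]) (simp add: hom_def S_One)
      qed
    qed
    then obtain f where f: "\<And>j. j < dlen d \<Longrightarrow> f j \<in> hom C (S (lab d ! j)) (S l)"
      "\<And>j. j < dlen d \<Longrightarrow> ev \<cdot> (inc d j \<otimes> a) = ev0 l \<cdot> (f j \<otimes> Ident C (S l))" by metis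
    obtain h where h: "h \<in> hom C D (S l)" "\<forall>j<dlen d. h \<cdot> inc d j = f j" using dec_extend[OF d f(1)] by auto
    have [simp]: "h \<in> Arr C" "Dom C h = D" "Cod C h = S l" using h(1) by (auto simp: hom_def)
    have "ev \<cdot> (Ident C D \<otimes> a) = ev0 l \<cdot> (h \<otimes> Ident C (S l))"
    proof (rule ten_epi[OF d unit_dec])
      fix j i assume "j < dlen d"
      then show "(ev \<cdot> (Ident C D \<otimes> a)) \<cdot> (inc d j \<otimes> inc (unit_dec l) i) = (ev0 l \<cdot> (h \<otimes> Ident C (S l))) \<cdot> (inc d j \<otimes> inc (unit_dec l) i)"
        using h(2) f(2)[of j] by (simp add: iu ten_comp_arr)
    qed (auto simp: hom_def)
    then show ?thesis using that h(1) by blast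
  qed
  have [simp]: "\<phi> \<in> Arr C" "Dom C \<phi> = D" "Cod C \<phi> = S l" using \<phi>(1) by (auto simp: hom_def)
  obtain \<psi> where \<psi>: "\<psi> \<in> hom C (S l) D" "(b \<otimes> Ident C D) \<cdot> coev = (Ident C (S l) \<otimes> \<psi>) \<cdot> coev0 l"
  proof -
    have "\<exists>f. f \<in> hom C (S l) (S (lab d ! j)) \<and> (b \<otimes> prj d j) \<cdot> coev = (Ident C (S l) \<otimes> f) \<cdot> coev0 l" if j: "j < dlen d" for j
    proof -
      let ?y = "lab d ! j"
      have g: "(b \<otimes> prj d j) \<cdot> coev \<in> hom C (S One) (S l \<odot> S ?y)" using j by (simp add: hom_def S_One)
      show ?thesis
      proof (cases "l = ?y")
        case True
        then obtain c where "(b \<otimes> prj d j) \<cdot> coev = c \<bullet> iota l ?y One" using hom_from_unit(2)[OF g] by blast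
        \<comment> \<open>The standard coevaluation is \<open>qdim l\<close> times the inclusion, so
          the multiple has to be divided by this factor.\<close>
        then show ?thesis using True qdim_nonzero[of l] by (intro exI[of _ "(c / qdim l) \<bullet> Ident C (S l)"]) (simp add: hom_def coev0_def)
      next
        case False
        then show ?thesis using hom_from_unit(1)[OF g False]
          by (intro exI[of _ "Zero C (S l) (S ?y)"]) (simp add: hom_def S_One)
      qed
    qed
    then obtain f where f: "\<And>j. j < dlen d \<Longrightarrow> f j \<in> hom C (S l) (S (lab d ! j))"
      "\<And>j. j < dlen d \<Longrightarrow> (b \<otimes> prj d j) \<cdot> coev = (Ident C (S l) \<otimes> f j) \<cdot> coev0 l" by metis
    obtain h where h: "h \<in> hom C (S l) D" "\<forall>j<dlen d. prj d j \<cdot> h = f j" using dec_coextend[OF d f(1)] by auto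
    have [simp]: "h \<in> Arr C" "Dom C h = S l" "Cod C h = D" using h(1) by (auto simp: hom_def)
    have "(b \<otimes> Ident C D) \<cdot> coev = (Ident C (S l) \<otimes> h) \<cdot> coev0 l"
    proof (rule ten_mono[OF d])
      fix j assume "j < dlen d"
      then show "(Ident C (S l) \<otimes> prj d j) \<cdot> ((b \<otimes> Ident C D) \<cdot> coev) = (Ident C (S l) \<otimes> prj d j) \<cdot> ((Ident C (S l) \<otimes> h) \<cdot> coev0 l)"
        using h(2) f(2)[of j] by (simp add: ten_comp_arr')
    qed (auto simp: hom_def)
    then show ?thesis using that h(1) by blast
  qed
  have [simp]: "\<psi> \<in> Arr C" "Dom C \<psi> = S l" "Cod C \<psi> = D" using \<psi>(1) by (auto simp: hom_def)
  define c where "c = coef (\<phi> \<cdot> \<psi>)"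
  have pp: "\<phi> \<cdot> \<psi> = c \<bullet> Ident C (S l)" unfolding c_def by (rule coef_hom) (simp add: hom_def)
  have nat1: "Braid C A D \<cdot> ((a \<otimes> Ident C D) \<cdot> h) = (Ident C D \<otimes> a) \<cdot> (Braid C (S l) D \<cdot> h)"
    if "h \<in> Arr C" "Cod C h = S l \<odot> D" for h
    using that comp_cancel[OF braid_nat[of a "Ident C D" A D], of h] by simp
  have nat2: "Braid C (S l) D \<cdot> ((Ident C (S l) \<otimes> \<psi>) \<cdot> h) = (\<psi> \<otimes> Ident C (S l)) \<cdot> (Braid C (S l) (S l) \<cdot> h)"
    if "h \<in> Arr C" "Cod C h = S l \<odot> S l" for h
    using that comp_cancel[OF braid_nat[of "Ident C (S l)" \<psi> "S l" D], of h] by simp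
  have "ev \<cdot> (Braid C A D \<cdot> (((a \<cdot> b) \<otimes> Ident C D) \<cdot> coev)) = ev \<cdot> (Braid C A D \<cdot> ((a \<otimes> Ident C D) \<cdot> ((b \<otimes> Ident C D) \<cdot> coev)))"
    by (simp add: ten_comp_arr')
  also have "\<dots> = (ev \<cdot> (Ident C D \<otimes> a)) \<cdot> (Braid C (S l) D \<cdot> ((b \<otimes> Ident C D) \<cdot> coev))" by (simp add: nat1)
  also have "\<dots> = (ev0 l \<cdot> (\<phi> \<otimes> Ident C (S l))) \<cdot> ((\<psi> \<otimes> Ident C (S l)) \<cdot> (Braid C (S l) (S l) \<cdot> coev0 l))"
    unfolding \<phi>(2) \<psi>(2) by (simp add: nat2)
  also have "\<dots> = ev0 l \<cdot> (((\<phi> \<cdot> \<psi>) \<otimes> Ident C (S l)) \<cdot> (Braid C (S l) (S l) \<cdot> coev0 l))" by (simp add: ten_comp_arr')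
  also have "\<dots> = (c * kappa l) \<bullet> Ident C (Unit C)" unfolding pp by (simp add: ev0_braid_coev0)
  finally have res: "ev \<cdot> (Braid C A D \<cdot> (((a \<cdot> b) \<otimes> Ident C D) \<cdot> coev)) = (c * kappa l) \<bullet> Ident C (Unit C)" .
  \<comment> \<open>The zigzag of \<open>A\<close> and \<open>D\<close> is inserted between
    \<open>a\<close> and \<open>b\<close>. Once both halves are expressed through the standard
    duality, it has become the zigzag of \<open>S l\<close> with the scalar \<open>c\<close> in
    front.\<close>
  have "(b \<cdot> a) \<cdot> LUnit C (S l) = b \<cdot> (LUnit C A \<cdot> (Ident C (Unit C) \<otimes> a))" using unit_nat(1)[of a "S l" A] by simp
  also have "\<dots> = b \<cdot> ((RUnit C A \<cdot> ((Ident C A \<otimes> ev) \<cdot> (Assoc C A D A \<cdot> (coev \<otimes> Ident C A)))) \<cdot> (Ident C (Unit C) \<otimes> a))"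
    unfolding left_dualD(9)[OF dual] ..
  also have "\<dots> = (b \<cdot> RUnit C A) \<cdot> ((Ident C A \<otimes> ev) \<cdot> (Assoc C A D A \<cdot> (coev \<otimes> a)))"
    by (simp add: ten_comp_arr)
  also have "\<dots> = (RUnit C (S l) \<cdot> (b \<otimes> Ident C (Unit C))) \<cdot> ((Ident C A \<otimes> ev) \<cdot> (Assoc C A D A \<cdot> (coev \<otimes> a)))"
    using unit_nat(2)[of b A "S l"] by simp
  also have "\<dots> = RUnit C (S l) \<cdot> ((Ident C (S l) \<otimes> ev) \<cdot> ((b \<otimes> (Ident C D \<otimes> Ident C A)) \<cdot> (Assoc C A D A \<cdot> (coev \<otimes> a))))"
    by (simp add: ten_comp_arr')
  also have "(b \<otimes> (Ident C D \<otimes> Ident C A)) \<cdot> (Assoc C A D A \<cdot> (coev \<otimes> a)) = Assoc C (S l) D A \<cdot> (((b \<otimes> Ident C D) \<cdot> coev) \<otimes> a)"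
    using comp_cancel[OF assoc_nat[of b "Ident C D" "Ident C A" "S l" D A], of "coev \<otimes> a"] by (simp add: ten_comp_arr)
  also have "((b \<otimes> Ident C D) \<cdot> coev) \<otimes> a = (Ident C (S l) \<otimes> \<psi> \<otimes> a) \<cdot> (coev0 l \<otimes> Ident C (S l))"
    unfolding \<psi>(2) by (simp add: ten_comp_arr)
  also have "Assoc C (S l) D A \<cdot> ((Ident C (S l) \<otimes> \<psi> \<otimes> a) \<cdot> (coev0 l \<otimes> Ident C (S l))) =
      (Ident C (S l) \<otimes> (\<psi> \<otimes> a)) \<cdot> (Assoc C (S l) (S l) (S l) \<cdot> (coev0 l \<otimes> Ident C (S l)))"
    using comp_cancel[OF assoc_nat[of "Ident C (S l)" \<psi> a "S l" D A], of "coev0 l \<otimes> Ident C (S l)"] by simp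
  also have "RUnit C (S l) \<cdot> ((Ident C (S l) \<otimes> ev) \<cdot> ((Ident C (S l) \<otimes> (\<psi> \<otimes> a)) \<cdot> (Assoc C (S l) (S l) (S l) \<cdot> (coev0 l \<otimes> Ident C (S l))))) =
     RUnit C (S l) \<cdot> ((Ident C (S l) \<otimes> (ev \<cdot> (\<psi> \<otimes> a))) \<cdot> (Assoc C (S l) (S l) (S l) \<cdot> (coev0 l \<otimes> Ident C (S l))))"
    by (simp add: ten_comp_arr')
  also have "ev \<cdot> (\<psi> \<otimes> a) = (ev \<cdot> (Ident C D \<otimes> a)) \<cdot> (\<psi> \<otimes> Ident C (S l))" by (simp add: ten_comp_arr)
  also have "\<dots> = c \<bullet> ev0 l" unfolding \<phi>(2) using pp by (simp add: ten_comp_arr)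
  also have "RUnit C (S l) \<cdot> ((Ident C (S l) \<otimes> (c \<bullet> ev0 l)) \<cdot> (Assoc C (S l) (S l) (S l) \<cdot> (coev0 l \<otimes> Ident C (S l)))) = c \<bullet> LUnit C (S l)"
    by (simp add: zigzag0_left)
  finally have "(b \<cdot> a) \<cdot> LUnit C (S l) = c \<bullet> LUnit C (S l)" .
  then have "((b \<cdot> a) \<cdot> LUnit C (S l)) \<cdot> inv_arr C (LUnit C (S l)) = (c \<bullet> LUnit C (S l)) \<cdot> inv_arr C (LUnit C (S l))" by (simp only:)
  then have "b \<cdot> a = c \<bullet> Ident C (S l)" by simp
  then have "coef (b \<cdot> a) = c" by (rule coef_eqI)
  then show ?thesis using res by simp
qed

text \<open>The loop is additive in \<open>g\<close>, and \<open>g\<close> is the sum of its scalars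
  times the projectors onto the summands. Each projector factors through a simple object, so
  \<open>trace_factor\<close> evaluates its loop to \<open>kappa\<close>.\<close>

lemma trace_decomposition:
  assumes dual: "left_dual C A D ev coev" and d: "dec d A" and g: "g \<in> hom C A A"
    and c: "\<And>r. r < dlen d \<Longrightarrow> g \<cdot> inc d r = c r \<bullet> inc d r"
  shows "ev \<cdot> (Braid C A D \<cdot> ((g \<otimes> Ident C D) \<cdot> coev)) = (\<Sum>r<dlen d. c r * kappa (lab d ! r)) \<bullet> Ident C (Unit C)"
proof -
  note [simp] = left_dualD(1-8)[OF dual] decD[OF d]
  have [simp]: "g \<in> Arr C" "Dom C g = A" "Cod C g = A" using g by (auto simp: hom_def)
  let ?L = "\<lambda>h. ev \<cdot> (Braid C A D \<cdot> ((h \<otimes> Ident C D) \<cdot> coev))"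
  have "g = g \<cdot> osum A A (\<lambda>r. inc d r \<cdot> prj d r) (dlen d)" by (simp add: dec_complete[OF d])
  also have "\<dots> = osum A A (\<lambda>r. g \<cdot> (inc d r \<cdot> prj d r)) (dlen d)" by (intro osum_comp) (auto simp: hom_def)
  also have "\<dots> = osum A A (\<lambda>r. c r \<bullet> (inc d r \<cdot> prj d r)) (dlen d)"
  proof (rule osum_cong)
    fix r assume r: "r < dlen d"
    have "g \<cdot> (inc d r \<cdot> prj d r) = (g \<cdot> inc d r) \<cdot> prj d r" using r by simp
    also have "\<dots> = c r \<bullet> (inc d r \<cdot> prj d r)" unfolding c[OF r] using r by simp
    finally show "g \<cdot> (inc d r \<cdot> prj d r) = c r \<bullet> (inc d r \<cdot> prj d r)" .
  qed
  finally have "?L g = ?L (osum A A (\<lambda>r. c r \<bullet> (inc d r \<cdot> prj d r)) (dlen d))" by (rule arg_cong)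
  also have "\<dots> = osum (Unit C) (Unit C) (\<lambda>r. ?L (c r \<bullet> (inc d r \<cdot> prj d r))) (dlen d)"
    by (intro osum_map[where L = ?L]) (auto simp: hom_def ten_add_arr)
  also have "\<dots> = osum (Unit C) (Unit C) (\<lambda>r. (c r * kappa (lab d ! r)) \<bullet> Ident C (Unit C)) (dlen d)"
  proof (rule osum_cong)
    fix r assume r: "r < dlen d"
    have "?L (c r \<bullet> (inc d r \<cdot> prj d r)) = c r \<bullet> ?L (inc d r \<cdot> prj d r)" using r by simp
    also have "\<dots> = (c r * kappa (lab d ! r)) \<bullet> Ident C (Unit C)"
      using trace_factor[OF dual dec_hom[OF d r]] r by (simp add: dec_prj_inc[OF d])
    finally show "?L (c r \<bullet> (inc d r \<cdot> prj d r)) = (c r * kappa (lab d ! r)) \<bullet> Ident C (Unit C)" .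
  qed
  also have "\<dots> = (\<Sum>r<dlen d. c r * kappa (lab d ! r)) \<bullet> Ident C (Unit C)"
    by (rule osum_smult) (simp add: hom_def)
  finally show ?thesis .
qed

text \<open>The definite description admits any dual, so uniqueness requires the value of the loop
  for all of them, and existence requires one, which self-duality provides.\<close>

lemma trace_eqI:
  assumes A: "A \<in> Obj C" and g: "f \<in> hom C A A"
    and t: "\<And>D ev coev. left_dual C A D ev coev \<Longrightarrow> ev \<cdot> (Braid C A D \<cdot> (((Twist C A \<cdot> f) \<otimes> Ident C D) \<cdot> coev)) = t \<bullet> Ident C (Unit C)"
  shows "trace C A f = t"
proof -
  have eq: "ev \<cdot> Braid C A D \<cdot> ((Twist C A \<cdot> f) \<otimes> Ident C D) \<cdot> coev = t \<bullet> Ident C (Unit C)"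
    if dual: "left_dual C A D ev coev" for D ev coev
    using t[OF dual] left_dualD(1-8)[OF dual] g by (simp add: hom_def)
  obtain ev coev where dual: "left_dual C A A ev coev" using self_dual[OF A] by blast
  have "s \<bullet> Ident C (Unit C) = t \<bullet> Ident C (Unit C) \<Longrightarrow> s = t" for s using scalar_inj[of s One t] by (simp add: S_One)
  then show ?thesis unfolding trace_def using eq dual by (intro the_equality) (blast, metis)
qed

lemma simple_dec:
  assumes "iso_obj C Z (S z)" shows "\<exists>d. dec d Z \<and> lab d = [z]"
proof -
  obtain g where g: "g \<in> hom C (S z) Z" "iso_arr C g" using iso_obj_sym[OF assms] by (auto simp: iso_obj_def)
  note I = inv_arr[OF g(2)] inv_arr_cancel[OF g(2)]
  have [simp]: "g \<in> Arr C" "Dom C g = S z" "Cod C g = Z" "Z \<in> Obj C" using g(1) hom_obj by (auto simp: hom_def)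
  note [simp] = I[simplified]
  have "x = y" if x: "x \<in> hom C Z B" and y: "y \<in> hom C Z B" and eq: "x \<cdot> g = y \<cdot> g" for x y B
  proof -
    have "x = (x \<cdot> g) \<cdot> inv_arr C g" using x by (simp add: hom_def)
    also have "\<dots> = y" unfolding eq using y by (simp add: hom_def)
    finally show ?thesis .
  qed
  then have "dec (Dec [z] (\<lambda>_. g) (\<lambda>_. inv_arr C g)) Z" by (auto simp: is_dec_def hom_def)
  then show ?thesis by (intro exI[of _ "Dec [z] (\<lambda>_. g) (\<lambda>_. inv_arr C g)"]) simp
qed

lemma Tc_nonzero: "Tc l \<noteq> 0"
  using Tc_solution(1) Tc_root root_nonzero by (cases l) auto

text \<open>The balancing formula for the S-matrix. One factor \<open>Tc w\<close> comes from
  writing the double braiding as a quotient of twists; the other, together with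
  \<open>kappa w\<close>, gives the dimension of the channel \<open>w\<close>.\<close>

definition s_entry :: "fib \<Rightarrow> fib \<Rightarrow> 'k" where
  "s_entry y z = (\<Sum>w\<leftarrow>fuse z y. Tc w * Tc w * kappa w) / (Tc z * Tc y)"

lemma s_matrix_simple:
  assumes Y: "iso_obj C Y (S y)" and Z: "iso_obj C Z (S z)"
  shows "s_matrix C Y Z = s_entry y z"
  unfolding s_matrix_def
proof (rule trace_eqI)
  obtain dY dZ where d: "dec dY Y" "lab dY = [y]" "dec dZ Z" "lab dZ = [z]" using simple_dec[OF Y] simple_dec[OF Z] by blast
  note [simp] = decD[OF d(1)] decD[OF d(3)]
  let ?A = "Z \<odot> Y" and ?d = "ten_dec dZ dY"
  have dA: "dec ?d ?A" by (rule ten_dec[OF d(3,1)])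
  note [simp] = decD[OF dA]
  have lab: "lab ?d = fuse z y" using d by (simp add: fib_tenO_eval ten_basis_eval comp_def)
  show "?A \<in> Obj C" by simp
  let ?f = "Braid C Y Z \<cdot> Braid C Z Y"
  show fh: "?f \<in> hom C ?A ?A" by (simp add: hom_def)
  have tw: "Twist C B = Tc x \<bullet> Ident C B" if dB: "dec dB B" "lab dB = [x]" for B dB x
  proof (rule dec_epi[OF dB(1)])
    note [simp] = decD[OF dB(1)]
    show "Twist C B \<in> hom C B B" "Tc x \<bullet> Ident C B \<in> hom C B B" by (simp_all add: hom_def)
    fix i assume "i < dlen dB"
    then have "i = 0" using dB by simp
    then show "Twist C B \<cdot> inc dB i = Tc x \<bullet> Ident C B \<cdot> inc dB i"
      using dB twist_nat[of "inc dB 0" "S x" B] by (simp add: twist_S)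
  qed
  \<comment> \<open>Balancing read backwards: on a product of simple objects the double braiding is
    the twist divided by the two scalars, so it acts on each channel by a scalar.\<close>
  have "Twist C ?A = (Tc z * Tc y) \<bullet> ?f"
    by (subst twist_ten) (simp_all add: tw[OF d(3,4)] tw[OF d(1,2)] mult.commute)
  then have "inverse (Tc z * Tc y) \<bullet> Twist C ?A = inverse (Tc z * Tc y) \<bullet> ((Tc z * Tc y) \<bullet> ?f)" by simp
  also have "\<dots> = (inverse (Tc z * Tc y) * (Tc z * Tc y)) \<bullet> ?f" by (intro smult_simps) simp
  also have "inverse (Tc z * Tc y) * (Tc z * Tc y) = 1" using Tc_nonzero[of z] Tc_nonzero[of y] by (intro left_inverse) simp
  also have "1 \<bullet> ?f = ?f" by simp
  finally have f: "?f = inverse (Tc z * Tc y) \<bullet> Twist C ?A" ..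
  fix D ev coev assume dual: "left_dual C ?A D ev coev"
  have th: "Twist C ?A \<cdot> ?f \<in> hom C ?A ?A" by (simp add: hom_def)
  have c: "(Twist C ?A \<cdot> ?f) \<cdot> inc ?d r = (inverse (Tc z * Tc y) * (Tc (lab ?d ! r) * Tc (lab ?d ! r))) \<bullet> inc ?d r" if r: "r < dlen ?d" for r
  proof -
    have "Twist C ?A \<cdot> inc ?d r = Tc (lab ?d ! r) \<bullet> inc ?d r"
      using r twist_nat[of "inc ?d r" "S (lab ?d ! r)" ?A] by (simp add: twist_S)
    then show ?thesis unfolding f using r by simp
  qed
  have "(\<Sum>r<dlen ?d. inverse (Tc z * Tc y) * (Tc (lab ?d ! r) * Tc (lab ?d ! r)) * kappa (lab ?d ! r)) = s_entry y z"
    unfolding lab s_entry_def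
    by (simp add: sum_list_sum_nth atLeast0LessThan sum_divide_distrib field_simps)
  then show "ev \<cdot> (Braid C ?A D \<cdot> (((Twist C ?A \<cdot> ?f) \<otimes> Ident C D) \<cdot> coev)) = s_entry y z \<bullet> Ident C (Unit C)"
    using trace_decomposition[OF dual dA th c] by simp
qed

text \<open>The last identity is the determinant of the S-matrix, whose vanishing would mean
  \<open>a = 3\<close>.\<close>

lemma s_entries:
  defines "\<delta> \<equiv> 1 - (u + inverse u)"
  shows "s_entry One One = 1" "s_entry One Tau = \<delta>" "s_entry Tau One = \<delta>" "s_entry Tau Tau = - 1"
    "- 1 - \<delta> * \<delta> = (u + inverse u) - 3"
proof -
  define w where "w = inverse u"
  have uw: "u * w = 1" using root_nonzero by (simp add: w_def)
  have eq: "(u + w) * (u + w) = (u + w) + 1" using root_equation by (simp add: w_def)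
  have d: "\<delta> = 1 - (u + w)" by (simp add: \<delta>_def w_def)
  have ud: "(u + w) * \<delta> = - 1" unfolding d using eq by algebra
  have nz: "u + w \<noteq> 0" using trace_root_nonzero by (simp add: w_def)
  have "\<delta> = inverse (u + w) * ((u + w) * \<delta>)" using nz by (simp add: mult.assoc[symmetric])
  also have "\<dots> = - inverse (u + w)" unfolding ud by simp
  finally have q: "qdim Tau = \<delta>" by (simp add: qdim_def w_def)
  have T: "Tc One = 1" "Tc Tau = w * w" using Tc_solution(1) Tc_root by (simp_all add: w_def power2_eq_square)
  have k: "kappa One = 1" "kappa Tau = u * u * \<delta>"
    using Rc_unit[of One One One] Rc_solution(1) q by (simp_all add: kappa_def qdim_def braid_root_def)
  show "s_entry One One = 1" by (simp add: s_entry_def T k)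
  have e: "w * w * (w * w) * (u * u * \<delta>) = w * w * \<delta>" using uw by algebra
  have w0: "w \<noteq> 0" using uw by auto
  show "s_entry One Tau = \<delta>" "s_entry Tau One = \<delta>" using w0 by (simp_all add: s_entry_def T k e)
  \<comment> \<open>Expanded, the left side is \<open>u^4 - u^3 + u^2 - u\<close>, which the
    equation of \<open>u\<close> makes equal to \<open>-1\<close>.\<close>
  have "(1 + w * w * \<delta>) * (u * u * (u * u)) = - 1" unfolding d using uw eq by algebra
  moreover have "1 + w * w * \<delta> = (1 + w * w * \<delta>) * (u * u * (u * u)) * (w * w * (w * w))" using uw by algebra
  then have "(1 + w * w * \<delta>) / (w * w * (w * w)) = (1 + w * w * \<delta>) * (u * u * (u * u))"
    using w0 by (subst nonzero_divide_eq_eq) simp_all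
  ultimately show "s_entry Tau Tau = - 1" by (simp add: s_entry_def T k e)
  show "- 1 - \<delta> * \<delta> = (u + inverse u) - 3" unfolding d w_def[symmetric] using eq by algebra
qed

end

lemma nondegenerate_two:
  assumes "M a a = (1::'k::field)" "M a b = d" "M b a = d" "M b b = e" "e - d * d \<noteq> 0" "a \<noteq> b"
  shows "nondegenerate_on {a, b} M"
  unfolding nondegenerate_on_def
proof (intro allI impI)
  fix v assume "\<forall>Y\<in>{a, b}. (\<Sum>Z\<in>{a, b}. M Y Z * v Z) = 0"
  then have 1: "v a + d * v b = 0" and 2: "d * v a + e * v b = 0" using assms by auto
  have "(e - d * d) * v b = 0" using 1 2 by algebra
  then have "v b = 0" using assms(5) by simp
  then show "\<forall>Z\<in>{a, b}. v Z = 0" using 1 by simp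
qed

text \<open>The only arithmetic input to nondegeneracy: \<open>a = 3\<close> in
  \<open>a * a = a + 1\<close> gives \<open>9 = 4\<close>. It is a locale assumption because the
  scalars are an arbitrary field there.\<close>

locale modular_frame = normal_frame C S iX pX + fibonacci_category C
  for C :: "('o, 'm, 'k :: field, 'x) balcat_scheme" (structure) and S :: "fib \<Rightarrow> 'o" and iX pX +
  assumes five_nonzero: "(5 :: 'k) \<noteq> 0"
begin

lemma s_nondegenerate:
  assumes R: "simple_reps C R" shows "nondegenerate_on R (s_matrix C)"
proof -
  obtain T1 where T1: "T1 \<in> R" "iso_obj C (S One) T1" using R simple_S[of One] unfolding simple_reps_def by blast
  obtain T2 where T2: "T2 \<in> R" "iso_obj C (S Tau) T2" using R simple_S[of Tau] unfolding simple_reps_def by blast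
  have ne: "T1 \<noteq> T2" using T1 T2 S_not_iso[of One Tau] iso_obj_trans iso_obj_sym by blast
  have "T = T1 \<or> T = T2" if T: "T \<in> R" for T
  proof -
    have s: "simple C T" using T R unfolding simple_reps_def by blast
    obtain l where l: "iso_obj C T (S l)" using simple_iso_S[OF s] by blast
    have u: "\<exists>!T'. T' \<in> R \<and> iso_obj C T T'" using s R unfolding simple_reps_def by blast
    have "T \<in> Obj C" using s by (simp add: simple_def)
    then have "iso_obj C T T" by (rule iso_obj_refl)
    moreover have "iso_obj C T T1 \<or> iso_obj C T T2" using l T1(2) T2(2) iso_obj_trans by (cases l) blast+
    ultimately show ?thesis using u T T1(1) T2(1) by blast
  qed
  then have RR: "R = {T1, T2}" using T1(1) T2(1) by blast
  note i = iso_obj_sym[OF T1(2)] iso_obj_sym[OF T2(2)]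
  show ?thesis unfolding RR
  proof (rule nondegenerate_two[OF _ _ _ _ _ ne])
    show "s_matrix C T1 T1 = 1" "s_matrix C T1 T2 = 1 - (u + inverse u)" "s_matrix C T2 T1 = 1 - (u + inverse u)" "s_matrix C T2 T2 = - 1"
      using s_matrix_simple i s_entries(1-4) by simp_all
    show "- 1 - (1 - (u + inverse u)) * (1 - (u + inverse u)) \<noteq> 0"
    proof
      assume "- 1 - (1 - (u + inverse u)) * (1 - (u + inverse u)) = 0"
      then have "u + inverse u = 3" using s_entries(5) by simp
      then have "(3::'k) * 3 = 3 + 1" using root_equation by simp
      then have "(9::'k) - 4 = 0" by simp
      then show False using five_nonzero by simp
    qed
  qed
qed

lemma modular: "modular_category C"
proof -
  interpret ribbon_category C by (rule ribbon)
  have "simple_reps C {S One, S Tau}"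
    unfolding simple_reps_def
  proof (intro conjI allI impI)
    show "{S One, S Tau} \<subseteq> {S. simple C S}" using simple_S by blast
    fix T assume "simple C T"
    then obtain l where l: "iso_obj C T (S l)" using simple_iso_S by blast
    have "iso_obj C T (S m) \<longleftrightarrow> m = l" for m
      using l S_not_iso[of m l] iso_obj_trans[of T "S m"] iso_obj_trans[OF iso_obj_sym, of T "S m" "S l"] by blast
    then show "\<exists>!U. U \<in> {S One, S Tau} \<and> iso_obj C T U" using l by (intro ex1I[of _ "S l"]) (cases l; auto)+
  qed
  then have "\<exists>R. finite R \<and> simple_reps C R" by (intro exI[of _ "{S One, S Tau}"]) auto
  then show ?thesis
    by unfold_locales (use rigid_C unit_simple s_nondegenerate in auto)
qed

end

section \<open>Classification\<close>

text \<open>If \<open>X\<close> is nonzero and receives only zero from the unit, its image must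
  contain the label \<open>Tau\<close>. The twist of \<open>X\<close> is a scalar and is preserved,
  so the scalar can be read off at a diagonal position labelled \<open>Tau\<close>.\<close>

lemma twist_invariant:
  fixes C :: "('o, 'm, 'k :: field, 'x) balcat_scheme" (structure)
  assumes "braided_balanced_functor C (fib_cat v) FO FA J J0" and eqv: "is_equivalence C (fib_cat v) FO FA"
    and X: "X \<in> Obj C" "Ident C X \<noteq> Zero C X X" and IX: "\<And>f. f \<in> hom C (Unit C) X \<Longrightarrow> f = Zero C (Unit C) X"
    and tw: "Twist C X = \<theta> \<bullet> Ident C X"
  shows "\<theta> = inverse (v ^ 2)"
proof -
  let ?D = "fib_cat v" and ?I = "Unit C"
  interpret F: braided_balanced_functor C ?D FO FA J J0 by (rule assms(1))
  obtain GO GA \<eta> \<epsilon> where G: "cat_functor ?D C GO GA"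
    and eta: "natural_iso C C (\<lambda>A. A) (\<lambda>f. f) (\<lambda>A. GO (FO A)) (\<lambda>f. GA (FA f)) \<eta>"
    and eps: "natural_iso ?D ?D (\<lambda>B. FO (GO B)) (\<lambda>g. FA (GA g)) (\<lambda>B. B) (\<lambda>g. g) \<epsilon>"
    using eqv unfolding is_equivalence_def by blast
  interpret G: cat_functor ?D C GO GA by (rule G)
  have eta_h: "\<eta> A \<in> hom C A (GO (FO A))" "iso_arr C (\<eta> A)" if "A \<in> Obj C" for A
    using eta that by (auto simp: natural_iso_def)
  have eta_n: "\<eta> (Cod C f) \<cdot> f = GA (FA f) \<cdot> \<eta> (Dom C f)" if "f \<in> Arr C" for f
    using eta that by (auto simp: natural_iso_def)
  have eps_h: "\<epsilon> B \<in> hom ?D (FO (GO B)) B" "iso_arr ?D (\<epsilon> B)" for B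
    using eps by (auto simp: natural_iso_def)
  have eps_n: "fib_comp (\<epsilon> (tgt g)) (FA (GA g)) = fib_comp g (\<epsilon> (src g))" if "farr g" for g
    using eps that by (auto simp: natural_iso_def)
  have I: "?I \<in> Obj C" by (rule F.C.unit_obj)
  have FA_zero: "FA (Zero C A B) = Zero ?D (FO A) (FO B)" if "A \<in> Obj C" "B \<in> Obj C" for A B
  proof -
    have z: "Zero C A B \<in> hom C A B" using that by (rule F.C.zero_hom)
    have "FA (0 \<bullet> Zero C A B) = 0 \<bullet>\<^bsub>?D\<^esub> FA (Zero C A B)" by (rule F.smult_map[OF z])
    moreover have "0 \<bullet> Zero C A B = Zero C A B" using F.C.smult_zero[OF z] .
    moreover have "0 \<bullet>\<^bsub>?D\<^esub> FA (Zero C A B) = Zero ?D (FO A) (FO B)" by (rule F.D.smult_zero[OF F.arr_map[OF z]])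
    ultimately show ?thesis by simp
  qed
  have "Tau \<in> set (FO X)"
  proof (rule ccontr)
    assume nT: "Tau \<notin> set (FO X)"
    show False
    proof (cases "FO X")
      case Nil
      \<comment> \<open>An empty image would identify the identity and the zero of \<open>X\<close>
        under \<open>FA\<close>, and the isomorphism \<open>\<eta> X\<close> reflects this back to
        the source category.\<close>
      have e: "FA (Ident C X) = FA (Zero C X X)"
        unfolding FA_zero[OF X(1,1)] F.ident_map[OF X(1)] Nil by (intro farr_eqI) auto
      have "\<eta> X \<cdot> Ident C X = \<eta> X \<cdot> Zero C X X"
        using eta_n[of "Ident C X"] eta_n[of "Zero C X X"] X(1) e by simp
      then have "inv_arr C (\<eta> X) \<cdot> (\<eta> X \<cdot> Ident C X) = inv_arr C (\<eta> X) \<cdot> (\<eta> X \<cdot> Zero C X X)" by simp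
      moreover have "inv_arr C (\<eta> X) \<cdot> (\<eta> X \<cdot> Ident C X) = Ident C X" "inv_arr C (\<eta> X) \<cdot> (\<eta> X \<cdot> Zero C X X) = Zero C X X"
        using X(1) homE[OF eta_h(1)[OF X(1)]] by (auto intro!: F.C.inv_arr_cancel(1)[OF eta_h(2)[OF X(1)]] simp del: F.C.comp_ident_arr F.C.comp_zero_arr)
      ultimately show False using X(2) by simp
    next
      case (Cons l xs)
      then have l: "FO X = One # xs" using nT by (cases l) auto
      \<comment> \<open>Without \<open>Tau\<close> a nonempty image begins with \<open>One\<close>,
        and then the inclusion of that summand is a nonzero arrow from the unit.\<close>
      define k where "k = (fib_inc (FO X) 0 :: 'k fib_arr)"
      have k: "farr k" "src k = [One]" "tgt k = FO X" "entry k 0 0 = 1"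
        using l by (simp_all add: k_def entry_fib_inc)
      have j: "farr J0" "src J0 = [One]" "tgt J0 = FO ?I" using F.J0_hom by (auto simp: hom_fib_cat)
      note ji = F.D.inv_arr[OF F.J0_iso]
      define h where "h = fib_comp k (inv_arr ?D J0)"
      have h: "farr h" "src h = FO ?I" "tgt h = FO X" using k j ji by (auto simp: h_def)
      have hh: "h \<in> hom ?D (FO ?I) (FO X)" using h by (simp add: hom_fib_cat)
      note gh = G.arr_map[OF hh]
      \<comment> \<open>The inclusion, moved to the image of the unit by \<open>J0\<close>, is
        pulled back along the quasi-inverse. It becomes an arrow from the unit to \<open>X\<close>,
        hence zero; following it forward again through \<open>\<epsilon>\<close> makes the inclusion
        itself zero.\<close>
      define f where "f = inv_arr C (\<eta> X) \<cdot> (GA h \<cdot> \<eta> ?I)"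
      note ei = F.C.inv_arr[OF eta_h(2)[OF X(1)]]
      have "f \<in> hom C ?I X" unfolding f_def using gh eta_h(1)[OF I] eta_h(1)[OF X(1)] ei by (simp add: hom_def)
      then have "f = Zero C ?I X" by (rule IX)
      then have "\<eta> X \<cdot> f = Zero C ?I (GO (FO X))" using eta_h(1)[OF X(1)] I by (simp add: hom_def)
      moreover have "\<eta> X \<cdot> f = GA h \<cdot> \<eta> ?I"
        unfolding f_def using F.C.inv_arr_cancel(2)[OF eta_h(2)[OF X(1)], of "GA h \<cdot> \<eta> ?I"] gh eta_h(1)[OF I] eta_h(1)[OF X(1)]
        by (simp add: hom_def)
      ultimately have z: "GA h \<cdot> \<eta> ?I = Zero C ?I (GO (FO X))" by simp
      note e0 = F.C.inv_arr[OF eta_h(2)[OF I]]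
      have "GA h = (GA h \<cdot> \<eta> ?I) \<cdot> inv_arr C (\<eta> ?I)" using gh eta_h(1)[OF I] e0 by (simp add: hom_def)
      also have "\<dots> = Zero C (GO (FO ?I)) (GO (FO X))"
        unfolding z using e0 eta_h(1)[OF I] I G.obj_map[of "FO X"] by (simp add: hom_def)
      finally have "FA (GA h) = Zero ?D (FO (GO (FO ?I))) (FO (GO (FO X)))"
        using FA_zero G.obj_map by simp
      then have "fib_comp (\<epsilon> (FO X)) (FA (GA h)) = Zero ?D (FO (GO (FO ?I))) (FO X)"
        using eps_h(1)[of "FO X"] F.D.comp_zero_arr(2)[of "\<epsilon> (FO X)" "FO (GO (FO ?I))" "FO (GO (FO X))"] by (simp add: hom_def)
      then have he: "fib_comp h (\<epsilon> (FO ?I)) = Zero ?D (FO (GO (FO ?I))) (FO X)" using eps_n[OF h(1)] h by simp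
      note ie = F.D.inv_arr[OF eps_h(2)[of "FO ?I"]]
      have "h = fib_comp (fib_comp h (\<epsilon> (FO ?I))) (inv_arr ?D (\<epsilon> (FO ?I)))"
        using h ie eps_h(1)[of "FO ?I"] fib_comp_ident(2)[OF h(1)] by (simp add: hom_fib_cat fib_comp_assoc)
      also have "\<dots> = Zero ?D (FO ?I) (FO X)"
        unfolding he using ie eps_h(1)[of "FO ?I"] F.D.comp_zero_arr(1)[of "inv_arr ?D (\<epsilon> (FO ?I))" "FO (GO (FO ?I))" "FO X"]
        by (simp add: hom_fib_cat)
      finally have h0: "h = Zero ?D (FO ?I) (FO X)" .
      have "k = fib_comp h J0"
        using k j ji fib_comp_ident(2)[OF k(1)] by (simp add: h_def fib_comp_assoc)
      also have "\<dots> = Zero ?D [One] (FO X)" unfolding h0 using j F.D.comp_zero_arr(1)[of J0 "FO ?I" "FO X"] by simp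
      finally have "entry k 0 0 = entry (Zero ?D [One] (FO X)) 0 0" by simp
      then show False using k(4) by simp
    qed
  qed
  then obtain i where i: "i < length (FO X)" "FO X ! i = Tau" by (auto simp: in_set_conv_nth)
  have "FA (Twist C X) = fib_twist v (FO X)" using F.twist_map[OF X(1)] by simp
  moreover have "FA (Twist C X) = \<theta> \<bullet>\<^bsub>?D\<^esub> fib_ident (FO X)"
    unfolding tw using F.smult_map[OF F.C.ident_hom[OF X(1)]] F.ident_map[OF X(1)] by simp
  ultimately have "entry (fib_twist v (FO X)) i i = entry (\<theta> \<bullet>\<^bsub>?D\<^esub> fib_ident (FO X)) i i" by simp
  then show ?thesis using i by (simp add: fib_twist_gen gen_twist_def)
qed

text \<open>Multiplication by \<open>u * u\<close> turns the quadratic equation for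
  \<open>u + inverse u\<close> into the tenth cyclotomic polynomial.\<close>

lemma golden_root_iff:
  fixes u :: "'k::field"
  shows "u \<noteq> 0 \<and> (u + inverse u) * (u + inverse u) = (u + inverse u) + 1 \<longleftrightarrow> u ^ 4 - u ^ 3 + u ^ 2 - u + 1 = 0"
proof (cases "u = 0")
  case False
  define w where "w = inverse u"
  have uw: "u * w = 1" using False by (simp add: w_def)
  have "(u + w) * (u + w) = (u + w) + 1 \<longleftrightarrow> u ^ 4 - u ^ 3 + u ^ 2 - u + 1 = 0"
  proof
    assume "(u + w) * (u + w) = (u + w) + 1"
    then show "u ^ 4 - u ^ 3 + u ^ 2 - u + 1 = 0" using uw by algebra
  next
    assume "u ^ 4 - u ^ 3 + u ^ 2 - u + 1 = 0"
    then show "(u + w) * (u + w) = (u + w) + 1" using uw by algebra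
  qed
  then show ?thesis using False by (simp add: w_def)
qed simp

text \<open>Forwards, \<open>u^10 - 1\<close> is the product of \<open>u^5 - 1\<close>,
  \<open>u + 1\<close> and the tenth cyclotomic polynomial, and the first two factors do not vanish
  at an element of order 10. Backwards, a smaller order contradicts characteristic zero.\<close>

lemma primitive_root_10_iff:
  fixes u :: "'k::field_char_0"
  shows "primitive_root 10 u \<longleftrightarrow> u ^ 4 - u ^ 3 + u ^ 2 - u + 1 = 0"
proof
  assume p: "primitive_root 10 u"
  then have u: "u ^ 10 = 1" "u ^ 5 \<noteq> 1" "u ^ 2 \<noteq> 1" by (auto simp: primitive_root_def)
  have "(u ^ 5 - 1) * (u ^ 5 + 1) = 0" using u(1) by algebra
  then have 5: "u ^ 5 + 1 = 0" using u(2) by simp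
  have "u + 1 \<noteq> 0"
  proof
    assume "u + 1 = 0"
    then have "u ^ 2 = 1" by algebra
    then show False using u by simp
  qed
  moreover have "(u + 1) * (u ^ 4 - u ^ 3 + u ^ 2 - u + 1) = 0" using 5 by algebra
  ultimately show "u ^ 4 - u ^ 3 + u ^ 2 - u + 1 = 0" by simp
next
  assume P: "u ^ 4 - u ^ 3 + u ^ 2 - u + 1 = 0"
  have "u ^ m \<noteq> 1" if m: "0 < m" "m < 10" for m
  proof
    assume h: "u ^ m = 1"
    have "m \<in> {1, 2, 3, 4, 5, 6, 7, 8, 9}" using m by auto
    \<comment> \<open>For every smaller \<open>m\<close>, the number 10 lies in the ideal generated
      by \<open>u^m - 1\<close> and the cyclotomic polynomial.\<close>
    then have "(10 :: 'k) = 0"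
    proof (elim insertE)
      assume "m = 1" with h have "u ^ 1 = 1" by simp with P show ?thesis by algebra
    next
      assume "m = 2" with h have "u ^ 2 = 1" by simp with P show ?thesis by algebra
    next
      assume "m = 3" with h have "u ^ 3 = 1" by simp with P show ?thesis by algebra
    next
      assume "m = 4" with h have "u ^ 4 = 1" by simp with P show ?thesis by algebra
    next
      assume "m = 5" with h have "u ^ 5 = 1" by simp with P show ?thesis by algebra
    next
      assume "m = 6" with h have "u ^ 6 = 1" by simp with P show ?thesis by algebra
    next
      assume "m = 7" with h have "u ^ 7 = 1" by simp with P show ?thesis by algebra
    next
      assume "m = 8" with h have "u ^ 8 = 1" by simp with P show ?thesis by algebra
    next
      assume "m = 9" with h have "u ^ 9 = 1" by simp with P show ?thesis by algebra
    qed simp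
    then show False by simp
  qed
  moreover have "u ^ 10 = 1" using P by algebra
  ultimately show "primitive_root 10 u" by (simp add: primitive_root_def)
qed

lemma card_primitive_roots_10: "card {u :: 'k :: {alg_closed_field, field_char_0}. primitive_root 10 u} = 4"
proof -
  have "degree [:1, -1, 1, -1, 1 :: 'k:] > 0" by simp
  then obtain u where "poly [:1, -1, 1, -1, 1 :: 'k:] u = 0" using alg_closed_imp_poly_has_root by blast
  then have u: "u ^ 4 - u ^ 3 + u ^ 2 - u + 1 = 0" by (simp add: algebra_simps power2_eq_square power3_eq_cube power4_eq_xxxx)
  \<comment> \<open>The roots are the powers of \<open>u\<close> with exponents 1, 3, 7 and 9, prime
    to 10; since \<open>u^5 = -1\<close>, the last two are \<open>-(u^2)\<close> and
    \<open>-(u^4)\<close>. Any coincidence among them would again give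
    \<open>10 = 0\<close>.\<close>
  have "v ^ 4 - v ^ 3 + v ^ 2 - v + 1 = (v - u) * (v - u ^ 3) * (v + u ^ 2) * (v + u ^ 4)" for v
    using u by algebra
  then have "{v. primitive_root 10 v} = {u, u ^ 3, - (u ^ 2), - (u ^ 4)}"
    by (auto simp: primitive_root_10_iff add_eq_0_iff2)
  moreover have "u \<noteq> u ^ 3" "u \<noteq> - (u ^ 2)" "u \<noteq> - (u ^ 4)" "u ^ 3 \<noteq> - (u ^ 2)" "u ^ 3 \<noteq> - (u ^ 4)" "- (u ^ 2) \<noteq> - (u ^ 4)"
  proof -
    have F: "x \<noteq> y" if "x = y \<Longrightarrow> (10 :: 'k) = 0" for x y :: 'k using that by auto
    show "u \<noteq> u ^ 3" by (rule F) (use u in algebra)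
    show "u \<noteq> - (u ^ 2)" by (rule F) (use u in algebra)
    show "u \<noteq> - (u ^ 4)" by (rule F) (use u in algebra)
    show "u ^ 3 \<noteq> - (u ^ 2)" by (rule F) (use u in algebra)
    show "u ^ 3 \<noteq> - (u ^ 4)" by (rule F) (use u in algebra)
    show "- (u ^ 2) \<noteq> - (u ^ 4)" by (rule F) (use u in algebra)
  qed
  ultimately show ?thesis by simp
qed

text \<open>From \<open>u^5 = -1\<close> follows \<open>u = -(u^2)^3\<close>, so the square
  determines \<open>u\<close>.\<close>

lemma primitive_root_10_square_inj:
  fixes u v :: "'k::field_char_0"
  assumes "primitive_root 10 u" "primitive_root 10 v" "inverse (u ^ 2) = inverse (v ^ 2)"
  shows "u = v"
proof -
  have P: "u ^ 4 - u ^ 3 + u ^ 2 - u + 1 = 0" "v ^ 4 - v ^ 3 + v ^ 2 - v + 1 = 0" "u ^ 2 = v ^ 2"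
    using assms by (simp_all add: primitive_root_10_iff)
  then show ?thesis by algebra
qed

text \<open>Algebraic closure is handed to the locales as the existence of roots. Uniqueness applies
  \<open>twist_invariant\<close> to \<open>S Tau\<close>, whose twist is
  \<open>inverse (braid_root ^ 2)\<close>.\<close>

lemma fibonacci_classification:
  fixes C :: "('o, 'm, 'k :: {alg_closed_field, field_char_0}) balcat"
  assumes "fibonacci_category C" "balanced_category C"
  shows "modular_category C" "\<exists>!u. primitive_root 10 u \<and> balanced_equivalent C (fib_cat u)"
proof -
  interpret fibonacci_category C by (rule assms(1))
  interpret balanced_category C by (rule assms(2))
  have closed: "\<exists>z. poly p z = 0" if "0 < degree p" for p :: "'k poly"
    using that alg_closed_imp_poly_has_root by blast
  obtain S iX pX where fr: "fib_frame C S iX pX" and n: "fib_frame.Fc C S iX pX Tau Tau Tau Tau Tau One = 1"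
    using ex_fib_frame[OF closed] by blast
  interpret fib_frame C S iX pX by (rule fr)
  interpret modular_frame C S iX pX by unfold_locales (use n in simp_all)
  show "modular_category C" by (rule modular)
  have p: "primitive_root 10 braid_root"
    unfolding primitive_root_10_iff golden_root_iff[symmetric] using root_nonzero root_equation by blast
  show "\<exists>!u. primitive_root 10 u \<and> balanced_equivalent C (fib_cat u)"
  proof (rule ex1I[of _ braid_root])
    show "primitive_root 10 braid_root \<and> balanced_equivalent C (fib_cat braid_root)" using p balanced_equivalent_root by blast
    fix v assume v: "primitive_root 10 v \<and> balanced_equivalent C (fib_cat v)"
    then obtain FO FA J J0 where F: "braided_balanced_functor C (fib_cat v) FO FA J J0" "is_equivalence C (fib_cat v) FO FA"
      unfolding balanced_equivalent_def by blast
    have "Tc Tau = inverse (v ^ 2)"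
      by (rule twist_invariant[OF F S_obj ident_nonzero _ twist_S]) (use schur_zero[of One Tau] S_One in auto)
    then have "inverse (v ^ 2) = inverse (braid_root ^ 2)" unfolding Tc_root by (rule sym)
    then show "v = braid_root" by (rule primitive_root_10_square_inj[OF conjunct1[OF v] p])
  qed
qed

theorem theorem16:
  shows
    "(\<forall>C :: ('o, 'm, 'k :: {alg_closed_field, field_char_0}) balcat.
        fibonacci_category C \<and> balanced_category C \<longrightarrow> modular_category C) \<and>
     card {u :: 'k. primitive_root 10 u} = 4 \<and>
     (\<forall>u :: 'k. primitive_root 10 u \<longrightarrow>
        fibonacci_category (fib_cat u) \<and> modular_category (fib_cat u)) \<and>
     (\<forall>u v :: 'k. primitive_root 10 u \<and> primitive_root 10 v \<and>
        balanced_equivalent (fib_cat u) (fib_cat v) \<longrightarrow> u = v) \<and>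
     (\<forall>C :: ('o, 'm, 'k) balcat. fibonacci_category C \<and> balanced_category C \<longrightarrow>
        (\<exists>!u. primitive_root 10 u \<and> balanced_equivalent C (fib_cat u)))"
proof (intro conjI allI impI)
  show "card {u :: 'k. primitive_root 10 u} = 4" by (rule card_primitive_roots_10)
  fix u :: 'k assume "primitive_root 10 u"
  then have u: "u \<noteq> 0" "(u + inverse u) * (u + inverse u) = (u + inverse u) + 1"
    unfolding primitive_root_10_iff golden_root_iff[symmetric] by blast+
  show "fibonacci_category (fib_cat u)" by (rule fib_fibonacci[OF u])
  \<comment> \<open>Modularity of \<open>fib_cat u\<close> is the general result applied to it as a
    balanced Fibonacci category.\<close>
  then show "modular_category (fib_cat u)" by (rule fibonacci_classification(1)[OF _ fib_balanced[OF u]])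
next
  fix u v :: 'k assume h: "primitive_root 10 u \<and> primitive_root 10 v \<and> balanced_equivalent (fib_cat u) (fib_cat v)"
  obtain FO FA J J0 where F: "braided_balanced_functor (fib_cat u) (fib_cat v) FO FA J J0" "is_equivalence (fib_cat u) (fib_cat v) FO FA"
    using h unfolding balanced_equivalent_def by blast
  interpret simple_system "fib_cat u" fib_simple by (rule fib_simple_system)
  have t: "Twist (fib_cat u) [Tau] = inverse (u ^ 2) \<bullet>\<^bsub>fib_cat u\<^esub> Ident (fib_cat u) [Tau]"
    by (intro farr_eqI) (auto simp: fib_twist_gen gen_twist_def)
  have "inverse (u ^ 2) = inverse (v ^ 2)"
    by (rule twist_invariant[OF F S_obj ident_nonzero _ t]) (use schur_zero[of One Tau] in auto)
  then show "u = v" using primitive_root_10_square_inj h by blast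
next
  fix C :: "('o, 'm, 'k) balcat" assume C: "fibonacci_category C \<and> balanced_category C"
  show "modular_category C" using C fibonacci_classification(1) by blast
  show "\<exists>!u. primitive_root 10 u \<and> balanced_equivalent C (fib_cat u)" using C fibonacci_classification(2) by blast
qed

end
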